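(* Let $G=SL(2n,\mathbb{C})$, $K=Sp(2n,\mathbb{C})$, and parametrize $K\backslash G/B$ by the fixed point-free involutions in $W=S_{2n}$ via $Q\mapsto\phi(Q)w_0$, where $\phi$ is the Richardson–Springer map and $w_0$ the longest element. The weak order on $K\backslash G/B$ corresponds to the order on fixed point-free involutions given inductively as follows: starting with $w_0$, for any fixed point-free involution $b$ and any simple reflection $s_i=(i,i+1)$ such that $l(s_ib)<l(b)$, one has $b<_i s_ibs_i$ if and only if $s_ibs_i\ne b$. All roots are complex, and hence all edges (of the weak order graph) are black.
   Context: $J_{n,n}=\begin{pmatrix}0&J_n\\-J_n&0\end{pmatrix}$ with $J_n$ the antidiagonal matrix of $1$'s; $K$ is the isometry group of the skew form $J_{n,n}$, i.e. $K=G^\theta$ for $\theta(g)=J_{n,n}(g^{-1})^tJ_{n,n}^{-1}$. $T$ is the diagonal torus and $B$ the lower-triangular Borel subgroup of $G$, both $\theta$-stable. $l$ is the length function on $S_{2n}$; $\theta$ induces $w\mapsto w_0ww_0$ on $W$, and twisted involutions are the $w\in W$ with $\theta(w)=w^{-1}$. Richardson–Springer map: every $K$-orbit on $G/B$ can be written $K\cdot g^{-1}B$ with $g\theta(g)^{-1}\in N_G(T)$, and $\phi(K\cdot g^{-1}B)\in W=N_G(T)/T$ is the class of $g\theta(g)^{-1}$; this is well-defined. For this pair it is known that $\phi$ is injective with image the set of twisted involutions $a$ such that $aw_0$ is a fixed point-free involution. Weak order: for a simple root $\alpha_i=Y_i-Y_{i+1}$ (with $Y_i$ the diagonal coordinates)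 let $P_{\alpha_i}\supset B$ be the minimal parabolic subgroup of type $\alpha_i$ and $\pi_i:G/B\to G/P_{\alpha_i}$ the projection. For a $K$-orbit $Q$, $s_i\cdot Q$ is the dense $K$-orbit in $\pi_i^{-1}(\pi_i(Q))$. Write $Q<_iQ'$ if $Q'=s_i\cdot Q$ and $\dim Q'=\dim Q+1$; the weak order is the partial order generated by these relations, and its graph has an edge labelled $i$ for each of them. The edge is black if the restriction of $\pi_i$ to $\overline Q$ has degree $1$ over its image (otherwise the degree is $2$ and it is blue). $b<_ib'$ for involutions means this relation for the corresponding orbits. Complex roots: for a $K$-orbit $Q$ choose $gB\in Q$ such that $gTg^{-1}$ is $\theta$-stable, and let $\alpha'$ be the root of $gTg^{-1}$ obtained from $\alpha_i$ via conjugation by $g$; $\alpha_i$ is complex for $Q$ if $\theta(\alpha')\ne\pm\alpha'$ (independent of the choice).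
   Formalization: "All roots are complex" fails when s_i b s_i = b (e.g. n=1, where θ is the identity); it is stated instead as: for every edge labelled i of the weak order graph, α_i is complex for both of its end orbits, and the edge is black. *)

theory Defs
  imports
    "Jordan_Normal_Form.Determinant"
    "HOL-Algebra.Group_Action"
    "HOL-Analysis.Abstract_Topology"
    "HOL-Library.Extended_Nat"
    "HOL-Combinatorics.Transposition"
begin

text \<open>
  Matrix rows and columns, and hence the points permuted by the Weyl group of type \<open>A\<close>, are
  numbered from \<open>0\<close>. So \<open>S\<^sub>2\<^sub>n\<close> consists of the permutations of \<open>{..<2*n}\<close>, and the simple
  root \<open>Y\<^sub>i - Y\<^sub>i\<^sub>+\<^sub>1\<close> has an index \<open>i\<close> with \<open>Suc i < 2 * n\<close>.
\<close>

section \<open>The groups\<close>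

definition SL :: "nat \<Rightarrow> complex mat monoid" where
  "SL m = \<lparr>carrier = {A \<in> carrier_mat m m. det A = 1}, mult = (*), one = 1\<^sub>m m\<rparr>"

abbreviation grp :: "nat \<Rightarrow> complex mat monoid" where
  "grp n \<equiv> SL (2 * n)"

definition antidiag :: "nat \<Rightarrow> complex mat" where
  "antidiag n = mat n n (\<lambda>(i, j). if i + j + 1 = n then 1 else 0)"

definition Jnn :: "nat \<Rightarrow> complex mat" where
  "Jnn n = four_block_mat (0\<^sub>m n n) (antidiag n) (- antidiag n) (0\<^sub>m n n)"

text \<open>The inverse of \<open>Jnn n\<close> may be taken in \<open>SL (2 * n)\<close>, see \<open>Jnn_in_SL\<close> below.\<close>

definition theta :: "nat \<Rightarrow> complex mat \<Rightarrow> complex mat" where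
  "theta n g = Jnn n * transpose_mat (inv\<^bsub>grp n\<^esub> g) * inv\<^bsub>grp n\<^esub> (Jnn n)"

definition Sp :: "nat \<Rightarrow> complex mat set" where
  "Sp n = {g \<in> carrier (grp n). transpose_mat g * Jnn n * g = Jnn n}"

definition torus :: "nat \<Rightarrow> complex mat set" where
  "torus n = {t \<in> carrier (grp n). diagonal_mat t}"

definition borel :: "nat \<Rightarrow> complex mat set" where
  "borel n = {g \<in> carrier (grp n). \<forall>r c. r < c \<and> c < 2 * n \<longrightarrow> g $$ (r, c) = 0}"

definition parabolic :: "nat \<Rightarrow> nat \<Rightarrow> complex mat set" where
  "parabolic n i = {g \<in> carrier (grp n).
     \<forall>r c. r < c \<and> c < 2 * n \<and> (r, c) \<noteq> (i, Suc i) \<longrightarrow> g $$ (r, c) = 0}"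


section \<open>Zariski topology, dimension, degree\<close>

inductive_set poly_funs :: "nat \<Rightarrow> (complex mat \<Rightarrow> complex) set" for m :: nat where
  const: "(\<lambda>_. c) \<in> poly_funs m"
| entry: "i < m \<Longrightarrow> j < m \<Longrightarrow> (\<lambda>A. A $$ (i, j)) \<in> poly_funs m"
| add: "p \<in> poly_funs m \<Longrightarrow> q \<in> poly_funs m \<Longrightarrow> (\<lambda>A. p A + q A) \<in> poly_funs m"
| mult: "p \<in> poly_funs m \<Longrightarrow> q \<in> poly_funs m \<Longrightarrow> (\<lambda>A. p A * q A) \<in> poly_funs m"

definition zariski :: "nat \<Rightarrow> complex mat topology" where
  "zariski m = topology_generated_by {{A \<in> carrier (SL m). p A \<noteq> 0} | p. p \<in> poly_funs m}"

definition quotient_space :: "nat \<Rightarrow> complex mat set \<Rightarrow> complex mat set set" where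
  "quotient_space n H = {g <#\<^bsub>grp n\<^esub> H | g. g \<in> carrier (grp n)}"

text \<open>The Zariski topology of the variety \<open>G/H\<close> is the quotient topology.\<close>

definition quotient_zariski :: "nat \<Rightarrow> complex mat set \<Rightarrow> complex mat set topology" where
  "quotient_zariski n H =
     topology (\<lambda>U. U \<subseteq> quotient_space n H \<and>
                 openin (zariski (2 * n)) {g \<in> carrier (grp n). g <#\<^bsub>grp n\<^esub> H \<in> U})"

definition irreducible_in :: "'a topology \<Rightarrow> 'a set \<Rightarrow> bool" where
  "irreducible_in X S \<longleftrightarrow> S \<noteq> {} \<and> S \<subseteq> topspace X \<and>
     (\<forall>C D. closedin X C \<longrightarrow> closedin X D \<longrightarrow> S \<subseteq> C \<union> D \<longrightarrow> S \<subseteq> C \<or> S \<subseteq> D)"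

text \<open>The Krull dimension: the supremum of the lengths of chains of irreducible closed sets.\<close>

definition krull_dim :: "'a topology \<Rightarrow> enat" where
  "krull_dim X = Sup {enat d | d. \<exists>Z :: nat \<Rightarrow> 'a set.
     (\<forall>k\<le>d. closedin X (Z k) \<and> irreducible_in X (Z k)) \<and> (\<forall>k<d. Z k \<subset> Z (Suc k))}"

text \<open>
  The restriction of \<open>f\<close> to \<open>S\<close> has degree \<open>d\<close> over its image, in the sense of complex varieties:
  the general fibre has \<open>d\<close> points.
\<close>

definition has_degree_on :: "'b topology \<Rightarrow> ('a \<Rightarrow> 'b) \<Rightarrow> 'a set \<Rightarrow> nat \<Rightarrow> bool" where
  "has_degree_on Y f S d \<longleftrightarrow>
     (\<exists>U. openin (subtopology Y (f ` S)) U \<and> U \<noteq> {} \<and> f ` S \<subseteq> Y closure_of U \<and>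
        (\<forall>y\<in>U. finite {x \<in> S. f x = y} \<and> card {x \<in> S. f x = y} = d))"


section \<open>Orbits on the flag variety and the weak order\<close>

abbreviation flag_variety :: "nat \<Rightarrow> complex mat set set" where
  "flag_variety n \<equiv> quotient_space n (borel n)"

abbreviation flag_zariski :: "nat \<Rightarrow> complex mat set topology" where
  "flag_zariski n \<equiv> quotient_zariski n (borel n)"

text \<open>The orbit of the point \<open>gB\<close> of the flag variety under \<open>K = Sp n\<close>.\<close>

definition K_orbit :: "nat \<Rightarrow> complex mat \<Rightarrow> complex mat set set" where
  "K_orbit n g = {k <#\<^bsub>grp n\<^esub> (g <#\<^bsub>grp n\<^esub> borel n) | k. k \<in> Sp n}"

definition K_orbits :: "nat \<Rightarrow> complex mat set set set" where
  "K_orbits n = {K_orbit n g | g. g \<in> carrier (grp n)}"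

definition orbit_dim :: "nat \<Rightarrow> complex mat set set \<Rightarrow> enat" where
  "orbit_dim n Q = krull_dim (subtopology (flag_zariski n) Q)"

text \<open>The projection \<open>G/B \<rightarrow> G/P\<^sub>i\<close>, \<open>gB \<mapsto> gP\<^sub>i = (gB)P\<^sub>i\<close>.\<close>

definition proj :: "nat \<Rightarrow> nat \<Rightarrow> complex mat set \<Rightarrow> complex mat set" where
  "proj n i C = C <#>\<^bsub>grp n\<^esub> parabolic n i"

definition saturation :: "nat \<Rightarrow> nat \<Rightarrow> complex mat set set \<Rightarrow> complex mat set set" where
  "saturation n i Q = {C \<in> flag_variety n. proj n i C \<in> proj n i ` Q}"

definition s_act :: "nat \<Rightarrow> nat \<Rightarrow> complex mat set set \<Rightarrow> complex mat set set" where
  "s_act n i Q = (THE R. R \<in> K_orbits n \<and> R \<subseteq> saturation n i Q \<and>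
                         saturation n i Q \<subseteq> flag_zariski n closure_of R)"

definition orbit_edge :: "nat \<Rightarrow> nat \<Rightarrow> complex mat set set \<Rightarrow> complex mat set set \<Rightarrow> bool" where
  "orbit_edge n i Q Q' \<longleftrightarrow> Suc i < 2 * n \<and> Q \<in> K_orbits n \<and> Q' \<in> K_orbits n \<and>
     Q' = s_act n i Q \<and> orbit_dim n Q' = orbit_dim n Q + 1"

definition weak_le :: "nat \<Rightarrow> complex mat set set \<Rightarrow> complex mat set set \<Rightarrow> bool" where
  "weak_le n = (\<lambda>Q Q'. \<exists>i. orbit_edge n i Q Q')\<^sup>*\<^sup>*"

definition black :: "nat \<Rightarrow> nat \<Rightarrow> complex mat set set \<Rightarrow> bool" where
  "black n i Q \<longleftrightarrow>
     has_degree_on (quotient_zariski n (parabolic n i)) (proj n i) (flag_zariski n closure_of Q) 1"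


section \<open>Complex roots\<close>

definition conj_torus :: "nat \<Rightarrow> complex mat \<Rightarrow> complex mat set" where
  "conj_torus n g = {g \<otimes>\<^bsub>grp n\<^esub> t \<otimes>\<^bsub>grp n\<^esub> inv\<^bsub>grp n\<^esub> g | t. t \<in> torus n}"

definition simple_root :: "nat \<Rightarrow> complex mat \<Rightarrow> complex" where
  "simple_root i t = t $$ (i, i) / t $$ (Suc i, Suc i)"

definition conj_root :: "nat \<Rightarrow> nat \<Rightarrow> complex mat \<Rightarrow> complex mat \<Rightarrow> complex" where
  "conj_root n i g s = simple_root i (inv\<^bsub>grp n\<^esub> g \<otimes>\<^bsub>grp n\<^esub> s \<otimes>\<^bsub>grp n\<^esub> g)"

text \<open>
  Roots are characters, written multiplicatively: as \<open>theta\<close> is an involution, it sends the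
  character \<open>\<chi>\<close> to \<open>\<chi> \<circ> theta\<close>, and the negative of \<open>\<chi>\<close> is its pointwise inverse.
\<close>

definition complex_root :: "nat \<Rightarrow> nat \<Rightarrow> complex mat set set \<Rightarrow> bool" where
  "complex_root n i Q \<longleftrightarrow>
     (\<exists>g\<in>carrier (grp n). g <#\<^bsub>grp n\<^esub> borel n \<in> Q \<and> theta n ` conj_torus n g = conj_torus n g \<and>
        \<not> (\<forall>s\<in>conj_torus n g. conj_root n i g (theta n s) = conj_root n i g s) \<and>
        \<not> (\<forall>s\<in>conj_torus n g. conj_root n i g (theta n s) = inverse (conj_root n i g s)))"


section \<open>The Weyl group and the Richardson--Springer map\<close>

definition simple_refl :: "nat \<Rightarrow> nat \<Rightarrow> nat" where
  "simple_refl i = Transposition.transpose i (Suc i)"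

definition w0 :: "nat \<Rightarrow> nat \<Rightarrow> nat" where
  "w0 n j = (if j < 2 * n then 2 * n - 1 - j else j)"

definition weyl_length :: "nat \<Rightarrow> (nat \<Rightarrow> nat) \<Rightarrow> nat" where
  "weyl_length n w =
     (LEAST k. \<exists>is. length is = k \<and> (\<forall>i\<in>set is. Suc i < 2 * n) \<and>
                    w = foldr (\<lambda>i v. simple_refl i \<circ> v) is id)"

definition fpf_involutions :: "nat \<Rightarrow> (nat \<Rightarrow> nat) set" where
  "fpf_involutions n = {b. b permutes {..<2 * n} \<and> b \<circ> b = id \<and> (\<forall>j<2 * n. b j \<noteq> j)}"

text \<open>
  The identification of \<open>N\<^sub>G(T)/T\<close> with the symmetric group: \<open>x \<in> N\<^sub>G(T)\<close> represents the
  permutation \<open>w\<close> for which \<open>x\<close> maps the \<open>j\<close>-th coordinate line to the \<open>w j\<close>-th one.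
\<close>

definition represents :: "nat \<Rightarrow> complex mat \<Rightarrow> (nat \<Rightarrow> nat) \<Rightarrow> bool" where
  "represents n x w \<longleftrightarrow> x \<in> normalizer (grp n) (torus n) \<and> w permutes {..<2 * n} \<and>
     (\<forall>i<2 * n. \<forall>j<2 * n. x $$ (i, j) \<noteq> 0 \<longleftrightarrow> i = w j)"

definition RS_map :: "nat \<Rightarrow> complex mat set set \<Rightarrow> nat \<Rightarrow> nat" where
  "RS_map n Q = (THE w. \<exists>g\<in>carrier (grp n). Q = K_orbit n (inv\<^bsub>grp n\<^esub> g) \<and>
                          represents n (g \<otimes>\<^bsub>grp n\<^esub> inv\<^bsub>grp n\<^esub> (theta n g)) w)"

definition inv_param :: "nat \<Rightarrow> complex mat set set \<Rightarrow> nat \<Rightarrow> nat" where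
  "inv_param n Q = RS_map n Q \<circ> w0 n"

text \<open>The relation \<open>b <\<^sub>i b'\<close>, by transport along \<open>inv_param\<close>.\<close>

definition inv_edge :: "nat \<Rightarrow> nat \<Rightarrow> (nat \<Rightarrow> nat) \<Rightarrow> (nat \<Rightarrow> nat) \<Rightarrow> bool" where
  "inv_edge n i b b' \<longleftrightarrow>
     (\<exists>Q\<in>K_orbits n. \<exists>Q'\<in>K_orbits n.
        inv_param n Q = b \<and> inv_param n Q' = b' \<and> orbit_edge n i Q Q')"

text \<open>The combinatorial order on fixed point-free involutions.\<close>

definition inv_step :: "nat \<Rightarrow> nat \<Rightarrow> (nat \<Rightarrow> nat) \<Rightarrow> (nat \<Rightarrow> nat) \<Rightarrow> bool" where
  "inv_step n i b b' \<longleftrightarrow> b \<in> fpf_involutions n \<and> Suc i < 2 * n \<and>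
     weyl_length n (simple_refl i \<circ> b) < weyl_length n b \<and>
     b' = simple_refl i \<circ> b \<circ> simple_refl i \<and> b' \<noteq> b"

definition inv_le :: "nat \<Rightarrow> (nat \<Rightarrow> nat) \<Rightarrow> (nat \<Rightarrow> nat) \<Rightarrow> bool" where
  "inv_le n = (\<lambda>b b'. \<exists>i. inv_step n i b b')\<^sup>*\<^sup>*"


section \<open>Well-definedness of the constructions above\<close>

lemma carrier_SL: "carrier (SL m) = {A \<in> carrier_mat m m. det A = 1}"
  and mult_SL: "x \<otimes>\<^bsub>SL m\<^esub> y = x * y"
  and one_SL: "\<one>\<^bsub>SL m\<^esub> = 1\<^sub>m m"
  by (simp_all add: SL_def)

lemma group_SL: "group (SL m)"
proof (rule groupI)
  fix x assume "x \<in> carrier (SL m)"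
  then have x: "x \<in> carrier_mat m m" and d: "det x = 1" by (auto simp: carrier_SL)
  have a: "adj_mat x \<in> carrier_mat m m" "x * adj_mat x = 1\<^sub>m m" "adj_mat x * x = 1\<^sub>m m"
    using adj_mat[OF x] d by (auto simp: smult_one)
  have "det x * det (adj_mat x) = 1"
    using det_mult[OF x a(1)] a(2) by simp
  with d have "det (adj_mat x) = 1" by simp
  with a show "\<exists>y\<in>carrier (SL m). y \<otimes>\<^bsub>SL m\<^esub> x = \<one>\<^bsub>SL m\<^esub>"
    by (intro bexI[of _ "adj_mat x"]) (auto simp: carrier_SL mult_SL one_SL)
qed (auto simp: carrier_SL mult_SL one_SL det_mult)

lemma antidiag_carrier: "antidiag n \<in> carrier_mat n n"
  by (simp add: antidiag_def)

lemma antidiag_squared: "antidiag n * antidiag n = 1\<^sub>m n"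
proof (rule eq_matI)
  fix i j assume "i < dim_row (1\<^sub>m n :: complex mat)" "j < dim_col (1\<^sub>m n :: complex mat)"
  then have i: "i < n" and j: "j < n" by auto
  have "(antidiag n * antidiag n) $$ (i, j) =
      (\<Sum>k = 0..<n. (if i + k + 1 = n then 1 else 0) * (if k + j + 1 = n then 1 else 0))"
    using i j by (simp add: antidiag_def scalar_prod_def)
  also have "\<dots> = (\<Sum>k = 0..<n. if k = n - 1 - i then (if i = j then 1 else 0) else 0)"
    using i j by (intro sum.cong) auto
  also have "\<dots> = (1\<^sub>m n) $$ (i, j)"
    using i j by (simp add: one_mat_def)
  finally show "(antidiag n * antidiag n) $$ (i, j) = (1\<^sub>m n) $$ (i, j)" .
qed (auto simp: antidiag_def)

lemma Jnn_in_SL: "Jnn n \<in> carrier (grp n)"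
proof -
  note c = antidiag_carrier[of n]
  have d: "det (antidiag n) * det (antidiag n) = 1"
    using det_mult[OF c c] by (simp add: antidiag_squared)
  let ?I = "1\<^sub>m n :: complex mat" and ?O = "0\<^sub>m n n :: complex mat"
  let ?U = "four_block_mat ?I ?I ?O ?I" and ?L = "four_block_mat ?I ?O (- ?I) ?I"
  let ?D = "four_block_mat (antidiag n) ?O ?O (antidiag n)"
  have U: "?U \<in> carrier_mat (n + n) (n + n)" and L: "?L \<in> carrier_mat (n + n) (n + n)"
    and D: "?D \<in> carrier_mat (n + n) (n + n)"
    using c by (auto intro!: four_block_carrier_mat)
  have dets: "det ?U = 1" "det ?L = 1" "det ?D = 1"
    using det_four_block_mat_lower_left_zero[of ?I n ?I n ?O ?I]
      det_four_block_mat_upper_right_zero[of ?I n ?O n "- ?I" ?I]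
      det_four_block_mat_lower_left_zero[of "antidiag n" n ?O n ?O "antidiag n"] c d by auto
  have UL: "?U * ?L = four_block_mat ?O ?I (- ?I) ?I"
    by (subst mult_four_block_mat[where ?nr1.0 = n and ?n1.0 = n and ?n2.0 = n
          and ?nr2.0 = n and ?nc1.0 = n and ?nc2.0 = n]) (auto intro!: eq_matI)
  have ULU: "?U * ?L * ?U = four_block_mat ?O ?I (- ?I) ?O"
    unfolding UL
    by (subst mult_four_block_mat[where ?nr1.0 = n and ?n1.0 = n and ?n2.0 = n
          and ?nr2.0 = n and ?nc1.0 = n and ?nc2.0 = n]) (auto intro!: eq_matI)
  have ULUD: "?U * ?L * ?U * ?D = Jnn n"
    unfolding ULU Jnn_def
    by (subst mult_four_block_mat[where ?nr1.0 = n and ?n1.0 = n and ?n2.0 = n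
          and ?nr2.0 = n and ?nc1.0 = n and ?nc2.0 = n]) (use c in auto)
  have "det (Jnn n) = 1"
    unfolding ULUD[symmetric] using dets
    by (simp add: det_mult[OF mult_carrier_mat[OF mult_carrier_mat[OF U L] U] D]
        det_mult[OF mult_carrier_mat[OF U L] U] det_mult[OF U L])
  moreover have "Jnn n \<in> carrier_mat (2 * n) (2 * n)"
    unfolding ULUD[symmetric] using mult_carrier_mat[OF mult_carrier_mat[OF mult_carrier_mat[OF U L] U] D]
    by (simp add: mult_2)
  ultimately show ?thesis by (simp add: carrier_SL)
qed

lemma openin_quotient_zariski:
  "openin (quotient_zariski n H) U \<longleftrightarrow> U \<subseteq> quotient_space n H \<and>
     openin (zariski (2 * n)) {g \<in> carrier (grp n). g <#\<^bsub>grp n\<^esub> H \<in> U}"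
proof -
  let ?pre = "\<lambda>U. {g \<in> carrier (grp n). g <#\<^bsub>grp n\<^esub> H \<in> U}"
  have "?pre (U \<inter> V) = ?pre U \<inter> ?pre V" for U V by auto
  moreover have "?pre (\<Union>\<U>) = (\<Union>U\<in>\<U>. ?pre U)" for \<U> by auto
  ultimately have "istopology (\<lambda>U. U \<subseteq> quotient_space n H \<and> openin (zariski (2 * n)) (?pre U))"
    unfolding istopology_def by (auto intro: openin_Int)
  then show ?thesis
    unfolding quotient_zariski_def by (simp add: topology_inverse')
qed

end

theory Submission
  imports Defs
begin

text \<open>
  The fibres of \<open>x \<mapsto> Y = x\<^sup>T J x\<close> are the cosets \<open>Kx\<close>, and \<open>B\<close> acts on the skew matrices \<open>Y\<close> by
  congruence; symplectic Gram-Schmidt brings \<open>Y\<close> into the monomial form of exactly one fixed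
  point-free involution \<open>b\<close>. With \<open>x = g\<inverse>\<close> one has \<open>Y \<cdot> g\<theta>(g)\<inverse> = J\<close>, so that \<open>b\<close> is the parameter of the orbit.
  For \<open>b (i + 1) < b i\<close> the set \<open>stratum b \<cdot> P\<^sub>i\<close> is the union of the strata of \<open>b\<close> and \<open>s\<^sub>i b s\<^sub>i\<close>, the latter being
  dense. If moreover \<open>b i \<noteq> i + 1\<close>, then distinct points of the smaller orbit have distinct images
  in \<open>G/P\<^sub>i\<close>, and ranks of corner blocks of \<open>Y\<close> separate the closures of the two.

  Dimensions are computed with chains of irreducible \<open>B\<close>-stable subsets of \<open>G\<close>. A chain of length \<open>d\<close>
  yields \<open>d\<close> algebraically independent regular functions, whence \<open>dim G/B \<le> n(2n - 1)\<close>; the closed orbit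
  contains a chain of length \<open>n\<^sup>2\<close> built from root subgroups of \<open>K\<close>; and each step \<open>b \<mapsto> s\<^sub>i b s\<^sub>i\<close> transports a
  chain and lengthens it by one. As the number of steps from \<open>w\<^sub>0\<close> to the top equals the difference of the two
  bounds, all the estimates are equalities. Finiteness of the set of strata makes the image of an
  orbit in \<open>G/P\<^sub>i\<close> open in its closure, which gives degree one.
\<close>

section \<open>Fixed point-free involutions\<close>

text \<open>The form \<open>Y\<close> may only be normalised by matrices of determinant one. This
  costs nothing: isometries of \<open>Jnn n\<close> have determinant one. The members of a chain are
  irreducible but not necessarily closed; strictness is recorded by a regular function that vanishes
  on one member and not on the next. So chains can be pushed through products of sets whose
  closedness is unknown. The obstacle is strictness along an edge: if \<open>x\<close> lies outside
  the closure of \<open>S\<close>, then \<open>x s\<close> must stay outside the closure of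
  \<open>S s B\<close>, where \<open>s\<close> represents the reflection. It does, because the point
  of the smaller stratum in the fibre through a point \<open>y\<close> of the larger one depends
  rationally on \<open>y\<close>, so that functions on the smaller stratum can be pulled back. The
  same rational section carries irreducibility from the dense stratum down to all others, and the
  upper bound for dimensions rests on it. Every edge is complex because \<open>b i = i\<close> is
  excluded, while for \<open>b i = Suc i\<close> the saturation is a single stratum and there is no
  edge.\<close>

definition inversions :: "nat \<Rightarrow> (nat \<Rightarrow> nat) \<Rightarrow> (nat \<times> nat) set" where
  "inversions m w = {(j, k). j < k \<and> k < m \<and> w k < w j}"

abbreviation conj_refl :: "nat \<Rightarrow> (nat \<Rightarrow> nat) \<Rightarrow> nat \<Rightarrow> nat" where
  "conj_refl i b \<equiv> simple_refl i \<circ> b \<circ> simple_refl i"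

text \<open>The descents of \<open>b\<close> at which conjugation by the reflection moves
  \<open>b\<close>. They turn out to be the edges leaving the orbit of \<open>b\<close>; the
  remaining descents are those with \<open>b i = Suc i\<close>.\<close>

abbreviation cdesc :: "nat \<Rightarrow> nat \<Rightarrow> (nat \<Rightarrow> nat) \<Rightarrow> bool" where
  "cdesc n i b \<equiv> Suc i < 2 * n \<and> b (Suc i) < b i \<and> b i \<noteq> Suc i"

lemma simple_refl_simps [simp]: "simple_refl i i = Suc i" "simple_refl i (Suc i) = i"
  "j \<noteq> i \<Longrightarrow> j \<noteq> Suc i \<Longrightarrow> simple_refl i j = j" "simple_refl i (simple_refl i j) = j"
  "simple_refl i \<circ> simple_refl i = id"
  by (auto simp: simple_refl_def)

lemma simple_refl_less_iff:
  "simple_refl i x < simple_refl i y \<longleftrightarrow> (if x = i \<and> y = Suc i then False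
     else if x = Suc i \<and> y = i then True else x < y)"
  by (auto simp: simple_refl_def Transposition.transpose_def)

lemma simple_refl_eq_iff: "simple_refl i x = y \<longleftrightarrow> x = simple_refl i y"
  by (auto simp: simple_refl_def)

lemma simple_refl_permutes: "Suc i < m \<Longrightarrow> simple_refl i permutes {..<m}"
  unfolding simple_refl_def by (rule permutes_swap_id) auto

section \<open>Inversions and the length function\<close>

lemma finite_inversions [simp]: "finite (inversions m w)"
  by (rule finite_subset[of _ "{..<m} \<times> {..<m}"]) (auto simp: inversions_def)

lemma card_inversions_le: "card (inversions m w) \<le> m * m"
proof -
  have "inversions m w \<subseteq> {..<m} \<times> {..<m}" by (auto simp: inversions_def)
  from card_mono[OF _ this] show ?thesis by simp
qed

text \<open>The reflection exchanges two adjacent values, so the relative order changes only at the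
  pair of positions that carry them.\<close>

lemma inversions_refl_insert:
  assumes "w permutes {..<m}" "Suc i < m" "w a = i" "w c = Suc i" "a < c"
  shows "inversions m (simple_refl i \<circ> w) = insert (a, c) (inversions m w)"
    and "(a, c) \<notin> inversions m w"
proof -
  have inj: "w x = w y \<longleftrightarrow> x = y" for x y using permutes_inj[OF assms(1)] by (auto dest: injD)
  have ca: "c < m" using permutes_in_image[OF assms(1), of c] assms(2,4) by simp
  have e: "w x = i \<longleftrightarrow> x = a" "w x = Suc i \<longleftrightarrow> x = c" for x using inj assms(3,4) by metis+
  show "inversions m (simple_refl i \<circ> w) = insert (a, c) (inversions m w)"
    using assms(5) ca by (auto simp: inversions_def simple_refl_less_iff e assms(3,4) split: if_splits)
  show "(a, c) \<notin> inversions m w" using assms by (auto simp: inversions_def)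
qed

lemma card_inversions_refl:
  assumes "w permutes {..<m}" "Suc i < m" "w a = i" "w c = Suc i"
  shows "card (inversions m (simple_refl i \<circ> w)) =
    (if a < c then Suc (card (inversions m w)) else card (inversions m w) - 1)"
    "c < a \<Longrightarrow> card (inversions m w) > 0" "a \<noteq> c"
proof -
  \<comment> \<open>For \<open>c < a\<close> it is the reflected permutation that satisfies the
    hypotheses of the insertion lemma, with \<open>a\<close> and \<open>c\<close> exchanged.\<close>
  have *: "card (inversions m w) = Suc (card (inversions m (simple_refl i \<circ> w)))" if "c < a"
  proof -
    have "simple_refl i \<circ> w permutes {..<m}"
      using permutes_compose[OF assms(1) simple_refl_permutes[OF assms(2)]] .
    from inversions_refl_insert[OF this assms(2), of c a] that assms
    show ?thesis by (simp add: comp_assoc[symmetric])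
  qed
  show ac: "a \<noteq> c" using assms by auto
  show "card (inversions m (simple_refl i \<circ> w)) =
    (if a < c then Suc (card (inversions m w)) else card (inversions m w) - 1)"
    using * ac inversions_refl_insert[OF assms(1-4)] by (cases "a < c") auto
  show "card (inversions m w) > 0" if "c < a" using * that by simp
qed

text \<open>An increasing map satisfies \<open>j \<le> w j\<close>. A permutation preserves the sum
  of all points, so none of these inequalities is strict.\<close>

lemma permutes_increasing_id:
  assumes w: "w permutes {..<m}" and inc: "\<And>i. Suc i < m \<Longrightarrow> w i < w (Suc i)"
  shows "w = id"
proof -
  have ge: "j < m \<Longrightarrow> j \<le> w j" for j
    by (induction j) (auto dest: inc Suc_lessD intro: le_less_trans less_le_trans Suc_leI)
  have "(\<Sum>j<m. w j) = (\<Sum>j<m. j)"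
    using sum.permute[OF w, of "\<lambda>x. x"] by simp
  then have "(\<Sum>j<m. w j - j) = 0"
    using ge sum_subtractf_nat[of "{..<m}" "\<lambda>j. j" w] by simp
  then have "j < m \<Longrightarrow> w j = j" for j using ge[of j] by (simp add: le_antisym)
  moreover have "\<not> j < m \<Longrightarrow> w j = j" for j using w by (simp add: permutes_def)
  ultimately show ?thesis by (metis eq_id_iff)
qed

lemma w0_simps [simp]: "j < 2 * n \<Longrightarrow> w0 n j = 2 * n - 1 - j" "w0 n (w0 n j) = j" "w0 n \<circ> w0 n = id"
  by (auto simp: w0_def)

lemma w0_less [simp]: "j < 2 * n \<Longrightarrow> w0 n j < 2 * n"
  by (auto simp: w0_def)

lemma w0_permutes: "w0 n permutes {..<2 * n}"
proof (rule bij_imp_permutes)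
  show "bij_betw (w0 n) {..<2 * n} {..<2 * n}"
    by (rule bij_betw_byWitness[where f' = "w0 n"]) (auto simp del: w0_simps(1))
qed (auto simp: w0_def)

lemma permutes_decreasing_w0:
  assumes w: "w permutes {..<2 * n}" and dec: "\<And>i. Suc i < 2 * n \<Longrightarrow> w (Suc i) < w i"
  shows "w = w0 n"
proof -
  have "w0 n \<circ> w = id"
  proof (rule permutes_increasing_id)
    show "w0 n \<circ> w permutes {..<2 * n}" using permutes_compose[OF w w0_permutes] .
    fix i assume i: "Suc i < 2 * n"
    then have "w i < 2 * n" "w (Suc i) < 2 * n" using permutes_in_image[OF w] by auto
    then show "(w0 n \<circ> w) i < (w0 n \<circ> w) (Suc i)" using dec[OF i] by simp
  qed
  then have "w0 n \<circ> (w0 n \<circ> w) = w0 n" by simp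
  then show ?thesis by (simp add: comp_assoc[symmetric])
qed

lemma card_inversions_refl_le:
  assumes w: "w permutes {..<m}" and i: "Suc i < m"
  shows "card (inversions m (simple_refl i \<circ> w)) \<le> Suc (card (inversions m w))"
proof -
  obtain a c where "w a = i" "w c = Suc i" using permutes_surj[OF w] by (metis surjD)
  from card_inversions_refl(1)[OF w i this] show ?thesis by (auto split: if_splits)
qed

lemma card_inversions_word:
  assumes "\<forall>i\<in>set is. Suc i < m"
  shows "foldr (\<lambda>i v. simple_refl i \<circ> v) is id permutes {..<m} \<and>
    card (inversions m (foldr (\<lambda>i v. simple_refl i \<circ> v) is id)) \<le> length is"
  using assms
proof (induction "is")
  case Nil
  have "inversions m id = {}" by (auto simp: inversions_def)
  then show ?case by (simp add: permutes_id[unfolded id_def] id_def)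
next
  case (Cons i "is")
  let ?w = "foldr (\<lambda>i v. simple_refl i \<circ> v) is id"
  have i: "Suc i < m" and "\<forall>i\<in>set is. Suc i < m" using Cons.prems by simp_all
  from Cons.IH[OF this(2)]
  have w: "?w permutes {..<m}" and l: "card (inversions m ?w) \<le> length is" by blast+
  from card_inversions_refl_le[OF w i] l have c: "card (inversions m (simple_refl i \<circ> ?w)) \<le> length (i # is)"
    unfolding list.size by linarith
  have f: "foldr (\<lambda>i v. simple_refl i \<circ> v) (i # is) id = simple_refl i \<circ> ?w"
    by (simp only: foldr_Cons o_apply)
  show ?case unfolding f using c permutes_compose[OF w simple_refl_permutes[OF i]] by blast
qed

text \<open>Unless the inverse of \<open>w\<close> is increasing, and \<open>w\<close> the identity,
  some value \<open>Suc i\<close> occurs before \<open>i\<close>; the reflection on the left then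
  removes one inversion and contributes one letter.\<close>

lemma inversions_word:
  assumes "w permutes {..<m}"
  shows "\<exists>is. length is = card (inversions m w) \<and> (\<forall>i\<in>set is. Suc i < m) \<and>
    w = foldr (\<lambda>i v. simple_refl i \<circ> v) is id"
  using assms
proof (induction "card (inversions m w)" arbitrary: w rule: less_induct)
  case less
  show ?case
  proof (cases "\<forall>i. Suc i < m \<longrightarrow> Hilbert_Choice.inv w i < Hilbert_Choice.inv w (Suc i)")
    case True
    then have "Hilbert_Choice.inv w = id"
      using permutes_increasing_id[OF permutes_inv[OF less.prems]] by blast
    then have w: "w = id" using permutes_inv_inv[OF less.prems] by (metis inv_id)
    have "inversions m w = {}" by (auto simp: inversions_def w)
    then show ?thesis using w by (intro exI[of _ "[]"]) simp
  next
    case False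
    then obtain i where i: "Suc i < m" "\<not> Hilbert_Choice.inv w i < Hilbert_Choice.inv w (Suc i)"
      by blast
    let ?a = "Hilbert_Choice.inv w i" and ?c = "Hilbert_Choice.inv w (Suc i)"
    have ac: "w ?a = i" "w ?c = Suc i" using permutes_inverses[OF less.prems] by auto
    note k = card_inversions_refl[OF less.prems i(1) ac]
    have ca: "?c < ?a" using i(2) k(3) by linarith
    with k have l: "card (inversions m w) = Suc (card (inversions m (simple_refl i \<circ> w)))" by auto
    have "simple_refl i \<circ> w permutes {..<m}"
      using permutes_compose[OF less.prems simple_refl_permutes[OF i(1)]] .
    from less.hyps[OF _ this] l obtain "is" where
      "length is = card (inversions m (simple_refl i \<circ> w))" "\<forall>i\<in>set is. Suc i < m"
      "simple_refl i \<circ> w = foldr (\<lambda>i v. simple_refl i \<circ> v) is id" by auto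
    moreover have "w = simple_refl i \<circ> (simple_refl i \<circ> w)" by (simp add: comp_assoc[symmetric])
    ultimately show ?thesis using l i(1) by (intro exI[of _ "i # is"]) simp
  qed
qed

lemma weyl_length_inversions:
  assumes "w permutes {..<2 * n}"
  shows "weyl_length n w = card (inversions (2 * n) w)"
  unfolding weyl_length_def
proof (rule Least_equality)
  show "\<exists>is. length is = card (inversions (2 * n) w) \<and> (\<forall>i\<in>set is. Suc i < 2 * n) \<and>
    w = foldr (\<lambda>i v. simple_refl i \<circ> v) is id"
    using inversions_word[OF assms] .
qed (use card_inversions_word in blast)

section \<open>Conjugating a fixed point-free involution by a simple reflection\<close>

lemma fpfD:
  assumes "b \<in> fpf_involutions n"
  shows "b permutes {..<2 * n}" "b (b j) = j" "j < 2 * n \<Longrightarrow> b j \<noteq> j" "b j < 2 * n \<longleftrightarrow> j < 2 * n"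
    "b j = b k \<longleftrightarrow> j = k"
proof -
  show p: "b permutes {..<2 * n}" using assms by (simp add: fpf_involutions_def)
  show "b (b j) = j" using assms by (auto simp: fpf_involutions_def fun_eq_iff)
  show "j < 2 * n \<Longrightarrow> b j \<noteq> j" using assms by (auto simp: fpf_involutions_def)
  show "b j < 2 * n \<longleftrightarrow> j < 2 * n" using permutes_in_image[OF p, of j] by simp
  show "b j = b k \<longleftrightarrow> j = k" using permutes_inj[OF p] by (auto dest: injD)
qed

lemma fpf_refl_nbrs:
  assumes b: "b \<in> fpf_involutions n" and i: "Suc i < 2 * n" and ne: "b i \<noteq> Suc i"
  shows "b i \<noteq> i" "b (Suc i) \<noteq> i" "b (Suc i) \<noteq> Suc i"
  using fpfD(3)[OF b, of i] fpfD(3)[OF b, of "Suc i"] fpfD(2)[OF b, of "Suc i"] i ne by auto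

lemma conj_refl_fpf:
  assumes b: "b \<in> fpf_involutions n" and i: "Suc i < 2 * n"
  shows "conj_refl i b \<in> fpf_involutions n"
proof -
  have "conj_refl i b permutes {..<2 * n}"
    using permutes_compose[OF simple_refl_permutes[OF i]
        permutes_compose[OF fpfD(1)[OF b] simple_refl_permutes[OF i]]] by simp
  moreover have "conj_refl i b j \<noteq> j" if "j < 2 * n" for j
  proof -
    have "simple_refl i j < 2 * n" using permutes_in_image[OF simple_refl_permutes[OF i], of j] that by simp
    then have "b (simple_refl i j) \<noteq> simple_refl i j" using fpfD(3)[OF b] by blast
    then show ?thesis by (simp add: simple_refl_eq_iff)
  qed
  ultimately show ?thesis
    by (simp add: fpf_involutions_def fun_eq_iff fpfD(2)[OF b])
qed

lemma conj_refl_idem [simp]: "conj_refl i (conj_refl i b) = b"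
  by (auto simp: fun_eq_iff)

lemma conj_refl_simps:
  assumes b: "b \<in> fpf_involutions n" and i: "Suc i < 2 * n" and ne: "b i \<noteq> Suc i"
  shows "conj_refl i b i = b (Suc i)" "conj_refl i b (Suc i) = b i"
    "conj_refl i b (b i) = Suc i" "conj_refl i b (b (Suc i)) = i"
    "j \<noteq> i \<Longrightarrow> j \<noteq> Suc i \<Longrightarrow> j \<noteq> b i \<Longrightarrow> j \<noteq> b (Suc i) \<Longrightarrow> conj_refl i b j = b j"
proof -
  note nb = fpf_refl_nbrs[OF assms]
  show "j \<noteq> i \<Longrightarrow> j \<noteq> Suc i \<Longrightarrow> j \<noteq> b i \<Longrightarrow> j \<noteq> b (Suc i) \<Longrightarrow> conj_refl i b j = b j"
    using fpfD(2)[OF b] by (metis comp_apply simple_refl_simps(3))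
qed (use ne fpf_refl_nbrs[OF assms] fpfD(2)[OF b] in auto)

lemma conj_refl_eq_iff:
  assumes b: "b \<in> fpf_involutions n" and i: "Suc i < 2 * n"
  shows "conj_refl i b = b \<longleftrightarrow> b i = Suc i"
proof
  assume e: "conj_refl i b = b"
  show "b i = Suc i"
  proof (rule ccontr)
    assume ne: "b i \<noteq> Suc i"
    from conj_refl_simps(1)[OF b i ne] e have "b i = b (Suc i)" by simp
    then show False using fpfD(5)[OF b] by simp
  qed
next
  assume e: "b i = Suc i"
  then have e': "b (Suc i) = i" using fpfD(2)[OF b, of i] by simp
  show "conj_refl i b = b"
  proof
    fix j show "conj_refl i b j = b j"
    proof (cases "j = i \<or> j = Suc i")
      case False
      then have "b j \<noteq> i" "b j \<noteq> Suc i" using e e' fpfD(5)[OF b, of j] by metis+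
      with False show ?thesis by simp
    qed (use e e' in auto)
  qed
qed

lemma weyl_length_refl_less_iff:
  assumes b: "b \<in> fpf_involutions n" and i: "Suc i < 2 * n"
  shows "weyl_length n (simple_refl i \<circ> b) < weyl_length n b \<longleftrightarrow> b (Suc i) < b i"
proof -
  note p = fpfD(1)[OF b]
  have "b (b i) = i" "b (b (Suc i)) = Suc i" using fpfD(2)[OF b] by auto
  note k = card_inversions_refl[OF p i this]
  show ?thesis
    using k weyl_length_inversions[OF p]
      weyl_length_inversions[OF permutes_compose[OF p simple_refl_permutes[OF i]]]
    by (cases "b i < b (Suc i)") auto
qed

lemma inv_step_iff:
  "inv_step n i b b' \<longleftrightarrow> b \<in> fpf_involutions n \<and> cdesc n i b \<and> b' = conj_refl i b"
proof (cases "b \<in> fpf_involutions n \<and> Suc i < 2 * n")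
  case True
  then show ?thesis
    using weyl_length_refl_less_iff[of b n i] conj_refl_eq_iff[of b n i] by (auto simp: inv_step_def)
qed (auto simp: inv_step_def)

lemma card_inversions_inverse:
  assumes w: "\<And>x. w (v x) = x" "\<And>x. v (w x) = x" and p: "w permutes {..<m}" "v permutes {..<m}"
  shows "card (inversions m w) = card (inversions m v)"
proof (rule bij_betw_same_card)
  have l: "x < m \<Longrightarrow> w x < m" "x < m \<Longrightarrow> v x < m" for x
    using permutes_in_image[OF p(1)] permutes_in_image[OF p(2)] by auto
  show "bij_betw (\<lambda>(j, k). (w k, w j)) (inversions m w) (inversions m v)"
    by (rule bij_betw_byWitness[where f' = "\<lambda>(j, k). (v k, v j)"])
      (use l in \<open>auto simp: inversions_def w\<close>)
qed

lemma card_inversions_conj: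
  assumes b: "b \<in> fpf_involutions n" and d: "cdesc n i b"
  shows "card (inversions (2 * n) b) = card (inversions (2 * n) (conj_refl i b)) + 2"
proof -
  have i: "Suc i < 2 * n" and ne: "b i \<noteq> Suc i" and lt: "b (Suc i) < b i" using d by auto
  note p = fpfD(1)[OF b] and nb = fpf_refl_nbrs[OF b i ne] and s = simple_refl_permutes[OF i]
  let ?u = "simple_refl i \<circ> b" and ?v = "b \<circ> simple_refl i"
  have "b (b i) = i" "b (b (Suc i)) = Suc i" using fpfD(2)[OF b] by auto
  note k = card_inversions_refl[OF p i this]
  have k1: "card (inversions (2 * n) b) = Suc (card (inversions (2 * n) ?u))" using k lt by auto
  \<comment> \<open>\<open>?u\<close> and \<open>?v\<close> are inverse to each other. Passing to
    the inverse turns the reflection on the right into one on the left, where the second inversion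
    is lost.\<close>
  have k2: "card (inversions (2 * n) ?u) = card (inversions (2 * n) ?v)"
    by (rule card_inversions_inverse)
      (use fpfD(2)[OF b] permutes_compose[OF p s] permutes_compose[OF s p] in auto)
  have "?v (b i) = i" "?v (b (Suc i)) = Suc i" using nb fpfD(2)[OF b] ne by auto
  note k = card_inversions_refl[OF permutes_compose[OF s p] i this]
  have "card (inversions (2 * n) ?v) = Suc (card (inversions (2 * n) (simple_refl i \<circ> ?v)))"
    unfolding k(1) if_not_P[OF less_not_sym[OF lt]] using k(2)[OF lt] by linarith
  with k1 k2 show ?thesis by (simp only: comp_assoc)
qed

lemma w0_fpf: "w0 n \<in> fpf_involutions n"
proof -
  have "w0 n j \<noteq> j" if "j < 2 * n" for j using that by (simp, presburger)
  then show ?thesis by (simp add: fpf_involutions_def w0_permutes)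
qed

text \<open>Any \<open>b\<close> other than \<open>w0 n\<close> has an ascent, and conjugating there
  adds two inversions; as their number is bounded, this ends at \<open>w0 n\<close>. The closed
  orbit is thus the base case and each edge a step.\<close>

lemma fpf_induct [consumes 1, case_names w0 step]:
  assumes "b \<in> fpf_involutions n" and "P (w0 n)"
    and step: "\<And>b i. b \<in> fpf_involutions n \<Longrightarrow> cdesc n i b \<Longrightarrow> P b \<Longrightarrow> P (conj_refl i b)"
  shows "P b"
  using assms(1)
proof (induction "(2 * n) * (2 * n) - card (inversions (2 * n) b)" arbitrary: b rule: less_induct)
  case less
  note b = less.prems
  show ?case
  proof (cases "\<forall>i. Suc i < 2 * n \<longrightarrow> b (Suc i) < b i")
    case True
    then show ?thesis using permutes_decreasing_w0[OF fpfD(1)[OF b]] assms(2) by simp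
  next
    case False
    then obtain i where i: "Suc i < 2 * n" "\<not> b (Suc i) < b i" by blast
    have lt: "b i < b (Suc i)" using i fpfD(5)[OF b, of i "Suc i"] by linarith
    have ne: "b i \<noteq> Suc i"
    proof
      assume "b i = Suc i"
      moreover from this have "b (Suc i) = i" using fpfD(2)[OF b, of i] by simp
      ultimately show False using lt by simp
    qed
    note c = conj_refl_simps[OF b i(1) ne] and f = conj_refl_fpf[OF b i(1)]
    have nb: "b (Suc i) \<noteq> Suc i" using fpfD(3)[OF b i(1)] .
    have d: "cdesc n i (conj_refl i b)" using i(1) c(1,2) lt nb by auto
    have "card (inversions (2 * n) (conj_refl i b)) = card (inversions (2 * n) b) + 2"
      using card_inversions_conj[OF f d] unfolding conj_refl_idem .
    then have "P (conj_refl i b)"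
      using less.hyps[OF _ f] card_inversions_le[of "2 * n" "conj_refl i b"] by auto
    from step[OF f d this] show ?thesis unfolding conj_refl_idem .
  qed
qed

lemma inv_le_w0: "b \<in> fpf_involutions n \<Longrightarrow> inv_le n (w0 n) b"
proof (induction rule: fpf_induct)
  case (step b i)
  then have "inv_step n i b (conj_refl i b)" by (simp add: inv_step_iff)
  then show ?case using step(3) unfolding inv_le_def by (rule_tac rtranclp.rtrancl_into_rtrancl) blast+
qed (simp add: inv_le_def)

text \<open>The only involution without outgoing edges is (0 1)(2 3)... . If the first
  \<open>j\<close> pairs are as claimed and \<open>2 * j\<close> is paired with \<open>Suc l\<close>
  where \<open>l\<close> exceeds \<open>2 * j\<close>, then \<open>b l\<close> exceeds
  \<open>2 * j = b (Suc l)\<close>, so that \<open>l\<close> is a descent; it is not paired with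
  \<open>Suc l\<close>, hence gives an edge.\<close>

lemma no_cdesc_top:
  assumes b: "b \<in> fpf_involutions n" and no: "\<And>i. \<not> cdesc n i b" and "j < n"
  shows "b (2 * j) = Suc (2 * j)"
  using \<open>j < n\<close>
proof (induction j rule: less_induct)
  case (less j)
  let ?p = "2 * j" let ?k = "b ?p"
  have p: "?p < 2 * n" using less.prems by simp
  have small: "b x < ?p" if "x < ?p" for x
  proof (cases "even x")
    case True
    then obtain y where y: "x = 2 * y" by auto
    with that less show ?thesis by auto
  next
    case False
    then obtain y where y: "x = Suc (2 * y)" by (auto elim: oddE)
    with that less have "b (2 * y) = x" by auto
    then have "b x = 2 * y" using fpfD(2)[OF b, of "2 * y"] by simp
    then show ?thesis using that y by auto
  qed
  have k: "?p < ?k" using small[of ?k] fpfD(2)[OF b, of ?p] fpfD(3)[OF b p] by linarith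
  have km: "?k < 2 * n" using fpfD(4)[OF b] p by simp
  obtain l where l: "?k = Suc l" using k by (cases ?k) auto
  have bl: "b l \<noteq> ?p" using fpfD(2)[OF b, of l] l by (metis n_not_Suc_n)
  show ?case
  proof (cases "l = ?p")
    case False
    have "?p < b l"
      using small[of "b l"] fpfD(2)[OF b, of l] bl k l False by (metis linorder_neqE_nat not_less_eq less_antisym)
    then have "b (Suc l) < b l" using fpfD(2)[OF b, of ?p] l by simp
    then have "b l = Suc l" using no[of l] km l by auto
    then have "b l = b ?p" using l by simp
    then show ?thesis using fpfD(5)[OF b] False by simp
  qed (simp add: l)
qed

lemma card_inversions_top:
  assumes b: "b \<in> fpf_involutions n" and no: "\<And>i. \<not> cdesc n i b"
  shows "card (inversions (2 * n) b) \<le> n"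
proof -
  note t = no_cdesc_top[OF b no]
  have t': "b (Suc (2 * j)) = 2 * j" if "j < n" for j using t[OF that] fpfD(2)[OF b, of "2 * j"] by simp
  have "inversions (2 * n) b \<subseteq> (\<lambda>j. (2 * j, Suc (2 * j))) ` {..<n}"
  proof clarify
    fix x y assume "(x, y) \<in> inversions (2 * n) b"
    then have xy: "x < y" "y < 2 * n" "b y < b x" by (auto simp: inversions_def)
    have "x = 2 * (x div 2) \<or> x = Suc (2 * (x div 2))" "y = 2 * (y div 2) \<or> y = Suc (2 * (y div 2))" by auto
    then obtain u v where "x = 2 * u \<or> x = Suc (2 * u)" "y = 2 * v \<or> y = Suc (2 * v)" by blast
    with xy t[of u] t[of v] t'[of u] t'[of v]
    have "x = 2 * u \<and> y = Suc (2 * u) \<and> u < n" by auto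
    then show "(x, y) \<in> (\<lambda>j. (2 * j, Suc (2 * j))) ` {..<n}" by auto
  qed
  from card_mono[OF _ this] card_image_le[of "{..<n}" "\<lambda>j. (2 * j, Suc (2 * j))"] show ?thesis by auto
qed

lemma card_inversions_w0: "card (inversions (2 * n) (w0 n)) = n * (2 * n - 1)"
proof -
  have "inversions (2 * n) (w0 n) = (\<lambda>(k, j). (j, k)) ` Sigma {..<2 * n} (\<lambda>k. {..<k})"
    by (force simp: inversions_def image_iff)
  then have "card (inversions (2 * n) (w0 n)) = card (Sigma {..<2 * n} (\<lambda>k. {..<k}))"
    by (simp add: card_image inj_on_def)
  also have "\<dots> = \<Sum>{..<2 * n}" by simp
  also have "\<dots> = n * (2 * n - 1)" by (induction n) (auto simp: algebra_simps)
  finally show ?thesis .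
qed

section \<open>The special linear group\<close>

abbreviation GG :: "nat \<Rightarrow> complex mat set" where "GG m \<equiv> carrier (SL m)"
abbreviation minv :: "nat \<Rightarrow> complex mat \<Rightarrow> complex mat" where "minv m x \<equiv> inv\<^bsub>SL m\<^esub> x"

lemma SL_mat: "x \<in> GG m \<Longrightarrow> x \<in> carrier_mat m m" and SL_det: "x \<in> GG m \<Longrightarrow> det x = 1"
  by (auto simp: carrier_SL)

lemma SL_I: "x \<in> carrier_mat m m \<Longrightarrow> det x = 1 \<Longrightarrow> x \<in> GG m"
  by (auto simp: carrier_SL)

lemma SL_dim: "x \<in> GG m \<Longrightarrow> dim_row x = m" "x \<in> GG m \<Longrightarrow> dim_col x = m"
  by (auto simp: carrier_SL)

lemma SL_closed [simp, intro]: "x \<in> GG m \<Longrightarrow> y \<in> GG m \<Longrightarrow> x * y \<in> GG m"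
  using monoid.m_closed[OF group.is_monoid[OF group_SL], of x m y] by (simp add: mult_SL)

lemma SL_one [simp, intro]: "1\<^sub>m m \<in> GG m"
  by (simp add: carrier_SL)

lemma SL_inv [simp, intro]: "x \<in> GG m \<Longrightarrow> minv m x \<in> GG m"
  using group.inv_closed[OF group_SL] .

lemma SL_inverse [simp]: "x \<in> GG m \<Longrightarrow> minv m x * x = 1\<^sub>m m" "x \<in> GG m \<Longrightarrow> x * minv m x = 1\<^sub>m m"
  using group.l_inv[OF group_SL, of x m] group.r_inv[OF group_SL, of x m] by (simp_all add: mult_SL one_SL)

lemma SL_unit [simp]: "x \<in> GG m \<Longrightarrow> 1\<^sub>m m * x = x" "x \<in> GG m \<Longrightarrow> x * 1\<^sub>m m = x"
  by (auto dest: SL_mat)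

lemma mat_assoc: "x \<in> carrier_mat m m \<Longrightarrow> y \<in> carrier_mat m m \<Longrightarrow> z \<in> carrier_mat m m \<Longrightarrow>
    x * y * z = x * (y * z)"
  by (rule assoc_mult_mat)

lemma SL_assoc: "x \<in> GG m \<Longrightarrow> y \<in> GG m \<Longrightarrow> z \<in> GG m \<Longrightarrow> x * y * z = x * (y * z)"
  by (auto dest!: SL_mat intro: mat_assoc)

lemma SL_cancel [simp]:
  assumes "x \<in> GG m" "y \<in> GG m"
  shows "minv m x * (x * y) = y" "x * (minv m x * y) = y" "y * x * minv m x = y" "y * minv m x * x = y"
  using assms SL_assoc[of "minv m x" m x y] SL_assoc[of x m "minv m x" y]
    SL_assoc[of y m x "minv m x"] SL_assoc[of y m "minv m x" x] by simp_all

lemma SL_inv_eq: "x \<in> GG m \<Longrightarrow> y \<in> GG m \<Longrightarrow> y * x = 1\<^sub>m m \<Longrightarrow> minv m x = y"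
  by (metis SL_cancel(3) SL_inv SL_unit(1))

lemma SL_inv_mult: "x \<in> GG m \<Longrightarrow> y \<in> GG m \<Longrightarrow> minv m (x * y) = minv m y * minv m x"
  using group.inv_mult_group[OF group_SL, of x m y] by (simp add: mult_SL)

lemma SL_inv_inv [simp]: "x \<in> GG m \<Longrightarrow> minv m (minv m x) = x"
  using group.inv_inv[OF group_SL] .

lemma SL_transpose [simp, intro]: "x \<in> GG m \<Longrightarrow> transpose_mat x \<in> GG m"
  by (auto simp: carrier_SL det_transpose)

lemma mult_index: "x \<in> carrier_mat m m \<Longrightarrow> y \<in> carrier_mat m m \<Longrightarrow> i < m \<Longrightarrow> j < m \<Longrightarrow>
    (x * y) $$ (i, j) = (\<Sum>k<m. x $$ (i, k) * y $$ (k, j))"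
  by (auto simp: scalar_prod_def atLeast0LessThan intro!: sum.cong)

lemma coset_mem: "g <#\<^bsub>SL m\<^esub> H = (\<lambda>h. g * h) ` H"
  by (auto simp: l_coset_def mult_SL)

section \<open>Block triangular matrices\<close>

text \<open>Stability of the span of the coordinate vectors from \<open>p\<close> on. The Borel
  subgroup and the parabolics are intersections of such stabilisers, and the same notion controls
  corner blocks later.\<close>

definition blocktri :: "nat \<Rightarrow> nat \<Rightarrow> complex mat \<Rightarrow> bool" where
  "blocktri m p x \<longleftrightarrow> (\<forall>l r. l < p \<longrightarrow> p \<le> r \<longrightarrow> r < m \<longrightarrow> x $$ (l, r) = 0)"

lemma blocktri_mult:
  assumes "x \<in> carrier_mat m m" "y \<in> carrier_mat m m" "blocktri m p x" "blocktri m p y"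
  shows "blocktri m p (x * y)"
  unfolding blocktri_def
proof (intro allI impI)
  fix l r assume lr: "l < p" "p \<le> r" "r < m"
  have "x $$ (l, k) * y $$ (k, r) = 0" if "k < m" for k
    using assms(3,4) lr that by (cases "k < p") (auto simp: blocktri_def)
  then show "(x * y) $$ (l, r) = 0" using assms(1,2) lr by (subst mult_index[of _ m]) (auto intro: sum.neutral)
qed

lemma borel_iff: "x \<in> borel n \<longleftrightarrow> x \<in> GG (2 * n) \<and> (\<forall>p. blocktri (2 * n) p x)"
  by (force simp: borel_def blocktri_def intro: le_less_trans less_le_trans)

text \<open>An entry \<open>(r, c)\<close> above the diagonal is killed by each \<open>p\<close>
  with \<open>r < p \<le> c\<close>. Only for \<open>(i, Suc i)\<close> is \<open>p = Suc i\<close>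
  the sole choice.\<close>

lemma parabolic_iff:
  assumes "Suc i < 2 * n"
  shows "x \<in> parabolic n i \<longleftrightarrow> x \<in> GG (2 * n) \<and> (\<forall>p. p \<noteq> Suc i \<longrightarrow> blocktri (2 * n) p x)"
proof -
  have "x $$ (r, c) = 0" if *: "\<forall>p. p \<noteq> Suc i \<longrightarrow> blocktri (2 * n) p x" and "r < c" "c < 2 * n" "(r, c) \<noteq> (i, Suc i)" for r c
  proof (cases "r = i")
    case True
    then have "blocktri (2 * n) c x" using that by auto
    with that show ?thesis by (auto simp: blocktri_def)
  next
    case False
    then have "blocktri (2 * n) (Suc r) x" using that by auto
    with that show ?thesis by (auto simp: blocktri_def)
  qed
  moreover have "blocktri (2 * n) p x" if "x \<in> parabolic n i" "p \<noteq> Suc i" for p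
    using that by (auto simp: parabolic_def blocktri_def)
  ultimately show ?thesis by (auto simp: parabolic_def)
qed

lemma borel_SL: "x \<in> borel n \<Longrightarrow> x \<in> GG (2 * n)" by (simp add: borel_iff)
lemma parabolic_SL: "x \<in> parabolic n i \<Longrightarrow> x \<in> GG (2 * n)" by (simp add: parabolic_def)
lemma Sp_SL: "x \<in> Sp n \<Longrightarrow> x \<in> GG (2 * n)" by (simp add: Sp_def)

lemma borel_zero: "x \<in> borel n \<Longrightarrow> r < c \<Longrightarrow> c < 2 * n \<Longrightarrow> x $$ (r, c) = 0" by (simp add: borel_def)

lemma borel_subset_parabolic: "borel n \<subseteq> parabolic n i" by (auto simp: borel_def parabolic_def)

lemma borel_mult [simp, intro]: "x \<in> borel n \<Longrightarrow> y \<in> borel n \<Longrightarrow> x * y \<in> borel n"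
  unfolding borel_iff by (meson SL_closed SL_mat blocktri_mult)

lemma borel_one [simp, intro]: "1\<^sub>m (2 * n) \<in> borel n"
  by (auto simp: borel_def)

lemma parabolic_mult:
  assumes i: "Suc i < 2 * n" and "x \<in> parabolic n i" "y \<in> parabolic n i"
  shows "x * y \<in> parabolic n i"
proof -
  have x: "x \<in> GG (2 * n)" "\<And>p. p \<noteq> Suc i \<Longrightarrow> blocktri (2 * n) p x"
    and y: "y \<in> GG (2 * n)" "\<And>p. p \<noteq> Suc i \<Longrightarrow> blocktri (2 * n) p y"
    using assms(2,3) unfolding parabolic_iff[OF i] by blast+
  show ?thesis unfolding parabolic_iff[OF i]
    using SL_closed[OF x(1) y(1)] blocktri_mult[OF SL_mat[OF x(1)] SL_mat[OF y(1)] x(2) y(2)] by blast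
qed

lemma borel_diag_prod: "x \<in> borel n \<Longrightarrow> (\<Prod>j<2 * n. x $$ (j, j)) = 1"
proof -
  assume x: "x \<in> borel n"
  have "1 = prod_list (diag_mat x)"
    using det_lower_triangular[OF borel_zero[OF x] SL_mat[OF borel_SL[OF x]]] SL_det[OF borel_SL[OF x]] by simp
  also have "\<dots> = (\<Prod>j<2 * n. x $$ (j, j))"
    using SL_dim(1)[OF borel_SL[OF x]] by (simp only: prod_list_diag_prod atLeast0LessThan)
  finally show ?thesis by simp
qed

lemma borel_diag: "x \<in> borel n \<Longrightarrow> j < 2 * n \<Longrightarrow> x $$ (j, j) \<noteq> 0"
  using borel_diag_prod[of x n] prod_zero_iff[of "{..<2 * n}" "\<lambda>j. x $$ (j, j)"] by auto

lemma borel_inv [simp, intro]: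
  assumes x: "x \<in> borel n"
  shows "minv (2 * n) x \<in> borel n"
proof -
  let ?y = "minv (2 * n) x"
  have y: "?y \<in> GG (2 * n)" and xG: "x \<in> GG (2 * n)" using borel_SL[OF x] by auto
  \<comment> \<open>Forward substitution in column \<open>r\<close> of \<open>x * ?y = 1\<close>: at
    row \<open>l\<close> the earlier rows of \<open>?y\<close> contribute nothing, and the diagonal
    entry of \<open>x\<close> can be cancelled.\<close>
  have "l < r \<Longrightarrow> ?y $$ (l, r) = 0" if r: "r < 2 * n" for l r
  proof (induction l rule: less_induct)
    case (less l)
    then have l: "l < 2 * n" using r by simp
    have "0 = (x * ?y) $$ (l, r)" using xG l r less.prems by simp
    also have "\<dots> = (\<Sum>k<2 * n. x $$ (l, k) * ?y $$ (k, r))"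
      using SL_mat[OF xG] SL_mat[OF y] l r by (rule mult_index)
    also have "\<dots> = (\<Sum>k<2 * n. if k = l then x $$ (l, l) * ?y $$ (l, r) else 0)"
    proof (rule sum.cong[OF refl])
      fix k assume k: "k \<in> {..<2 * n}"
      consider "k < l" | "k = l" | "l < k" by linarith
      then show "x $$ (l, k) * ?y $$ (k, r) = (if k = l then x $$ (l, l) * ?y $$ (l, r) else 0)"
        using less borel_zero[OF x, of l k] k by cases auto
    qed
    also have "\<dots> = x $$ (l, l) * ?y $$ (l, r)" using l by simp
    finally show ?case using borel_diag[OF x l] by auto
  qed
  then show ?thesis using y by (simp add: borel_def)
qed

section \<open>Elementary matrices\<close>

lemma addrow_mat_SL [simp, intro]: "k \<noteq> l \<Longrightarrow> addrow_mat m a k l \<in> GG m"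
  by (rule SL_I) (auto simp: det_addrow_mat)

lemma mult_addrow_index:
  fixes x :: "complex mat"
  assumes "x \<in> carrier_mat m m" "r < m" "c < m" "k < m"
  shows "(x * addrow_mat m a k l) $$ (r, c) = x $$ (r, c) + (if c = l then a * x $$ (r, k) else 0)"
proof -
  have "(x * addrow_mat m a k l) $$ (r, c) = (\<Sum>j<m. x $$ (r, j) * addrow_mat m a k l $$ (j, c))"
    using assms by (intro mult_index) auto
  also have "\<dots> = (\<Sum>j<m. (if j = c then x $$ (r, c) else 0) + (if j = k then (if c = l then a * x $$ (r, k) else 0) else 0))"
    using assms by (intro sum.cong) (auto simp: algebra_simps)
  finally show ?thesis using assms by (simp add: sum.distrib)
qed

lemma addrow_mult_index:
  fixes x :: "complex mat"
  assumes "x \<in> carrier_mat m m" "r < m" "c < m" "l < m"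
  shows "(addrow_mat m a k l * x) $$ (r, c) = x $$ (r, c) + (if r = k then a * x $$ (l, c) else 0)"
proof -
  have "(addrow_mat m a k l * x) $$ (r, c) = (\<Sum>j<m. addrow_mat m a k l $$ (r, j) * x $$ (j, c))"
    using assms by (intro mult_index) auto
  also have "\<dots> = (\<Sum>j<m. (if j = r then x $$ (r, c) else 0) + (if j = l then (if r = k then a * x $$ (l, c) else 0) else 0))"
    using assms by (intro sum.cong) (auto simp: algebra_simps)
  finally show ?thesis using assms by (simp add: sum.distrib)
qed

lemma transpose_addrow: "transpose_mat (addrow_mat m a k l) = addrow_mat m a l k"
  by (rule eq_matI) auto

lemma addrow_mat_borel: "l < k \<Longrightarrow> k < 2 * n \<Longrightarrow> addrow_mat (2 * n) a k l \<in> borel n"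
  by (auto simp: borel_def)

lemma addrow_mat_add:
  fixes a b :: complex
  assumes "k \<noteq> l" "k < m" "l < m"
  shows "addrow_mat m a k l * addrow_mat m b k l = addrow_mat m (a + b) k l"
  by (rule eq_matI) (use assms in \<open>auto simp: mult_addrow_index simp del: index_mult_mat(1)\<close>)

lemma addrow_mat_zero: "addrow_mat m 0 k l = 1\<^sub>m m"
  by (rule eq_matI) auto

lemma minv_addrow: "k \<noteq> l \<Longrightarrow> k < m \<Longrightarrow> l < m \<Longrightarrow> minv m (addrow_mat m a k l) = addrow_mat m (- a) k l"
  by (rule SL_inv_eq) (auto simp: addrow_mat_add addrow_mat_zero)

text \<open>A representative of the simple reflection in the normaliser of the torus; the sign gives
  it determinant one.\<close>

definition smat :: "nat \<Rightarrow> nat \<Rightarrow> complex mat" where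
  "smat m i = mat m m (\<lambda>(r, c). if r = i \<and> c = Suc i then 1 else if r = Suc i \<and> c = i then - 1
     else if r = c \<and> r \<noteq> i \<and> r \<noteq> Suc i then 1 else 0)"

lemma smat_carrier [simp]: "smat m i \<in> carrier_mat m m" "dim_row (smat m i) = m" "dim_col (smat m i) = m"
  by (simp_all add: smat_def)

lemma mult_smat_index:
  assumes "x \<in> carrier_mat m m" "r < m" "c < m" "Suc i < m"
  shows "(x * smat m i) $$ (r, c) = (if c = i then - x $$ (r, Suc i) else if c = Suc i then x $$ (r, i) else x $$ (r, c))"
proof -
  have "(x * smat m i) $$ (r, c) = (\<Sum>j<m. x $$ (r, j) * smat m i $$ (j, c))"
    using assms by (intro mult_index) auto
  also have "\<dots> = (\<Sum>j<m. if j = simple_refl i c then (if c = i then - x $$ (r, Suc i) else if c = Suc i then x $$ (r, i) else x $$ (r, c)) else 0)"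
    using assms by (intro sum.cong) (auto simp: smat_def simple_refl_def Transposition.transpose_def)
  also have "simple_refl i c < m" using assms by (auto simp: simple_refl_def Transposition.transpose_def)
  then have "(\<Sum>j<m. if j = simple_refl i c then (if c = i then - x $$ (r, Suc i) else if c = Suc i then x $$ (r, i) else x $$ (r, c)) else 0)
    = (if c = i then - x $$ (r, Suc i) else if c = Suc i then x $$ (r, i) else x $$ (r, c))" by simp
  finally show ?thesis .
qed

lemma smat_eq_addrows:
  assumes "Suc i < m"
  shows "smat m i = addrow_mat m 1 i (Suc i) * addrow_mat m (- 1) (Suc i) i * addrow_mat m 1 i (Suc i)"
proof -
  have c: "addrow_mat m (1 :: complex) i (Suc i) * addrow_mat m (- 1) (Suc i) i \<in> carrier_mat m m"
    by (rule mult_carrier_mat[of _ m m]) auto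
  show ?thesis
    by (rule eq_matI) (use assms c in \<open>auto simp: mult_addrow_index smat_def simp del: index_mult_mat(1)\<close>)
qed

lemma smat_SL [simp, intro]: "Suc i < m \<Longrightarrow> smat m i \<in> GG m"
  unfolding smat_eq_addrows by (intro SL_closed) auto

lemma smat_transpose: "Suc i < m \<Longrightarrow> transpose_mat (smat m i) * smat m i = 1\<^sub>m m"
proof (rule eq_matI)
  fix r c assume i: "Suc i < m" and "r < dim_row (1\<^sub>m m :: complex mat)" "c < dim_col (1\<^sub>m m :: complex mat)"
  then have rc: "r < m" "c < m" by auto
  have t: "transpose_mat (smat m i) \<in> carrier_mat m m" by simp
  show "(transpose_mat (smat m i) * smat m i) $$ (r, c) = 1\<^sub>m m $$ (r, c)"
    unfolding mult_smat_index[OF t rc i] using rc i by (auto simp: smat_def)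
qed auto

lemma minv_smat: "Suc i < m \<Longrightarrow> minv m (smat m i) = transpose_mat (smat m i)"
  by (rule SL_inv_eq) (auto simp: smat_transpose)

lemma transpose_mult_index:
  fixes x :: "complex mat"
  assumes "x \<in> carrier_mat m m" "y \<in> carrier_mat m m" "r < m" "c < m"
  shows "(transpose_mat y * x) $$ (r, c) = (transpose_mat x * y) $$ (c, r)"
proof -
  have "transpose_mat (transpose_mat x * y) = transpose_mat y * x"
    using transpose_mult[of "transpose_mat x" m m y m] assms by simp
  moreover have "transpose_mat (transpose_mat x * y) $$ (r, c) = (transpose_mat x * y) $$ (c, r)"
    using assms by (intro index_transpose_mat) auto
  ultimately show ?thesis by simp
qed

lemma minv_smat_mult_index:
  assumes "x \<in> carrier_mat m m" "r < m" "c < m" "Suc i < m"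
  shows "(minv m (smat m i) * x) $$ (r, c) = (if r = i then - x $$ (Suc i, c) else if r = Suc i then x $$ (i, c) else x $$ (r, c))"
proof -
  have "(minv m (smat m i) * x) $$ (r, c) = (transpose_mat x * smat m i) $$ (c, r)"
    using assms by (simp add: minv_smat transpose_mult_index del: index_mult_mat(1))
  then show ?thesis using assms by (simp add: mult_smat_index del: index_mult_mat(1))
qed

lemma smat_parabolic: "Suc i < 2 * n \<Longrightarrow> smat (2 * n) i \<in> parabolic n i"
  "Suc i < 2 * n \<Longrightarrow> minv (2 * n) (smat (2 * n) i) \<in> parabolic n i"
   apply (simp add: parabolic_def)
   apply (auto simp: smat_def)[1]
  apply (simp add: parabolic_def minv_smat)
  apply (auto simp: smat_def)
  done

text \<open>The simple root itself is the only root of \<open>B\<close> that its reflection sends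
  outside \<open>B\<close>.\<close>

lemma smat_conj_borel:
  assumes x: "x \<in> borel n" and i: "Suc i < 2 * n" and z: "x $$ (Suc i, i) = 0"
  shows "minv (2 * n) (smat (2 * n) i) * x * smat (2 * n) i \<in> borel n"
proof -
  let ?s = "smat (2 * n) i"
  have xG: "x \<in> GG (2 * n)" and sG: "?s \<in> GG (2 * n)" using borel_SL[OF x] i by auto
  have sx: "minv (2 * n) ?s * x \<in> carrier_mat (2 * n) (2 * n)" using xG sG SL_mat by blast
  have "(minv (2 * n) ?s * x * ?s) $$ (r, c) = 0" if "r < c" "c < 2 * n" for r c
  proof -
    have r: "r < 2 * n" using that by simp
    show ?thesis
      using that r i z borel_zero[OF x] SL_mat[OF xG]
      by (auto simp: mult_smat_index[OF sx] minv_smat_mult_index simp del: index_mult_mat(1))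
  qed
  then show ?thesis using xG sG by (simp add: borel_def)
qed

text \<open>The Bruhat decomposition of \<open>P_i\<close> into \<open>B\<close> and the open cell,
  the latter with its root subgroup coordinate \<open>c\<close> made explicit.\<close>

lemma parabolic_cases:
  assumes x: "x \<in> parabolic n i" and i: "Suc i < 2 * n"
  obtains "x \<in> borel n" | c y where "y \<in> borel n" "x = addrow_mat (2 * n) c (Suc i) i * smat (2 * n) i * y"
proof (cases "x $$ (i, Suc i) = 0")
  case True
  then have "x \<in> borel n" using x by (auto simp: parabolic_def borel_def)
  then show ?thesis by (rule that(1))
next
  case False
  let ?m = "2 * n" let ?s = "smat ?m i"
  \<comment> \<open>Subtracting \<open>c\<close> times row \<open>i\<close> clears the entry
    \<open>(Suc i, Suc i)\<close>; after exchanging the two rows nothing is left above the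
    diagonal.\<close>
  define c where "c = x $$ (Suc i, Suc i) / x $$ (i, Suc i)"
  let ?l = "addrow_mat ?m c (Suc i) i"
  have G: "x \<in> GG ?m" "?s \<in> GG ?m" "?l \<in> GG ?m" using x i by (auto simp: parabolic_SL)
  define z where "z = addrow_mat ?m (- c) (Suc i) i * x"
  have zG: "z \<in> GG ?m" using G by (auto simp: z_def)
  have z: "z $$ (r, k) = x $$ (r, k) + (if r = Suc i then - c * x $$ (i, k) else 0)" if "r < ?m" "k < ?m" for r k
    unfolding z_def using SL_mat[OF G(1)] that i by (subst addrow_mult_index) auto
  define y where "y = minv ?m ?s * z"
  have yG: "y \<in> GG ?m" using G zG by (auto simp: y_def)
  have y: "y $$ (r, k) = (if r = i then - z $$ (Suc i, k) else if r = Suc i then z $$ (i, k) else z $$ (r, k))"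
    if "r < ?m" "k < ?m" for r k
    unfolding y_def using SL_mat[OF zG] that i by (rule minv_smat_mult_index)
  have x0: "x $$ (r, k) = 0" if "r < k" "k < ?m" "(r, k) \<noteq> (i, Suc i)" for r k
    using x that by (auto simp: parabolic_def)
  have "y $$ (r, k) = 0" if "r < k" "k < ?m" for r k
    using that i x0[of r k] x0[of i k] x0[of "Suc i" k] False
    by (cases "k = Suc i"; cases "r = i") (auto simp: y z c_def)
  then have "y \<in> borel n" using yG by (simp add: borel_def)
  moreover have "x = ?l * ?s * y"
  proof -
    have "?l * ?s * y = ?l * z" using G zG by (simp add: y_def SL_assoc[of _ ?m])
    also have "\<dots> = ?l * minv ?m ?l * x" using G i by (simp add: z_def minv_addrow SL_assoc[of _ ?m])
    also have "\<dots> = x" using G by simp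
    finally show ?thesis by simp
  qed
  ultimately show ?thesis by (rule that(2))
qed

lemma parabolic_inv:
  assumes x: "x \<in> parabolic n i" and i: "Suc i < 2 * n"
  shows "minv (2 * n) x \<in> parabolic n i"
  using assms
proof (cases rule: parabolic_cases)
  case 1
  then show ?thesis using borel_subset_parabolic by blast
next
  case (2 c y)
  let ?m = "2 * n"
  have l: "addrow_mat ?m c (Suc i) i \<in> borel n" using i by (simp add: addrow_mat_borel)
  then have "minv ?m x = minv ?m y * (minv ?m (smat ?m i) * minv ?m (addrow_mat ?m c (Suc i) i))"
    using 2 borel_SL i by (simp add: SL_inv_mult)
  moreover have "minv ?m y \<in> parabolic n i" "minv ?m (addrow_mat ?m c (Suc i) i) \<in> parabolic n i"
    using l 2 borel_subset_parabolic by blast+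
  ultimately show ?thesis using smat_parabolic(2)[OF i] parabolic_mult[OF i] by simp
qed

section \<open>The Gram matrix\<close>

definition jsgn :: "nat \<Rightarrow> nat \<Rightarrow> complex" where "jsgn n k = (if k < n then 1 else - 1)"

lemma Jnn_carrier [simp]: "Jnn n \<in> carrier_mat (2 * n) (2 * n)"
  using Jnn_in_SL SL_mat by blast

lemma Jnn_index: "r < 2 * n \<Longrightarrow> c < 2 * n \<Longrightarrow> Jnn n $$ (r, c) = (if c = w0 n r then jsgn n r else 0)"
  by (auto simp: Jnn_def four_block_mat_def antidiag_def Let_def jsgn_def)

definition gram :: "nat \<Rightarrow> complex mat \<Rightarrow> complex mat" where
  "gram n x = transpose_mat x * Jnn n * x"

lemma gram_carrier [simp, intro]: "x \<in> carrier_mat (2 * n) (2 * n) \<Longrightarrow> gram n x \<in> carrier_mat (2 * n) (2 * n)"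
  unfolding gram_def by (intro mult_carrier_mat[of _ "2 * n" "2 * n"]) auto

lemma gram_SL [simp, intro]: "x \<in> GG (2 * n) \<Longrightarrow> gram n x \<in> GG (2 * n)"
  unfolding gram_def using Jnn_in_SL by auto

lemma gram_mult:
  assumes "x \<in> carrier_mat (2 * n) (2 * n)" "y \<in> carrier_mat (2 * n) (2 * n)"
  shows "gram n (x * y) = transpose_mat y * gram n x * y"
proof -
  have t: "transpose_mat x \<in> carrier_mat (2 * n) (2 * n)" "transpose_mat y \<in> carrier_mat (2 * n) (2 * n)"
    using assms by auto
  note c = mult_carrier_mat[of _ "2 * n" "2 * n" _ "2 * n"]
  show ?thesis
    using assms t by (simp add: gram_def transpose_mult[of x "2 * n" "2 * n" y "2 * n"] mat_assoc[of _ "2 * n"] c)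
qed

lemma gram_index:
  assumes x: "x \<in> carrier_mat (2 * n) (2 * n)" and r: "r < 2 * n" and c: "c < 2 * n"
  shows "gram n x $$ (r, c) = (\<Sum>k<2 * n. jsgn n k * x $$ (k, r) * x $$ (w0 n k, c))"
proof -
  have tx: "transpose_mat x \<in> carrier_mat (2 * n) (2 * n)" using x by auto
  have "gram n x = transpose_mat x * (Jnn n * x)" using x tx by (simp add: gram_def mat_assoc[of _ "2 * n"])
  then have "gram n x $$ (r, c) = (\<Sum>k<2 * n. transpose_mat x $$ (r, k) * (Jnn n * x) $$ (k, c))"
    using mult_index[OF tx mult_carrier_mat[OF Jnn_carrier x] r c] by simp
  also have "\<dots> = (\<Sum>k<2 * n. jsgn n k * x $$ (k, r) * x $$ (w0 n k, c))"
  proof (rule sum.cong[OF refl])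
    fix k assume "k \<in> {..<2 * n}"
    then have k: "k < 2 * n" by simp
    have "(Jnn n * x) $$ (k, c) = (\<Sum>j<2 * n. Jnn n $$ (k, j) * x $$ (j, c))"
      using mult_index[OF Jnn_carrier x k c] .
    also have "\<dots> = (\<Sum>j<2 * n. if j = w0 n k then jsgn n k * x $$ (w0 n k, c) else 0)"
      using k by (intro sum.cong) (auto simp: Jnn_index)
    also have "\<dots> = jsgn n k * x $$ (w0 n k, c)" using w0_less[OF k] by (simp del: w0_simps)
    finally show "transpose_mat x $$ (r, k) * (Jnn n * x) $$ (k, c) = jsgn n k * x $$ (k, r) * x $$ (w0 n k, c)"
      using x k r by simp
  qed
  finally show ?thesis .
qed

lemma jsgn_w0: "k < 2 * n \<Longrightarrow> jsgn n (w0 n k) = - jsgn n k"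
  by (auto simp: jsgn_def)

lemma gram_skew:
  assumes x: "x \<in> carrier_mat (2 * n) (2 * n)" and r: "r < 2 * n" and c: "c < 2 * n"
  shows "gram n x $$ (c, r) = - gram n x $$ (r, c)"
proof -
  have "gram n x $$ (c, r) = (\<Sum>k<2 * n. jsgn n k * x $$ (k, c) * x $$ (w0 n k, r))"
    using gram_index[OF x c r] .
  also have "\<dots> = (\<Sum>k<2 * n. jsgn n (w0 n k) * x $$ (w0 n k, c) * x $$ (w0 n (w0 n k), r))"
    using sum.permute[OF w0_permutes, of "\<lambda>k. jsgn n k * x $$ (k, c) * x $$ (w0 n k, r)" n] by (simp add: o_def)
  also have "\<dots> = (\<Sum>k<2 * n. - (jsgn n k * x $$ (k, r) * x $$ (w0 n k, c)))"
    by (intro sum.cong) (auto simp: jsgn_w0 simp del: w0_simps(1))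
  also have "\<dots> = - gram n x $$ (r, c)" using gram_index[OF x r c] by (simp add: sum_negf)
  finally show ?thesis .
qed

lemma gram_diag: "x \<in> carrier_mat (2 * n) (2 * n) \<Longrightarrow> r < 2 * n \<Longrightarrow> gram n x $$ (r, r) = 0"
  using gram_skew[of x n r r] by simp

lemma gram_one: "gram n (1\<^sub>m (2 * n)) = Jnn n"
  using left_mult_one_mat[OF Jnn_carrier[of n]] right_mult_one_mat[OF Jnn_carrier[of n]]
  by (simp add: gram_def)

lemma Sp_iff: "k \<in> Sp n \<longleftrightarrow> k \<in> GG (2 * n) \<and> gram n k = Jnn n"
  by (simp add: Sp_def gram_def)

lemma gram_Sp_mult:
  assumes "k \<in> Sp n" "x \<in> GG (2 * n)"
  shows "gram n (k * x) = gram n x"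
  using gram_mult[of k n x] assms SL_mat by (auto simp: Sp_iff gram_def)

lemma gram_eq_Sp:
  assumes x: "x \<in> GG (2 * n)" and y: "y \<in> GG (2 * n)" and e: "gram n x = gram n y"
  shows "y * minv (2 * n) x \<in> Sp n"
proof -
  let ?m = "2 * n"
  have xi: "minv ?m x \<in> GG ?m" using x by simp
  have "gram n (y * minv ?m x) = transpose_mat (minv ?m x) * gram n x * minv ?m x"
    using gram_mult[OF SL_mat[OF y] SL_mat[OF xi]] e by simp
  also have "\<dots> = gram n (x * minv ?m x)" using gram_mult[OF SL_mat[OF x] SL_mat[OF xi]] by simp
  also have "\<dots> = Jnn n" using x by (simp add: gram_one)
  finally show ?thesis using y xi by (simp add: Sp_iff)
qed

lemma Sp_mult: "k \<in> Sp n \<Longrightarrow> l \<in> Sp n \<Longrightarrow> k * l \<in> Sp n"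
  using gram_Sp_mult[of k n l] by (auto simp: Sp_iff)

lemma Sp_one: "1\<^sub>m (2 * n) \<in> Sp n"
  by (simp add: Sp_iff gram_one)

declare w0_simps(1) [simp del]

section \<open>Symplectic matrices have determinant one\<close>

text \<open>Such a permutation acts on the pairs \<open>{i, w0 n i}\<close>. Composing with the
  transposition of one pair that is turned over changes both the sign of the permutation and the
  product. When no pair is turned over, the permutation acts by the same rule on both halves and is
  even.\<close>

lemma sign_commuting_w0:
  assumes "\<sigma> permutes {..<2 * n}" "\<And>i. i < n \<Longrightarrow> \<sigma> (w0 n i) = w0 n (\<sigma> i)"
  shows "of_int (sign \<sigma>) * (\<Prod>i<n. jsgn n (\<sigma> i)) = 1"
  using assms
proof (induction "card {i. i < n \<and> n \<le> \<sigma> i}" arbitrary: \<sigma>)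
  case 0
  note s = "0.prems"
  have small: "\<sigma> i < n" if "i < n" for i using 0(1) that by (auto simp: not_le)
  define \<rho> where "\<rho> j = (if j < n then \<sigma> j else j)" for j
  have inj: "inj \<sigma>" using permutes_inj[OF s(1)] .
  have "\<sigma> ` {..<n} = {..<n}"
    using small by (intro card_subset_eq) (auto simp: card_image inj_on_subset[OF inj])
  then have "bij_betw \<sigma> {..<n} {..<n}" using inj_on_subset[OF inj, of "{..<n}"] by (simp add: bij_betw_def)
  then have "bij_betw \<rho> {..<n} {..<n}" by (rule bij_betw_cong[THEN iffD1, rotated]) (simp add: \<rho>_def)
  then have "\<rho> permutes {..<n}" by (rule bij_imp_permutes) (simp add: \<rho>_def)
  then have r: "\<rho> permutes {..<2 * n}" by (rule permutes_subset) auto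
  let ?q = "w0 n \<circ> \<rho> \<circ> w0 n"
  have "\<sigma> j = (\<rho> \<circ> ?q) j" for j
  proof -
    consider "j < n" | "n \<le> j" "j < 2 * n" | "2 * n \<le> j" by linarith
    then show ?thesis
    proof cases
      case 1
      then have "\<rho> (w0 n j) = w0 n j" by (simp add: \<rho>_def w0_simps)
      then show ?thesis using 1 by (simp add: \<rho>_def)
    next
      case 2
      then have w: "w0 n j < n" by (simp add: w0_simps)
      then have "\<sigma> j = w0 n (\<sigma> (w0 n j))" using s(2)[of "w0 n j"] by simp
      moreover have "w0 n (\<sigma> (w0 n j)) \<ge> n" using small[OF w] by (simp add: w0_simps)
      ultimately show ?thesis using w by (simp add: \<rho>_def)
    next
      case 3
      then have "w0 n j = j" "\<rho> j = j" "\<sigma> j = j" using s(1) by (auto simp: w0_def \<rho>_def permutes_def)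
      then show ?thesis by simp
    qed
  qed
  then have "\<sigma> = \<rho> \<circ> ?q" by blast
  moreover have "permutation \<rho>" "permutation (w0 n)"
    using r w0_permutes permutation_permutes by blast+
  ultimately have "sign \<sigma> = sign \<rho> * (sign (w0 n) * sign \<rho> * sign (w0 n))"
    by (simp add: sign_compose permutation_compose)
  also have "\<dots> = (sign \<rho> * sign \<rho>) * (sign (w0 n) * sign (w0 n))" by (simp only: ac_simps)
  finally have "sign \<sigma> = 1" by simp
  then show ?case using small by (simp add: jsgn_def)
next
  case (Suc k)
  note s = Suc.prems
  from Suc(2) have "{i. i < n \<and> n \<le> \<sigma> i} \<noteq> {}" by (metis Zero_not_Suc card.empty)
  then obtain i0 where i0: "i0 < n" "n \<le> \<sigma> i0" by blast
  let ?j0 = "w0 n i0"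
  have j0: "n \<le> ?j0" "?j0 < 2 * n" "i0 \<noteq> ?j0" using i0 by (auto simp: w0_simps)
  have si0: "\<sigma> i0 < 2 * n" using permutes_in_image[OF s(1), of i0] i0 by simp
  define \<tau> where "\<tau> = \<sigma> \<circ> Transposition.transpose i0 ?j0"
  have t: "\<tau> i0 = w0 n (\<sigma> i0)" "\<tau> ?j0 = \<sigma> i0" "\<And>j. j \<noteq> i0 \<Longrightarrow> j \<noteq> ?j0 \<Longrightarrow> \<tau> j = \<sigma> j"
    using s(2)[OF i0(1)] by (auto simp: \<tau>_def)
  have tp: "\<tau> permutes {..<2 * n}"
    unfolding \<tau>_def using i0 j0 by (intro permutes_compose[OF permutes_swap_id s(1)]) auto
  have tc: "\<tau> (w0 n i) = w0 n (\<tau> i)" if i: "i < n" for i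
  proof (cases "i = i0")
    case True
    then show ?thesis using t(1,2) by simp
  next
    case False
    have "w0 n i \<noteq> i0" "w0 n i \<noteq> ?j0" "i \<noteq> ?j0" using i i0 False j0 by (auto simp: w0_simps)
    then show ?thesis using t(3)[of i] t(3)[of "w0 n i"] s(2)[OF i] False by simp
  qed
  have "{i. i < n \<and> n \<le> \<sigma> i} = insert i0 {i. i < n \<and> n \<le> \<tau> i}"
  proof (rule Set.set_eqI)
    fix i
    have "n \<le> \<sigma> i \<longleftrightarrow> n \<le> \<tau> i" if "i < n" "i \<noteq> i0" using t(3)[of i] that j0 by simp
    then show "i \<in> {i. i < n \<and> n \<le> \<sigma> i} \<longleftrightarrow> i \<in> insert i0 {i. i < n \<and> n \<le> \<tau> i}" using i0 by auto
  qed
  moreover have "\<not> n \<le> \<tau> i0" using t(1) si0 i0 by (simp add: w0_simps)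
  ultimately have k: "k = card {i. i < n \<and> n \<le> \<tau> i}" using Suc(2) by simp
  have "of_int (sign \<tau>) * (\<Prod>i<n. jsgn n (\<tau> i)) = 1" using Suc(1)[OF k tp tc] .
  moreover have "sign \<tau> = - sign \<sigma>"
    unfolding \<tau>_def using i0 j0 s(1) permutation_permutes
    by (subst sign_compose) (auto simp: sign_swap_id permutation_swap_id)
  moreover have "(\<Prod>i<n. jsgn n (\<tau> i)) = - (\<Prod>i<n. jsgn n (\<sigma> i))"
  proof -
    have "(\<Prod>i<n. jsgn n (\<tau> i)) = jsgn n (\<tau> i0) * (\<Prod>i\<in>{..<n} - {i0}. jsgn n (\<tau> i))"
      using i0 by (intro prod.remove) auto
    also have "(\<Prod>i\<in>{..<n} - {i0}. jsgn n (\<tau> i)) = (\<Prod>i\<in>{..<n} - {i0}. jsgn n (\<sigma> i))"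
      using t(3) j0 by (intro prod.cong) auto
    also have "jsgn n (\<tau> i0) = - jsgn n (\<sigma> i0)" using t(1) si0 by (simp add: jsgn_w0)
    also have "- jsgn n (\<sigma> i0) * (\<Prod>i\<in>{..<n} - {i0}. jsgn n (\<sigma> i)) = - (\<Prod>i<n. jsgn n (\<sigma> i))"
      using i0 prod.remove[of "{..<n}" i0 "\<lambda>i. jsgn n (\<sigma> i)"] by simp
    finally show ?thesis .
  qed
  ultimately show ?case by simp
qed

text \<open>An unnormalised Pfaffian. On the Gram matrix of \<open>h\<close> it is \<open>det h\<close> times its value at \<open>Jnn n\<close>,
  which counts the permutations commuting with \<open>w0\<close> and so is nonzero.\<close>

definition pfaff :: "nat \<Rightarrow> complex mat \<Rightarrow> complex" where
  "pfaff n Y = (\<Sum>\<sigma> | \<sigma> permutes {0..<2 * n}. of_int (sign \<sigma>) * (\<Prod>i<n. Y $$ (\<sigma> i, \<sigma> (w0 n i))))"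

lemma prod_w0_split:
  fixes f :: "nat \<Rightarrow> complex"
  shows "(\<Prod>j<2 * n. f j) = (\<Prod>i<n. f i * f (w0 n i))"
proof -
  have "{..<2 * n} = {..<n} \<union> w0 n ` {..<n}"
  proof -
    have *: "j \<in> w0 n ` {..<n}" if "n \<le> j" "j < 2 * n" for j
      by (rule image_eqI[of _ _ "w0 n j"]) (use that in \<open>auto simp: w0_simps\<close>)
    show ?thesis
    proof (rule Set.set_eqI)
      fix j show "j \<in> {..<2 * n} \<longleftrightarrow> j \<in> {..<n} \<union> w0 n ` {..<n}"
        using *[of j] by (cases "j < n") (auto simp: w0_simps)
    qed
  qed
  moreover have "inj_on (w0 n) {..<n}" by (rule inj_on_inverseI[of _ "w0 n"]) simp
  moreover have "{..<n} \<inter> w0 n ` {..<n} = {}" by (auto simp: w0_simps)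
  ultimately show ?thesis by (simp add: prod.union_disjoint prod.reindex prod.distrib)
qed

text \<open>Expanding each entry of the Gram matrix chooses a row \<open>\<phi> i\<close> of
  \<open>h\<close> for every \<open>i < n\<close>. As \<open>Jnn n\<close> couples row
  \<open>k\<close> with row \<open>w0 n k\<close>, this choice extends to \<open>e \<phi>\<close> on
  all indices, and the signed sum over permutations becomes \<open>det (R \<phi> * h)\<close>. So
  \<open>det h\<close> factors out; the other factor does not depend on \<open>h\<close> and is read
  off at the identity.\<close>

lemma pfaff_gram:
  assumes h: "h \<in> carrier_mat (2 * n) (2 * n)"
  shows "pfaff n (gram n h) = det h * pfaff n (Jnn n)"
proof -
  let ?m = "2 * n" and ?\<Phi> = "PiE {..<n} (\<lambda>_. {..<2 * n})" and ?P = "{\<sigma>. \<sigma> permutes {0..<2 * n}}"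
  define e where "e \<phi> j = (if j < n then \<phi> j else w0 n (\<phi> (w0 n j)))" for \<phi> :: "nat \<Rightarrow> nat" and j
  define R :: "(nat \<Rightarrow> nat) \<Rightarrow> complex mat" where "R \<phi> = mat ?m ?m (\<lambda>(i, j). if j = e \<phi> i then 1 else 0)" for \<phi>
  have Rc: "R \<phi> \<in> carrier_mat ?m ?m" for \<phi> by (simp add: R_def)
  have wl: "w0 n j < n" if "\<not> j < n" "j < ?m" for j using that by (simp add: w0_simps)
  have el: "e \<phi> j < ?m" if "\<phi> \<in> ?\<Phi>" "j < ?m" for \<phi> j
    using that wl[of j] by (auto simp: e_def PiE_iff)
  have main: "pfaff n (gram n g) = (\<Sum>\<phi>\<in>?\<Phi>. (\<Prod>i<n. jsgn n (\<phi> i)) * det (R \<phi>)) * det g"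
    if g: "g \<in> carrier_mat ?m ?m" for g
  proof -
    have Rg: "(R \<phi> * g) $$ (i, j) = g $$ (e \<phi> i, j)" if "\<phi> \<in> ?\<Phi>" "i < ?m" "j < ?m" for \<phi> i j
    proof -
      have "(R \<phi> * g) $$ (i, j) = (\<Sum>k<?m. R \<phi> $$ (i, k) * g $$ (k, j))"
        using mult_index[OF Rc g that(2,3)] .
      also have "\<dots> = (\<Sum>k<?m. if k = e \<phi> i then g $$ (e \<phi> i, j) else 0)"
        using that by (intro sum.cong) (auto simp: R_def)
      finally show ?thesis using el[OF that(1,2)] by simp
    qed
    have "pfaff n (gram n g) = (\<Sum>\<sigma>\<in>?P. of_int (sign \<sigma>) *
       (\<Prod>i<n. \<Sum>k<?m. jsgn n k * g $$ (k, \<sigma> i) * g $$ (w0 n k, \<sigma> (w0 n i))))"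
      unfolding pfaff_def
    proof (intro sum.cong refl arg_cong2[of _ _ _ _ "(*)"] prod.cong)
      fix \<sigma> i assume s: "\<sigma> \<in> ?P" and i: "i \<in> {..<n}"
      then have "\<sigma> i < ?m" "\<sigma> (w0 n i) < ?m" using permutes_in_image[of \<sigma> "{0..<2 * n}"] by auto
      then show "gram n g $$ (\<sigma> i, \<sigma> (w0 n i)) = (\<Sum>k<?m. jsgn n k * g $$ (k, \<sigma> i) * g $$ (w0 n k, \<sigma> (w0 n i)))"
        using gram_index[OF g] by blast
    qed
    also have "\<dots> = (\<Sum>\<sigma>\<in>?P. of_int (sign \<sigma>) * (\<Sum>\<phi>\<in>?\<Phi>. \<Prod>i<n.
        jsgn n (\<phi> i) * g $$ (\<phi> i, \<sigma> i) * g $$ (w0 n (\<phi> i), \<sigma> (w0 n i))))"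
      by (subst prod_sum_PiE) auto
    also have "\<dots> = (\<Sum>\<sigma>\<in>?P. \<Sum>\<phi>\<in>?\<Phi>. (\<Prod>i<n. jsgn n (\<phi> i)) * (of_int (sign \<sigma>) * (\<Prod>j<?m. g $$ (e \<phi> j, \<sigma> j))))"
      unfolding sum_distrib_left
    proof (intro sum.cong refl)
      fix \<sigma> \<phi>
      have "(\<Prod>j<?m. g $$ (e \<phi> j, \<sigma> j)) = (\<Prod>i<n. g $$ (\<phi> i, \<sigma> i) * g $$ (w0 n (\<phi> i), \<sigma> (w0 n i)))"
        unfolding prod_w0_split by (intro prod.cong refl) (auto simp: e_def w0_simps(1))
      then show "of_int (sign \<sigma>) * (\<Prod>i<n. jsgn n (\<phi> i) * g $$ (\<phi> i, \<sigma> i) * g $$ (w0 n (\<phi> i), \<sigma> (w0 n i))) =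
        (\<Prod>i<n. jsgn n (\<phi> i)) * (of_int (sign \<sigma>) * (\<Prod>j<?m. g $$ (e \<phi> j, \<sigma> j)))"
        by (simp add: prod.distrib mult.assoc mult.left_commute)
    qed
    also have "\<dots> = (\<Sum>\<phi>\<in>?\<Phi>. \<Sum>\<sigma>\<in>?P. (\<Prod>i<n. jsgn n (\<phi> i)) * (of_int (sign \<sigma>) * (\<Prod>j<?m. g $$ (e \<phi> j, \<sigma> j))))"
      by (rule sum.swap)
    also have "\<dots> = (\<Sum>\<phi>\<in>?\<Phi>. (\<Prod>i<n. jsgn n (\<phi> i)) * det (R \<phi> * g))"
    proof (rule sum.cong[OF refl])
      fix \<phi> assume f: "\<phi> \<in> ?\<Phi>"
      have "det (R \<phi> * g) = (\<Sum>\<sigma>\<in>?P. of_int (sign \<sigma>) * (\<Prod>j = 0..<?m. (R \<phi> * g) $$ (j, \<sigma> j)))"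
        using det_def'[of "R \<phi> * g" ?m] mult_carrier_mat[OF Rc g] by simp
      also have "\<dots> = (\<Sum>\<sigma>\<in>?P. of_int (sign \<sigma>) * (\<Prod>j<?m. g $$ (e \<phi> j, \<sigma> j)))"
      proof (intro sum.cong refl arg_cong2[of _ _ _ _ "(*)"] prod.cong)
        fix \<sigma> j assume s: "\<sigma> \<in> ?P" and j: "j \<in> {..<?m}"
        then have "\<sigma> j < ?m" using permutes_in_image[of \<sigma> "{0..<2 * n}"] by auto
        then show "(R \<phi> * g) $$ (j, \<sigma> j) = g $$ (e \<phi> j, \<sigma> j)" using Rg[OF f] j by auto
      qed auto
      finally show "(\<Sum>\<sigma>\<in>?P. (\<Prod>i<n. jsgn n (\<phi> i)) * (of_int (sign \<sigma>) * (\<Prod>j<?m. g $$ (e \<phi> j, \<sigma> j)))) =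
          (\<Prod>i<n. jsgn n (\<phi> i)) * det (R \<phi> * g)" by (simp add: sum_distrib_left)
    qed
    also have "\<dots> = (\<Sum>\<phi>\<in>?\<Phi>. (\<Prod>i<n. jsgn n (\<phi> i)) * det (R \<phi>)) * det g"
      unfolding sum_distrib_right by (intro sum.cong refl) (simp add: det_mult[OF Rc g])
    finally show ?thesis .
  qed
  from main[of "1\<^sub>m ?m"] main[OF h] show ?thesis by (simp add: gram_one)
qed

lemma pfaff_Jnn: "pfaff n (Jnn n) \<noteq> 0"
proof -
  let ?C = "{\<sigma>. \<sigma> permutes {0..<2 * n} \<and> (\<forall>i<n. \<sigma> (w0 n i) = w0 n (\<sigma> i))}"
  have fin: "finite {\<sigma>. \<sigma> permutes {0..<2 * n}}" by (rule finite_permutations) simp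
  have "pfaff n (Jnn n) = (\<Sum>\<sigma> | \<sigma> permutes {0..<2 * n}. if \<forall>i<n. \<sigma> (w0 n i) = w0 n (\<sigma> i) then 1 else 0)"
    unfolding pfaff_def
  proof (rule sum.cong[OF refl])
    fix \<sigma> assume "\<sigma> \<in> {\<sigma>. \<sigma> permutes {0..<2 * n}}"
    then have s: "\<sigma> permutes {..<2 * n}" by (simp add: atLeast0LessThan)
    have lt: "\<sigma> i < 2 * n" if "i < 2 * n" for i using permutes_in_image[OF s, of i] that by simp
    have J: "Jnn n $$ (\<sigma> i, \<sigma> (w0 n i)) = (if \<sigma> (w0 n i) = w0 n (\<sigma> i) then jsgn n (\<sigma> i) else 0)" if "i < n" for i
      using lt[of i] lt[of "w0 n i"] that by (intro Jnn_index) auto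
    show "of_int (sign \<sigma>) * (\<Prod>i<n. Jnn n $$ (\<sigma> i, \<sigma> (w0 n i))) =
        (if \<forall>i<n. \<sigma> (w0 n i) = w0 n (\<sigma> i) then 1 else 0)"
    proof (cases "\<forall>i<n. \<sigma> (w0 n i) = w0 n (\<sigma> i)")
      case True
      then have "(\<Prod>i<n. Jnn n $$ (\<sigma> i, \<sigma> (w0 n i))) = (\<Prod>i<n. jsgn n (\<sigma> i))"
        using J by (intro prod.cong) auto
      then show ?thesis using sign_commuting_w0[OF s] True by simp
    next
      case False
      then obtain i where i: "i < n" "\<sigma> (w0 n i) \<noteq> w0 n (\<sigma> i)" by blast
      then have z: "(\<Prod>i<n. Jnn n $$ (\<sigma> i, \<sigma> (w0 n i))) = 0" using J[OF i(1)] by (intro prod_zero) auto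
      show ?thesis unfolding z using False by simp
    qed
  qed
  also have "\<dots> = of_nat (card ?C)"
    using fin by (simp add: sum.If_cases Int_def conj_commute)
  also have "card ?C \<noteq> 0"
  proof -
    have f: "finite ?C" using fin by (rule rev_finite_subset) auto
    have "id \<in> ?C" by (simp add: permutes_id)
    then have "?C \<noteq> {}" by blast
    with card_0_eq[OF f] show ?thesis by (simp only: not_False_eq_True)
  qed
  then have "of_nat (card ?C) \<noteq> (0 :: complex)" by simp
  finally show ?thesis .
qed

lemma det_symplectic:
  assumes "h \<in> carrier_mat (2 * n) (2 * n)" "gram n h = Jnn n"
  shows "det h = 1"
  using pfaff_gram[OF assms(1)] pfaff_Jnn[of n] assms(2) by simp

section \<open>Normal form under lower triangular congruence\<close>

definition monomial_type :: "nat \<Rightarrow> (nat \<Rightarrow> nat) \<Rightarrow> complex mat \<Rightarrow> bool" where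
  "monomial_type n b Y \<longleftrightarrow> (\<forall>r<2 * n. \<forall>c<2 * n. Y $$ (r, c) \<noteq> 0 \<longleftrightarrow> r = b c)"

definition stratum :: "nat \<Rightarrow> (nat \<Rightarrow> nat) \<Rightarrow> complex mat set" where
  "stratum n b = {x \<in> GG (2 * n). \<exists>\<beta>\<in>borel n. monomial_type n b (gram n (x * \<beta>))}"

lemma transpose_mult_index':
  assumes "x \<in> carrier_mat m m" "y \<in> carrier_mat m m" "r < m" "c < m"
  shows "(transpose_mat y * x) $$ (r, c) = (\<Sum>k<m. y $$ (k, r) * x $$ (k, c))"
proof -
  have "transpose_mat y \<in> carrier_mat m m" using assms by auto
  from mult_index[OF this assms(1,3,4)] show ?thesis using assms by (auto intro: sum.cong)
qed

text \<open>One symplectic Gram-Schmidt step: the last index \<open>p\<close> not yet treated is paired with the last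
  \<open>q\<close> that is not orthogonal to it, and the other vectors are made orthogonal to both.\<close>

lemma gram_schmidt_step:
  assumes x: "x \<in> GG (2 * n)" and pq: "q < p" "p < 2 * n" and ne: "gram n x $$ (p, q) \<noteq> 0"
    and zp: "\<And>k. q < k \<Longrightarrow> k < 2 * n \<Longrightarrow> gram n x $$ (p, k) = 0"
    and zq: "\<And>k. p < k \<Longrightarrow> k < 2 * n \<Longrightarrow> gram n x $$ (k, q) = 0"
  obtains \<beta> where "\<beta> \<in> borel n"
    "\<And>c. c < 2 * n \<Longrightarrow> gram n (x * \<beta>) $$ (p, c) \<noteq> 0 \<longleftrightarrow> c = q"
    "\<And>c. c < 2 * n \<Longrightarrow> gram n (x * \<beta>) $$ (q, c) \<noteq> 0 \<longleftrightarrow> c = p"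
    "\<And>r c. r < 2 * n \<Longrightarrow> c < 2 * n \<Longrightarrow> gram n x $$ (r, p) = 0 \<Longrightarrow> gram n x $$ (r, q) = 0 \<Longrightarrow> r \<noteq> p \<Longrightarrow> r \<noteq> q \<Longrightarrow>
      gram n (x * \<beta>) $$ (r, c) = gram n x $$ (r, c)"
proof -
  let ?m = "2 * n" let ?g = "gram n x"
  have xm: "x \<in> carrier_mat ?m ?m" using x SL_mat by blast
  have gm: "?g \<in> carrier_mat ?m ?m" using xm by blast
  have sk: "?g $$ (c, r) = - ?g $$ (r, c)" if "r < ?m" "c < ?m" for r c using gram_skew[OF xm that] .
  have q: "q < ?m" using pq by simp
  have pp: "?g $$ (p, p) = 0" "?g $$ (q, q) = 0" using gram_diag[OF xm] pq q by auto
  have qp: "?g $$ (q, p) = - ?g $$ (p, q)" using sk[of p q] pq q by simp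
  \<comment> \<open>Column \<open>k\<close> of \<open>x * \<beta>\<close> is column \<open>k\<close>
    of \<open>x\<close> minus \<open>a k\<close> times column \<open>q\<close> and
    \<open>a' k\<close> times column \<open>p\<close>. The hypotheses on zeros make
    \<open>a k\<close> vanish beyond \<open>q\<close> and \<open>a' k\<close> beyond
    \<open>p\<close>, which is exactly lower triangularity.\<close>
  define a where "a k = ?g $$ (k, p) / ?g $$ (q, p)" for k
  define a' where "a' k = ?g $$ (k, q) / ?g $$ (p, q)" for k
  define \<beta> where "\<beta> = mat ?m ?m (\<lambda>(l, k). (if l = k then 1 else 0) -
    (if k = p \<or> k = q then 0 else (if l = q then a k else 0) + (if l = p then a' k else 0)))"
  have bm: "\<beta> \<in> carrier_mat ?m ?m" by (simp add: \<beta>_def)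
  have lower: "\<beta> $$ (l, k) = 0" if "l < k" "k < ?m" for l k
    using that zp[of k] zq[of k] sk[of p k] pq by (auto simp: \<beta>_def a_def a'_def)
  have diag: "\<beta> $$ (l, l) = 1" if "l < ?m" for l using that by (auto simp: \<beta>_def)
  have "det \<beta> = (\<Prod>j = 0..<?m. \<beta> $$ (j, j))"
    using det_lower_triangular[OF lower bm] bm by (simp add: prod_list_diag_prod)
  then have "det \<beta> = 1" using diag by simp
  then have "\<beta> \<in> GG ?m" using bm SL_I by blast
  then have B: "\<beta> \<in> borel n" using lower by (simp add: borel_def)
  define h where "h = ?g * \<beta>"
  have hm: "h \<in> carrier_mat ?m ?m" using gm bm by (simp add: h_def)
  have h: "h $$ (r, c) = ?g $$ (r, c) - (if c = p \<or> c = q then 0 else a c * ?g $$ (r, q) + a' c * ?g $$ (r, p))"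
    if rc: "r < ?m" "c < ?m" for r c
  proof -
    have "h $$ (r, c) = (\<Sum>l<?m. ?g $$ (r, l) * \<beta> $$ (l, c))" unfolding h_def by (rule mult_index[OF gm bm rc])
    also have "\<dots> = (\<Sum>l<?m. (if l = c then ?g $$ (r, c) else 0) -
       (if c = p \<or> c = q then 0 else (if l = q then a c * ?g $$ (r, q) else 0) + (if l = p then a' c * ?g $$ (r, p) else 0)))"
      using rc by (intro sum.cong) (auto simp: \<beta>_def algebra_simps)
    also have "\<dots> = ?g $$ (r, c) - (if c = p \<or> c = q then 0 else a c * ?g $$ (r, q) + a' c * ?g $$ (r, p))"
      using rc pq q by (auto simp: sum_subtractf sum.distrib)
    finally show ?thesis .
  qed
  have G: "gram n (x * \<beta>) = transpose_mat \<beta> * h"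
    using gram_mult[OF xm bm] mat_assoc[of "transpose_mat \<beta>" ?m ?g \<beta>] gm bm by (simp add: h_def)
  have g': "gram n (x * \<beta>) $$ (r, c) = h $$ (r, c) - (if r = p \<or> r = q then 0 else a r * h $$ (q, c) + a' r * h $$ (p, c))"
    if rc: "r < ?m" "c < ?m" for r c
  proof -
    have "gram n (x * \<beta>) $$ (r, c) = (\<Sum>l<?m. \<beta> $$ (l, r) * h $$ (l, c))"
      unfolding G by (rule transpose_mult_index'[OF hm bm rc])
    also have "\<dots> = (\<Sum>l<?m. (if l = r then h $$ (r, c) else 0) -
       (if r = p \<or> r = q then 0 else (if l = q then a r * h $$ (q, c) else 0) + (if l = p then a' r * h $$ (p, c) else 0)))"
      using rc by (intro sum.cong) (auto simp: \<beta>_def algebra_simps)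
    also have "\<dots> = h $$ (r, c) - (if r = p \<or> r = q then 0 else a r * h $$ (q, c) + a' r * h $$ (p, c))"
      using rc pq q by (auto simp: sum_subtractf sum.distrib)
    finally show ?thesis .
  qed
  have hp: "h $$ (p, c) = (if c = q then ?g $$ (p, q) else 0)" if "c < ?m" for c
    using h[of p c] that pq pp ne sk[of p c] qp by (auto simp: a_def a'_def)
  have hq: "h $$ (q, c) = (if c = p then ?g $$ (q, p) else 0)" if "c < ?m" for c
    using h[of q c] that pq q pp ne sk[of q c] qp by (auto simp: a_def a'_def)
  show ?thesis
  proof (rule that[OF B])
    fix c assume c: "c < ?m"
    show "gram n (x * \<beta>) $$ (p, c) \<noteq> 0 \<longleftrightarrow> c = q" using g'[of p c] hp[OF c] pq c ne by simp
    show "gram n (x * \<beta>) $$ (q, c) \<noteq> 0 \<longleftrightarrow> c = p" using g'[of q c] hq[OF c] q c ne qp by simp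
  next
    fix r c assume rc: "r < ?m" "c < ?m" and z: "?g $$ (r, p) = 0" "?g $$ (r, q) = 0" and rn: "r \<noteq> p" "r \<noteq> q"
    then have "a r = 0" "a' r = 0" by (auto simp: a_def a'_def)
    then show "gram n (x * \<beta>) $$ (r, c) = ?g $$ (r, c)" by (simp add: g'[OF rc] h[OF rc] z rn)
  qed
qed

text \<open>\<open>D\<close> is the set of indices already paired off by \<open>f\<close>. The
  largest index outside \<open>D\<close> is treated next: every index above it is already orthogonal
  to the vectors being modified, so the corrections are lower triangular and leave the rows in
  \<open>D\<close> unchanged.\<close>

lemma monomial_normal_form_aux:
  assumes "x \<in> GG (2 * n)" "D \<subseteq> {..<2 * n}"
    "\<And>j. j \<in> D \<Longrightarrow> f j \<in> D \<and> f (f j) = j \<and> (\<forall>c<2 * n. gram n x $$ (j, c) \<noteq> 0 \<longleftrightarrow> c = f j)"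
  shows "\<exists>\<beta>\<in>borel n. \<exists>b\<in>fpf_involutions n. monomial_type n b (gram n (x * \<beta>))"
  using assms
proof (induction "card ({..<2 * n} - D)" arbitrary: x D f rule: less_induct)
  case less
  let ?m = "2 * n" let ?g = "gram n x"
  note x = less.prems(1) and D = less.prems(2) and f = less.prems(3)
  have xm: "x \<in> carrier_mat ?m ?m" using x SL_mat by blast
  have sk: "?g $$ (c, r) = - ?g $$ (r, c)" if "r < ?m" "c < ?m" for r c using gram_skew[OF xm that] .
  show ?case
  proof (cases "D = {..<?m}")
    case True
    define b where "b j = (if j < ?m then f j else j)" for j
    have bb: "b (b j) = j" for j using f[of j] True by (auto simp: b_def)
    have ne: "b j \<noteq> j" if "j < ?m" for j
      using f[of j] True that gram_diag[OF xm that] by (auto simp: b_def)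
    have "b ` {..<?m} \<subseteq> {..<?m}" using f True by (auto simp: b_def)
    then have "bij_betw b {..<?m} {..<?m}" by (intro bij_betw_byWitness[where f' = b]) (simp_all only: bb ball_simps, blast+)
    then have "b permutes {..<?m}" by (rule bij_imp_permutes) (simp add: b_def)
    then have "b \<in> fpf_involutions n" using bb ne by (auto simp: fpf_involutions_def)
    moreover have "monomial_type n b (gram n (x * 1\<^sub>m ?m))"
      unfolding monomial_type_def
    proof (intro allI impI)
      fix r c assume rc: "r < ?m" "c < ?m"
      have "gram n x $$ (r, c) \<noteq> 0 \<longleftrightarrow> gram n x $$ (c, r) \<noteq> 0" using sk[OF rc] by simp
      then show "gram n (x * 1\<^sub>m ?m) $$ (r, c) \<noteq> 0 \<longleftrightarrow> r = b c"
        using f[of c] True rc x by (auto simp: b_def)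
    qed
    ultimately show ?thesis using borel_one by blast
  next
    case False
    define p where "p = Max ({..<?m} - D)"
    have "{..<?m} - D \<noteq> {}" using False D by auto
    then have "p \<in> {..<?m} - D" unfolding p_def by (intro Max_in) auto
    then have p: "p < ?m" "p \<notin> D" by auto
    have pmax: "k \<in> D" if "p < k" "k < ?m" for k
    proof (rule ccontr)
      assume "k \<notin> D"
      then have "k \<le> p" unfolding p_def using that by (intro Max_ge) auto
      then show False using that by simp
    qed
    have "\<exists>q<?m. ?g $$ (p, q) \<noteq> 0"
    proof (rule ccontr)
      assume z: "\<not> ?thesis"
      have G: "?g \<in> GG ?m" using x by simp
      have "1 = (?g * minv ?m ?g) $$ (p, p)" using G p by simp
      also have "\<dots> = (\<Sum>k<?m. ?g $$ (p, k) * minv ?m ?g $$ (k, p))"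
        using SL_mat[OF G] SL_mat[OF SL_inv[OF G]] p by (intro mult_index) auto
      also have "\<dots> = 0" using z by (intro sum.neutral) auto
      finally show False by simp
    qed
    then have N: "{q. q < ?m \<and> ?g $$ (p, q) \<noteq> 0} \<noteq> {}" by auto
    define q where "q = Max {q. q < ?m \<and> ?g $$ (p, q) \<noteq> 0}"
    have "q \<in> {q. q < ?m \<and> ?g $$ (p, q) \<noteq> 0}" unfolding q_def using N by (intro Max_in) auto
    then have q: "q < ?m" "?g $$ (p, q) \<noteq> 0" by auto
    have qmax: "?g $$ (p, k) = 0" if "q < k" "k < ?m" for k
    proof (rule ccontr)
      assume "?g $$ (p, k) \<noteq> 0"
      then have "k \<le> q" unfolding q_def using that by (intro Max_ge) auto
      then show False using that by simp
    qed
    have Dz: "?g $$ (r, p) = 0" if "r \<in> D" for r using f[OF that] p by metis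
    have qD: "q \<notin> D" using Dz[of q] sk[of p q] p q by auto
    have Dzq: "?g $$ (r, q) = 0" if "r \<in> D" for r using f[OF that] q qD by metis
    have "q \<noteq> p" using gram_diag[OF xm p(1)] q by auto
    moreover have "q \<le> p" using pmax[of q] q qD by (meson not_le)
    ultimately have qp: "q < p" by simp
    have zq: "?g $$ (k, q) = 0" if "p < k" "k < 2 * n" for k using pmax[OF that] Dzq by blast
    obtain \<beta> where B: "\<beta> \<in> borel n"
      and gp: "\<And>c. c < 2 * n \<Longrightarrow> gram n (x * \<beta>) $$ (p, c) \<noteq> 0 \<longleftrightarrow> c = q"
      and gq: "\<And>c. c < 2 * n \<Longrightarrow> gram n (x * \<beta>) $$ (q, c) \<noteq> 0 \<longleftrightarrow> c = p"
      and gr: "\<And>r c. r < 2 * n \<Longrightarrow> c < 2 * n \<Longrightarrow> gram n x $$ (r, p) = 0 \<Longrightarrow> gram n x $$ (r, q) = 0 \<Longrightarrow> r \<noteq> p \<Longrightarrow> r \<noteq> q \<Longrightarrow>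
        gram n (x * \<beta>) $$ (r, c) = gram n x $$ (r, c)"
      using gram_schmidt_step[OF x qp p(1) q(2) qmax zq] by blast
    let ?D = "insert p (insert q D)" let ?f = "f(p := q, q := p)"
    have BG: "\<beta> \<in> GG ?m" using B borel_SL by blast
    have fD: "f j \<noteq> p" "f j \<noteq> q" if "j \<in> D" for j using f[OF that] p qD by metis+
    have "\<exists>\<gamma>\<in>borel n. \<exists>b\<in>fpf_involutions n. monomial_type n b (gram n (x * \<beta> * \<gamma>))"
    proof (rule less.hyps[of ?D "x * \<beta>" ?f])
      show "card ({..<?m} - ?D) < card ({..<?m} - D)" using p by (intro psubset_card_mono) auto
      show "x * \<beta> \<in> GG ?m" using x BG by simp
      show "?D \<subseteq> {..<?m}" using D p q by auto
      fix j assume "j \<in> ?D"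
      then consider "j = p" | "j = q" | "j \<in> D" "j \<noteq> p" "j \<noteq> q" by blast
      then show "?f j \<in> ?D \<and> ?f (?f j) = j \<and> (\<forall>c<?m. gram n (x * \<beta>) $$ (j, c) \<noteq> 0 \<longleftrightarrow> c = ?f j)"
      proof cases
        case 3
        then have "j < ?m" using D by auto
        then have "gram n (x * \<beta>) $$ (j, c) = ?g $$ (j, c)" if "c < ?m" for c
          using gr[of j c] that Dz[OF 3(1)] Dzq[OF 3(1)] 3 by simp
        then show ?thesis using f[OF 3(1)] fD[OF 3(1)] 3 by simp
      qed (use gp gq qp in auto)
    qed
    then obtain \<gamma> b where "\<gamma> \<in> borel n" "b \<in> fpf_involutions n" "monomial_type n b (gram n (x * (\<beta> * \<gamma>)))"
      using x BG borel_SL SL_assoc by metis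
    then show ?thesis using B by blast
  qed
qed

lemma stratum_cover: "x \<in> GG (2 * n) \<Longrightarrow> \<exists>b\<in>fpf_involutions n. x \<in> stratum n b"
  using monomial_normal_form_aux[of x n "{}"] by (auto simp: stratum_def)

text \<open>Compare the entries at \<open>(r, b r)\<close> in the identity of \<open>\<beta>\<close>
  transposed times \<open>gram n x\<close> with \<open>gram n (x * \<beta>)\<close> times the
  inverse of \<open>\<beta>\<close>. On the left a single term survives and it contains a diagonal
  entry of \<open>\<beta>\<close>; on the right it is a multiple of the entry
  \<open>(b' r, b r)\<close> of a lower triangular matrix, which is therefore not above the
  diagonal.\<close>

lemma monomial_type_unique_le:
  assumes x: "x \<in> GG (2 * n)" and B: "\<beta> \<in> borel n" and b: "b \<in> fpf_involutions n" "b' \<in> fpf_involutions n"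
    and t: "monomial_type n b (gram n x)" "monomial_type n b' (gram n (x * \<beta>))" and r: "r < 2 * n"
  shows "b r \<le> b' r"
proof -
  let ?m = "2 * n" let ?c = "minv ?m \<beta>" let ?g' = "gram n (x * \<beta>)"
  have BG: "\<beta> \<in> GG ?m" and CB: "?c \<in> borel n" using B borel_SL by auto
  have CG: "?c \<in> GG ?m" using BG by simp
  have tG: "transpose_mat \<beta> \<in> GG ?m" using BG by simp
  have e: "transpose_mat \<beta> * gram n x = ?g' * ?c"
    using gram_mult[OF SL_mat[OF x] SL_mat[OF BG]] x BG tG by (simp add: SL_assoc[of _ "2 * n"])
  have br: "b r < ?m" "b' r < ?m" using fpfD(4) b r by auto
  have "(transpose_mat \<beta> * gram n x) $$ (r, b r) = (\<Sum>u<?m. \<beta> $$ (u, r) * gram n x $$ (u, b r))"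
    using transpose_mult_index'[OF SL_mat[OF gram_SL[OF x]] SL_mat[OF BG] r br(1)] .
  also have "\<dots> = (\<Sum>u<?m. if u = r then \<beta> $$ (r, r) * gram n x $$ (r, b r) else 0)"
    using t(1) br fpfD(2)[OF b(1), of r] by (intro sum.cong) (auto simp: monomial_type_def)
  also have "\<dots> = \<beta> $$ (r, r) * gram n x $$ (r, b r)" using r by simp
  finally have 1: "(transpose_mat \<beta> * gram n x) $$ (r, b r) \<noteq> 0"
    using borel_diag[OF B r] t(1) r br fpfD(2)[OF b(1), of r] by (simp add: monomial_type_def)
  have "(?g' * ?c) $$ (r, b r) = (\<Sum>u<?m. ?g' $$ (r, u) * ?c $$ (u, b r))"
    using x BG CG r br by (intro mult_index SL_mat) auto
  also have "\<dots> = (\<Sum>u<?m. if u = b' r then ?g' $$ (r, b' r) * ?c $$ (b' r, b r) else 0)"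
  proof (rule sum.cong[OF refl])
    fix u assume "u \<in> {..<?m}"
    moreover have "r = b' u \<longleftrightarrow> u = b' r" using fpfD(2)[OF b(2)] by metis
    ultimately show "?g' $$ (r, u) * ?c $$ (u, b r) = (if u = b' r then ?g' $$ (r, b' r) * ?c $$ (b' r, b r) else 0)"
      using t(2) r unfolding monomial_type_def by auto
  qed
  also have "\<dots> = ?g' $$ (r, b' r) * ?c $$ (b' r, b r)" using br by simp
  finally have "?c $$ (b' r, b r) \<noteq> 0" using 1 e by auto
  then show ?thesis using borel_zero[OF CB, of "b' r" "b r"] br by (meson not_le)
qed

lemma stratum_disjoint:
  assumes "x \<in> stratum n b" "x \<in> stratum n b'" and b: "b \<in> fpf_involutions n" "b' \<in> fpf_involutions n"
  shows "b = b'"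
proof -
  let ?m = "2 * n"
  obtain \<beta> \<gamma> where x: "x \<in> GG ?m" and B: "\<beta> \<in> borel n" "\<gamma> \<in> borel n"
    and t: "monomial_type n b (gram n (x * \<beta>))" "monomial_type n b' (gram n (x * \<gamma>))"
    using assms by (auto simp: stratum_def)
  have G: "\<beta> \<in> GG ?m" "\<gamma> \<in> GG ?m" using B borel_SL by auto
  have e1: "x * \<beta> * (minv ?m \<beta> * \<gamma>) = x * \<gamma>" and e2: "x * \<gamma> * (minv ?m \<gamma> * \<beta>) = x * \<beta>"
    using x G by (simp_all add: SL_assoc[of _ ?m])
  have "b r = b' r" for r
  proof (cases "r < ?m")
    case True
    have "b r \<le> b' r"
      by (rule monomial_type_unique_le[of "x * \<beta>" n "minv ?m \<beta> * \<gamma>"]) (use x G B b t e1 True in auto)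
    moreover have "b' r \<le> b r"
      by (rule monomial_type_unique_le[of "x * \<gamma>" n "minv ?m \<gamma> * \<beta>"]) (use x G B b t e2 True in auto)
    ultimately show ?thesis by simp
  next
    case False
    then show ?thesis using fpfD(1) b by (metis lessThan_iff permutes_def)
  qed
  then show ?thesis by blast
qed

section \<open>The strata are the double cosets\<close>

text \<open>On each pair \<open>j\<close>, \<open>b j\<close> the ratio of the two entries is put on
  the smaller index. The determinant of \<open>t\<close> is not adjusted by hand:
  \<open>x * t\<close> times the inverse of \<open>y\<close> is an isometry of \<open>Jnn n\<close>,
  which forces \<open>det t = 1\<close>.\<close>

lemma monomial_type_torus:
  assumes x: "x \<in> GG (2 * n)" and y: "y \<in> GG (2 * n)" and b: "b \<in> fpf_involutions n"
    and t: "monomial_type n b (gram n x)" "monomial_type n b (gram n y)"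
  obtains t where "t \<in> borel n" "gram n (x * t) = gram n y"
proof -
  let ?m = "2 * n"
  have xm: "x \<in> carrier_mat ?m ?m" and ym: "y \<in> carrier_mat ?m ?m" using x y SL_mat by auto
  define \<tau> where "\<tau> j = (if j < b j then gram n y $$ (j, b j) / gram n x $$ (j, b j) else 1)" for j
  define t where "t = mat ?m ?m (\<lambda>(i, j). if i = j then \<tau> i else 0)"
  have tm: "t \<in> carrier_mat ?m ?m" by (simp add: t_def)
  have gm: "gram n x \<in> carrier_mat ?m ?m" using xm by blast
  have gt: "(gram n x * t) $$ (r, c) = gram n x $$ (r, c) * \<tau> c" if rc: "r < ?m" "c < ?m" for r c
  proof -
    have "(gram n x * t) $$ (r, c) = (\<Sum>k<?m. gram n x $$ (r, k) * t $$ (k, c))" by (rule mult_index[OF gm tm rc])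
    also have "\<dots> = (\<Sum>k<?m. if k = c then gram n x $$ (r, c) * \<tau> c else 0)"
      using rc by (intro sum.cong) (auto simp: t_def)
    finally show ?thesis using rc by simp
  qed
  have g: "gram n (x * t) $$ (r, c) = \<tau> r * gram n x $$ (r, c) * \<tau> c" if rc: "r < ?m" "c < ?m" for r c
  proof -
    have "gram n (x * t) = transpose_mat t * (gram n x * t)"
      using gram_mult[OF xm tm] mat_assoc[of "transpose_mat t" ?m "gram n x" t] gm tm by simp
    then have "gram n (x * t) $$ (r, c) = (\<Sum>k<?m. t $$ (k, r) * (gram n x * t) $$ (k, c))"
      using transpose_mult_index'[OF mult_carrier_mat[OF gm tm] tm rc] by simp
    also have "\<dots> = (\<Sum>k<?m. if k = r then \<tau> r * (gram n x $$ (r, c) * \<tau> c) else 0)"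
      using rc gt by (intro sum.cong) (auto simp: t_def simp del: index_mult_mat(1))
    finally show ?thesis using rc by simp
  qed
  have e: "gram n (x * t) = gram n y"
  proof (rule eq_matI)
    fix r c assume "r < dim_row (gram n y)" "c < dim_col (gram n y)"
    then have rc: "r < ?m" "c < ?m" using gram_carrier[OF ym] by auto
    show "gram n (x * t) $$ (r, c) = gram n y $$ (r, c)"
    proof (cases "r = b c")
      case False
      then have "gram n x $$ (r, c) = 0" "gram n y $$ (r, c) = 0"
        using t rc unfolding monomial_type_def by blast+
      then show ?thesis using g[OF rc] by simp
    next
      case True
      have br: "b r = c" using True fpfD(2)[OF b] by simp
      have nz: "gram n x $$ (r, c) \<noteq> 0" "gram n x $$ (c, r) \<noteq> 0" using t(1) rc True br by (auto simp: monomial_type_def)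
      have sk: "gram n x $$ (c, r) = - gram n x $$ (r, c)" "gram n y $$ (c, r) = - gram n y $$ (r, c)"
        using gram_skew[OF xm rc] gram_skew[OF ym rc] by auto
      have "r \<noteq> c" using True fpfD(3)[OF b rc(2)] by simp
      then consider "r < c" | "c < r" by linarith
      then show ?thesis using g[OF rc] nz sk br True by cases (auto simp: \<tau>_def)
    qed
  qed (use gram_carrier[OF mult_carrier_mat[OF xm tm]] gram_carrier[OF ym] in auto)
  have yi: "minv ?m y \<in> carrier_mat ?m ?m" using y SL_mat by blast
  have "gram n (x * t * minv ?m y) = gram n (y * minv ?m y)"
    using gram_mult[OF mult_carrier_mat[OF xm tm] yi] gram_mult[OF ym yi] e by simp
  then have "det (x * t * minv ?m y) = 1"
    using det_symplectic[of "x * t * minv ?m y" n] xm tm yi y by (simp add: gram_one)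
  then have "det t = 1"
    using SL_det[OF x] SL_det[OF SL_inv[OF y]] by (simp add: det_mult[OF mult_carrier_mat[OF xm tm] yi] det_mult[OF xm tm])
  then have "t \<in> GG ?m" using tm SL_I by blast
  then have "t \<in> borel n" by (auto simp: borel_def t_def)
  with e show ?thesis using that by blast
qed

lemma stratum_SL: "x \<in> stratum n b \<Longrightarrow> x \<in> GG (2 * n)"
  by (simp add: stratum_def)

lemma stratum_borel [simp, intro]:
  assumes "x \<in> stratum n b" and B: "\<beta> \<in> borel n"
  shows "x * \<beta> \<in> stratum n b"
proof -
  let ?m = "2 * n"
  obtain \<gamma> where x: "x \<in> GG ?m" and C: "\<gamma> \<in> borel n" and t: "monomial_type n b (gram n (x * \<gamma>))"
    using assms by (auto simp: stratum_def)
  have "x * \<beta> * (minv ?m \<beta> * \<gamma>) = x * \<gamma>"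
    using x borel_SL[OF B] borel_SL[OF C] by (simp add: SL_assoc[of _ ?m])
  then have "monomial_type n b (gram n (x * \<beta> * (minv ?m \<beta> * \<gamma>)))" using t by simp
  then show ?thesis using x B C borel_SL by (auto simp: stratum_def)
qed

lemma stratum_Sp [simp, intro]:
  assumes "x \<in> stratum n b" and k: "k \<in> Sp n"
  shows "k * x \<in> stratum n b"
proof -
  obtain \<gamma> where x: "x \<in> GG (2 * n)" and C: "\<gamma> \<in> borel n" and t: "monomial_type n b (gram n (x * \<gamma>))"
    using assms by (auto simp: stratum_def)
  have "k * x * \<gamma> = k * (x * \<gamma>)" using x Sp_SL[OF k] borel_SL[OF C] by (simp add: SL_assoc[of _ "2 * n"])
  then have "monomial_type n b (gram n (k * x * \<gamma>))" using t gram_Sp_mult[OF k, of "x * \<gamma>"] x borel_SL[OF C] by simp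
  then show ?thesis using x C Sp_SL[OF k] by (auto simp: stratum_def)
qed

lemma stratum_rep:
  assumes "x \<in> stratum n b"
  obtains \<beta> where "\<beta> \<in> borel n" "x * \<beta> \<in> stratum n b" "monomial_type n b (gram n (x * \<beta>))"
  using assms stratum_borel[OF assms] by (auto simp: stratum_def)

lemma stratum_transitive:
  assumes x: "x \<in> stratum n b" and y: "y \<in> stratum n b" and b: "b \<in> fpf_involutions n"
  obtains k \<beta> where "k \<in> Sp n" "\<beta> \<in> borel n" "y = k * x * \<beta>"
proof -
  let ?m = "2 * n"
  obtain \<beta> where B: "\<beta> \<in> borel n" "x * \<beta> \<in> stratum n b" "monomial_type n b (gram n (x * \<beta>))" using stratum_rep[OF x] .
  obtain \<gamma> where C: "\<gamma> \<in> borel n" "y * \<gamma> \<in> stratum n b" "monomial_type n b (gram n (y * \<gamma>))" using stratum_rep[OF y] .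
  obtain t where t: "t \<in> borel n" "gram n (x * \<beta> * t) = gram n (y * \<gamma>)"
    using monomial_type_torus[OF stratum_SL[OF B(2)] stratum_SL[OF C(2)] b B(3) C(3)] .
  have G: "x \<in> GG ?m" "y \<in> GG ?m" "\<beta> \<in> GG ?m" "\<gamma> \<in> GG ?m" "t \<in> GG ?m"
    using stratum_SL[OF x] stratum_SL[OF y] B C t borel_SL by auto
  define k where "k = y * \<gamma> * minv ?m (x * \<beta> * t)"
  have k: "k \<in> Sp n" unfolding k_def by (rule gram_eq_Sp) (use G t in auto)
  have kG: "k \<in> GG ?m" using k Sp_SL by blast
  have "k * (x * \<beta> * t) = y * \<gamma>" using G by (simp add: k_def)
  then have "y = k * (x * \<beta> * t) * minv ?m \<gamma>" using G by simp
  also have "\<dots> = k * x * (\<beta> * t * minv ?m \<gamma>)" using G kG by (simp add: SL_assoc[of _ "2 * n"])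
  finally show ?thesis using that[OF k, of "\<beta> * t * minv ?m \<gamma>"] B C t by blast
qed

section \<open>Regular functions, closures and irreducibility\<close>

text \<open>Functions are compared with polynomials on \<open>m\<close> by \<open>m\<close> matrices
  only, since functions such as \<open>det\<close> follow other formulas on matrices of other
  shapes.\<close>

definition regular :: "nat \<Rightarrow> (complex mat \<Rightarrow> complex) \<Rightarrow> bool" where
  "regular m f \<longleftrightarrow> (\<exists>q\<in>poly_funs m. \<forall>x\<in>carrier_mat m m. f x = q x)"

lemma poly_funs_regular: "p \<in> poly_funs m \<Longrightarrow> regular m p"
  by (auto simp: regular_def)

lemma regular_const: "regular m (\<lambda>_. c)"
  by (rule poly_funs_regular) (rule poly_funs.const)

lemma regular_entry: "i < m \<Longrightarrow> j < m \<Longrightarrow> regular m (\<lambda>x. x $$ (i, j))"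
  by (rule poly_funs_regular) (rule poly_funs.entry)

lemma regular_add: "regular m f \<Longrightarrow> regular m g \<Longrightarrow> regular m (\<lambda>x. f x + g x)"
proof -
  assume "regular m f" "regular m g"
  then obtain p q where "p \<in> poly_funs m" "q \<in> poly_funs m"
    "\<And>x. x \<in> carrier_mat m m \<Longrightarrow> f x = p x" "\<And>x. x \<in> carrier_mat m m \<Longrightarrow> g x = q x"
    unfolding regular_def by blast
  then show ?thesis
    unfolding regular_def by (intro bexI[of _ "\<lambda>x. p x + q x"] poly_funs.add) auto
qed

lemma regular_mult: "regular m f \<Longrightarrow> regular m g \<Longrightarrow> regular m (\<lambda>x. f x * g x)"
proof -
  assume "regular m f" "regular m g"
  then obtain p q where "p \<in> poly_funs m" "q \<in> poly_funs m"
    "\<And>x. x \<in> carrier_mat m m \<Longrightarrow> f x = p x" "\<And>x. x \<in> carrier_mat m m \<Longrightarrow> g x = q x"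
    unfolding regular_def by blast
  then show ?thesis
    unfolding regular_def by (intro bexI[of _ "\<lambda>x. p x * q x"] poly_funs.mult) auto
qed

lemma regular_uminus: "regular m f \<Longrightarrow> regular m (\<lambda>x. - f x)"
  using regular_mult[OF regular_const[of m "- 1"]] by simp

lemma regular_diff: "regular m f \<Longrightarrow> regular m g \<Longrightarrow> regular m (\<lambda>x. f x - g x)"
  using regular_add[OF _ regular_uminus] by simp

lemma regular_power: "regular m f \<Longrightarrow> regular m (\<lambda>x. f x ^ k)"
  by (induction k) (auto intro: regular_const regular_mult)

lemma regular_sum: "(\<And>a. a \<in> A \<Longrightarrow> regular m (f a)) \<Longrightarrow> regular m (\<lambda>x. \<Sum>a\<in>A. f a x)"
  by (induction A rule: infinite_finite_induct) (auto intro: regular_const regular_add)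

lemma regular_prod: "(\<And>a. a \<in> A \<Longrightarrow> regular m (f a)) \<Longrightarrow> regular m (\<lambda>x. \<Prod>a\<in>A. f a x)"
  by (induction A rule: infinite_finite_induct) (auto intro: regular_const regular_mult)

lemma regular_cong: "(\<And>x. x \<in> carrier_mat m m \<Longrightarrow> f x = g x) \<Longrightarrow> regular m f \<longleftrightarrow> regular m g"
  by (auto simp: regular_def)

lemma regular_det:
  assumes "\<And>i j. i < k \<Longrightarrow> j < k \<Longrightarrow> regular m (f i j)"
  shows "regular m (\<lambda>x. det (mat k k (\<lambda>(i, j). f i j x)))"
proof -
  have "det (mat k k (\<lambda>(i, j). f i j x)) = (\<Sum>p | p permutes {0..<k}. of_int (sign p) * (\<Prod>i = 0..<k. f i (p i) x))" for x
    by (subst det_def'[of _ k]) (auto intro!: sum.cong prod.cong dest: permutes_in_image)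
  moreover have "regular m (\<lambda>x. \<Sum>p | p permutes {0..<k}. of_int (sign p) * (\<Prod>i = 0..<k. f i (p i) x))"
  proof (intro regular_sum regular_mult regular_const regular_prod)
    fix p i assume "p \<in> {p. p permutes {0..<k}}" "i \<in> {0..<k}"
    then show "regular m (f i (p i))" using assms[of i "p i"] permutes_in_image[of p "{0..<k}" i] by auto
  qed
  ultimately show ?thesis by simp
qed

section \<open>Regular maps between spaces of matrices\<close>

definition rmap :: "nat \<Rightarrow> (complex mat \<Rightarrow> complex mat) \<Rightarrow> bool" where
  "rmap m M \<longleftrightarrow> (\<forall>x\<in>carrier_mat m m. M x \<in> carrier_mat m m) \<and>
     (\<forall>i<m. \<forall>j<m. regular m (\<lambda>x. M x $$ (i, j)))"

lemma regular_comp: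
  assumes p: "regular m p" and M: "rmap m M"
  shows "regular m (\<lambda>x. p (M x))"
proof -
  obtain q where q: "q \<in> poly_funs m" "\<And>x. x \<in> carrier_mat m m \<Longrightarrow> p x = q x"
    using p by (auto simp: regular_def)
  from q(1) have "regular m (\<lambda>x. q (M x))"
  proof induction
    case (entry i j)
    then show ?case using M by (simp add: rmap_def)
  qed (auto intro: regular_const regular_add regular_mult)
  moreover have "p (M x) = q (M x)" if "x \<in> carrier_mat m m" for x
    using q(2) M that by (simp add: rmap_def)
  ultimately show ?thesis using regular_cong by metis
qed

lemma rmap_id: "rmap m (\<lambda>x. x)"
  by (simp add: rmap_def regular_entry)

lemma rmap_const: "a \<in> carrier_mat m m \<Longrightarrow> rmap m (\<lambda>_. a)"
  by (simp add: rmap_def regular_const)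

lemma rmap_transpose: "rmap m transpose_mat"
proof -
  have "regular m (\<lambda>x. transpose_mat x $$ (i, j))" if "i < m" "j < m" for i j
    using regular_entry[OF that(2,1)] by (rule regular_cong[THEN iffD1, rotated]) (use that in auto)
  then show ?thesis by (auto simp: rmap_def)
qed

lemma rmap_mult:
  assumes "rmap m M" "rmap m N"
  shows "rmap m (\<lambda>x. M x * N x)"
proof -
  have c: "M x \<in> carrier_mat m m" "N x \<in> carrier_mat m m" if "x \<in> carrier_mat m m" for x
    using assms that by (auto simp: rmap_def)
  have "regular m (\<lambda>x. (M x * N x) $$ (i, j))" if "i < m" "j < m" for i j
  proof (rule regular_cong[THEN iffD1])
    show "(\<Sum>k<m. M x $$ (i, k) * N x $$ (k, j)) = (M x * N x) $$ (i, j)" if "x \<in> carrier_mat m m" for x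
      using mult_index[OF c[OF that] \<open>i < m\<close> \<open>j < m\<close>] by simp
    show "regular m (\<lambda>x. \<Sum>k<m. M x $$ (i, k) * N x $$ (k, j))"
      using assms that by (intro regular_sum regular_mult) (auto simp: rmap_def)
  qed
  moreover have "M x * N x \<in> carrier_mat m m" if "x \<in> carrier_mat m m" for x
    using mult_carrier_mat[OF c[OF that]] .
  ultimately show ?thesis unfolding rmap_def by blast
qed

lemma rmap_gram: "rmap (2 * n) (gram n)"
proof -
  have "rmap (2 * n) (\<lambda>x. transpose_mat x * Jnn n * x)"
    by (intro rmap_mult rmap_const rmap_id Jnn_carrier, rule rmap_transpose)
  then show ?thesis by (simp add: gram_def[abs_def])
qed

text \<open>Cofactors are determinants of submatrices. On \<open>SL\<close> these entries are those
  of the inverse, which so become regular functions.\<close>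

lemma regular_adj_mat:
  assumes i: "i < m" and j: "j < m"
  shows "regular m (\<lambda>x. adj_mat x $$ (i, j))"
proof (rule regular_cong[THEN iffD1])
  let ?e = "\<lambda>a b x. x $$ (if a < j then a else Suc a, if b < i then b else Suc b)"
  show "(- 1) ^ (j + i) * det (mat (m - 1) (m - 1) (\<lambda>(a, b). ?e a b x)) = adj_mat x $$ (i, j)"
    if "x \<in> carrier_mat m m" for x
    using that i j by (simp add: adj_mat_def cofactor_def mat_delete_def)
  show "regular m (\<lambda>x. (- 1) ^ (j + i) * det (mat (m - 1) (m - 1) (\<lambda>(a, b). ?e a b x)))"
    by (intro regular_mult regular_const regular_det regular_entry) (use i j in auto)
qed

lemma adj_mat_SL: "x \<in> GG m \<Longrightarrow> adj_mat x = minv m x"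
proof -
  assume x: "x \<in> GG m"
  note c = adj_mat[OF SL_mat[OF x]]
  have "1 \<cdot>\<^sub>m 1\<^sub>m m = (1\<^sub>m m :: complex mat)" by (rule eq_matI) auto
  with c(3) SL_det[OF x] have e: "adj_mat x * x = 1\<^sub>m m" by simp
  then have "det (adj_mat x) = 1" using det_mult[OF c(1) SL_mat[OF x]] SL_det[OF x] by simp
  then show ?thesis using SL_inv_eq[OF x SL_I[OF c(1)] e] by simp
qed

lemma regular_det_mat: "regular m det"
proof (rule regular_cong[THEN iffD1])
  show "det (mat m m (\<lambda>(i, j). x $$ (i, j))) = det x" if "x \<in> carrier_mat m m" for x
    using that by (intro arg_cong[of _ _ det] eq_matI) auto
  show "regular m (\<lambda>x. det (mat m m (\<lambda>(i, j). x $$ (i, j))))"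
    by (intro regular_det regular_entry)
qed

text \<open>The Zariski closure in the space of all matrices. As \<open>det x = 1\<close> is a
  closed condition, closures of subsets of \<open>SL\<close> stay in \<open>SL\<close>.\<close>

definition zc :: "nat \<Rightarrow> complex mat set \<Rightarrow> complex mat set" where
  "zc m S = {x \<in> carrier_mat m m. \<forall>p. regular m p \<longrightarrow> (\<forall>y\<in>S. p y = 0) \<longrightarrow> p x = 0}"

lemma zc_D: "x \<in> zc m S \<Longrightarrow> regular m p \<Longrightarrow> (\<And>y. y \<in> S \<Longrightarrow> p y = 0) \<Longrightarrow> p x = 0"
  by (simp add: zc_def)

lemma zc_carrier: "zc m S \<subseteq> carrier_mat m m" by (auto simp: zc_def)

lemma zc_superset: "S \<subseteq> carrier_mat m m \<Longrightarrow> S \<subseteq> zc m S" by (auto simp: zc_def)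

lemma zc_mono: "S \<subseteq> T \<Longrightarrow> zc m S \<subseteq> zc m T" by (auto simp: zc_def)

lemma zc_closed: "S \<subseteq> zc m T \<Longrightarrow> zc m S \<subseteq> zc m T"
  unfolding zc_def by blast

lemma zc_SL: "S \<subseteq> GG m \<Longrightarrow> zc m S \<subseteq> GG m"
proof
  fix x assume S: "S \<subseteq> GG m" and x: "x \<in> zc m S"
  have "det x - 1 = 0"
    by (rule zc_D[OF x regular_diff[OF regular_det_mat regular_const]]) (use S SL_det in auto)
  then show "x \<in> GG m" using SL_I[OF subsetD[OF zc_carrier x]] by simp
qed

lemma zc_image:
  assumes M: "rmap m M" and x: "x \<in> zc m S"
  shows "M x \<in> zc m (M ` S)"
proof -
  have "p (M x) = 0" if "regular m p" "\<forall>y\<in>M ` S. p y = 0" for p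
    using zc_D[OF x regular_comp[OF that(1) M]] that(2) by auto
  moreover have "M x \<in> carrier_mat m m" using M x zc_carrier by (auto simp: rmap_def)
  ultimately show ?thesis by (auto simp: zc_def)
qed

text \<open>The vanishing ideal of \<open>S\<close> is prime. In this form irreducibility makes
  sense for sets that are not closed and passes both ways between a set and a dense subset.\<close>

definition irr :: "nat \<Rightarrow> complex mat set \<Rightarrow> bool" where
  "irr m S \<longleftrightarrow> S \<noteq> {} \<and> S \<subseteq> carrier_mat m m \<and>
     (\<forall>p q. regular m p \<longrightarrow> regular m q \<longrightarrow> (\<forall>x\<in>S. p x * q x = 0) \<longrightarrow>
        (\<forall>x\<in>S. p x = 0) \<or> (\<forall>x\<in>S. q x = 0))"

lemma irr_D:
  assumes "irr m S" "regular m p" "regular m q" "\<And>x. x \<in> S \<Longrightarrow> p x = 0 \<or> q x = 0"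
  shows "(\<forall>x\<in>S. p x = 0) \<or> (\<forall>x\<in>S. q x = 0)"
proof -
  have "\<forall>x\<in>S. p x * q x = 0" using assms(4) by auto
  then show ?thesis using assms(1-3) unfolding irr_def by blast
qed

lemma irr_two_points:
  assumes "irr m S" "regular m p" "regular m q" "x \<in> S" "p x \<noteq> 0" "y \<in> S" "q y \<noteq> 0"
  shows "\<exists>z\<in>S. p z \<noteq> 0 \<and> q z \<noteq> 0"
  using irr_D[OF assms(1-3)] assms(4-) by blast

lemma irr_dense:
  assumes S: "irr m S" and T: "S \<subseteq> T" "T \<subseteq> zc m S"
  shows "irr m T"
  unfolding irr_def
proof (intro conjI allI impI)
  show "T \<noteq> {}" using S T by (auto simp: irr_def)
  show "T \<subseteq> carrier_mat m m" using T zc_carrier by blast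
  fix p q assume pq: "regular m p" "regular m q" and z: "\<forall>x\<in>T. p x * q x = 0"
  have "p x = 0 \<or> q x = 0" if "x \<in> S" for x using z T(1) that by auto
  from irr_D[OF S pq this] consider "\<And>x. x \<in> S \<Longrightarrow> p x = 0" | "\<And>x. x \<in> S \<Longrightarrow> q x = 0" by blast
  then show "(\<forall>x\<in>T. p x = 0) \<or> (\<forall>x\<in>T. q x = 0)"
  proof cases
    case 1
    then show ?thesis using zc_D[OF subsetD[OF T(2)] pq(1)] by blast
  next
    case 2
    then show ?thesis using zc_D[OF subsetD[OF T(2)] pq(2)] by blast
  qed
qed

lemma irr_dense':
  assumes T: "irr m T" and S: "S \<subseteq> T" "T \<subseteq> zc m S"
  shows "irr m S"
  unfolding irr_def
proof (intro conjI allI impI)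
  show "S \<noteq> {}"
  proof
    assume "S = {}"
    then have "zc m S = {}" using regular_const[of m 1] by (auto simp: zc_def)
    then show False using S T by (auto simp: irr_def)
  qed
  show "S \<subseteq> carrier_mat m m" using S T by (auto simp: irr_def)
  fix p q assume pq: "regular m p" "regular m q" and z: "\<forall>x\<in>S. p x * q x = 0"
  have "p x = 0 \<or> q x = 0" if "x \<in> T" for x
    using zc_D[OF subsetD[OF S(2) that] regular_mult[OF pq]] z by simp
  from irr_D[OF T pq this] show "(\<forall>x\<in>S. p x = 0) \<or> (\<forall>x\<in>S. q x = 0)" using S by blast
qed

lemma irr_image:
  assumes S: "irr m S" and M: "rmap m M"
  shows "irr m (M ` S)"
  unfolding irr_def
proof (intro conjI allI impI)
  show "M ` S \<noteq> {}" "M ` S \<subseteq> carrier_mat m m" using S M by (auto simp: irr_def rmap_def)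
  fix p q assume pq: "regular m p" "regular m q" and z: "\<forall>x\<in>M ` S. p x * q x = 0"
  show "(\<forall>x\<in>M ` S. p x = 0) \<or> (\<forall>x\<in>M ` S. q x = 0)"
  proof -
    have "p (M x) = 0 \<or> q (M x) = 0" if "x \<in> S" for x using z that by auto
    from irr_D[OF S regular_comp[OF pq(1) M] regular_comp[OF pq(2) M] this] show ?thesis by blast
  qed
qed

definition mprod :: "complex mat set \<Rightarrow> complex mat set \<Rightarrow> complex mat set" where
  "mprod S T = {s * t | s t. s \<in> S \<and> t \<in> T}"

text \<open>Fix the two right factors and find one left factor at which neither function vanishes;
  then keep it and vary the right factor. This takes the place of irreducibility of a product
  variety.\<close>

lemma irr_mprod:
  assumes S: "irr m S" and T: "irr m T"
  shows "irr m (mprod S T)"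
  unfolding irr_def
proof (intro conjI allI impI)
  have c: "S \<subseteq> carrier_mat m m" "T \<subseteq> carrier_mat m m" using S T by (auto simp: irr_def)
  show "mprod S T \<noteq> {}" using S T by (auto simp: irr_def mprod_def)
  show "mprod S T \<subseteq> carrier_mat m m" using c unfolding mprod_def by (blast intro: mult_carrier_mat)
  fix p q assume pq: "regular m p" "regular m q" and z: "\<forall>x\<in>mprod S T. p x * q x = 0"
  show "(\<forall>x\<in>mprod S T. p x = 0) \<or> (\<forall>x\<in>mprod S T. q x = 0)"
  proof (rule ccontr)
    assume "\<not> ?thesis"
    then obtain s t s' t' where st: "s \<in> S" "t \<in> T" "p (s * t) \<noteq> 0" "s' \<in> S" "t' \<in> T" "q (s' * t') \<noteq> 0"
      by (auto simp: mprod_def)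
    have "rmap m (\<lambda>x. x * t)" "rmap m (\<lambda>x. x * t')"
      using st c by (intro rmap_mult rmap_id rmap_const; auto)+
    then have "\<exists>z\<in>S. p (z * t) \<noteq> 0 \<and> q (z * t') \<noteq> 0"
      using irr_two_points[OF S regular_comp[OF pq(1)] regular_comp[OF pq(2)]] st by blast
    then obtain u where u: "u \<in> S" "p (u * t) \<noteq> 0" "q (u * t') \<noteq> 0" by blast
    have "rmap m (\<lambda>x. u * x)" using u c by (intro rmap_mult rmap_id rmap_const) auto
    then have "\<exists>v\<in>T. p (u * v) \<noteq> 0 \<and> q (u * v) \<noteq> 0"
      using irr_two_points[OF T regular_comp[OF pq(1)] regular_comp[OF pq(2)]] st u by blast
    then show False using z u by (auto simp: mprod_def)
  qed
qed

lemma irr_singleton: "x \<in> carrier_mat m m \<Longrightarrow> irr m {x}"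
  by (simp add: irr_def)

text \<open>Irreducibility is proved by joining points by rational curves: a regular function restricted to
  such a curve becomes a polynomial in \<open>t\<close> after clearing the denominator \<open>q\<close>.\<close>

lemma poly_funs_curve:
  assumes "p \<in> poly_funs m"
  shows "\<exists>R D. \<forall>A t. (\<forall>i<m. \<forall>j<m. A $$ (i, j) * poly q t = poly (P i j) t) \<longrightarrow> p A * poly q t ^ D = poly R t"
  using assms
proof induction
  case (const c)
  show ?case by (rule exI[of _ "[:c:]"], rule exI[of _ 0]) simp
next
  case (entry i j)
  then show ?case by (intro exI[of _ "P i j"] exI[of _ 1]) simp
next
  case (add f g)
  then obtain R D R' D' where
    1: "\<forall>A t. (\<forall>i<m. \<forall>j<m. A $$ (i, j) * poly q t = poly (P i j) t) \<longrightarrow> f A * poly q t ^ D = poly R t" and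
    2: "\<forall>A t. (\<forall>i<m. \<forall>j<m. A $$ (i, j) * poly q t = poly (P i j) t) \<longrightarrow> g A * poly q t ^ D' = poly R' t" by blast
  show ?case
  proof (rule exI[of _ "R * q ^ D' + R' * q ^ D"], rule exI[of _ "D + D'"], intro allI impI)
    fix A t assume "\<forall>i<m. \<forall>j<m. A $$ (i, j) * poly q t = poly (P i j) t"
    with 1 2 have e: "f A * poly q t ^ D = poly R t" "g A * poly q t ^ D' = poly R' t" by blast+
    have "(f A + g A) * poly q t ^ (D + D') = (f A * poly q t ^ D) * poly q t ^ D' + (g A * poly q t ^ D') * poly q t ^ D"
      by (simp add: power_add algebra_simps)
    then show "(f A + g A) * poly q t ^ (D + D') = poly (R * q ^ D' + R' * q ^ D) t" unfolding e by simp
  qed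
next
  case (mult f g)
  then obtain R D R' D' where
    1: "\<forall>A t. (\<forall>i<m. \<forall>j<m. A $$ (i, j) * poly q t = poly (P i j) t) \<longrightarrow> f A * poly q t ^ D = poly R t" and
    2: "\<forall>A t. (\<forall>i<m. \<forall>j<m. A $$ (i, j) * poly q t = poly (P i j) t) \<longrightarrow> g A * poly q t ^ D' = poly R' t" by blast
  show ?case
  proof (rule exI[of _ "R * R'"], rule exI[of _ "D + D'"], intro allI impI)
    fix A t assume "\<forall>i<m. \<forall>j<m. A $$ (i, j) * poly q t = poly (P i j) t"
    with 1 2 have e: "f A * poly q t ^ D = poly R t" "g A * poly q t ^ D' = poly R' t" by blast+
    have "(f A * g A) * poly q t ^ (D + D') = (f A * poly q t ^ D) * (g A * poly q t ^ D')"
      by (simp add: power_add algebra_simps)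
    then show "(f A * g A) * poly q t ^ (D + D') = poly (R * R') t" unfolding e by simp
  qed
qed

lemma regular_curve:
  assumes "regular m p"
  shows "\<exists>R D. \<forall>A\<in>carrier_mat m m. \<forall>t. (\<forall>i<m. \<forall>j<m. A $$ (i, j) * poly q t = poly (P i j) t) \<longrightarrow>
    p A * poly q t ^ D = poly R t"
proof -
  obtain p' where p': "p' \<in> poly_funs m" "\<And>x. x \<in> carrier_mat m m \<Longrightarrow> p x = p' x"
    using assms by (auto simp: regular_def)
  show ?thesis using poly_funs_curve[OF p'(1), of q P]
    by (elim ex_forward) (simp add: p'(2))
qed

lemma irr_curves:
  assumes S: "S \<noteq> {}" "S \<subseteq> carrier_mat m m"
    and curve: "\<And>x y. x \<in> S \<Longrightarrow> y \<in> S \<Longrightarrow> \<exists>q P \<gamma> t0 t1. poly q t0 \<noteq> 0 \<and> poly q t1 \<noteq> 0 \<and> \<gamma> t0 = x \<and> \<gamma> t1 = y \<and>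
      (\<forall>t. poly q t \<noteq> 0 \<longrightarrow> \<gamma> t \<in> S \<and> (\<forall>i<m. \<forall>j<m. \<gamma> t $$ (i, j) * poly q t = poly (P i j) t))"
  shows "irr m S"
  unfolding irr_def
proof (intro conjI allI impI S)
  fix f g assume fg: "regular m f" "regular m g" and z: "\<forall>x\<in>S. f x * g x = 0"
  show "(\<forall>x\<in>S. f x = 0) \<or> (\<forall>x\<in>S. g x = 0)"
  proof (rule ccontr)
    assume "\<not> ?thesis"
    then obtain x y where xy: "x \<in> S" "f x \<noteq> 0" "y \<in> S" "g y \<noteq> 0" by blast
    obtain q P \<gamma> t0 t1 where c: "poly q t0 \<noteq> 0" "poly q t1 \<noteq> 0" "\<gamma> t0 = x" "\<gamma> t1 = y"
      "\<And>t. poly q t \<noteq> 0 \<Longrightarrow> \<gamma> t \<in> S" "\<And>t i j. poly q t \<noteq> 0 \<Longrightarrow> i < m \<Longrightarrow> j < m \<Longrightarrow> \<gamma> t $$ (i, j) * poly q t = poly (P i j) t"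
      using curve[OF xy(1,3)] by blast
    have cc: "\<gamma> t \<in> carrier_mat m m" if "poly q t \<noteq> 0" for t using c(5)[OF that] S by blast
    obtain R D where "\<forall>A\<in>carrier_mat m m. \<forall>t. (\<forall>i<m. \<forall>j<m. A $$ (i, j) * poly q t = poly (P i j) t) \<longrightarrow>
      f A * poly q t ^ D = poly R t" using regular_curve[OF fg(1), of q P] by (elim exE) (rule that)
    then have R: "f (\<gamma> t) * poly q t ^ D = poly R t" if "poly q t \<noteq> 0" for t using cc[OF that] c(6)[OF that] by simp
    obtain R' D' where "\<forall>A\<in>carrier_mat m m. \<forall>t. (\<forall>i<m. \<forall>j<m. A $$ (i, j) * poly q t = poly (P i j) t) \<longrightarrow>
      g A * poly q t ^ D' = poly R' t" using regular_curve[OF fg(2), of q P] by (elim exE) (rule that)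
    then have R': "g (\<gamma> t) * poly q t ^ D' = poly R' t" if "poly q t \<noteq> 0" for t using cc[OF that] c(6)[OF that] by simp
    have "poly R t0 \<noteq> 0" using R[OF c(1)] c(1,3) xy by auto
    moreover have "poly R' t1 \<noteq> 0" using R'[OF c(2)] c(2,4) xy by auto
    ultimately have "R * R' * q \<noteq> 0" using c(1) by auto
    \<comment> \<open>The factor \<open>q\<close> takes care of the poles, where the curve says
      nothing about \<open>R\<close> and \<open>R'\<close>.\<close>
    moreover have "poly (R * R' * q) t = 0" for t
    proof (cases "poly q t = 0")
      case False
      have "f (\<gamma> t) * g (\<gamma> t) = 0" using z c(5)[OF False] by blast
      then have "poly R t = 0 \<or> poly R' t = 0"
        using R[OF False] R'[OF False] by auto
      then show ?thesis by auto
    qed simp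
    ultimately show False using poly_all_0_iff_0 by blast
  qed
qed

lemma irr_carrier_mat: "irr m (carrier_mat m m)"
proof (rule irr_curves)
  fix x y :: "complex mat" assume "x \<in> carrier_mat m m" "y \<in> carrier_mat m m"
  then show "\<exists>q P \<gamma> t0 t1. poly q t0 \<noteq> 0 \<and> poly q t1 \<noteq> 0 \<and> \<gamma> t0 = x \<and> \<gamma> t1 = y \<and>
      (\<forall>t. poly q t \<noteq> 0 \<longrightarrow> \<gamma> t \<in> carrier_mat m m \<and> (\<forall>i<m. \<forall>j<m. \<gamma> t $$ (i, j) * poly q t = poly (P i j) t))"
    by (intro exI[of _ "[:1:]"] exI[of _ "\<lambda>i j. [:x $$ (i, j), y $$ (i, j) - x $$ (i, j):]"]
        exI[of _ "\<lambda>t. mat m m (\<lambda>(i, j). x $$ (i, j) + t * (y $$ (i, j) - x $$ (i, j)))"] exI[of _ 0] exI[of _ 1])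
      (auto intro!: eq_matI)
qed (auto intro: exI[of _ "0\<^sub>m m m"])

lemma irr_line:
  "irr m (range (\<lambda>c. mat m m (\<lambda>(i, j). a i j + c * b i j)))"
proof (rule irr_curves)
  let ?S = "range (\<lambda>c. mat m m (\<lambda>(i, j). a i j + c * b i j))"
  fix x y assume "x \<in> ?S" "y \<in> ?S"
  then obtain c d where "x = mat m m (\<lambda>(i, j). a i j + c * b i j)" "y = mat m m (\<lambda>(i, j). a i j + d * b i j)" by blast
  then show "\<exists>q P \<gamma> t0 t1. poly q t0 \<noteq> 0 \<and> poly q t1 \<noteq> 0 \<and> \<gamma> t0 = x \<and> \<gamma> t1 = y \<and>
      (\<forall>t. poly q t \<noteq> 0 \<longrightarrow> \<gamma> t \<in> ?S \<and> (\<forall>i<m. \<forall>j<m. \<gamma> t $$ (i, j) * poly q t = poly (P i j) t))"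
    by (intro exI[of _ "[:1:]"] exI[of _ "\<lambda>i j. [:a i j, b i j:]"]
        exI[of _ "\<lambda>t. mat m m (\<lambda>(i, j). a i j + t * b i j)"] exI[of _ c] exI[of _ d])
      auto
qed auto

text \<open>The straight line between two elements leaves \<open>SL\<close>; dividing column 0 by
  the determinant \<open>R\<close> along the line brings it back. Prescribed entries outside column
  0 are constant on the line, and those in column 0 survive the rescaling because they are
  zero.\<close>

lemma irr_SL_constraints:
  assumes m: "m > 0" and v: "\<And>r. (r, 0) \<in> E \<Longrightarrow> v r 0 = 0"
    and ne: "{A \<in> GG m. \<forall>(r, c)\<in>E. r < m \<longrightarrow> c < m \<longrightarrow> A $$ (r, c) = v r c} \<noteq> {}" (is "?S \<noteq> {}")
  shows "irr m ?S"
proof (rule irr_curves[OF ne])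
  show "?S \<subseteq> carrier_mat m m" using SL_mat by blast
  fix x y assume x: "x \<in> ?S" and y: "y \<in> ?S"
  have xG: "x \<in> GG m" and yG: "y \<in> GG m" using x y by auto
  define l where "l i j = [:x $$ (i, j), y $$ (i, j) - x $$ (i, j):]" for i j
  define L where "L t = mat m m (\<lambda>(i, j). poly (l i j) t)" for t
  have Lc: "L t \<in> carrier_mat m m" for t by (simp add: L_def)
  have L01: "L 0 = x" "L 1 = y" using x y SL_dim by (auto simp: L_def l_def intro!: eq_matI)
  obtain R D where "\<forall>A\<in>carrier_mat m m. \<forall>t. (\<forall>i<m. \<forall>j<m. A $$ (i, j) * poly [:1:] t = poly (l i j) t) \<longrightarrow>
      det A * poly [:1:] t ^ D = poly R t" using regular_curve[OF regular_det_mat, of m "[:1:]" l] by (elim exE) (rule that)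
  then have R: "det (L t) = poly R t" for t using Lc[of t] by (simp add: L_def)
  define \<gamma> where "\<gamma> t = L t * multrow_mat m 0 (inverse (poly R t))" for t
  have \<gamma>: "\<gamma> t $$ (i, j) = poly (l i j) t * (if j = 0 then inverse (poly R t) else 1)" if ij: "i < m" "j < m" for t i j
  proof -
    have "\<gamma> t $$ (i, j) = (\<Sum>k<m. L t $$ (i, k) * multrow_mat m 0 (inverse (poly R t)) $$ (k, j))"
      unfolding \<gamma>_def by (rule mult_index[OF Lc _ ij]) simp
    also have "\<dots> = (\<Sum>k<m. if k = j then L t $$ (i, j) * (if j = 0 then inverse (poly R t) else 1) else 0)"
      using ij by (intro sum.cong) auto
    finally show ?thesis using ij by (simp add: L_def)
  qed
  have R01: "poly R 0 = 1" "poly R 1 = 1" using R[of 0] R[of 1] SL_det[OF xG] SL_det[OF yG] by (simp_all add: L01)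
  have gc: "dim_row (\<gamma> t) = m" "dim_col (\<gamma> t) = m" for t by (simp_all add: \<gamma>_def L_def)
  have g0: "\<gamma> 0 = x" by (rule eq_matI) (auto simp: \<gamma> R01 gc SL_dim[OF xG] l_def)
  have g1: "\<gamma> 1 = y" by (rule eq_matI) (auto simp: \<gamma> R01 gc SL_dim[OF yG] l_def)
  have g: "\<gamma> t \<in> ?S" if t: "poly R t \<noteq> 0" for t
  proof -
    have "det (\<gamma> t) = 1" using t m by (simp add: \<gamma>_def det_mult[OF Lc] R det_multrow_mat)
    moreover have "\<gamma> t \<in> carrier_mat m m" using gc by (intro carrier_matI)
    moreover have "\<gamma> t $$ (r, c) = v r c" if "(r, c) \<in> E" "r < m" "c < m" for r c
    proof -
      have "x $$ (r, c) = v r c" "y $$ (r, c) = v r c" using x y that by auto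
      then show ?thesis using \<gamma>[OF that(2,3)] v that(1) by (cases "c = 0") (auto simp: l_def)
    qed
    ultimately show ?thesis using SL_I by auto
  qed
  show "\<exists>q P \<gamma> t0 t1. poly q t0 \<noteq> 0 \<and> poly q t1 \<noteq> 0 \<and> \<gamma> t0 = x \<and> \<gamma> t1 = y \<and>
      (\<forall>t. poly q t \<noteq> 0 \<longrightarrow> \<gamma> t \<in> ?S \<and> (\<forall>i<m. \<forall>j<m. \<gamma> t $$ (i, j) * poly q t = poly (P i j) t))"
    using R01 g0 g1 g \<gamma>
    by (intro exI[of _ R] exI[of _ "\<lambda>i j. if j = 0 then l i j else l i j * R"] exI[of _ \<gamma>] exI[of _ 0] exI[of _ 1]) auto
qed

lemma irr_SL: "m > 0 \<Longrightarrow> irr m (GG m)"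
  using irr_SL_constraints[of m "{}"] SL_one[of m] by auto

lemma irr_borel: 
  assumes n: "n > 0" shows "irr (2 * n) (borel n)"
proof -
  let ?S = "{A \<in> GG (2 * n). \<forall>(r, c)\<in>{(r, c). r < c}. r < 2 * n \<longrightarrow> c < 2 * n \<longrightarrow> A $$ (r, c) = 0}"
  have "borel n = ?S" by (auto simp: borel_def)
  moreover have "irr (2 * n) ?S"
    by (rule irr_SL_constraints[where v = "\<lambda>_ _. 0"]) (use n borel_one[of n] calculation in auto)
  ultimately show ?thesis by simp
qed

section \<open>Dimension\<close>

text \<open>\<open>S\<close> is the largest member and \<open>d\<close> the number of steps. The
  pair \<open>f\<close>, \<open>y\<close> certifies that the closures increase strictly;
  \<open>adm\<close> is a condition imposed on every member.\<close>

inductive zchain :: "nat \<Rightarrow> (complex mat set \<Rightarrow> bool) \<Rightarrow> complex mat set \<Rightarrow> nat \<Rightarrow> bool" for m adm where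
  base: "irr m S \<Longrightarrow> adm S \<Longrightarrow> zchain m adm S 0"
| step: "zchain m adm S d \<Longrightarrow> irr m S' \<Longrightarrow> adm S' \<Longrightarrow> S \<subseteq> S' \<Longrightarrow> regular m f \<Longrightarrow>
    (\<And>x. x \<in> S \<Longrightarrow> f x = 0) \<Longrightarrow> y \<in> S' \<Longrightarrow> f y \<noteq> 0 \<Longrightarrow> zchain m adm S' (Suc d)"

lemma zchain_irr: "zchain m adm S d \<Longrightarrow> irr m S"
  by (auto elim: zchain.cases)

lemma zchain_adm: "zchain m adm S d \<Longrightarrow> adm S"
  by (auto elim: zchain.cases)

lemma zchain_mono: "zchain m adm S d \<Longrightarrow> (\<And>S. adm S \<Longrightarrow> adm' S) \<Longrightarrow> zchain m adm' S d"
  by (induction rule: zchain.induct) (auto intro: zchain.intros)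

lemma zchain_enlarge_top:
  assumes "zchain m adm T d" "T \<subseteq> S" "irr m S"
  shows "zchain m (\<lambda>_. True) S d"
  using assms(1)
proof cases
  case base
  then show ?thesis using assms(3) by (auto intro: zchain.base)
next
  case (step S' d' f y)
  have "zchain m (\<lambda>_. True) S' d'" by (rule zchain_mono[OF step(2) TrueI])
  from zchain.step[OF this assms(3) TrueI subset_trans[OF step(5) assms(2)] step(6,7) subsetD[OF assms(2) step(8)] step(9)]
  show ?thesis unfolding step(1) .
qed

section \<open>Algebraic independence of the functions that separate a chain\<close>

abbreviation idx :: "nat \<Rightarrow> nat \<Rightarrow> nat list set" where
  "idx d M \<equiv> {l. set l \<subseteq> {..M} \<and> length l = d}"

primrec fmono :: "(complex mat \<Rightarrow> complex) list \<Rightarrow> nat list \<Rightarrow> complex mat \<Rightarrow> complex" where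
  "fmono [] l x = 1"
| "fmono (f # fs) l x = f x ^ hd l * fmono fs (tl l) x"

lemma finite_idx [simp]: "finite (idx d M)"
  by (rule finite_lists_length_eq) simp

lemma sum_idx_Suc:
  fixes g :: "nat list \<Rightarrow> complex"
  shows "(\<Sum>l\<in>idx (Suc d) M. g l) = (\<Sum>j\<le>M. \<Sum>l\<in>idx d M. g (j # l))"
proof -
  have "(\<Sum>l\<in>idx (Suc d) M. g l) = (\<Sum>(l, j)\<in>idx d M \<times> {..M}. g (j # l))"
    unfolding lists_length_Suc_eq by (subst sum.reindex) (auto simp: inj_on_def intro!: sum.cong)
  also have "\<dots> = (\<Sum>l\<in>idx d M. \<Sum>j\<le>M. g (j # l))" by (simp add: sum.cartesian_product)
  finally show ?thesis by (simp add: sum.swap[of _ "{..M}"])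
qed

lemma regular_fmono: "(\<And>f. f \<in> set fs \<Longrightarrow> regular m f) \<Longrightarrow> regular m (fmono fs l)"
proof (induction fs arbitrary: l)
  case Nil
  have "fmono [] l = (\<lambda>_. 1)" by auto
  then show ?case by (simp only: regular_const)
next
  case (Cons f fs)
  have "fmono (f # fs) l = (\<lambda>x. f x ^ hd l * fmono fs (tl l) x)" by auto
  moreover have "regular m (\<lambda>x. f x ^ hd l * fmono fs (tl l) x)"
    by (intro regular_mult regular_power Cons) (use Cons.prems in auto)
  ultimately show ?case by (simp only:)
qed

text \<open>A function vanishing on one member of the chain but not on the next is transcendental over the
  functions obtained from the earlier members: the lowest coefficient of a polynomial relation
  would vanish on the smaller set.\<close>

lemma zchain_independent:
  assumes "zchain m adm S d"
  shows "\<exists>fs. length fs = d \<and> (\<forall>f\<in>set fs. regular m f) \<and>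
    (\<forall>M c. (\<forall>x\<in>S. (\<Sum>l\<in>idx d M. c l * fmono fs l x) = 0) \<longrightarrow> (\<forall>l\<in>idx d M. c l = 0))"
  using assms
proof induction
  case (base S)
  then obtain x where "x \<in> S" by (auto simp: irr_def)
  moreover have "idx 0 M = {[]}" for M by auto
  ultimately show ?case by (intro exI[of _ "[]"]) auto
next
  case (step S d S' f y)
  then obtain fs where fs: "length fs = d" "\<And>f. f \<in> set fs \<Longrightarrow> regular m f"
    and ind: "\<And>M c. (\<forall>x\<in>S. (\<Sum>l\<in>idx d M. c l * fmono fs l x) = 0) \<Longrightarrow> \<forall>l\<in>idx d M. c l = 0" by blast
  note irr = step.hyps(2) and SS = step.hyps(4) and f = step.hyps(5) and f0 = step.hyps(6) and y = step.hyps(7,8)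
  show ?case
  proof (intro exI[of _ "f # fs"] conjI allI impI)
    show "length (f # fs) = Suc d" using fs by simp
    show "\<forall>f\<in>set (f # fs). regular m f" using fs f by simp
    fix M c assume z: "\<forall>x\<in>S'. (\<Sum>l\<in>idx (Suc d) M. c l * fmono (f # fs) l x) = 0"
    define P where "P j x = (\<Sum>l\<in>idx d M. c (j # l) * fmono fs l x)" for j x
    have P: "regular m (P j)" for j
      unfolding P_def[abs_def] by (intro regular_sum regular_mult regular_const regular_fmono fs(2))
    have z': "(\<Sum>j\<le>M. f x ^ j * P j x) = 0" if "x \<in> S'" for x
    proof -
      have "(\<Sum>l\<in>idx (Suc d) M. c l * fmono (f # fs) l x) = 0" using z that by blast
      then show ?thesis by (simp add: sum_idx_Suc P_def sum_distrib_left mult.left_commute)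
    qed
    have c0: "\<forall>l\<in>idx d M. c (j # l) = 0" if "j \<le> M" for j
      using that
    proof (induction j rule: less_induct)
      case (less j)
      have Pz: "P i x = 0" if "i < j" for i x
        using less.IH[OF that] less.prems that by (simp add: P_def)
      \<comment> \<open>The coefficients below \<open>j\<close> are already zero, so the relation is
        divisible by \<open>f x ^ j\<close>; on an irreducible set this factor can be cancelled. On
        \<open>S\<close>, where \<open>f\<close> vanishes, the quotient reduces to the coefficient
        \<open>P j\<close>.\<close>
      define Q where "Q x = (\<Sum>i\<in>{j..M}. f x ^ (i - j) * P i x)" for x
      have Q: "regular m Q" unfolding Q_def[abs_def] by (intro regular_sum regular_mult regular_power f P)
      have "f x ^ j = 0 \<or> Q x = 0" if x: "x \<in> S'" for x
      proof -
        have "(\<Sum>i\<le>M. f x ^ i * P i x) = (\<Sum>i\<in>{j..M}. f x ^ i * P i x)"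
          by (rule sum.mono_neutral_right) (auto simp: Pz)
        also have "\<dots> = (\<Sum>i\<in>{j..M}. f x ^ j * (f x ^ (i - j) * P i x))"
          by (intro sum.cong refl) (auto simp: mult.assoc[symmetric] power_add[symmetric])
        also have "\<dots> = f x ^ j * Q x" by (simp add: Q_def sum_distrib_left)
        finally show ?thesis using z'[OF x] by simp
      qed
      from irr_D[OF irr regular_power[OF f] Q this] y have Q0: "\<forall>x\<in>S'. Q x = 0" by auto
      have "Q x = P j x" if "x \<in> S" for x
      proof -
        have "Q x = (\<Sum>i\<in>{j..M}. if i = j then P j x else 0)"
          unfolding Q_def using f0[OF that] by (intro sum.cong refl) auto
        then show ?thesis using less.prems by simp
      qed
      then have "\<forall>x\<in>S. P j x = 0" using Q0 SS by fastforce
      then show ?case unfolding P_def by (rule ind)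
    qed
    show "\<forall>l\<in>idx (Suc d) M. c l = 0"
    proof
      fix l assume "l \<in> idx (Suc d) M"
      then obtain j l' where "l = j # l'" "j \<le> M" "l' \<in> idx d M" by (cases l) auto
      then show "c l = 0" using c0 by blast
    qed
  qed
qed

section \<open>Counting monomials in the matrix entries\<close>

definition mat_monom :: "nat \<Rightarrow> (nat \<times> nat \<Rightarrow> nat) \<Rightarrow> complex mat \<Rightarrow> complex" where
  "mat_monom m a x = (\<Prod>ij\<in>{..<m} \<times> {..<m}. x $$ ij ^ a ij)"

abbreviation exps :: "nat \<Rightarrow> nat \<Rightarrow> (nat \<times> nat \<Rightarrow> nat) set" where
  "exps m D \<equiv> PiE ({..<m} \<times> {..<m}) (\<lambda>_. {..D})"

text \<open>Polynomials whose degree is at most \<open>D\<close> in each matrix entry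
  separately.\<close>

definition bdd :: "nat \<Rightarrow> nat \<Rightarrow> (complex mat \<Rightarrow> complex) \<Rightarrow> bool" where
  "bdd m D f \<longleftrightarrow> (\<exists>C. \<forall>x\<in>carrier_mat m m. f x = (\<Sum>a\<in>exps m D. C a * mat_monom m a x))"

lemma finite_exps [simp]: "finite (exps m D)"
  by (rule finite_PiE) auto

lemma bdd_mult:
  assumes "bdd m D f" "bdd m D' g"
  shows "bdd m (D + D') (\<lambda>x. f x * g x)"
proof -
  obtain C C' where C: "\<And>x. x \<in> carrier_mat m m \<Longrightarrow> f x = (\<Sum>a\<in>exps m D. C a * mat_monom m a x)"
    and C': "\<And>x. x \<in> carrier_mat m m \<Longrightarrow> g x = (\<Sum>a\<in>exps m D'. C' a * mat_monom m a x)"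
    using assms unfolding bdd_def by blast
  let ?I = "{..<m} \<times> {..<m}"
  let ?h = "\<lambda>(a, a'). restrict (\<lambda>ij. a ij + a' ij :: nat) ?I"
  let ?S = "exps m D \<times> exps m D'"
  have h: "?h ` ?S \<subseteq> exps m (D + D')" by (fastforce simp: PiE_iff intro: add_mono)
  have mon: "mat_monom m (restrict (\<lambda>ij. a ij + a' ij) ?I) x = mat_monom m a x * mat_monom m a' x" for a a' x
    unfolding mat_monom_def prod.distrib[symmetric] by (intro prod.cong refl) (auto simp: power_add)
  have key: "f x * g x = (\<Sum>b\<in>exps m (D + D'). (\<Sum>(a, a')\<in>{s \<in> ?S. ?h s = b}. C a * C' a') * mat_monom m b x)"
    if x: "x \<in> carrier_mat m m" for x
  proof -
    have "f x * g x = (\<Sum>(a, a')\<in>?S. C a * mat_monom m a x * (C' a' * mat_monom m a' x))"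
      by (simp add: C[OF x] C'[OF x] sum_product sum.cartesian_product)
    also have "\<dots> = (\<Sum>s\<in>?S. (case s of (a, a') \<Rightarrow> C a * C' a') * mat_monom m (?h s) x)"
      by (intro sum.cong refl) (auto simp: mon mult_ac)
    also have "\<dots> = (\<Sum>b\<in>exps m (D + D'). \<Sum>s\<in>{s \<in> ?S. ?h s = b}. (case s of (a, a') \<Rightarrow> C a * C' a') * mat_monom m (?h s) x)"
      using h by (intro sum.group[symmetric]) auto
    also have "\<dots> = (\<Sum>b\<in>exps m (D + D'). (\<Sum>(a, a')\<in>{s \<in> ?S. ?h s = b}. C a * C' a') * mat_monom m b x)"
      unfolding sum_distrib_right by (intro sum.cong refl) auto
    finally show ?thesis .
  qed
  show ?thesis unfolding bdd_def
    by (intro exI[of _ "\<lambda>b. \<Sum>(a, a')\<in>{s \<in> ?S. ?h s = b}. C a * C' a'"] ballI key)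
qed

lemma bdd_const: "bdd m D (\<lambda>_. c)"
proof -
  let ?z = "restrict (\<lambda>_. 0 :: nat) ({..<m} \<times> {..<m})"
  have "?z \<in> exps m D" by auto
  moreover have "mat_monom m ?z x = 1" for x unfolding mat_monom_def by (intro prod.neutral) auto
  ultimately have "c = (\<Sum>a\<in>exps m D. (if a = ?z then c else 0) * mat_monom m a x)" for x
    by (subst sum.remove[of _ ?z]) auto
  then show ?thesis unfolding bdd_def by (intro exI[of _ "\<lambda>a. if a = ?z then c else 0"]) blast
qed

lemma bdd_entry:
  assumes "i < m" "j < m"
  shows "bdd m 1 (\<lambda>x. x $$ (i, j))"
proof -
  let ?I = "{..<m} \<times> {..<m}"
  let ?e = "restrict (\<lambda>ij. if ij = (i, j) then 1 else 0 :: nat) ?I"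
  have e: "?e \<in> exps m 1" by auto
  have mon: "mat_monom m ?e x = x $$ (i, j)" for x
  proof -
    have "mat_monom m ?e x = (\<Prod>ij\<in>?I. if ij = (i, j) then x $$ (i, j) else 1)"
      unfolding mat_monom_def by (intro prod.cong refl) auto
    then show ?thesis using assms by (subst (asm) prod.delta) auto
  qed
  have "x $$ (i, j) = (\<Sum>a\<in>exps m 1. (if a = ?e then 1 else 0) * mat_monom m a x)" for x
    by (subst sum.remove[OF _ e]) (auto simp: mon intro!: sum.neutral[symmetric])
  then show ?thesis unfolding bdd_def by (intro exI[of _ "\<lambda>a. if a = ?e then 1 else 0"]) blast
qed

lemma bdd_mono:
  assumes "bdd m D f" "D \<le> D'" shows "bdd m D' f"
  using bdd_mult[OF assms(1) bdd_const[of m "D' - D" 1]] assms(2) by simp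

lemma bdd_add':
  assumes "bdd m D f" "bdd m D g" shows "bdd m D (\<lambda>x. f x + g x)"
proof -
  obtain C C' where "\<And>x. x \<in> carrier_mat m m \<Longrightarrow> f x = (\<Sum>a\<in>exps m D. C a * mat_monom m a x)"
    "\<And>x. x \<in> carrier_mat m m \<Longrightarrow> g x = (\<Sum>a\<in>exps m D. C' a * mat_monom m a x)"
    using assms unfolding bdd_def by blast
  then show ?thesis unfolding bdd_def
    by (intro exI[of _ "\<lambda>a. C a + C' a"]) (simp add: sum.distrib distrib_right)
qed

lemma bdd_power: "bdd m D f \<Longrightarrow> bdd m (k * D) (\<lambda>x. f x ^ k)"
  by (induction k) (auto intro: bdd_const bdd_mult)

lemma regular_bdd:
  assumes "regular m f" shows "\<exists>D. bdd m D f"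
proof -
  obtain q where q: "q \<in> poly_funs m" "\<And>x. x \<in> carrier_mat m m \<Longrightarrow> f x = q x"
    using assms by (auto simp: regular_def)
  from q(1) have "\<exists>D. bdd m D q"
  proof induction
    case (add p q)
    then obtain D D' where "bdd m D p" "bdd m D' q" by blast
    then have "bdd m (max D D') (\<lambda>x. p x + q x)" by (intro bdd_add') (auto intro: bdd_mono)
    then show ?case by blast
  qed (use bdd_const bdd_entry bdd_mult in blast)+
  then show ?thesis using q(2) by (simp add: bdd_def)
qed

lemma bdd_fmono:
  assumes "\<And>f. f \<in> set fs \<Longrightarrow> bdd m e f" "l \<in> idx (length fs) M"
  shows "bdd m (length fs * (M * e)) (fmono fs l)"
  using assms
proof (induction fs arbitrary: l)
  case Nil
  have "fmono [] l = (\<lambda>_. 1)" by auto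
  then show ?case by (simp only: bdd_const)
next
  case (Cons f fs)
  then obtain j l' where l: "l = j # l'" "j \<le> M" "l' \<in> idx (length fs) M" by (cases l) auto
  have "bdd m (M * e) (\<lambda>x. f x ^ j)"
    by (rule bdd_mono[OF bdd_power]) (use Cons.prems l in auto)
  moreover have "bdd m (length fs * (M * e)) (fmono fs l')" using Cons l by auto
  ultimately have "bdd m (M * e + length fs * (M * e)) (\<lambda>x. f x ^ j * fmono fs l' x)" by (rule bdd_mult)
  moreover have "fmono (f # fs) l = (\<lambda>x. f x ^ j * fmono fs l' x)" using l by auto
  moreover have "length (f # fs) * (M * e) = M * e + length fs * (M * e)" by simp
  ultimately show ?case by (simp only:)
qed

text \<open>Gaussian elimination: equation \<open>a\<close> expresses the unknown \<open>k\<close>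
  by the others, and what remains is a smaller system.\<close>

lemma homogeneous_solution:
  fixes C :: "'l \<Rightarrow> 'a \<Rightarrow> complex"
  assumes "finite A" "finite L" "card A < card L"
  shows "\<exists>c. (\<exists>l\<in>L. c l \<noteq> 0) \<and> (\<forall>a\<in>A. (\<Sum>l\<in>L. c l * C l a) = 0)"
  using assms
proof (induction A arbitrary: L C rule: finite_induct)
  case empty
  then have "L \<noteq> {}" by auto
  then show ?case by (intro exI[of _ "\<lambda>_. 1"]) auto
next
  case (insert a A)
  show ?case
  proof (cases "\<forall>l\<in>L. C l a = 0")
    case True
    have "card A < card L" using insert by simp
    from insert.IH[OF insert.prems(1) this, of C] True show ?thesis by auto
  next
    case False
    then obtain k where k: "k \<in> L" "C k a \<noteq> 0" by blast
    let ?L = "L - {k}"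
    have "card A < card ?L" using insert k by simp
    from insert.IH[OF _ this, of "\<lambda>l b. C l b - C l a / C k a * C k b"] insert.prems(1)
    obtain c where c: "\<exists>l\<in>?L. c l \<noteq> 0" "\<And>b. b \<in> A \<Longrightarrow> (\<Sum>l\<in>?L. c l * (C l b - C l a / C k a * C k b)) = 0" by auto
    define s where "s = - (\<Sum>l\<in>?L. c l * C l a / C k a)"
    have split: "(\<Sum>l\<in>L. (c(k := s)) l * C l b) = s * C k b + (\<Sum>l\<in>?L. c l * C l b)" for b
    proof -
      have "(\<Sum>l\<in>L. (c(k := s)) l * C l b) = (c(k := s)) k * C k b + (\<Sum>l\<in>?L. (c(k := s)) l * C l b)"
        using insert.prems(1) k(1) by (rule sum.remove)
      also have "(\<Sum>l\<in>?L. (c(k := s)) l * C l b) = (\<Sum>l\<in>?L. c l * C l b)" by (intro sum.cong) auto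
      finally show ?thesis by simp
    qed
    have "(\<Sum>l\<in>L. (c(k := s)) l * C l b) = 0" if "b \<in> A" for b
    proof -
      have "0 = (\<Sum>l\<in>?L. c l * C l b - c l * C l a / C k a * C k b)"
        using c(2)[OF that] by (simp add: right_diff_distrib mult.assoc)
      also have "\<dots> = (\<Sum>l\<in>?L. c l * C l b) + s * C k b"
        by (simp add: sum_subtractf s_def sum_distrib_right)
      finally show ?thesis unfolding split by (simp add: add.commute)
    qed
    moreover have "(\<Sum>l\<in>L. (c(k := s)) l * C l a) = 0"
      unfolding split using k(2) by (simp add: s_def sum_divide_distrib[symmetric])
    moreover have "\<exists>l\<in>L. (c(k := s)) l \<noteq> 0" using c(1) by auto
    ultimately show ?thesis by (intro exI[of _ "c(k := s)"]) blast
  qed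
qed

text \<open>The monomials with exponents up to \<open>M\<close> in \<open>d\<close> independent
  functions number \<open>(M + 1) ^ d\<close>, and they lie in a space of dimension
  \<open>(D + 1) ^ (m * m)\<close> with \<open>D\<close> linear in \<open>M\<close>. For
  \<open>d\<close> above \<open>m * m\<close> and large \<open>M\<close> there are too many of them,
  and a linear relation contradicts independence.\<close>

lemma zchain_le_square:
  assumes "zchain m adm S d"
  shows "d \<le> m * m"
proof (rule ccontr)
  assume "\<not> d \<le> m * m"
  then have dm: "m * m + 1 \<le> d" by simp
  obtain fs where fs: "length fs = d" "\<And>f. f \<in> set fs \<Longrightarrow> regular m f"
    and ind: "\<And>M c. (\<forall>x\<in>S. (\<Sum>l\<in>idx d M. c l * fmono fs l x) = 0) \<Longrightarrow> \<forall>l\<in>idx d M. c l = 0"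
    using zchain_independent[OF assms] by blast
  have "\<exists>e. \<forall>f\<in>set fs. bdd m e f"
    using fs(2)
  proof (induction fs)
    case (Cons f fs)
    then obtain e e' where "\<forall>f\<in>set fs. bdd m e f" "bdd m e' f" using regular_bdd by fastforce
    then have "\<forall>g\<in>set (f # fs). bdd m (max e e') g" by (auto intro: bdd_mono)
    then show ?case by blast
  qed simp
  then obtain e where e: "\<And>f. f \<in> set fs \<Longrightarrow> bdd m e f" by blast
  \<comment> \<open>Because \<open>D + 1\<close> is at most \<open>(d * e + 1) * (M + 1)\<close>,
    this value bounds the dimension by \<open>M * (M + 1) ^ (m * m)\<close>, just below the next
    power of \<open>M + 1\<close>.\<close>
  define M where "M = (d * e + 1) ^ (m * m)"
  define D where "D = d * (M * e)"
  define C where "C l = (SOME C. \<forall>x\<in>carrier_mat m m. fmono fs l x = (\<Sum>a\<in>exps m D. C a * mat_monom m a x))" for l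
  have C: "fmono fs l x = (\<Sum>a\<in>exps m D. C l a * mat_monom m a x)" if l: "l \<in> idx d M" and x: "x \<in> carrier_mat m m" for l x
  proof -
    have "bdd m D (fmono fs l)" using bdd_fmono[of fs m e l M] e l fs(1) unfolding D_def by simp
    from someI_ex[OF this[unfolded bdd_def]] show ?thesis using x unfolding C_def by (rule bspec)
  qed
  have "D + 1 \<le> (d * e + 1) * (M + 1)" by (simp add: D_def algebra_simps)
  then have "(D + 1) ^ (m * m) \<le> ((d * e + 1) * (M + 1)) ^ (m * m)" by (rule power_mono) simp
  also have "\<dots> = M * (M + 1) ^ (m * m)" by (simp only: power_mult_distrib M_def)
  also have "\<dots> < (M + 1) * (M + 1) ^ (m * m)" by simp
  also have "\<dots> = (M + 1) ^ (m * m + 1)" by simp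
  also have "\<dots> \<le> (M + 1) ^ d" using dm by (intro power_increasing) auto
  finally have "(D + 1) ^ (m * m) < (M + 1) ^ d" .
  moreover have "card (exps m D) = (D + 1) ^ (m * m)" by (simp add: card_PiE)
  moreover have "card (idx d M) = (M + 1) ^ d" using card_lists_length_eq[of "{..M}" d] by simp
  ultimately have "card (exps m D) < card (idx d M)" by simp
  from homogeneous_solution[OF finite_exps finite_idx this, of C]
  obtain c where c: "\<exists>l\<in>idx d M. c l \<noteq> 0" "\<And>a. a \<in> exps m D \<Longrightarrow> (\<Sum>l\<in>idx d M. c l * C l a) = 0" by blast
  have "(\<Sum>l\<in>idx d M. c l * fmono fs l x) = 0" if "x \<in> S" for x
  proof -
    have x: "x \<in> carrier_mat m m" using zchain_irr[OF assms] that by (auto simp: irr_def)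
    have "(\<Sum>l\<in>idx d M. c l * fmono fs l x) = (\<Sum>l\<in>idx d M. \<Sum>a\<in>exps m D. c l * C l a * mat_monom m a x)"
      by (intro sum.cong refl) (simp only: C[OF _ x] sum_distrib_left mult.assoc)
    also have "\<dots> = (\<Sum>a\<in>exps m D. \<Sum>l\<in>idx d M. c l * C l a * mat_monom m a x)" by (rule sum.swap)
    also have "\<dots> = (\<Sum>a\<in>exps m D. (\<Sum>l\<in>idx d M. c l * C l a) * mat_monom m a x)" by (simp only: sum_distrib_right)
    also have "\<dots> = 0" using c(2) by (intro sum.neutral) simp
    finally show ?thesis .
  qed
  then have "\<forall>l\<in>idx d M. c l = 0" by (intro ind) blast
  then show False using c(1) by blast
qed

subsection \<open>An upper bound for the flag variety\<close>

text \<open>Identity entries are prescribed outside \<open>F\<close>, except at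
  \<open>(0, 0)\<close>, which stays free to correct the determinant. All prescribed entries of
  column 0 are then zero, as \<open>irr_SL_constraints\<close> demands.\<close>

definition cset :: "nat \<Rightarrow> (nat \<times> nat) set \<Rightarrow> complex mat set" where
  "cset m F = {A \<in> GG m. \<forall>r<m. \<forall>c<m. (r, c) \<noteq> (0, 0) \<longrightarrow> (r, c) \<notin> F \<longrightarrow> A $$ (r, c) = (if r = c then 1 else 0)}"

lemma one_in_cset: "1\<^sub>m m \<in> cset m F"
  by (auto simp: cset_def)

lemma irr_cset:
  assumes m: "m > 0" shows "irr m (cset m F)"
proof -
  let ?E = "{(r, c). (r, c) \<noteq> (0, 0) \<and> (r, c) \<notin> F}" and ?v = "\<lambda>r c. if r = c then 1 else 0 :: complex"
  have e: "cset m F = {A \<in> GG m. \<forall>(r, c)\<in>?E. r < m \<longrightarrow> c < m \<longrightarrow> A $$ (r, c) = ?v r c}"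
    unfolding cset_def by (rule Collect_cong) blast
  show ?thesis unfolding e
    by (rule irr_SL_constraints[OF m]) (use one_in_cset[of m F, unfolded e] in auto)
qed

lemma cset_mono: "F \<subseteq> F' \<Longrightarrow> cset m F \<subseteq> cset m F'"
  unfolding cset_def by blast

lemma cset_witness:
  assumes "r < m" "c < m" "(r, c) \<noteq> (0, 0)"
  obtains W where "W \<in> cset m {(r, c)}" "W $$ (r, c) \<noteq> (if r = c then 1 else 0)"
proof (cases "r = c")
  case False
  then have "addrow_mat m 1 r c \<in> cset m {(r, c)}" using addrow_mat_SL[of r c m 1] by (auto simp: cset_def)
  moreover have "addrow_mat m 1 r c $$ (r, c) \<noteq> (0 :: complex)" using False assms by auto
  ultimately show ?thesis using that False by auto
next
  case True
  then have r0: "0 < r" using assms by auto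
  \<comment> \<open>The diagonal entry is moved from 1 to 2, and the determinant is restored at
    \<open>(0, 0)\<close>.\<close>
  let ?W = "multrow 0 (1 / 2) (multrow_mat m r (2 :: complex))"
  have c: "multrow_mat m r (2 :: complex) \<in> carrier_mat m m" by simp
  have "det ?W = 1" using assms r0 det_multrow[OF _ c, of 0 "1 / 2"] det_multrow_mat[of r m "2 :: complex"] by simp
  moreover have "?W \<in> carrier_mat m m" by simp
  ultimately have "?W \<in> GG m" by (intro SL_I)
  then have "?W \<in> cset m {(r, c)}" using True by (auto simp: cset_def)
  moreover have "?W $$ (r, c) \<noteq> 1" using True r0 assms by auto
  ultimately show ?thesis using that True by auto
qed

lemma zchain_cset:
  assumes z: "z \<in> GG m" and m: "m > 0" and F: "finite F" "F \<subseteq> {..<m} \<times> {..<m}" "(0, 0) \<notin> F"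
  shows "zchain m (\<lambda>_. True) ((\<lambda>x. z * x) ` cset m F) (card F)"
  using F
proof (induction F rule: finite_induct)
  have rm: "rmap m (\<lambda>x. z * x)" using z SL_mat by (intro rmap_mult rmap_const rmap_id) auto
  {
    case empty
    then show ?case using irr_image[OF irr_cset[OF m] rm] by (auto intro: zchain.base)
  next
    case (insert p F)
    obtain r c where p: "p = (r, c)" by (cases p)
    then have rc: "r < m" "c < m" "(r, c) \<noteq> (0, 0)" "(r, c) \<notin> F" using insert by auto
    obtain W where W: "W \<in> cset m {(r, c)}" "W $$ (r, c) \<noteq> (if r = c then 1 else 0)" using cset_witness[OF rc(1-3)] .
    let ?f = "\<lambda>x. (minv m z * x) $$ (r, c) - (if r = c then 1 else 0)"
    have e: "minv m z * (z * A) = A" if "A \<in> cset m F'" for A F' using that z by (simp add: cset_def)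
    have "zchain m (\<lambda>_. True) ((\<lambda>x. z * x) ` cset m (insert p F)) (Suc (card F))"
    proof (rule zchain.step[where f = ?f and y = "z * W"])
      show "zchain m (\<lambda>_. True) ((\<lambda>x. z * x) ` cset m F) (card F)" using insert by auto
      show "irr m ((\<lambda>x. z * x) ` cset m (insert p F))" using irr_image[OF irr_cset[OF m] rm] .
      show "(\<lambda>x. z * x) ` cset m F \<subseteq> (\<lambda>x. z * x) ` cset m (insert p F)" by (intro image_mono cset_mono) auto
      have "rmap m (\<lambda>x. minv m z * x)" using z SL_mat by (intro rmap_mult rmap_const rmap_id) auto
      then have "regular m (\<lambda>x. (minv m z * x) $$ (r, c))" using rc by (simp add: rmap_def)
      then show "regular m ?f" by (intro regular_diff regular_const)
      show "z * W \<in> (\<lambda>x. z * x) ` cset m (insert p F)" using W cset_mono[of "{(r, c)}" "insert p F" m] p by auto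
      show "?f (z * W) \<noteq> 0" using W(2) by (simp only: e[OF W(1)] right_minus_eq not_False_eq_True)
      fix x assume "x \<in> (\<lambda>x. z * x) ` cset m F"
      then obtain A where A: "A \<in> cset m F" "x = z * A" by blast
      have "A $$ (r, c) = (if r = c then 1 else 0)" using A(1) rc unfolding cset_def by blast
      then show "?f x = 0" by (simp only: A(2) e[OF A(1)] right_minus_eq)
    qed simp
    then show ?case using insert by simp
  }
qed

text \<open>Right \<open>B\<close>-stable subsets of \<open>T\<close>: they stand for subsets of the
  image of \<open>T\<close> in the flag variety.\<close>

definition adm :: "nat \<Rightarrow> complex mat set \<Rightarrow> complex mat set \<Rightarrow> bool" where
  "adm n T S \<longleftrightarrow> S \<subseteq> T \<and> (\<forall>x\<in>S. \<forall>\<beta>\<in>borel n. x * \<beta> \<in> S)"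

lemma card_lower_positions:
  "card ((SIGMA r:{..<2 * n}. {..r}) - {(0, 0)}) = n * (2 * n + 1) - 1"
proof (cases "n = 0")
  case False
  have "card (SIGMA r:{..<2 * n}. {..r}) = (\<Sum>r<2 * n. Suc r)" by simp
  also have "\<dots> = n * (2 * n + 1)" by (induction n) (auto simp: algebra_simps)
  finally have "card (SIGMA r:{..<2 * n}. {..r}) = n * (2 * n + 1)" .
  moreover have "(0, 0) \<in> (SIGMA r:{..<2 * n}. {..r})" using False by auto
  ultimately show ?thesis by (simp add: card_Diff_singleton)
qed simp

text \<open>Below a chain of right \<open>B\<close>-stable sets there is room for a chain of length \<open>dim B\<close> inside a
  single coset \<open>zB\<close>, and above it for the space of all matrices.\<close>

lemma flag_chain_bound:
  assumes n: "n > 0" and ch: "zchain (2 * n) (adm n (GG (2 * n))) S d"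
  shows "d \<le> n * (2 * n - 1)"
proof -
  let ?m = "2 * n" and ?F = "(SIGMA r:{..<2 * n}. {..r}) - {(0, 0)}"
  let ?K = "n * (2 * n + 1) - 1"
  have m: "?m > 0" using n by simp
  have F: "finite ?F" "?F \<subseteq> {..<?m} \<times> {..<?m}" "(0, 0) \<notin> ?F" by auto
  have cb: "cset ?m ?F \<subseteq> borel n"
  proof
    fix A assume A: "A \<in> cset ?m ?F"
    have "A $$ (r, c) = 0" if "r < c" "c < ?m" for r c
    proof -
      have "r < ?m" "(r, c) \<noteq> (0, 0)" "(r, c) \<notin> ?F" using that by auto
      then have "A $$ (r, c) = (if r = c then 1 else 0)" using A that unfolding cset_def by blast
      then show ?thesis using that by simp
    qed
    then show "A \<in> borel n" using A by (simp add: borel_def cset_def)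
  qed
  have "zchain ?m (\<lambda>_. True) S (d + ?K)"
    using ch
  proof induction
    case (base S)
    then obtain z where z: "z \<in> S" "z \<in> GG ?m" by (auto simp: irr_def adm_def)
    have "zchain ?m (\<lambda>_. True) ((\<lambda>x. z * x) ` cset ?m ?F) ?K"
      using zchain_cset[OF z(2) m F] by (simp only: card_lower_positions)
    moreover have "(\<lambda>x. z * x) ` cset ?m ?F \<subseteq> S" using base(2) z cb by (auto simp: adm_def)
    ultimately show ?case using zchain_enlarge_top base(1) by (metis add_0)
  next
    case (step S d S' f y)
    then have "zchain ?m (\<lambda>_. True) S' (Suc (d + ?K))" by (intro zchain.step[of ?m _ S]) auto
    then show ?case by simp
  qed
  moreover have "S \<subseteq> GG ?m" using zchain_adm[OF ch] by (simp add: adm_def)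
  ultimately have "zchain ?m (\<lambda>_. True) (carrier_mat ?m ?m) (Suc (d + ?K))"
  proof (intro zchain.step[where f = "\<lambda>x. det x - 1" and y = "0\<^sub>m ?m ?m"])
    show "regular ?m (\<lambda>x. det x - 1)" by (intro regular_diff regular_det_mat regular_const)
    show "det (0\<^sub>m ?m ?m) - 1 \<noteq> (0 :: complex)" using m by simp
  qed (use irr_carrier_mat SL_mat SL_det in auto)
  from zchain_le_square[OF this] have "Suc (d + ?K) \<le> 2 * n * (2 * n)" .
  moreover have "?K + 1 = n * (2 * n + 1)" using n by simp
  ultimately have "d + n * (2 * n + 1) \<le> 2 * n * (2 * n)" by linarith
  then show ?thesis by (simp add: algebra_simps)
qed

subsection \<open>A chain of length n^2 in the closed orbit\<close>

lemma square_eqI: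
  "A \<in> carrier_mat m m \<Longrightarrow> B \<in> carrier_mat m m \<Longrightarrow> (\<And>r s. r < m \<Longrightarrow> s < m \<Longrightarrow> A $$ (r, s) = B $$ (r, s)) \<Longrightarrow> A = B"
  by (rule eq_matI) auto

lemma gram_addrow_index:
  assumes x: "x \<in> carrier_mat (2 * n) (2 * n)" and rc: "r < 2 * n" "c < 2 * n" and kl: "k < 2 * n" "l < 2 * n"
  shows "gram n (x * addrow_mat (2 * n) a k l) $$ (r, c) = gram n x $$ (r, c) +
    (if c = l then a * gram n x $$ (r, k) else 0) + (if r = l then a * gram n x $$ (k, c) else 0)"
proof -
  let ?m = "2 * n" let ?g = "gram n x" let ?E = "addrow_mat ?m a k l" let ?E' = "addrow_mat ?m a l k"
  have E: "?E \<in> carrier_mat ?m ?m" "?E' \<in> carrier_mat ?m ?m" by auto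
  have g: "?g \<in> carrier_mat ?m ?m" using x by blast
  have "gram n (x * ?E) = ?E' * ?g * ?E" using gram_mult[OF x E(1)] by (simp only: transpose_addrow)
  also have "\<dots> $$ (r, c) = (?E' * ?g) $$ (r, c) + (if c = l then a * (?E' * ?g) $$ (r, k) else 0)"
    by (rule mult_addrow_index[OF mult_carrier_mat[OF E(2) g] rc kl(1)])
  finally show ?thesis
    unfolding addrow_mult_index[OF g rc kl(1)] addrow_mult_index[OF g rc(1) kl(1) kl(1)]
    using gram_diag[OF x kl(1)] by (simp add: distrib_left)
qed

text \<open>A one-parameter root subgroup of \<open>Sp n\<close>. The position
  \<open>(w0 n j, w0 n i)\<close> is the mirror image of \<open>(i, j)\<close> in the antidiagonal;
  both coincide for \<open>j = w0 n i\<close>, the long roots.\<close>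

definition root_elt :: "nat \<Rightarrow> nat \<Rightarrow> nat \<Rightarrow> complex \<Rightarrow> complex mat" where
  "root_elt n i j c = mat (2 * n) (2 * n) (\<lambda>(r, s). (if r = s then 1 else 0) +
     c * (if r = i \<and> s = j then 1 else if r = w0 n j \<and> s = w0 n i then - jsgn n j else 0))"

text \<open>These pairs list the root subgroups of \<open>Sp n\<close> above the diagonal, with one
  position from each mirror pair. Row \<open>i\<close> contains \<open>2 * (n - i) - 1\<close> of
  them, altogether \<open>n * n\<close>.\<close>

context
  fixes n i j :: nat
  assumes ij: "i < n" "i < j" "j \<le> w0 n i"
begin

lemma root_bounds: "i < 2 * n" "j < 2 * n" "w0 n i < 2 * n" "w0 n j < 2 * n" "i \<noteq> j" "w0 n j \<noteq> w0 n i"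
  "i \<noteq> w0 n i" "j \<noteq> w0 n j" "i \<le> w0 n j" "w0 n i < w0 n j \<Longrightarrow> False" "j \<noteq> w0 n i \<Longrightarrow> i < w0 n j"
proof -
  have i: "i < 2 * n" "w0 n i < 2 * n" using ij by auto
  have j: "j < 2 * n" using le_less_trans[OF ij(3) i(2)] .
  show "i < 2 * n" "j < 2 * n" "w0 n i < 2 * n" "w0 n j < 2 * n" "i \<noteq> j" using i j ij by auto
  show "w0 n j \<noteq> w0 n i" "i \<noteq> w0 n i" "j \<noteq> w0 n j" "i \<le> w0 n j" "w0 n i < w0 n j \<Longrightarrow> False" "j \<noteq> w0 n i \<Longrightarrow> i < w0 n j"
    using i j ij by (simp_all add: w0_simps(1)) presburger?
qed

lemma root_elt_eq:
  "root_elt n i j c = (if j = w0 n i then addrow_mat (2 * n) c i j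
     else addrow_mat (2 * n) c i j * addrow_mat (2 * n) (- c * jsgn n j) (w0 n j) (w0 n i))"
proof (cases "j = w0 n i")
  case True
  then have "w0 n j = i" by simp
  then show ?thesis using True root_bounds by (auto simp: root_elt_def intro!: eq_matI)
next
  case False
  note bs = root_bounds(1-9) root_bounds(11)[OF False]
  have "root_elt n i j c = addrow_mat (2 * n) c i j * addrow_mat (2 * n) (- c * jsgn n j) (w0 n j) (w0 n i)"
  proof (rule eq_matI)
    fix r s assume "r < dim_row (addrow_mat (2 * n) c i j * addrow_mat (2 * n) (- c * jsgn n j) (w0 n j) (w0 n i))"
      "s < dim_col (addrow_mat (2 * n) c i j * addrow_mat (2 * n) (- c * jsgn n j) (w0 n j) (w0 n i))"
    then have rs: "r < 2 * n" "s < 2 * n" by auto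
    have E: "addrow_mat (2 * n) c i j \<in> carrier_mat (2 * n) (2 * n)" by simp
    show "root_elt n i j c $$ (r, s) = (addrow_mat (2 * n) c i j * addrow_mat (2 * n) (- c * jsgn n j) (w0 n j) (w0 n i)) $$ (r, s)"
      unfolding mult_addrow_index[OF E rs bs(4)] using rs bs by (auto simp: root_elt_def)
  qed (simp_all add: root_elt_def)
  then show ?thesis using False by simp
qed

lemma root_elt_SL: "root_elt n i j c \<in> GG (2 * n)"
  unfolding root_elt_eq using root_bounds by (auto intro!: SL_closed addrow_mat_SL)

lemma mult_root_elt_index:
  assumes v: "v \<in> carrier_mat (2 * n) (2 * n)" and ls: "l < 2 * n" "s < 2 * n"
  shows "(v * root_elt n i j c) $$ (l, s) = v $$ (l, s) + (if s = j then c * v $$ (l, i) else 0) +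
    (if s = w0 n i \<and> j \<noteq> w0 n i then - c * jsgn n j * v $$ (l, w0 n j) else 0)"
proof (cases "j = w0 n i")
  case True
  then show ?thesis unfolding root_elt_eq using mult_addrow_index[OF v ls root_bounds(1), of c j] by (simp del: index_mult_mat(1))
next
  case False
  let ?E = "addrow_mat (2 * n) c i j" let ?F = "addrow_mat (2 * n) (- c * jsgn n j) (w0 n j) (w0 n i)"
  have E: "?E \<in> carrier_mat (2 * n) (2 * n)" "?F \<in> carrier_mat (2 * n) (2 * n)" by auto
  have e: "v * root_elt n i j c = v * ?E * ?F" using False by (simp only: root_elt_eq if_False mat_assoc[OF v E])
  show ?thesis
    unfolding e mult_addrow_index[OF mult_carrier_mat[OF v E(1)] ls root_bounds(4)]
      mult_addrow_index[OF v ls root_bounds(1)] mult_addrow_index[OF v ls(1) root_bounds(4,1)]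
    using False root_bounds(8) by auto
qed

lemma minv_root_elt: "minv (2 * n) (root_elt n i j c) = root_elt n i j (- c)"
proof (rule SL_inv_eq[OF root_elt_SL root_elt_SL], rule eq_matI)
  fix r s assume "r < dim_row (1\<^sub>m (2 * n) :: complex mat)" "s < dim_col (1\<^sub>m (2 * n) :: complex mat)"
  then have rs: "r < 2 * n" "s < 2 * n" by auto
  note bs = root_bounds
  show "(root_elt n i j (- c) * root_elt n i j c) $$ (r, s) = 1\<^sub>m (2 * n) $$ (r, s)"
  proof -
    have v: "root_elt n i j (- c) $$ (r, i) = (if r = i then 1 else 0)"
      "root_elt n i j (- c) $$ (r, w0 n j) = (if r = w0 n j then 1 else 0)"
      using rs bs(1,4-8) by (simp_all add: root_elt_def)
    show ?thesis
      unfolding mult_root_elt_index[OF SL_mat[OF root_elt_SL] rs] v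
      using rs bs(1-8) by (auto simp: root_elt_def)
  qed
qed (simp_all add: root_elt_def)

lemma root_elt_Sp: "root_elt n i j c \<in> Sp n"
proof -
  note bs = root_bounds
  let ?m = "2 * n" let ?J = "Jnn n"
  have O: "1\<^sub>m ?m \<in> carrier_mat ?m ?m" by simp
  have jj: "jsgn n i = 1" "jsgn n (w0 n i) = - 1" "jsgn n (w0 n j) = - jsgn n j" "jsgn n j * jsgn n j = 1"
    using ij jsgn_w0[OF bs(1)] jsgn_w0[OF bs(2)] by (simp_all add: jsgn_def)
  have wi: "(i = w0 n r) = (r = w0 n i)" and wj: "(w0 n j = w0 n r) = (r = j)" for r using w0_simps(2) by metis+
  have J1: "?J $$ (r, i) = (if r = w0 n i then - 1 else 0)" "?J $$ (i, r) = (if r = w0 n i then 1 else 0)"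
    "?J $$ (r, w0 n j) = (if r = j then jsgn n j else 0)" "?J $$ (w0 n j, r) = (if r = j then - jsgn n j else 0)" if "r < ?m" for r
    unfolding Jnn_index[OF that bs(1)] Jnn_index[OF bs(1) that] Jnn_index[OF that bs(4)] Jnn_index[OF bs(4) that] wi wj
    using jj by simp_all
  have g1: "gram n (addrow_mat ?m c i j) $$ (r, s) = ?J $$ (r, s) + (if s = j then c * ?J $$ (r, i) else 0) + (if r = j then c * ?J $$ (i, s) else 0)"
    if "r < ?m" "s < ?m" for r s
    using gram_addrow_index[OF O that bs(1,2), of c] by (simp add: gram_one left_mult_one_mat[of _ ?m ?m])
  have "gram n (root_elt n i j c) $$ (r, s) = ?J $$ (r, s)" if rs: "r < ?m" "s < ?m" for r s
  proof (cases "j = w0 n i")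
    case True
    show ?thesis
      unfolding root_elt_eq if_P[OF True] g1[OF rs] J1(1)[OF rs(1)] J1(2)[OF rs(2)] using True by simp
  next
    case False
    have E: "addrow_mat ?m c i j \<in> carrier_mat ?m ?m" by simp
    have gj: "gram n (addrow_mat ?m c i j) $$ (r, w0 n j) = (if r = j then jsgn n j else 0)"
      "gram n (addrow_mat ?m c i j) $$ (w0 n j, s) = (if s = j then - jsgn n j else 0)"
      using g1[OF rs(1) bs(4)] g1[OF bs(4) rs(2)] J1 rs bs by auto
    have "gram n (root_elt n i j c) $$ (r, s) = gram n (addrow_mat ?m c i j) $$ (r, s) +
      (if s = w0 n i then - c * jsgn n j * (if r = j then jsgn n j else 0) else 0) +
      (if r = w0 n i then - c * jsgn n j * (if s = j then - jsgn n j else 0) else 0)"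
      using gram_addrow_index[OF E rs bs(4,3), of "- c * jsgn n j"] False by (simp only: root_elt_eq if_False gj)
    also have "\<dots> = ?J $$ (r, s)"
      unfolding g1[OF rs] J1(1)[OF rs(1)] J1(2)[OF rs(2)] using jj(4) False by (auto simp: mult.assoc)
    finally show ?thesis .
  qed
  then have "gram n (root_elt n i j c) = ?J"
    by (intro square_eqI[OF gram_carrier[OF SL_mat[OF root_elt_SL]] Jnn_carrier[of n]])
  then show ?thesis using root_elt_SL by (simp add: Sp_iff)
qed

end

lemma irr_root_elts: "irr (2 * n) (range (root_elt n i j))"
  unfolding root_elt_def[abs_def] by (rule irr_line)

text \<open>\<open>F\<close> collects the columns of row \<open>i\<close> that have already been filled by root subgroups.\<close>

definition row_state :: "nat \<Rightarrow> nat \<Rightarrow> nat set \<Rightarrow> complex mat set \<Rightarrow> bool" where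
  "row_state n i F A \<longleftrightarrow> A \<subseteq> Sp n \<and> 1\<^sub>m (2 * n) \<in> A \<and> irr (2 * n) A \<and>
     (\<forall>u\<in>A. \<forall>l s. l < i \<longrightarrow> s < 2 * n \<longrightarrow> minv (2 * n) u $$ (l, s) = (if l = s then 1 else 0)) \<and>
     (\<forall>u\<in>A. \<forall>s. i < s \<longrightarrow> s < 2 * n \<longrightarrow> s \<notin> F \<longrightarrow> minv (2 * n) u $$ (i, s) = 0)"

lemma monomial_type_Jnn: "monomial_type n (w0 n) (Jnn n)"
  unfolding monomial_type_def by (auto simp: Jnn_index jsgn_def)

lemma one_in_stratum_w0: "1\<^sub>m (2 * n) \<in> stratum n (w0 n)"
  unfolding stratum_def using borel_one[of n] monomial_type_Jnn[of n] by (auto simp: gram_one intro!: bexI[of _ "1\<^sub>m (2 * n)"])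

text \<open>The entry \<open>(i, j)\<close> of the inverse separates the two products. It vanishes
  on \<open>A B\<close>: a factor from \<open>B\<close> has a lower triangular inverse, and for
  inverses of elements of \<open>A\<close> the rows above \<open>i\<close> are trivial and column
  \<open>j\<close> of row \<open>i\<close> is not yet filled. Root elements with \<open>j\<close>
  other than \<open>w0 n i\<close> also disturb column \<open>w0 n i\<close>, so this column has to
  be filled first.\<close>

lemma row_state_step:
  assumes n: "n > 0" and st: "row_state n i F A" and ij: "i < n" "i < j" "j \<le> w0 n i" and j: "j \<notin> F" "j = w0 n i \<or> w0 n i \<in> F"
    and ch: "zchain (2 * n) (adm n (stratum n (w0 n))) (mprod A (borel n)) d"
  shows "\<exists>A'. row_state n i (insert j F) A' \<and> zchain (2 * n) (adm n (stratum n (w0 n))) (mprod A' (borel n)) (Suc d)"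
proof -
  let ?m = "2 * n" let ?R = "range (root_elt n i j)" let ?A = "mprod (range (root_elt n i j)) A"
  note bs = root_bounds[OF ij]
  have ASp: "A \<subseteq> Sp n" and A1: "1\<^sub>m ?m \<in> A" and Airr: "irr ?m A"
    and rows: "\<And>u l s. u \<in> A \<Longrightarrow> l < i \<Longrightarrow> s < ?m \<Longrightarrow> minv ?m u $$ (l, s) = (if l = s then 1 else 0)"
    and row: "\<And>u s. u \<in> A \<Longrightarrow> i < s \<Longrightarrow> s < ?m \<Longrightarrow> s \<notin> F \<Longrightarrow> minv ?m u $$ (i, s) = 0"
    using st unfolding row_state_def by blast+
  have AG: "u \<in> GG ?m" if "u \<in> A" for u using that ASp Sp_SL by blast
  have R0: "root_elt n i j 0 = 1\<^sub>m ?m" by (auto simp: root_elt_def intro!: eq_matI)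
  have inv: "minv ?m (root_elt n i j c * u) $$ (l, s) = minv ?m u $$ (l, s) + (if s = j then - c * minv ?m u $$ (l, i) else 0) +
    (if s = w0 n i \<and> j \<noteq> w0 n i then c * jsgn n j * minv ?m u $$ (l, w0 n j) else 0)"
    if "u \<in> A" "l < ?m" "s < ?m" for u c l s
  proof -
    have "minv ?m (root_elt n i j c * u) = minv ?m u * root_elt n i j (- c)"
      using SL_inv_mult[OF root_elt_SL[OF ij] AG[OF that(1)]] by (simp only: minv_root_elt[OF ij])
    then show ?thesis using mult_root_elt_index[OF ij SL_mat[OF SL_inv[OF AG[OF that(1)]]] that(2,3), of "- c"]
      by (simp del: index_mult_mat(1))
  qed
  have sub: "A \<subseteq> ?A"
  proof
    fix u assume u: "u \<in> A"
    then have "u = root_elt n i j 0 * u" using AG R0 by simp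
    then show "u \<in> ?A" using u unfolding mprod_def by blast
  qed
  have SpA: "?A \<subseteq> Sp n" using ASp root_elt_Sp[OF ij] Sp_mult unfolding mprod_def by blast
  have irrA: "irr ?m ?A" using irr_mprod[OF irr_root_elts Airr] .
  have st': "row_state n i (insert j F) ?A"
    unfolding row_state_def
  proof (intro conjI ballI allI impI)
    fix u l s assume u: "u \<in> ?A" and l: "l < i" and s: "s < ?m"
    obtain c v where v: "v \<in> A" "u = root_elt n i j c * v" using u unfolding mprod_def by blast
    have lm: "l < ?m" using less_trans[OF l bs(1)] .
    have "minv ?m v $$ (l, i) = 0" "minv ?m v $$ (l, w0 n j) = 0"
      using rows[OF v(1) l bs(1)] rows[OF v(1) l bs(4)] l bs(9) by auto
    then show "minv ?m u $$ (l, s) = (if l = s then 1 else 0)"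
      unfolding v(2) inv[OF v(1) lm s] using rows[OF v(1) l s] by simp
  next
    fix u s assume u: "u \<in> ?A" and s: "i < s" "s < ?m" "s \<notin> insert j F"
    obtain c v where v: "v \<in> A" "u = root_elt n i j c * v" using u unfolding mprod_def by blast
    have "s \<noteq> j" "\<not> (s = w0 n i \<and> j \<noteq> w0 n i)" using s j by auto
    then show "minv ?m u $$ (i, s) = 0"
      unfolding v(2) inv[OF v(1) bs(1) s(2)] using row[OF v(1) s(1,2)] s(3) by simp
  qed (use SpA irrA sub A1 in auto)
  have BG: "\<beta> \<in> GG ?m" if "\<beta> \<in> borel n" for \<beta> using that borel_SL by blast
  have irrB: "irr ?m (mprod ?A (borel n))" by (rule irr_mprod[OF irrA irr_borel[OF n]])
  have admB: "adm n (stratum n (w0 n)) (mprod ?A (borel n))"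
    unfolding adm_def
  proof (intro conjI ballI subsetI)
    fix x assume "x \<in> mprod ?A (borel n)"
    then obtain u \<beta> where x: "x = u * \<beta>" "u \<in> Sp n" "\<beta> \<in> borel n" "u \<in> ?A" using SpA unfolding mprod_def[of ?A] by blast
    have "u * 1\<^sub>m ?m * \<beta> \<in> stratum n (w0 n)" using one_in_stratum_w0 x by blast
    then show "x \<in> stratum n (w0 n)" using x Sp_SL by simp
    fix \<gamma> assume g: "\<gamma> \<in> borel n"
    have "x * \<gamma> = u * (\<beta> * \<gamma>)" using x g BG Sp_SL by (simp add: SL_assoc[of _ ?m])
    then show "x * \<gamma> \<in> mprod ?A (borel n)" using x g borel_mult unfolding mprod_def[of ?A "borel n"] by blast
  qed
  have "zchain ?m (adm n (stratum n (w0 n))) (mprod ?A (borel n)) (Suc d)"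
  proof (rule zchain.step[OF ch irrB admB, where f = "\<lambda>x. adj_mat x $$ (i, j)" and y = "root_elt n i j 1"])
    show "mprod A (borel n) \<subseteq> mprod ?A (borel n)" using sub unfolding mprod_def[of _ "borel n"] by blast
    show "regular ?m (\<lambda>x. adj_mat x $$ (i, j))" by (rule regular_adj_mat[OF bs(1,2)])
    have "root_elt n i j 1 = root_elt n i j 1 * 1\<^sub>m ?m * 1\<^sub>m ?m" using root_elt_SL[OF ij] by simp
    moreover have "root_elt n i j 1 * 1\<^sub>m ?m \<in> ?A" using A1 unfolding mprod_def by blast
    ultimately show "root_elt n i j 1 \<in> mprod ?A (borel n)" using borel_one unfolding mprod_def[of ?A] by blast
    show "adj_mat (root_elt n i j 1) $$ (i, j) \<noteq> 0"
      unfolding adj_mat_SL[OF root_elt_SL[OF ij]] minv_root_elt[OF ij] by (simp add: root_elt_def bs(1,2,5))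
    fix x assume "x \<in> mprod A (borel n)"
    then obtain u \<beta> where x: "x = u * \<beta>" "u \<in> A" "\<beta> \<in> borel n" unfolding mprod_def by blast
    have ub: "u \<in> GG ?m" "\<beta> \<in> GG ?m" using x AG BG by auto
    have "adj_mat x = minv ?m \<beta> * minv ?m u"
      using adj_mat_SL[of x ?m] SL_inv_mult[OF ub] ub unfolding x(1) by simp
    then have "adj_mat x $$ (i, j) = (\<Sum>k<?m. minv ?m \<beta> $$ (i, k) * minv ?m u $$ (k, j))"
      using mult_index[OF SL_mat[OF SL_inv[OF ub(2)]] SL_mat[OF SL_inv[OF ub(1)]] bs(1,2)] by simp
    also have "\<dots> = 0"
    proof (intro sum.neutral ballI)
      fix k assume k: "k \<in> {..<?m}"
      consider "k < i" | "k = i" | "i < k" by linarith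
      then show "minv ?m \<beta> $$ (i, k) * minv ?m u $$ (k, j) = 0"
      proof cases
        case 1
        then show ?thesis using rows[OF x(2) 1 bs(2)] ij(2) by simp
      next
        case 2
        then show ?thesis using row[OF x(2) ij(2) bs(2) j(1)] by simp
      next
        case 3
        then show ?thesis using borel_zero[OF borel_inv[OF x(3)] 3] k by simp
      qed
    qed
    finally show "adj_mat x $$ (i, j) = 0" .
  qed
  with st' show ?thesis by blast
qed

text \<open>Rows are filled from row \<open>n - 1\<close> up to row 0, so that the rows above are
  still trivial. Row \<open>n - Suc k\<close> has \<open>2 * k + 1\<close> root subgroups, and these
  odd numbers add up to squares.\<close>

lemma closed_orbit_chain_aux:
  assumes n: "n > 0" and "k \<le> n"
  shows "\<exists>A. A \<subseteq> Sp n \<and> 1\<^sub>m (2 * n) \<in> A \<and> irr (2 * n) A \<and>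
     (\<forall>u\<in>A. \<forall>l s. l < n - k \<longrightarrow> s < 2 * n \<longrightarrow> minv (2 * n) u $$ (l, s) = (if l = s then 1 else 0)) \<and>
     zchain (2 * n) (adm n (stratum n (w0 n))) (mprod A (borel n)) (k * k)"
  using \<open>k \<le> n\<close>
proof (induction k)
  case 0
  let ?m = "2 * n"
  have e: "mprod {1\<^sub>m ?m} (borel n) = borel n"
  proof -
    have "1\<^sub>m ?m * \<beta> = \<beta>" if "\<beta> \<in> borel n" for \<beta> using that borel_SL by simp
    then have "(\<lambda>\<beta>. 1\<^sub>m ?m * \<beta>) ` borel n = borel n" by simp
    moreover have "mprod {1\<^sub>m ?m} (borel n) = (\<lambda>\<beta>. 1\<^sub>m ?m * \<beta>) ` borel n" unfolding mprod_def by blast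
    ultimately show ?thesis by simp
  qed
  have "adm n (stratum n (w0 n)) (borel n)"
    unfolding adm_def
  proof (intro conjI ballI subsetI)
    fix x assume x: "x \<in> borel n"
    have "1\<^sub>m ?m * x \<in> stratum n (w0 n)" using one_in_stratum_w0 x by blast
    then show "x \<in> stratum n (w0 n)" using borel_SL[OF x] by simp
  qed auto
  then have "zchain ?m (adm n (stratum n (w0 n))) (mprod {1\<^sub>m ?m} (borel n)) 0"
    unfolding e by (intro zchain.base irr_borel n)
  moreover have "minv ?m (1\<^sub>m ?m) = 1\<^sub>m ?m" by (rule SL_inv_eq) auto
  ultimately show ?case using Sp_one by (intro exI[of _ "{1\<^sub>m ?m}"]) (auto intro: irr_singleton)
next
  case (Suc k)
  let ?m = "2 * n" let ?i = "n - Suc k"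
  obtain A where A: "A \<subseteq> Sp n" "1\<^sub>m ?m \<in> A" "irr ?m A"
    and rows: "\<And>u l s. u \<in> A \<Longrightarrow> l < n - k \<Longrightarrow> s < ?m \<Longrightarrow> minv ?m u $$ (l, s) = (if l = s then 1 else 0)"
    and ch: "zchain ?m (adm n (stratum n (w0 n))) (mprod A (borel n)) (k * k)"
    using Suc by (metis (no_types, lifting) Suc_leD)
  have i: "?i < n" "?i < n - k" using Suc.prems by auto
  have wi: "?i < w0 n ?i" "w0 n ?i = 2 * n - 1 - ?i" using i by (auto simp: w0_simps(1))
  have "row_state n ?i {} A" unfolding row_state_def using A rows i by auto
  from row_state_step[OF n this i(1) wi(1) order_refl _ _ ch]
  obtain A0 where A0: "row_state n ?i {w0 n ?i} A0" "zchain ?m (adm n (stratum n (w0 n))) (mprod A0 (borel n)) (Suc (k * k))" by auto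
  have "\<exists>A'. row_state n ?i (insert (w0 n ?i) F) A' \<and> zchain ?m (adm n (stratum n (w0 n))) (mprod A' (borel n)) (Suc (k * k) + card F)"
    if "finite F" "F \<subseteq> {?i<..<w0 n ?i}" for F
    using that
  proof (induction F rule: finite_induct)
    case empty
    then show ?case using A0 by auto
  next
    case (insert j F)
    then obtain A' where A': "row_state n ?i (insert (w0 n ?i) F) A'"
      "zchain ?m (adm n (stratum n (w0 n))) (mprod A' (borel n)) (Suc (k * k) + card F)" by auto
    have j: "?i < j" "j \<le> w0 n ?i" "j \<notin> insert (w0 n ?i) F" using insert by auto
    from row_state_step[OF n A'(1) i(1) j(1,2,3) _ A'(2)] show ?case
      using insert(1,2) by (simp add: insert_commute)
  qed
  from this[of "{?i<..<w0 n ?i}"] obtain A' where A': "row_state n ?i (insert (w0 n ?i) {?i<..<w0 n ?i}) A'"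
    "zchain ?m (adm n (stratum n (w0 n))) (mprod A' (borel n)) (Suc (k * k) + card {?i<..<w0 n ?i})" by auto
  have "Suc (k * k) + card {?i<..<w0 n ?i} = Suc k * Suc k" using wi Suc.prems by simp
  then have "zchain ?m (adm n (stratum n (w0 n))) (mprod A' (borel n)) (Suc k * Suc k)" using A'(2) by metis
  then show ?case using A'(1) unfolding row_state_def by blast
qed

lemma closed_orbit_chain:
  "n > 0 \<Longrightarrow> \<exists>S. zchain (2 * n) (adm n (stratum n (w0 n))) S (n * n)"
  using closed_orbit_chain_aux[of n n] by blast

section \<open>Minors and semicontinuity\<close>

lemma det_mat_Leibniz: "det (mat k k (\<lambda>(a, c). f a c)) = (\<Sum>p | p permutes {0..<k}. of_int (sign p) * (\<Prod>a = 0..<k. f a (p a)))"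
  for f :: "nat \<Rightarrow> nat \<Rightarrow> complex"
proof -
  have "det (mat k k (\<lambda>(a, c). f a c)) = (\<Sum>p | p permutes {0..<k}. of_int (sign p) * (\<Prod>a = 0..<k. mat k k (\<lambda>(a, c). f a c) $$ (a, p a)))"
    by (rule det_def') simp
  also have "\<dots> = (\<Sum>p | p permutes {0..<k}. of_int (sign p) * (\<Prod>a = 0..<k. f a (p a)))"
  proof (intro sum.cong refl arg_cong2[of _ _ _ _ "(*)"] prod.cong)
    fix p a assume "p \<in> {p. p permutes {0..<k}}" "a \<in> {0..<k}"
    then show "mat k k (\<lambda>(a, c). f a c) $$ (a, p a) = f a (p a)" using permutes_in_image[of p "{0..<k}" a] by auto
  qed
  finally show ?thesis .
qed

text \<open>Multilinearity in all rows at once, in the manner of Cauchy and Binet; selections with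
  repetitions are kept, so the sum runs over all functions.\<close>

lemma det_rows_expand:
  fixes u :: "nat \<Rightarrow> nat \<Rightarrow> complex"
  assumes "finite L"
  shows "det (mat k k (\<lambda>(a, c). \<Sum>l\<in>L. u a l * w l c)) =
    (\<Sum>\<phi>\<in>PiE {0..<k} (\<lambda>_. L). (\<Prod>a = 0..<k. u a (\<phi> a)) * det (mat k k (\<lambda>(a, c). w (\<phi> a) c)))"
proof -
  have "det (mat k k (\<lambda>(a, c). \<Sum>l\<in>L. u a l * w l c)) =
     (\<Sum>p | p permutes {0..<k}. \<Sum>\<phi>\<in>PiE {0..<k} (\<lambda>_. L). of_int (sign p) * (\<Prod>a = 0..<k. u a (\<phi> a) * w (\<phi> a) (p a)))"
    unfolding det_mat_Leibniz sum_distrib_left[symmetric] using assms by (subst prod_sum_PiE) auto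
  also have "\<dots> = (\<Sum>\<phi>\<in>PiE {0..<k} (\<lambda>_. L). \<Sum>p | p permutes {0..<k}. of_int (sign p) * (\<Prod>a = 0..<k. u a (\<phi> a) * w (\<phi> a) (p a)))"
    by (rule sum.swap)
  also have "\<dots> = (\<Sum>\<phi>\<in>PiE {0..<k} (\<lambda>_. L). (\<Prod>a = 0..<k. u a (\<phi> a)) * det (mat k k (\<lambda>(a, c). w (\<phi> a) c)))"
    unfolding det_mat_Leibniz sum_distrib_left by (intro sum.cong refl) (simp add: prod.distrib mult_ac)
  finally show ?thesis .
qed

lemma det_mat_swap: "det (mat k k (\<lambda>(a, c). f c a)) = det (mat k k (\<lambda>(a, c). f a c))"
  for f :: "nat \<Rightarrow> nat \<Rightarrow> complex"
proof -
  have "mat k k (\<lambda>(a, c). f c a) = transpose_mat (mat k k (\<lambda>(a, c). f a c))" by (rule eq_matI) auto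
  then show ?thesis using det_transpose[of "mat k k (\<lambda>(a, c). f a c)" k] by simp
qed

lemma det_row_linear:
  fixes w :: "nat \<Rightarrow> nat \<Rightarrow> complex"
  assumes "a0 < k"
  shows "det (mat k k (\<lambda>(a, c). if a = a0 then u c + t * v c else w a c)) =
    det (mat k k (\<lambda>(a, c). if a = a0 then u c else w a c)) + t * det (mat k k (\<lambda>(a, c). if a = a0 then v c else w a c))"
proof -
  have "(\<Prod>a = 0..<k. if a = a0 then z (p a) else w a (p a)) = z (p a0) * (\<Prod>a\<in>{0..<k} - {a0}. w a (p a))" for z p
  proof -
    have "(\<Prod>a = 0..<k. if a = a0 then z (p a) else w a (p a)) = z (p a0) * (\<Prod>a\<in>{0..<k} - {a0}. if a = a0 then z (p a) else w a (p a))"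
      using assms by (subst prod.remove[of _ a0]) auto
    also have "(\<Prod>a\<in>{0..<k} - {a0}. if a = a0 then z (p a) else w a (p a)) = (\<Prod>a\<in>{0..<k} - {a0}. w a (p a))"
      by (intro prod.cong) auto
    finally show ?thesis .
  qed
  from this[of "\<lambda>c. u c + t * v c"] this[of u] this[of v] show ?thesis
    unfolding det_mat_Leibniz sum_distrib_left sum.distrib[symmetric]
    by (intro sum.cong refl) (simp add: algebra_simps)
qed

lemma det_mat_zero_row:
  fixes f :: "nat \<Rightarrow> nat \<Rightarrow> complex"
  assumes "a0 < k" "\<And>c. c < k \<Longrightarrow> f a0 c = 0"
  shows "det (mat k k (\<lambda>(a, c). f a c)) = 0"
  unfolding det_mat_Leibniz
proof (rule sum.neutral, intro ballI)
  fix p assume "p \<in> {p. p permutes {0..<k}}"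
  then have "p a0 < k" using permutes_in_image[of p "{0..<k}" a0] assms(1) by auto
  then have "f a0 (p a0) = 0" by (rule assms(2))
  then have "(\<Prod>a = 0..<k. f a (p a)) = 0" using assms(1) by (intro prod_zero) auto
  then show "of_int (sign p) * (\<Prod>a = 0..<k. f a (p a)) = 0" by simp
qed

text \<open>The block with rows from \<open>p\<close> on and columns from \<open>q\<close> on has
  rank below \<open>k\<close>, expressed by polynomial equations so that it passes to
  closures.\<close>

definition minors_vanish :: "nat \<Rightarrow> nat \<Rightarrow> nat \<Rightarrow> nat \<Rightarrow> complex mat \<Rightarrow> bool" where
  "minors_vanish m p q k Y \<longleftrightarrow> (\<forall>\<rho> h. (\<forall>a<k. p \<le> \<rho> a \<and> \<rho> a < m) \<longrightarrow> (\<forall>a<k. q \<le> h a \<and> h a < m) \<longrightarrow>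
     det (mat k k (\<lambda>(a, c). Y $$ (\<rho> a, h c))) = 0)"

text \<open>The rows from \<open>p\<close> on of the product are combinations of the rows from
  \<open>p\<close> on of \<open>Y\<close>, so each minor is a combination of minors of the same
  corner.\<close>

lemma minors_vanish_left:
  assumes Y: "Y \<in> carrier_mat m m" and L: "L \<in> carrier_mat m m" "blocktri m p L" and v: "minors_vanish m p q k Y"
  shows "minors_vanish m p q k (transpose_mat L * Y)"
  unfolding minors_vanish_def
proof (intro allI impI)
  fix \<rho> h assume r: "\<forall>a<k. p \<le> \<rho> a \<and> \<rho> a < m" and h: "\<forall>a<k. q \<le> h a \<and> h a < m"
  have "(transpose_mat L * Y) $$ (\<rho> a, h c) = (\<Sum>l\<in>{p..<m}. L $$ (l, \<rho> a) * Y $$ (l, h c))" if "a < k" "c < k" for a c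
  proof -
    have "(transpose_mat L * Y) $$ (\<rho> a, h c) = (\<Sum>l<m. L $$ (l, \<rho> a) * Y $$ (l, h c))"
      using transpose_mult_index'[OF Y L(1)] r h that by blast
    also have "\<dots> = (\<Sum>l\<in>{p..<m}. L $$ (l, \<rho> a) * Y $$ (l, h c))"
      using L(2) r that by (intro sum.mono_neutral_right) (auto simp: blocktri_def)
    finally show ?thesis .
  qed
  then have "mat k k (\<lambda>(a, c). (transpose_mat L * Y) $$ (\<rho> a, h c)) = mat k k (\<lambda>(a, c). \<Sum>l\<in>{p..<m}. L $$ (l, \<rho> a) * Y $$ (l, h c))"
    by (intro eq_matI) (auto simp del: index_mult_mat(1))
  moreover have "det (mat k k (\<lambda>(a, c). Y $$ (\<phi> a, h c))) = 0" if "\<phi> \<in> PiE {0..<k} (\<lambda>_. {p..<m})" for \<phi>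
  proof -
    have "\<forall>a<k. p \<le> \<phi> a \<and> \<phi> a < m" using that by (auto simp: PiE_iff)
    then show ?thesis using v h unfolding minors_vanish_def by blast
  qed
  ultimately show "det (mat k k (\<lambda>(a, c). (transpose_mat L * Y) $$ (\<rho> a, h c))) = 0"
    using det_rows_expand[of "{p..<m}" k "\<lambda>a l. L $$ (l, \<rho> a)" "\<lambda>l c. Y $$ (l, h c)"] by simp
qed

lemma minors_vanish_right:
  assumes Y: "Y \<in> carrier_mat m m" and R: "R \<in> carrier_mat m m" "blocktri m q R" and v: "minors_vanish m p q k Y"
  shows "minors_vanish m p q k (Y * R)"
proof -
  have tr: "minors_vanish m q p k (transpose_mat Z) \<longleftrightarrow> minors_vanish m p q k Z" if Z: "Z \<in> carrier_mat m m" for Z p q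
  proof -
    have "det (mat k k (\<lambda>(a, c). transpose_mat Z $$ (\<rho> a, h c))) = det (mat k k (\<lambda>(a, c). Z $$ (h a, \<rho> c)))"
      if "\<forall>a<k. q \<le> \<rho> a \<and> \<rho> a < m" "\<forall>a<k. p \<le> h a \<and> h a < m" for \<rho> h
    proof -
      have "mat k k (\<lambda>(a, c). transpose_mat Z $$ (\<rho> a, h c)) = mat k k (\<lambda>(a, c). Z $$ (h c, \<rho> a))"
        using that Z by (intro eq_matI) auto
      then show ?thesis using det_mat_swap[of k "\<lambda>a c. Z $$ (h a, \<rho> c)"] by simp
    qed
    then show ?thesis unfolding minors_vanish_def by auto
  qed
  have "minors_vanish m q p k (transpose_mat R * transpose_mat Y)"
    by (rule minors_vanish_left[OF _ R]) (use Y v tr[OF Y] in auto)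
  moreover have "transpose_mat R * transpose_mat Y = transpose_mat (Y * R)" using transpose_mult[OF Y R(1)] by simp
  ultimately show ?thesis using tr[OF mult_carrier_mat[OF Y R(1)]] by simp
qed

text \<open>For a matrix of monomial type \<open>b\<close>, with \<open>b\<close> a fixed point-free
  involution, this is the rank of the block with rows from \<open>p\<close> on and columns from
  \<open>q\<close> on.\<close>

definition brank :: "nat \<Rightarrow> (nat \<Rightarrow> nat) \<Rightarrow> nat \<Rightarrow> nat \<Rightarrow> nat" where
  "brank m b p q = card {j. p \<le> j \<and> j < m \<and> q \<le> b j}"

lemma brank_minors_vanish:
  assumes b: "b \<in> fpf_involutions n" and t: "monomial_type n b Y" and k: "brank (2 * n) b p q < k"
  shows "minors_vanish (2 * n) p q k Y"
  unfolding minors_vanish_def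
proof (intro allI impI)
  fix \<rho> h assume r: "\<forall>a<k. p \<le> \<rho> a \<and> \<rho> a < 2 * n" and h: "\<forall>a<k. q \<le> h a \<and> h a < 2 * n"
  let ?M = "mat k k (\<lambda>(a, c). Y $$ (\<rho> a, h c))"
  show "det ?M = 0"
  proof (cases "inj_on \<rho> {..<k}")
    case False
    then obtain a a' where a: "a < k" "a' < k" "a \<noteq> a'" "\<rho> a = \<rho> a'" by (auto simp: inj_on_def)
    show ?thesis by (rule det_identical_rows[of _ k a a']) (use a in \<open>auto intro!: eq_vecI\<close>)
  next
    case True
    let ?R = "{j. p \<le> j \<and> j < 2 * n \<and> q \<le> b j}"
    have "finite ?R" by (rule finite_subset[of _ "{..<2 * n}"]) auto
    then have "\<not> \<rho> ` {..<k} \<subseteq> ?R" using card_mono[of ?R "\<rho> ` {..<k}"] card_image[OF True] k by (auto simp: brank_def)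
    then obtain a where a: "a < k" "\<not> q \<le> b (\<rho> a)" using r by blast
    show ?thesis
    proof (rule det_mat_zero_row[OF a(1)])
      fix c assume c: "c < k"
      have "\<rho> a \<noteq> b (h c)"
      proof
        assume "\<rho> a = b (h c)"
        then have "b (\<rho> a) = h c" using fpfD(2)[OF b] by simp
        then show False using a h c by simp
      qed
      then show "Y $$ (\<rho> a, h c) = 0" using t r h a c unfolding monomial_type_def by blast
    qed
  qed
qed

lemma brank_minor_nonzero:
  assumes b: "b \<in> fpf_involutions n" and t: "monomial_type n b Y"
    and \<rho>: "bij_betw \<rho> {..<brank (2 * n) b p q} {j. p \<le> j \<and> j < 2 * n \<and> q \<le> b j}"
  shows "det (mat (brank (2 * n) b p q) (brank (2 * n) b p q) (\<lambda>(a, c). Y $$ (\<rho> a, b (\<rho> c)))) \<noteq> 0"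
proof -
  let ?k = "brank (2 * n) b p q"
  let ?M = "mat ?k ?k (\<lambda>(a, c). Y $$ (\<rho> a, b (\<rho> c)))"
  have e: "Y $$ (\<rho> a, b (\<rho> c)) \<noteq> 0 \<longleftrightarrow> a = c" if "a < ?k" "c < ?k" for a c
  proof -
    have "\<rho> a < 2 * n" "\<rho> c < 2 * n" using bij_betwE[OF \<rho>] that by auto
    moreover have "\<rho> a = \<rho> c \<longleftrightarrow> a = c" using inj_on_eq_iff[OF bij_betw_imp_inj_on[OF \<rho>]] that by auto
    ultimately show ?thesis using t fpfD(2,4)[OF b] unfolding monomial_type_def by auto
  qed
  have z: "Y $$ (\<rho> a, b (\<rho> c)) = 0" if "a < c" "c < ?k" for a c using e[of a c] that by auto
  have "det ?M = prod_list (diag_mat ?M)" by (rule det_lower_triangular[of ?k]) (use z in auto)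
  also have "\<dots> = (\<Prod>a = 0..<?k. Y $$ (\<rho> a, b (\<rho> a)))" by (simp add: prod_list_diag_prod)
  also have "\<dots> \<noteq> 0" using e by (subst prod_zero_iff) auto
  finally show ?thesis .
qed

lemma brank_enum:
  obtains \<rho> where "bij_betw \<rho> {..<brank m b p q} {j. p \<le> j \<and> j < m \<and> q \<le> b j}"
proof -
  have "finite {j. p \<le> j \<and> j < m \<and> q \<le> b j}" by (rule finite_subset[of _ "{..<m}"]) auto
  from ex_bij_betw_nat_finite[OF this] that show ?thesis by (auto simp: brank_def atLeast0LessThan)
qed

lemma brank_le_iff:
  assumes b: "b \<in> fpf_involutions n" and t: "monomial_type n b Y" and v: "minors_vanish (2 * n) p q k Y"
  shows "brank (2 * n) b p q < k"
proof (rule ccontr)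
  assume k: "\<not> ?thesis"
  let ?r = "brank (2 * n) b p q"
  obtain \<rho> where \<rho>: "bij_betw \<rho> {..<?r} {j. p \<le> j \<and> j < 2 * n \<and> q \<le> b j}" using brank_enum .
  let ?S = "\<rho> ` {..<k}"
  have in_range: "p \<le> \<rho> a" "\<rho> a < 2 * n" "q \<le> b (\<rho> a)" if "a < k" for a using bij_betwE[OF \<rho>] that k by auto
  have e: "Y $$ (\<rho> a, b (\<rho> c)) \<noteq> 0 \<longleftrightarrow> a = c" if "a < k" "c < k" for a c
  proof -
    have "\<rho> a = \<rho> c \<longleftrightarrow> a = c" using inj_on_eq_iff[OF bij_betw_imp_inj_on[OF \<rho>]] that k by auto
    then show ?thesis using t in_range that fpfD(2,4)[OF b] unfolding monomial_type_def by auto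
  qed
  let ?M = "mat k k (\<lambda>(a, c). Y $$ (\<rho> a, b (\<rho> c)))"
  have z: "Y $$ (\<rho> a, b (\<rho> c)) = 0" if "a < c" "c < k" for a c using e[of a c] that by auto
  have "det ?M = prod_list (diag_mat ?M)" by (rule det_lower_triangular[of k]) (use z in auto)
  also have "\<dots> = (\<Prod>a = 0..<k. Y $$ (\<rho> a, b (\<rho> a)))" by (simp add: prod_list_diag_prod)
  also have "\<dots> \<noteq> 0" using e by (subst prod_zero_iff) auto
  finally have "det ?M \<noteq> 0" .
  moreover have "det ?M = 0"
    using v[unfolded minors_vanish_def, rule_format, of \<rho> "\<lambda>c. b (\<rho> c)"] in_range fpfD(4)[OF b] by auto
  ultimately show False by simp
qed

text \<open>Moving the first row from \<open>j\<close> to \<open>Suc j\<close> lowers the rank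
  exactly when \<open>q \<le> b j\<close>; letting \<open>q\<close> vary recovers
  \<open>b j\<close>.\<close>

lemma brank_determines:
  assumes b: "b \<in> fpf_involutions n" and c: "c \<in> fpf_involutions n"
    and eq: "\<And>p q. brank (2 * n) b p q = brank (2 * n) c p q"
  shows "b = c"
proof -
  have step: "brank (2 * n) b j q = (if q \<le> b j then 1 else 0) + brank (2 * n) b (Suc j) q" if "j < 2 * n" for b j q
  proof -
    have f: "finite {i. Suc j \<le> i \<and> i < 2 * n \<and> q \<le> b i}" by (rule finite_subset[of _ "{..<2 * n}"]) auto
    have "{i. j \<le> i \<and> i < 2 * n \<and> q \<le> b i} =
      (if q \<le> b j then {j} else {}) \<union> {i. Suc j \<le> i \<and> i < 2 * n \<and> q \<le> b i}"
      using that by (auto simp: Suc_le_eq le_less)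
    then show ?thesis using f by (auto simp: brank_def)
  qed
  have "b j = c j" for j
  proof (cases "j < 2 * n")
    case True
    have "q \<le> b j \<longleftrightarrow> q \<le> c j" for q
      using step[OF True, of b q] step[OF True, of c q] eq[of j q] eq[of "Suc j" q] by (simp split: if_splits)
    then show ?thesis by (metis le_antisym order_refl)
  next
    case False
    then show ?thesis using fpfD(1)[OF b] fpfD(1)[OF c] by (metis lessThan_iff permutes_def)
  qed
  then show ?thesis by blast
qed

section \<open>Closures of strata and corner ranks\<close>

lemma zc_right:
  assumes "x \<in> zc m S" "g \<in> GG m" "\<And>y. y \<in> S \<Longrightarrow> y * g \<in> T"
  shows "x * g \<in> zc m T"
proof -
  have "rmap m (\<lambda>x. x * g)" using SL_mat[OF assms(2)] by (intro rmap_mult rmap_id rmap_const)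
  from zc_image[OF this assms(1)] have "x * g \<in> zc m ((\<lambda>x. x * g) ` S)" .
  moreover have "(\<lambda>x. x * g) ` S \<subseteq> T" using assms(3) by blast
  ultimately show ?thesis using zc_mono by blast
qed

lemma stratum_zc: "stratum n b \<subseteq> zc (2 * n) (stratum n b)"
  using stratum_SL SL_mat by (intro zc_superset) blast

lemma zc_stratum_SL: "x \<in> zc (2 * n) (stratum n b) \<Longrightarrow> x \<in> GG (2 * n)"
  using zc_SL[of "stratum n b" "2 * n"] stratum_SL by blast

lemma zc_gram_minors:
  assumes x: "x \<in> zc (2 * n) S" and v: "\<And>y. y \<in> S \<Longrightarrow> minors_vanish (2 * n) p q k (gram n y)"
  shows "minors_vanish (2 * n) p q k (gram n x)"
  unfolding minors_vanish_def
proof (intro allI impI)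
  fix \<rho> h assume r: "\<forall>a<k. p \<le> \<rho> a \<and> \<rho> a < 2 * n" and h: "\<forall>a<k. q \<le> h a \<and> h a < 2 * n"
  have "regular (2 * n) (\<lambda>y. det (mat k k (\<lambda>(a, c). gram n y $$ (\<rho> a, h c))))"
    by (rule regular_det) (use rmap_gram r h in \<open>auto simp: rmap_def\<close>)
  then show "det (mat k k (\<lambda>(a, c). gram n x $$ (\<rho> a, h c))) = 0"
    by (rule zc_D[OF x]) (use v r h in \<open>auto simp: minors_vanish_def\<close>)
qed

lemma minors_vanish_gram_mult:
  assumes x: "x \<in> GG (2 * n)" and B: "\<beta> \<in> borel n" and v: "minors_vanish (2 * n) p q k (gram n x)"
  shows "minors_vanish (2 * n) p q k (gram n (x * \<beta>))"
proof -
  have c: "gram n x \<in> carrier_mat (2 * n) (2 * n)" "\<beta> \<in> carrier_mat (2 * n) (2 * n)"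
    using x borel_SL[OF B] SL_mat by blast+
  have tb: "blocktri (2 * n) r \<beta>" for r using B by (simp add: borel_iff)
  have t: "transpose_mat \<beta> * gram n x \<in> carrier_mat (2 * n) (2 * n)" using c by (intro mult_carrier_mat[of _ _ "2 * n"]) auto
  show ?thesis
    unfolding gram_mult[OF SL_mat[OF x] c(2)]
    by (rule minors_vanish_right[OF t c(2) tb minors_vanish_left[OF c(1,2) tb v]])
qed

lemma stratum_minors:
  assumes b: "b \<in> fpf_involutions n" and x: "x \<in> stratum n b" and k: "brank (2 * n) b p q < k"
  shows "minors_vanish (2 * n) p q k (gram n x)"
proof -
  obtain \<beta> where B: "\<beta> \<in> borel n" "x * \<beta> \<in> stratum n b" "monomial_type n b (gram n (x * \<beta>))" using stratum_rep[OF x] .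
  have "minors_vanish (2 * n) p q k (gram n (x * \<beta> * minv (2 * n) \<beta>))"
    using minors_vanish_gram_mult[OF stratum_SL[OF B(2)] borel_inv[OF B(1)] brank_minors_vanish[OF b B(3) k]] .
  then show ?thesis using stratum_SL[OF x] borel_SL[OF B(1)] by simp
qed

lemma stratum_closure_brank:
  assumes b: "b \<in> fpf_involutions n" and c: "c \<in> fpf_involutions n"
    and x: "x \<in> stratum n c" and z: "x \<in> zc (2 * n) (stratum n b)"
  shows "brank (2 * n) c p q \<le> brank (2 * n) b p q"
proof -
  have v: "minors_vanish (2 * n) p q (Suc (brank (2 * n) b p q)) (gram n x)"
    by (rule zc_gram_minors[OF z]) (auto intro: stratum_minors[OF b])
  obtain \<beta> where B: "\<beta> \<in> borel n" "x * \<beta> \<in> stratum n c" "monomial_type n c (gram n (x * \<beta>))" using stratum_rep[OF x] .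
  from brank_le_iff[OF c B(3) minors_vanish_gram_mult[OF stratum_SL[OF x] B(1) v]] show ?thesis by simp
qed

text \<open>Corner ranks do not increase in a closure and determine the involution. One point of
  each stratum in the closure of the other is therefore enough.\<close>

lemma stratum_T0:
  assumes b: "b \<in> fpf_involutions n" and c: "c \<in> fpf_involutions n"
    and "x \<in> stratum n c" "x \<in> zc (2 * n) (stratum n b)" "y \<in> stratum n b" "y \<in> zc (2 * n) (stratum n c)"
  shows "b = c"
  using stratum_closure_brank[OF b c assms(3,4)] stratum_closure_brank[OF c b assms(5,6)]
  by (intro brank_determines[OF b c] le_antisym)

section \<open>Minimal parabolic subgroups and strata\<close>

lemma monomial_type_smat:
  assumes x: "x \<in> GG (2 * n)" and i: "Suc i < 2 * n" and t: "monomial_type n b (gram n x)"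
  shows "monomial_type n (conj_refl i b) (gram n (x * smat (2 * n) i))"
  unfolding monomial_type_def
proof (intro allI impI)
  let ?m = "2 * n" let ?s = "smat ?m i" let ?g = "gram n x"
  fix r c assume rc: "r < ?m" "c < ?m"
  have g: "?g \<in> carrier_mat ?m ?m" using x SL_mat by blast
  have e: "gram n (x * ?s) = minv ?m ?s * ?g * ?s" using gram_mult[OF SL_mat[OF x], of ?s] i by (simp add: minv_smat)
  have c: "minv ?m ?s * ?g \<in> carrier_mat ?m ?m" using g SL_mat[OF SL_inv[OF smat_SL[OF i]]] by simp
  have s: "simple_refl i r < ?m" "simple_refl i c < ?m"
    using rc i by (auto simp: simple_refl_def Transposition.transpose_def)
  have "gram n (x * ?s) $$ (r, c) \<noteq> 0 \<longleftrightarrow> ?g $$ (simple_refl i r, simple_refl i c) \<noteq> 0"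
  proof -
    have im: "i < ?m" using i by simp
    show ?thesis
      unfolding e mult_smat_index[OF c rc i] minv_smat_mult_index[OF g rc(1) i i]
        minv_smat_mult_index[OF g rc(1) im i] minv_smat_mult_index[OF g rc i]
      by (auto simp: simple_refl_def Transposition.transpose_def)
  qed
  also have "\<dots> \<longleftrightarrow> simple_refl i r = b (simple_refl i c)" using t s unfolding monomial_type_def by blast
  also have "\<dots> \<longleftrightarrow> r = conj_refl i b c" by (simp add: simple_refl_eq_iff)
  finally show "gram n (x * ?s) $$ (r, c) \<noteq> 0 \<longleftrightarrow> r = conj_refl i b c" .
qed

lemma smat_square_borel:
  assumes i: "Suc i < 2 * n"
  shows "smat (2 * n) i * smat (2 * n) i \<in> borel n"
    and "minv (2 * n) (smat (2 * n) i) * minv (2 * n) (smat (2 * n) i) \<in> borel n"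
proof -
  let ?s = "smat (2 * n) i"
  have "(?s * ?s) $$ (r, c) = 0" if "r < c" "c < 2 * n" for r c
  proof -
    have r: "r < 2 * n" using that by simp
    show ?thesis unfolding mult_smat_index[OF smat_carrier(1) r that(2) i] using that i by (auto simp: smat_def)
  qed
  then show 1: "?s * ?s \<in> borel n" using i by (simp add: borel_def)
  show "minv (2 * n) ?s * minv (2 * n) ?s \<in> borel n" using borel_inv[OF 1] i by (simp add: SL_inv_mult)
qed

lemma stratum_nonempty:
  assumes "b \<in> fpf_involutions n"
  shows "\<exists>x\<in>stratum n b. monomial_type n b (gram n x)"
  using assms
proof (induction rule: fpf_induct)
  case w0
  show ?case
    by (rule bexI[OF _ one_in_stratum_w0]) (simp add: gram_one monomial_type_Jnn)
next
  case (step b i)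
  then obtain x where x: "x \<in> GG (2 * n)" "monomial_type n b (gram n x)" using stratum_SL by blast
  have i: "Suc i < 2 * n" using step by simp
  have "x * smat (2 * n) i \<in> GG (2 * n)" using x i by auto
  moreover from this have "x * smat (2 * n) i * 1\<^sub>m (2 * n) = x * smat (2 * n) i" by simp
  ultimately show ?case
    using monomial_type_smat[OF x(1) i x(2)] borel_one[of n] unfolding stratum_def
    by (intro bexI[of _ "x * smat (2 * n) i"]) (simp_all only: mem_Collect_eq, metis)
qed

text \<open>For \<open>b i = Suc i\<close> the Gram matrix does not change at all. Otherwise the
  root element creates entries at \<open>(i, ?w)\<close> and \<open>(?w, i)\<close>; adding a
  multiple of column \<open>?u\<close> to column \<open>?w\<close>, and likewise for rows, clears
  them. The descent says \<open>?w < ?u\<close>, so this correction lies in \<open>B\<close>. Equal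
  Gram matrices then differ by an element of \<open>K\<close>.\<close>

lemma addrow_absorb:
  assumes b: "b \<in> fpf_involutions n" and i: "Suc i < 2 * n" and lt: "b (Suc i) < b i"
    and x: "x \<in> GG (2 * n)" and t: "monomial_type n b (gram n x)"
  shows "\<exists>k\<in>Sp n. \<exists>\<gamma>\<in>borel n. \<gamma> $$ (Suc i, i) = 0 \<and> x * addrow_mat (2 * n) c (Suc i) i = k * x * \<gamma>"
proof -
  let ?m = "2 * n" let ?g = "gram n x" let ?l = "addrow_mat ?m c (Suc i) i" let ?g1 = "gram n (x * ?l)"
  have xm: "x \<in> carrier_mat ?m ?m" using x SL_mat by blast
  have im: "i < ?m" using i by simp
  have lG: "?l \<in> GG ?m" by auto
  have xl: "x * ?l \<in> GG ?m" using x lG by simp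
  have z: "?g $$ (r, s) = 0" if "r < ?m" "s < ?m" "r \<noteq> b s" for r s using t that unfolding monomial_type_def by blast
  have nz: "?g $$ (r, s) \<noteq> 0" if "r < ?m" "s < ?m" "r = b s" for r s using t that unfolding monomial_type_def by blast
  have g1: "?g1 $$ (r, s) = ?g $$ (r, s) + (if s = i then c * ?g $$ (r, Suc i) else 0) + (if r = i then c * ?g $$ (Suc i, s) else 0)"
    if "r < ?m" "s < ?m" for r s by (rule gram_addrow_index[OF xm that i im])
  show ?thesis
  proof (cases "b i = Suc i")
    case True
    then have bi: "b (Suc i) = i" using fpfD(2)[OF b, of i] by simp
    have "?g1 = ?g"
    proof (rule square_eqI[OF gram_carrier[OF SL_mat[OF xl]] gram_carrier[OF xm]])
      fix r s assume rs: "r < ?m" "s < ?m"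
      have "?g $$ (r, Suc i) = (if r = i then ?g $$ (i, Suc i) else 0)" using z[OF rs(1) i] bi by auto
      moreover have "?g $$ (Suc i, s) = (if s = i then ?g $$ (Suc i, i) else 0)"
      proof -
        have "Suc i = b s \<longleftrightarrow> s = i" using fpfD(2)[OF b] bi by metis
        then show ?thesis using z[OF i rs(2)] by auto
      qed
      moreover have "?g $$ (Suc i, i) = - ?g $$ (i, Suc i)" using gram_skew[OF xm im i] .
      ultimately show "?g1 $$ (r, s) = ?g $$ (r, s)" unfolding g1[OF rs] by simp
    qed
    then have k: "x * ?l * minv ?m x \<in> Sp n" using gram_eq_Sp[OF x xl] by simp
    have "x * ?l = x * ?l * minv ?m x * x * 1\<^sub>m ?m" using x xl by simp
    then show ?thesis using k borel_one[of n] i by (intro bexI[of _ "x * ?l * minv ?m x"] bexI[of _ "1\<^sub>m ?m"] conjI) auto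
  next
    case False
    note nb = fpf_refl_nbrs[OF b i False]
    let ?u = "b i" and ?w = "b (Suc i)"
    have uw: "?u < ?m" "?w < ?m" "b ?u = i" "b ?w = Suc i" "?w < ?u" using fpfD(2,4)[OF b] i im lt by auto
    define d where "d = - c * ?g $$ (Suc i, ?w) / ?g $$ (i, ?u)"
    let ?E = "addrow_mat ?m d ?u ?w"
    have EB: "?E \<in> borel n" using uw by (intro addrow_mat_borel)
    have EG: "?E \<in> GG ?m" using EB borel_SL by blast
    have giu: "?g $$ (i, ?u) \<noteq> 0" using nz[OF im uw(1)] uw by simp
    have "gram n (x * ?l * ?E) = ?g"
    proof (rule square_eqI[OF gram_carrier[OF SL_mat[OF SL_closed[OF xl EG]]] gram_carrier[OF xm]])
      fix r s assume rs: "r < ?m" "s < ?m"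
      have a1: "?g $$ (r', Suc i) = (if r' = ?w then - ?g $$ (Suc i, ?w) else 0)" if "r' < ?m" for r'
        using z[OF that i] gram_skew[OF xm i uw(2)] by auto
      have a2: "?g $$ (Suc i, s') = (if s' = ?w then ?g $$ (Suc i, ?w) else 0)" if "s' < ?m" for s'
      proof -
        have "Suc i = b s' \<longleftrightarrow> s' = ?w" using fpfD(2)[OF b] by metis
        then show ?thesis using z[OF i that] by auto
      qed
      have a3: "?g $$ (r', ?u) = (if r' = i then ?g $$ (i, ?u) else 0)" if "r' < ?m" for r'
        using z[OF that uw(1)] uw by auto
      have a4: "?g $$ (?u, s') = (if s' = i then - ?g $$ (i, ?u) else 0)" if "s' < ?m" for s'
        using z[OF uw(1) that] fpfD(5)[OF b, of i s'] gram_skew[OF xm im uw(1)] by auto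
      have b1: "?g1 $$ (r, ?u) = (if r = i then ?g $$ (i, ?u) else 0)"
        unfolding g1[OF rs(1) uw(1)] a1[OF rs(1)] a2[OF uw(1)] a3[OF rs(1)] using nb uw by auto
      have b2: "?g1 $$ (?u, s) = (if s = i then - ?g $$ (i, ?u) else 0)"
        unfolding g1[OF uw(1) rs(2)] a1[OF uw(1)] a2[OF rs(2)] a4[OF rs(2)] using nb uw by auto
      have dd: "d * ?g $$ (i, ?u) = - c * ?g $$ (Suc i, ?w)" using giu by (simp add: d_def)
      have "gram n (x * ?l * ?E) $$ (r, s) = ?g1 $$ (r, s) + (if s = ?w then d * ?g1 $$ (r, ?u) else 0) + (if r = ?w then d * ?g1 $$ (?u, s) else 0)"
        by (rule gram_addrow_index[OF SL_mat[OF xl] rs uw(1,2)])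
      also have "\<dots> = ?g $$ (r, s)"
        unfolding b1 b2 g1[OF rs] a1[OF rs(1)] a2[OF rs(2)] using dd by auto
      finally show "gram n (x * ?l * ?E) $$ (r, s) = ?g $$ (r, s)" .
    qed
    then have k: "x * ?l * ?E * minv ?m x \<in> Sp n" using gram_eq_Sp[OF x SL_closed[OF xl EG]] by simp
    have "x * ?l * ?E * minv ?m x * x * minv ?m ?E = x * ?l" using x xl EG by simp
    moreover have "minv ?m ?E = addrow_mat ?m (- d) ?u ?w" using uw by (intro minv_addrow) auto
    moreover have "addrow_mat ?m (- d) ?u ?w $$ (Suc i, i) = 0" using False im i by simp
    ultimately show ?thesis using k borel_inv[OF EB] by metis
  qed
qed

lemma borel_factor:
  assumes d: "\<delta> \<in> borel n" and i: "Suc i < 2 * n"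
  shows "\<exists>c \<delta>'. \<delta>' \<in> borel n \<and> \<delta>' $$ (Suc i, i) = 0 \<and> \<delta> = addrow_mat (2 * n) c (Suc i) i * \<delta>'"
    and "\<exists>c. \<delta> * addrow_mat (2 * n) c (Suc i) i \<in> borel n \<and> (\<delta> * addrow_mat (2 * n) c (Suc i) i) $$ (Suc i, i) = 0"
proof -
  let ?m = "2 * n" let ?l = "\<lambda>c. addrow_mat ?m c (Suc i) i"
  have im: "i < ?m" using i by simp
  have G: "\<delta> \<in> GG ?m" "?l c \<in> GG ?m" for c using borel_SL[OF d] by auto
  have lB: "?l c \<in> borel n" for c using i by (simp add: addrow_mat_borel)
  define c where "c = \<delta> $$ (Suc i, i) / \<delta> $$ (i, i)"
  have "(?l (- c) * \<delta>) $$ (Suc i, i) = 0"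
    unfolding addrow_mult_index[OF SL_mat[OF G(1)] i im im] using borel_diag[OF d im] by (simp add: c_def)
  moreover have "\<delta> = ?l c * (?l (- c) * \<delta>)"
    using minv_addrow[of "Suc i" i ?m c] i im SL_cancel(2)[OF G(2)[of c] G(1)] by simp
  ultimately show "\<exists>c \<delta>'. \<delta>' \<in> borel n \<and> \<delta>' $$ (Suc i, i) = 0 \<and> \<delta> = ?l c * \<delta>'" using borel_mult[OF lB d] by blast
  define e where "e = - \<delta> $$ (Suc i, i) / \<delta> $$ (Suc i, Suc i)"
  have "(\<delta> * ?l e) $$ (Suc i, i) = 0"
    unfolding mult_addrow_index[OF SL_mat[OF G(1)] i im i] using borel_diag[OF d i] by (simp add: e_def)
  then show "\<exists>c. \<delta> * ?l c \<in> borel n \<and> (\<delta> * ?l c) $$ (Suc i, i) = 0" using borel_mult[OF d lB] by blast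
qed

text \<open>Split an element of \<open>B\<close> into its simple root part and a rest with entry
  zero at \<open>(Suc i, i)\<close>. At a descent \<open>K\<close> absorbs the first part, and
  conjugation by the reflection keeps the rest in \<open>B\<close>; so the result does not depend on
  the chosen point of the stratum.\<close>

lemma stratum_smat:
  assumes b: "b \<in> fpf_involutions n" and i: "Suc i < 2 * n" and lt: "b (Suc i) < b i" and x: "x \<in> stratum n b"
  shows "x * smat (2 * n) i \<in> stratum n (conj_refl i b)"
proof -
  let ?m = "2 * n" let ?s = "smat ?m i"
  obtain \<beta> where B: "\<beta> \<in> borel n" "x * \<beta> \<in> stratum n b" "monomial_type n b (gram n (x * \<beta>))" using stratum_rep[OF x] .
  let ?x = "x * \<beta>"
  obtain c \<delta> where d: "\<delta> \<in> borel n" "\<delta> $$ (Suc i, i) = 0" "minv ?m \<beta> = addrow_mat ?m c (Suc i) i * \<delta>"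
    using borel_factor(1)[OF borel_inv[OF B(1)] i] by blast
  obtain k \<gamma> where k: "k \<in> Sp n" "\<gamma> \<in> borel n" "\<gamma> $$ (Suc i, i) = 0" "?x * addrow_mat ?m c (Suc i) i = k * ?x * \<gamma>"
    using addrow_absorb[OF b i lt stratum_SL[OF B(2)] B(3)] by blast
  have G: "x \<in> GG ?m" "\<beta> \<in> GG ?m" "\<delta> \<in> GG ?m" "\<gamma> \<in> GG ?m" "k \<in> GG ?m" "?s \<in> GG ?m" "addrow_mat ?m c (Suc i) i \<in> GG ?m"
    using stratum_SL[OF x] B d k borel_SL Sp_SL i by auto
  let ?c = "\<lambda>y. minv ?m ?s * y * ?s"
  have cb: "?c \<gamma> \<in> borel n" "?c \<delta> \<in> borel n" using smat_conj_borel[OF _ i] k d by auto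
  have "x * ?s = ?x * minv ?m \<beta> * ?s" using G by simp
  also have "\<dots> = ?x * addrow_mat ?m c (Suc i) i * \<delta> * ?s" using G by (simp add: d(3) SL_assoc[of _ ?m])
  also have "\<dots> = k * ?x * \<gamma> * \<delta> * ?s" by (simp only: k(4))
  also have "\<dots> = k * (?x * ?s) * (?c \<gamma> * ?c \<delta>)" using G by (simp add: SL_assoc[of _ ?m])
  finally have e: "x * ?s = k * (?x * ?s) * (?c \<gamma> * ?c \<delta>)" .
  have "monomial_type n (conj_refl i b) (gram n (?x * ?s))" by (rule monomial_type_smat[OF stratum_SL[OF B(2)] i B(3)])
  moreover have "?x * ?s \<in> GG ?m" using G by simp
  ultimately have "?x * ?s \<in> stratum n (conj_refl i b)"
    unfolding stratum_def using borel_one[of n] by (auto intro!: bexI[of _ "1\<^sub>m ?m"])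
  then show ?thesis unfolding e using cb k by blast
qed

text \<open>Points of the larger stratum have the form \<open>k * (x * ?s) * \<beta>\<close> with
  \<open>x\<close> in the smaller one. The value \<open>c\<close> removes the simple root part of
  \<open>\<beta>\<close>, after which the second reflection can pass through it.\<close>

lemma stratum_smat_back:
  assumes b: "b \<in> fpf_involutions n" and i: "Suc i < 2 * n" and lt: "b (Suc i) < b i" and y: "y \<in> stratum n (conj_refl i b)"
  shows "\<exists>c. y * addrow_mat (2 * n) c (Suc i) i * smat (2 * n) i \<in> stratum n b"
proof -
  let ?m = "2 * n" let ?s = "smat ?m i"
  obtain x where x: "x \<in> stratum n b" using stratum_nonempty[OF b] by blast
  obtain k \<beta> where k: "k \<in> Sp n" "\<beta> \<in> borel n" "y = k * (x * ?s) * \<beta>"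
    using stratum_transitive[OF stratum_smat[OF b i lt x] y conj_refl_fpf[OF b i]] .
  obtain c where c: "\<beta> * addrow_mat ?m c (Suc i) i \<in> borel n" "(\<beta> * addrow_mat ?m c (Suc i) i) $$ (Suc i, i) = 0"
    using borel_factor(2)[OF k(2) i] by blast
  let ?l = "addrow_mat ?m c (Suc i) i"
  let ?e = "minv ?m ?s * (\<beta> * ?l) * ?s"
  have e: "?e \<in> borel n" using smat_conj_borel[OF c(1) i c(2)] .
  have G: "x \<in> GG ?m" "\<beta> \<in> GG ?m" "k \<in> GG ?m" "?s \<in> GG ?m" "?l \<in> GG ?m"
    using stratum_SL[OF x] k borel_SL Sp_SL i by auto
  have "y * ?l * ?s = k * x * (?s * ?s) * ?e" using G by (simp add: k(3) SL_assoc[of _ ?m])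
  moreover have "k * x * (?s * ?s) * ?e \<in> stratum n b" using x k(1) smat_square_borel(1)[OF i] e by blast
  ultimately show ?thesis by metis
qed

lemma stratum_parabolic_big:
  assumes b: "b \<in> fpf_involutions n" and i: "Suc i < 2 * n" and lt: "b (Suc i) < b i" and x: "x \<in> stratum n b"
    and k: "\<kappa> \<in> parabolic n i" "\<kappa> \<notin> borel n"
  shows "x * \<kappa> \<in> stratum n (conj_refl i b)"
  using k(1) i
proof (cases rule: parabolic_cases)
  case 1
  then show ?thesis using k(2) by simp
next
  case (2 c y)
  let ?m = "2 * n"
  have l: "addrow_mat ?m c (Suc i) i \<in> borel n" using i by (simp add: addrow_mat_borel)
  have "x * \<kappa> = x * addrow_mat ?m c (Suc i) i * smat ?m i * y"
    using stratum_SL[OF x] borel_SL[OF l] borel_SL[OF 2(1)] i unfolding 2(2) by (simp add: SL_assoc[of _ ?m])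
  moreover have "x * addrow_mat ?m c (Suc i) i * smat ?m i * y \<in> stratum n (conj_refl i b)"
    using stratum_smat[OF b i lt stratum_borel[OF x l]] 2(1) by blast
  ultimately show ?thesis by simp
qed

lemma stratum_parabolic:
  assumes "b \<in> fpf_involutions n" "Suc i < 2 * n" "b (Suc i) < b i" "x \<in> stratum n b" "\<kappa> \<in> parabolic n i"
  shows "x * \<kappa> \<in> stratum n b \<union> stratum n (conj_refl i b)"
  using stratum_parabolic_big[OF assms] stratum_borel[OF assms(4)] by blast

lemma cdesc_conj_neq: "b \<in> fpf_involutions n \<Longrightarrow> cdesc n i b \<Longrightarrow> conj_refl i b \<noteq> b"
  using conj_refl_eq_iff[of b n i] by auto

lemma stratum_fibre:
  assumes b: "b \<in> fpf_involutions n" and d: "cdesc n i b" and x: "x \<in> stratum n b" "x * \<kappa> \<in> stratum n b"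
    and k: "\<kappa> \<in> parabolic n i"
  shows "\<kappa> \<in> borel n"
proof (rule ccontr)
  assume "\<kappa> \<notin> borel n"
  then have "x * \<kappa> \<in> stratum n (conj_refl i b)" using stratum_parabolic_big[OF b _ _ x(1) k] d by blast
  then have "b = conj_refl i b" using stratum_disjoint[OF x(2)] b conj_refl_fpf[OF b] d by blast
  then show False using cdesc_conj_neq[OF b d] by simp
qed

text \<open>The points \<open>x * ?v c\<close> on an irreducible line lie in the larger stratum for
  \<open>c \<noteq> 0\<close>. A function vanishing there vanishes on the whole line after
  multiplication by the coordinate \<open>c\<close>, hence also at \<open>c = 0\<close>.\<close>

lemma stratum_subset_closure:
  assumes b: "b \<in> fpf_involutions n" and i: "Suc i < 2 * n" and lt: "b (Suc i) < b i"
  shows "stratum n b \<subseteq> zc (2 * n) (stratum n (conj_refl i b))"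
proof
  fix x assume x: "x \<in> stratum n b"
  let ?m = "2 * n" let ?v = "\<lambda>c. addrow_mat ?m c i (Suc i)"
  have xG: "x \<in> GG ?m" and vG: "?v c \<in> GG ?m" for c using stratum_SL[OF x] by auto
  have im: "i < ?m" using i by simp
  have ve: "?v = (\<lambda>c. mat ?m ?m (\<lambda>(r, s). (if r = s then 1 else 0) + c * (if r = i \<and> s = Suc i then 1 else 0)))"
    by (rule ext, rule eq_matI) auto
  have "irr ?m (range ?v)" unfolding ve by (rule irr_line)
  moreover have rx: "rmap ?m (\<lambda>y. x * y)" using SL_mat[OF xG] by (intro rmap_mult rmap_id rmap_const)
  ultimately have irr: "irr ?m ((\<lambda>y. x * y) ` range ?v)" by (rule irr_image)
  have big: "x * ?v c \<in> stratum n (conj_refl i b)" if "c \<noteq> 0" for c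
  proof (rule stratum_parabolic_big[OF b i lt x])
    show "?v c \<in> parabolic n i" using vG[of c] by (auto simp: parabolic_def)
    have "?v c $$ (i, Suc i) \<noteq> 0" using that i im by simp
    then show "?v c \<notin> borel n" using i by (auto simp: borel_def)
  qed
  have "p x = 0" if p: "regular ?m p" and z: "\<forall>y\<in>stratum n (conj_refl i b). p y = 0" for p
  proof -
    let ?h = "\<lambda>y. (minv ?m x * y) $$ (i, Suc i)"
    have "rmap ?m (\<lambda>y. minv ?m x * y)" using SL_mat[OF SL_inv[OF xG]] by (intro rmap_mult rmap_id rmap_const)
    then have h: "regular ?m ?h" using i im by (simp add: rmap_def)
    have hv: "?h (x * ?v c) = c" for c using SL_cancel(1)[OF xG vG[of c]] i im by simp
    have "p y = 0 \<or> ?h y = 0" if yr: "y \<in> (\<lambda>y. x * y) ` range ?v" for y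
    proof -
      obtain c where c: "y = x * ?v c" using yr by blast
      show ?thesis using big[of c] z hv[of c] unfolding c by (cases "c = 0") auto
    qed
    from irr_D[OF irr p h this] have "(\<forall>c. p (x * ?v c) = 0) \<or> (\<forall>c. ?h (x * ?v c) = 0)" by blast
    then have "p (x * ?v 0) = 0" using hv[of 1] by auto
    then show ?thesis using xG by (simp add: addrow_mat_zero)
  qed
  then show "x \<in> zc ?m (stratum n (conj_refl i b))" using SL_mat[OF xG] by (auto simp: zc_def)
qed

text \<open>Row \<open>Suc i\<close> has its entry in column \<open>b (Suc i)\<close>, left of this
  block; conjugation moves it to column \<open>b i\<close>, the first column of the block, and no
  other row enters or leaves. This is the corner that separates the two strata.\<close>

lemma brank_conj:
  assumes b: "b \<in> fpf_involutions n" and d: "cdesc n i b"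
  shows "brank (2 * n) (conj_refl i b) (Suc i) (b i) = Suc (brank (2 * n) b (Suc i) (b i))"
proof -
  have i: "Suc i < 2 * n" and lt: "b (Suc i) < b i" and ne: "b i \<noteq> Suc i" using d by auto
  note nb = fpf_refl_nbrs[OF b i ne]
  let ?A = "{j. Suc i \<le> j \<and> j < 2 * n \<and> b i \<le> b j}"
  have e: "b i \<le> simple_refl i (b j) \<longleftrightarrow> b i \<le> b j" for j
    using nb ne by (auto simp: simple_refl_def Transposition.transpose_def)
  have "{j. Suc i \<le> j \<and> j < 2 * n \<and> b i \<le> conj_refl i b j} = insert (Suc i) ?A"
  proof (rule Set.set_eqI)
    fix j
    consider "j < Suc i" | "j = Suc i" | "Suc i < j" by linarith
    then show "j \<in> {j. Suc i \<le> j \<and> j < 2 * n \<and> b i \<le> conj_refl i b j} \<longleftrightarrow> j \<in> insert (Suc i) ?A"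
    proof cases
      case 2
      then show ?thesis using conj_refl_simps(2)[OF b i ne] i by simp
    next
      case 3
      then have "simple_refl i j = j" by simp
      then show ?thesis using e[of j] 3 by simp
    qed simp
  qed
  moreover have "finite ?A" by (rule finite_subset[of _ "{..<2 * n}"]) auto
  moreover have "Suc i \<notin> ?A" using lt by simp
  ultimately show ?thesis unfolding brank_def by simp
qed

lemma stratum_conj_notin_closure:
  assumes b: "b \<in> fpf_involutions n" and d: "cdesc n i b" and y: "y \<in> stratum n (conj_refl i b)"
  shows "y \<notin> zc (2 * n) (stratum n b)"
proof
  assume "y \<in> zc (2 * n) (stratum n b)"
  from stratum_closure_brank[OF b conj_refl_fpf[OF b] y this, of "Suc i" "b i"] brank_conj[OF b d] d
  show False by simp
qed

section \<open>The bundle structure of a complex edge\<close>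

definition smat_prod :: "nat \<Rightarrow> nat \<Rightarrow> complex mat set \<Rightarrow> complex mat set" where
  "smat_prod n i Z = {z * smat (2 * n) i * \<beta> | z \<beta>. z \<in> Z \<and> \<beta> \<in> borel n}"

text \<open>Substituting a matrix of fractions \<open>N i j y / F y\<close> into
  \<open>\<phi>\<close> and clearing denominators, with one exponent \<open>D\<close> that serves
  all \<open>y\<close>.\<close>

lemma regular_homogenize:
  assumes phi: "regular m \<phi>" and F: "regular m F" and N: "\<And>i j. i < m \<Longrightarrow> j < m \<Longrightarrow> regular m (N i j)"
  shows "\<exists>\<psi> D. regular m \<psi> \<and> (\<forall>y\<in>carrier_mat m m. \<forall>A\<in>carrier_mat m m.
    (\<forall>i<m. \<forall>j<m. A $$ (i, j) * F y = N i j y) \<longrightarrow> \<phi> A * F y ^ D = \<psi> y)"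
proof -
  obtain q where q: "q \<in> poly_funs m" "\<And>x. x \<in> carrier_mat m m \<Longrightarrow> \<phi> x = q x"
    using phi by (auto simp: regular_def)
  let ?P = "\<lambda>q \<psi> D. \<forall>y\<in>carrier_mat m m. \<forall>A\<in>carrier_mat m m.
    (\<forall>i<m. \<forall>j<m. A $$ (i, j) * F y = N i j y) \<longrightarrow> q A * F y ^ D = \<psi> y"
  from q(1) have "\<exists>\<psi> D. regular m \<psi> \<and> ?P q \<psi> D"
  proof induction
    case (const c)
    have "?P (\<lambda>_. c) (\<lambda>_. c) 0" by simp
    then show ?case using regular_const by blast
  next
    case (entry i j)
    then have "?P (\<lambda>A. A $$ (i, j)) (N i j) 1" by simp
    then show ?case using N[OF entry] by blast
  next
    case (add f g)
    then obtain \<psi> D \<psi>' D' where r: "regular m \<psi>" "regular m \<psi>'" and P: "?P f \<psi> D" "?P g \<psi>' D'" by blast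
    have "?P (\<lambda>A. f A + g A) (\<lambda>y. \<psi> y * F y ^ D' + \<psi>' y * F y ^ D) (D + D')"
    proof (intro ballI impI)
      fix y A assume "y \<in> carrier_mat m m" "A \<in> carrier_mat m m" "\<forall>i<m. \<forall>j<m. A $$ (i, j) * F y = N i j y"
      with P have e: "f A * F y ^ D = \<psi> y" "g A * F y ^ D' = \<psi>' y" by blast+
      have "(f A + g A) * F y ^ (D + D') = (f A * F y ^ D) * F y ^ D' + (g A * F y ^ D') * F y ^ D"
        by (simp add: power_add algebra_simps)
      then show "(f A + g A) * F y ^ (D + D') = \<psi> y * F y ^ D' + \<psi>' y * F y ^ D" unfolding e .
    qed
    moreover have "regular m (\<lambda>y. \<psi> y * F y ^ D' + \<psi>' y * F y ^ D)" by (intro regular_add regular_mult regular_power r F)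
    ultimately show ?case by blast
  next
    case (mult f g)
    then obtain \<psi> D \<psi>' D' where r: "regular m \<psi>" "regular m \<psi>'" and P: "?P f \<psi> D" "?P g \<psi>' D'" by blast
    have "?P (\<lambda>A. f A * g A) (\<lambda>y. \<psi> y * \<psi>' y) (D + D')"
    proof (intro ballI impI)
      fix y A assume "y \<in> carrier_mat m m" "A \<in> carrier_mat m m" "\<forall>i<m. \<forall>j<m. A $$ (i, j) * F y = N i j y"
      with P have e: "f A * F y ^ D = \<psi> y" "g A * F y ^ D' = \<psi>' y" by blast+
      have "(f A * g A) * F y ^ (D + D') = (f A * F y ^ D) * (g A * F y ^ D')"
        by (simp add: power_add algebra_simps)
      then show "(f A * g A) * F y ^ (D + D') = \<psi> y * \<psi>' y" unfolding e .
    qed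
    moreover have "regular m (\<lambda>y. \<psi> y * \<psi>' y)" by (intro regular_mult r)
    ultimately show ?case by blast
  qed
  then obtain \<psi> D where "regular m \<psi>" "?P q \<psi> D" by blast
  then show ?thesis by (intro exI[of _ \<psi>] exI[of _ D]) (simp add: q(2))
qed

text \<open>The \<open>c\<close> for which \<open>y l\<^sub>c s\<close> lies in the smaller stratum is the root of a minor that is affine
  linear in \<open>c\<close>, hence a rational function of \<open>y\<close>.\<close>

lemma minor_pencil:
  assumes b: "b \<in> fpf_involutions n" and d: "cdesc n i b" and y: "y \<in> GG (2 * n)"
    and yb: "y * addrow_mat (2 * n) c (Suc i) i * smat (2 * n) i \<in> stratum n b"
    and k: "k = brank (2 * n) (conj_refl i b) (Suc i) (b i)"
    and \<rho>: "\<And>a. a < k \<Longrightarrow> Suc i \<le> \<rho> a \<and> \<rho> a < 2 * n" and h: "\<And>a. a < k \<Longrightarrow> b i \<le> h a \<and> h a < 2 * n"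
    and a0: "a0 < k" "\<And>a. a < k \<Longrightarrow> \<rho> a = Suc i \<longleftrightarrow> a = a0"
  shows "det (mat k k (\<lambda>(a, u). if a = a0 then gram n y $$ (i, h u) else gram n y $$ (\<rho> a, h u))) +
    c * det (mat k k (\<lambda>(a, u). gram n y $$ (\<rho> a, h u))) = 0"
proof -
  let ?m = "2 * n" let ?l = "addrow_mat ?m c (Suc i) i" let ?s = "smat ?m i" let ?g = "gram n y"
  have i: "Suc i < ?m" and ne: "b i \<noteq> Suc i" using d by auto
  have im: "i < ?m" using i by simp
  let ?L = "?l * ?s"
  have G: "?l \<in> GG ?m" "?s \<in> GG ?m" "?L \<in> GG ?m" using i by auto
  have lP: "?l \<in> parabolic n i" using addrow_mat_borel[of i "Suc i" n c] i borel_subset_parabolic by blast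
  have Linv: "minv ?m ?L \<in> parabolic n i" by (intro parabolic_inv parabolic_mult lP smat_parabolic i)
  have gm: "?g \<in> carrier_mat ?m ?m" and Lm: "?L \<in> carrier_mat ?m ?m" and Im: "minv ?m ?L \<in> carrier_mat ?m ?m"
    and lm: "?l \<in> carrier_mat ?m ?m" and sm: "?s \<in> carrier_mat ?m ?m"
    using y G SL_mat by blast+
  have tm: "transpose_mat ?L \<in> carrier_mat ?m ?m" "transpose_mat ?L * ?g \<in> carrier_mat ?m ?m"
    using Lm gm by (auto intro!: mult_carrier_mat[of _ ?m ?m] transpose_carrier_mat[THEN iffD2])
  have "brank ?m b (Suc i) (b i) < k" using brank_conj[OF b d] k by simp
  from stratum_minors[OF b yb this]
  have "minors_vanish ?m (Suc i) (b i) k (gram n (y * ?L))" using mat_assoc[OF SL_mat[OF y] lm sm] by simp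
  \<comment> \<open>The right factor can be removed because \<open>P_i\<close> respects every block
    of columns that does not start at \<open>Suc i\<close>, and \<open>b i\<close> differs from
    \<open>Suc i\<close>. The left factor acts on the rows from \<open>Suc i\<close> on, which
    \<open>P_i\<close> does not respect; this is where \<open>c\<close> enters.\<close>
  then have "minors_vanish ?m (Suc i) (b i) k (gram n (y * ?L) * minv ?m ?L)"
    using Linv ne parabolic_iff[OF i] by (intro minors_vanish_right gram_carrier mult_carrier_mat[OF SL_mat[OF y] Lm] Im) blast
  moreover have "gram n (y * ?L) * minv ?m ?L = transpose_mat ?L * ?g"
    unfolding gram_mult[OF SL_mat[OF y] Lm] using mat_assoc[OF tm(2) Lm Im] right_mult_one_mat[OF tm(2)] G(3) by simp
  ultimately have v: "det (mat k k (\<lambda>(a, u). (transpose_mat ?L * ?g) $$ (\<rho> a, h u))) = 0"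
    using \<rho> h unfolding minors_vanish_def by auto
  have N: "(transpose_mat ?L * ?g) $$ (r, u) = (if r = Suc i then ?g $$ (i, u) + c * ?g $$ (Suc i, u) else ?g $$ (r, u))"
    if r: "Suc i \<le> r" "r < ?m" and u: "u < ?m" for r u
  proof -
    have gt: "transpose_mat ?g \<in> carrier_mat ?m ?m" using gm by simp
    have "(transpose_mat ?L * ?g) $$ (r, u) = (transpose_mat ?g * ?L) $$ (u, r)"
      by (rule transpose_mult_index[OF gm Lm r(2) u])
    also have "transpose_mat ?g * ?L = transpose_mat ?g * ?l * ?s" using mat_assoc[OF gt lm sm] by simp
    also have "(transpose_mat ?g * ?l * ?s) $$ (u, r) =
      (if r = i then - (transpose_mat ?g * ?l) $$ (u, Suc i) else if r = Suc i then (transpose_mat ?g * ?l) $$ (u, i) else (transpose_mat ?g * ?l) $$ (u, r))"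
      by (rule mult_smat_index[OF mult_carrier_mat[OF gt lm] u r(2) i])
    finally show ?thesis
      using r u gm im i by (auto simp: mult_addrow_index[OF gt u im i] mult_addrow_index[OF gt u r(2) i] simp del: index_mult_mat(1))
  qed
  have "mat k k (\<lambda>(a, u). (transpose_mat ?L * ?g) $$ (\<rho> a, h u)) =
    mat k k (\<lambda>(a, u). if a = a0 then ?g $$ (i, h u) + c * ?g $$ (Suc i, h u) else ?g $$ (\<rho> a, h u))"
  proof (rule square_eqI[of _ k])
    fix a u assume au: "a < k" "u < k"
    have "(transpose_mat ?L * ?g) $$ (\<rho> a, h u) = (if \<rho> a = Suc i then ?g $$ (i, h u) + c * ?g $$ (Suc i, h u) else ?g $$ (\<rho> a, h u))"
      by (rule N) (use \<rho>[OF au(1)] h[OF au(2)] in auto)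
    then show "mat k k (\<lambda>(a, u). (transpose_mat ?L * ?g) $$ (\<rho> a, h u)) $$ (a, u) =
      mat k k (\<lambda>(a, u). if a = a0 then ?g $$ (i, h u) + c * ?g $$ (Suc i, h u) else ?g $$ (\<rho> a, h u)) $$ (a, u)"
      using au a0(2)[OF au(1)] by simp
  qed auto
  moreover have "mat k k (\<lambda>(a, u). if a = a0 then ?g $$ (Suc i, h u) else ?g $$ (\<rho> a, h u)) = mat k k (\<lambda>(a, u). ?g $$ (\<rho> a, h u))"
    using a0(2)[OF a0(1)] by (intro square_eqI[of _ k]) auto
  ultimately show ?thesis
    using v det_row_linear[OF a0(1), of "\<lambda>u. ?g $$ (i, h u)" c "\<lambda>u. ?g $$ (Suc i, h u)" "\<lambda>a u. ?g $$ (\<rho> a, h u)"] by simp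
qed

text \<open>Suppose \<open>y\<close>, moved to a monomial representative, does not come from
  \<open>Z\<close>. Some \<open>\<phi>\<close> vanishes on \<open>Z\<close> but not at the point of
  the smaller stratum attached to \<open>y\<close>. That point is a rational function of
  \<open>y\<close>, so \<open>\<phi>\<close> pulls back, after clearing denominators, to a regular
  function that vanishes on the product of \<open>Z\<close> but not at \<open>y\<close>.\<close>

lemma smat_prod_closed:
  assumes b: "b \<in> fpf_involutions n" and d: "cdesc n i b" and Z: "Z \<subseteq> stratum n b"
    and stab: "\<And>z \<beta>. z \<in> Z \<Longrightarrow> \<beta> \<in> borel n \<Longrightarrow> z * \<beta> \<in> Z"
    and cl: "zc (2 * n) Z \<inter> stratum n b \<subseteq> Z"
    and y: "y \<in> stratum n (conj_refl i b)" "y \<in> zc (2 * n) (smat_prod n i Z)"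
  shows "y \<in> smat_prod n i Z"
proof -
  let ?m = "2 * n" let ?s = "smat ?m i" let ?b = "conj_refl i b"
  let ?l = "\<lambda>c. addrow_mat ?m c (Suc i) i"
  have i: "Suc i < ?m" and lt: "b (Suc i) < b i" and ne: "b i \<noteq> Suc i" using d by auto
  have im: "i < ?m" using i by simp
  have bf: "?b \<in> fpf_involutions n" using conj_refl_fpf[OF b i] .
  note cj = conj_refl_simps[OF b i ne]
  have sG: "?s \<in> GG ?m" and lG: "?l c \<in> GG ?m" for c using i by auto
  have ZG: "z \<in> GG ?m" if "z \<in> Z" for z using Z that stratum_SL by blast
  have stab': "w * \<beta> \<in> smat_prod n i Z" if wb: "w \<in> smat_prod n i Z" "\<beta> \<in> borel n" for w \<beta>
  proof -
    obtain z \<gamma> where w: "w = z * ?s * \<gamma>" "z \<in> Z" "\<gamma> \<in> borel n" using wb(1) unfolding smat_prod_def by blast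
    have "w * \<beta> = z * ?s * (\<gamma> * \<beta>)" using w ZG sG borel_SL wb(2) by (simp add: SL_assoc[of _ ?m])
    then show ?thesis using w wb(2) borel_mult unfolding smat_prod_def by blast
  qed
  obtain \<beta> where B: "\<beta> \<in> borel n" "y * \<beta> \<in> stratum n ?b" "monomial_type n ?b (gram n (y * \<beta>))" using stratum_rep[OF y(1)] .
  let ?y = "y * \<beta>"
  have yG: "y \<in> GG ?m" "\<beta> \<in> GG ?m" "?y \<in> GG ?m" using stratum_SL[OF y(1)] borel_SL[OF B(1)] by auto
  have yz: "?y \<in> zc ?m (smat_prod n i Z)" by (rule zc_right[OF y(2) yG(2)]) (use stab' B(1) in blast)
  define k where "k = brank ?m ?b (Suc i) (b i)"
  obtain \<rho> where r: "bij_betw \<rho> {..<k} {j. Suc i \<le> j \<and> j < ?m \<and> b i \<le> ?b j}"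
    unfolding k_def using brank_enum .
  have \<rho>: "Suc i \<le> \<rho> a \<and> \<rho> a < ?m \<and> b i \<le> ?b (\<rho> a)" if "a < k" for a using bij_betwE[OF r] that by auto
  define h where "h a = ?b (\<rho> a)" for a
  have h: "b i \<le> h a \<and> h a < ?m" if "a < k" for a using \<rho>[OF that] fpfD(4)[OF bf] unfolding h_def by blast
  have "Suc i \<in> {j. Suc i \<le> j \<and> j < ?m \<and> b i \<le> ?b j}" using cj(2) i by simp
  then obtain a0 where a0: "a0 < k" "\<rho> a0 = Suc i" using r unfolding bij_betw_def by (metis (no_types, lifting) imageE lessThan_iff)
  have a0u: "\<rho> a = Suc i \<longleftrightarrow> a = a0" if "a < k" for a
    using inj_on_eq_iff[OF bij_betw_imp_inj_on[OF r], of a a0] a0 that by auto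
  \<comment> \<open>For any \<open>x\<close> the parameter \<open>c\<close> of the point attached to
    it satisfies \<open>F x + c * F1 x = 0\<close>, so \<open>c\<close> is minus the quotient of
    \<open>F\<close> by \<open>F1\<close> where \<open>F1\<close> does not vanish.\<close>
  define F where "F x = det (mat k k (\<lambda>(a, u). if a = a0 then gram n x $$ (i, h u) else gram n x $$ (\<rho> a, h u)))" for x
  define F1 where "F1 x = det (mat k k (\<lambda>(a, u). gram n x $$ (\<rho> a, h u)))" for x
  have ent: "regular ?m (\<lambda>x. gram n x $$ (r, u))" if "r < ?m" "u < ?m" for r u using rmap_gram that by (simp add: rmap_def)
  have F1r: "regular ?m F1" unfolding F1_def[abs_def] by (intro regular_det ent) (use \<rho> h in auto)
  have Fr: "regular ?m F" unfolding F_def[abs_def]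
  proof (rule regular_det)
    fix a u assume au: "a < k" "u < k"
    show "regular ?m (\<lambda>x. if a = a0 then gram n x $$ (i, h u) else gram n x $$ (\<rho> a, h u))"
      using ent[OF im, of "h u"] ent[of "\<rho> a" "h u"] \<rho>[OF au(1)] h[OF au(2)] by (cases "a = a0") auto
  qed
  have pencil: "F w + c * F1 w = 0" if "w \<in> GG ?m" "w * ?l c * ?s \<in> stratum n b" for w c
    unfolding F_def F1_def by (rule minor_pencil[OF b d that k_def _ h a0(1) a0u]) (use \<rho> in auto)
  have F1y: "F1 ?y \<noteq> 0"
    using brank_minor_nonzero[OF bf B(3) r[unfolded k_def]] unfolding F1_def h_def k_def .
  have Fy: "F ?y = 0" unfolding F_def
  proof (rule det_mat_zero_row[OF a0(1)])
    fix u assume u: "u < k"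
    have "i \<noteq> ?b (h u)"
    proof
      assume "i = ?b (h u)"
      then have "?b i = h u" using fpfD(2)[OF bf, of "h u"] by metis
      then show False using cj(1) lt h[OF u] by simp
    qed
    then have "gram n ?y $$ (i, h u) = 0" using B(3) im h[OF u] unfolding monomial_type_def by blast
    then show "(if a0 = a0 then gram n ?y $$ (i, h u) else gram n ?y $$ (\<rho> a0, h u)) = 0" by simp
  qed
  obtain c where c: "?y * ?l c * ?s \<in> stratum n b" using stratum_smat_back[OF b i lt B(2)] by blast
  \<comment> \<open>At a monomial representative row \<open>i\<close> has its entry left of the
    block, so \<open>F\<close> vanishes there while \<open>F1\<close> does not.\<close>
  have "c = 0" using pencil[OF yG(3) c] Fy F1y by simp
  then have ys: "?y * ?s \<in> stratum n b" using c yG(3) by (simp add: addrow_mat_zero)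
  have "?y * ?s \<in> Z"
  proof (rule ccontr)
    assume "?y * ?s \<notin> Z"
    then have "?y * ?s \<notin> zc ?m Z" using cl ys by blast
    then obtain \<phi> where \<phi>: "regular ?m \<phi>" "\<And>z. z \<in> Z \<Longrightarrow> \<phi> z = 0" "\<phi> (?y * ?s) \<noteq> 0"
      using SL_mat[OF SL_closed[OF yG(3) sG]] unfolding zc_def by blast
    \<comment> \<open>\<open>F1 w\<close> times the entries of \<open>w * ?l c * ?s\<close>, with
      \<open>c\<close> eliminated through the pencil.\<close>
    define N where "N r j w = (if j = i then - w $$ (r, Suc i) * F1 w else if j = Suc i then w $$ (r, i) * F1 w - F w * w $$ (r, Suc i)
      else w $$ (r, j) * F1 w)" for r j and w :: "complex mat"
    have Nr: "regular ?m (N r j)" if "r < ?m" "j < ?m" for r j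
    proof -
      have "regular ?m (\<lambda>w. - w $$ (r, Suc i) * F1 w)" "regular ?m (\<lambda>w. w $$ (r, i) * F1 w - F w * w $$ (r, Suc i))"
        "regular ?m (\<lambda>w. w $$ (r, j) * F1 w)"
        using that im i by (intro regular_mult regular_diff regular_uminus regular_entry F1r Fr; simp)+
      then show ?thesis unfolding N_def[abs_def] by (cases "j = i"; cases "j = Suc i") auto
    qed
    have "\<exists>\<psi> D. regular ?m \<psi> \<and> (\<forall>w\<in>carrier_mat ?m ?m. \<forall>A\<in>carrier_mat ?m ?m.
      (\<forall>r<?m. \<forall>j<?m. A $$ (r, j) * F1 w = N r j w) \<longrightarrow> \<phi> A * F1 w ^ D = \<psi> w)"
      by (rule regular_homogenize[OF \<phi>(1) F1r]) (rule Nr)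
    then obtain \<psi> D where \<psi>: "regular ?m \<psi>" and e: "\<forall>w\<in>carrier_mat ?m ?m. \<forall>A\<in>carrier_mat ?m ?m.
      (\<forall>r<?m. \<forall>j<?m. A $$ (r, j) * F1 w = N r j w) \<longrightarrow> \<phi> A * F1 w ^ D = \<psi> w"
      by (elim exE conjE) (rule that)
    have \<psi>e: "\<phi> A * F1 w ^ D = \<psi> w" if "w \<in> carrier_mat ?m ?m" "A \<in> carrier_mat ?m ?m"
      "\<forall>r<?m. \<forall>j<?m. A $$ (r, j) * F1 w = N r j w" for w A using e that by blast
    have Ae: "(w * ?l c * ?s) $$ (r, j) * F1 w = N r j w" if w: "w \<in> GG ?m" and e: "F w + c * F1 w = 0" and rj: "r < ?m" "j < ?m" for w c r j
    proof -
      have wm: "w \<in> carrier_mat ?m ?m" using w SL_mat by blast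
      have wl: "w * ?l c \<in> carrier_mat ?m ?m" using SL_mat[OF SL_closed[OF w lG]] .
      have "c * F1 w = - F w" using e by (simp add: add_eq_0_iff)
      then have e': "(c * w $$ (r, Suc i)) * F1 w = - F w * w $$ (r, Suc i)" by (metis mult.commute mult.left_commute)
      show ?thesis
        unfolding mult_smat_index[OF wl rj i] N_def mult_addrow_index[OF wm rj(1) i i] mult_addrow_index[OF wm rj(1) im i] mult_addrow_index[OF wm rj i]
        using e' by (auto simp: distrib_right)
    qed
    have van: "\<psi> w * F1 w = 0" if w: "w \<in> smat_prod n i Z" for w
    proof (cases "F1 w = 0")
      case False
      obtain z \<gamma> where w: "w = z * ?s * \<gamma>" "z \<in> Z" "\<gamma> \<in> borel n" using w unfolding smat_prod_def by blast
      obtain c where c: "\<gamma> * ?l c \<in> borel n" "(\<gamma> * ?l c) $$ (Suc i, i) = 0" using borel_factor(2)[OF w(3) i] by blast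
      let ?e = "minv ?m ?s * (\<gamma> * ?l c) * ?s"
      have zG: "z \<in> GG ?m" "\<gamma> \<in> GG ?m" using w ZG borel_SL by auto
      have wG: "w \<in> GG ?m" using zG sG w by simp
      have "w * ?l c * ?s = z * (?s * ?s * ?e)" using zG sG lG[of c] by (simp add: w(1) SL_assoc[of _ ?m])
      moreover have "?s * ?s * ?e \<in> borel n" using smat_square_borel(1)[OF i] smat_conj_borel[OF c(1) i c(2)] by blast
      ultimately have AZ: "w * ?l c * ?s \<in> Z" using stab[OF w(2)] by simp
      then have "F w + c * F1 w = 0" using pencil[OF wG] Z by blast
      then have "\<phi> (w * ?l c * ?s) * F1 w ^ D = \<psi> w"
        using Ae[OF wG] SL_mat[OF wG] SL_mat[OF ZG[OF AZ]] by (intro \<psi>e) auto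
      then show ?thesis using \<phi>(2)[OF AZ] by simp
    qed simp
    have "F ?y + 0 * F1 ?y = 0" using Fy by simp
    from Ae[OF yG(3) this] have "\<forall>r<?m. \<forall>j<?m. (?y * ?s) $$ (r, j) * F1 ?y = N r j ?y"
      using yG(3) by (simp add: addrow_mat_zero del: index_mult_mat(1))
    from \<psi>e[OF SL_mat[OF yG(3)] SL_mat[OF SL_closed[OF yG(3) sG]] this]
    have "\<psi> ?y * F1 ?y \<noteq> 0" using \<phi>(3) F1y by auto
    moreover have "\<psi> ?y * F1 ?y = 0" by (rule zc_D[OF yz regular_mult[OF \<psi> F1r]]) (rule van)
    ultimately show False by simp
  qed
  moreover have "y = ?y * ?s * ?s * (minv ?m ?s * minv ?m ?s * minv ?m \<beta>)" using yG sG by (simp add: SL_assoc[of _ ?m])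
  moreover have "minv ?m ?s * minv ?m ?s * minv ?m \<beta> \<in> borel n" using smat_square_borel(2)[OF i] B(1) by blast
  ultimately show ?thesis unfolding smat_prod_def by blast
qed

text \<open>If no piece is dense, then each piece is annihilated by a function that is nonzero
  somewhere on \<open>S\<close>. The product of these functions annihilates \<open>S\<close> and
  yet, by irreducibility, is nonzero somewhere on it.\<close>

lemma irr_finite_cover:
  assumes S: "irr m S" and I: "finite I" and c: "S \<subseteq> (\<Union>i\<in>I. A i)"
  shows "\<exists>i\<in>I. S \<subseteq> zc m (A i)"
proof (rule ccontr)
  assume no: "\<not> ?thesis"
  have SC: "S \<subseteq> carrier_mat m m" using S by (simp add: irr_def)
  have "\<exists>p. regular m p \<and> (\<forall>x\<in>S. \<forall>i\<in>J. x \<in> A i \<longrightarrow> p x = 0) \<and> (\<exists>x\<in>S. p x \<noteq> 0)" if "finite J" "J \<subseteq> I" for J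
    using that
  proof (induction J rule: finite_induct)
    case empty
    then show ?case using S regular_const[of m 1] by (intro exI[of _ "\<lambda>_. 1"]) (auto simp: irr_def)
  next
    case (insert j J)
    then obtain p x where p: "regular m p" "\<forall>x\<in>S. \<forall>i\<in>J. x \<in> A i \<longrightarrow> p x = 0" "x \<in> S" "p x \<noteq> 0" by auto
    obtain y where y: "y \<in> S" "y \<notin> zc m (A j)" using no insert.prems by blast
    then obtain q where q: "regular m q" "\<forall>x\<in>A j. q x = 0" "q y \<noteq> 0" using SC unfolding zc_def by blast
    obtain z where z: "z \<in> S" "p z \<noteq> 0" "q z \<noteq> 0" using irr_two_points[OF S p(1) q(1) p(3,4) y(1) q(3)] by blast
    show ?case
    proof (intro exI[of _ "\<lambda>x. p x * q x"] conjI)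
      show "regular m (\<lambda>x. p x * q x)" using p(1) q(1) by (rule regular_mult)
      show "\<forall>x\<in>S. \<forall>i\<in>insert j J. x \<in> A i \<longrightarrow> p x * q x = 0" using p(2) q(2) by auto
      show "\<exists>x\<in>S. p x * q x \<noteq> 0" using z by auto
    qed
  qed
  from this[OF I order_refl] c show False by blast
qed

section \<open>Transport along an edge and irreducibility of strata\<close>

lemma regular_right: "regular m p \<Longrightarrow> g \<in> GG m \<Longrightarrow> regular m (\<lambda>y. p (y * g))"
  by (rule regular_comp) (auto intro!: rmap_mult rmap_id rmap_const dest: SL_mat)

lemma finite_fpf: "finite (fpf_involutions n)"
  by (rule finite_subset[OF _ finite_permutations[of "{..<2 * n}"]]) (auto simp: fpf_involutions_def)

lemma smat_prod_mono: "Z \<subseteq> Z' \<Longrightarrow> smat_prod n i Z \<subseteq> smat_prod n i Z'"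
  unfolding smat_prod_def by blast

lemma smat_prod_stratum:
  assumes "b \<in> fpf_involutions n" "Suc i < 2 * n" "b (Suc i) < b i" "Z \<subseteq> stratum n b"
  shows "smat_prod n i Z \<subseteq> stratum n (conj_refl i b)"
  using stratum_smat[OF assms(1-3)] assms(4) stratum_borel unfolding smat_prod_def by blast

lemma smat_prod_stable:
  assumes i: "Suc i < 2 * n" and Z: "Z \<subseteq> GG (2 * n)" and w: "w \<in> smat_prod n i Z" "\<beta> \<in> borel n"
  shows "w * \<beta> \<in> smat_prod n i Z"
proof -
  obtain z \<gamma> where e: "w = z * smat (2 * n) i * \<gamma>" "z \<in> Z" "\<gamma> \<in> borel n" using w unfolding smat_prod_def by blast
  have "w * \<beta> = z * smat (2 * n) i * (\<gamma> * \<beta>)" using e Z w(2) i borel_SL by (simp add: SL_assoc[of _ "2 * n"] subset_iff)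
  then show ?thesis using e w(2) borel_mult unfolding smat_prod_def by blast
qed

lemma smat_prod_whole:
  assumes b: "b \<in> fpf_involutions n" and i: "Suc i < 2 * n" and lt: "b (Suc i) < b i"
  shows "smat_prod n i (stratum n b) = stratum n (conj_refl i b)"
proof
  show "smat_prod n i (stratum n b) \<subseteq> stratum n (conj_refl i b)" by (rule smat_prod_stratum[OF b i lt order_refl])
  show "stratum n (conj_refl i b) \<subseteq> smat_prod n i (stratum n b)"
  proof
    fix y assume y: "y \<in> stratum n (conj_refl i b)"
    let ?m = "2 * n" let ?s = "smat ?m i"
    obtain c where c: "y * addrow_mat ?m c (Suc i) i * ?s \<in> stratum n b" using stratum_smat_back[OF b i lt y] by blast
    let ?l = "addrow_mat ?m c (Suc i) i"
    have lB: "?l \<in> borel n" using i by (simp add: addrow_mat_borel)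
    have G: "y \<in> GG ?m" "?l \<in> GG ?m" "?s \<in> GG ?m" using stratum_SL[OF y] i by auto
    have "y = (y * ?l * ?s) * ?s * (minv ?m ?s * minv ?m ?s * minv ?m ?l)" using G by (simp add: SL_assoc[of _ ?m])
    moreover have "minv ?m ?s * minv ?m ?s * minv ?m ?l \<in> borel n" using smat_square_borel(2)[OF i] lB by blast
    ultimately show "y \<in> smat_prod n i (stratum n b)" using c unfolding smat_prod_def by blast
  qed
qed

lemma smat_prod_inj:
  assumes b: "b \<in> fpf_involutions n" and d: "cdesc n i b" and Z: "Z \<subseteq> stratum n b"
    and stab: "\<And>z \<beta>. z \<in> Z \<Longrightarrow> \<beta> \<in> borel n \<Longrightarrow> z * \<beta> \<in> Z"
    and x: "x \<in> stratum n b" "x * smat (2 * n) i \<in> smat_prod n i Z"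
  shows "x \<in> Z"
proof -
  let ?m = "2 * n" let ?s = "smat ?m i"
  have i: "Suc i < ?m" using d by simp
  obtain z \<beta> where z: "x * ?s = z * ?s * \<beta>" "z \<in> Z" "\<beta> \<in> borel n" using x unfolding smat_prod_def by blast
  have G: "x \<in> GG ?m" "z \<in> GG ?m" "?s \<in> GG ?m" "\<beta> \<in> GG ?m" using stratum_SL x Z z borel_SL i by auto
  let ?k = "?s * \<beta> * minv ?m ?s"
  have "x = x * ?s * minv ?m ?s" using G by simp
  also have "\<dots> = z * ?k" unfolding z(1) using G by (simp add: SL_assoc[of _ ?m])
  finally have e: "x = z * ?k" .
  have "\<beta> \<in> parabolic n i" using z borel_subset_parabolic by blast
  then have "?k \<in> parabolic n i" by (intro parabolic_mult smat_parabolic i)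
  then have "?k \<in> borel n" using stratum_fibre[OF b d] e x(1) z(2) Z by blast
  then show ?thesis using e stab z(2) by simp
qed

text \<open>Since \<open>B\<close> is irreducible, each coset of the smaller stratum lies wholly in
  the zero set of \<open>p\<close> or of \<open>q\<close>. The transports of these two closed parts
  cover the larger stratum, so one of them is dense; being relatively closed it is everything, and
  transport is injective on \<open>B\<close>-stable sets.\<close>

lemma irr_stratum_step:
  assumes n: "n > 0" and b: "b \<in> fpf_involutions n" and d: "cdesc n i b" and irr: "irr (2 * n) (stratum n (conj_refl i b))"
  shows "irr (2 * n) (stratum n b)"
  unfolding irr_def
proof (intro conjI allI impI)
  let ?m = "2 * n"
  have i: "Suc i < ?m" and lt: "b (Suc i) < b i" using d by auto
  show "stratum n b \<noteq> {}" using stratum_nonempty[OF b] by blast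
  show "stratum n b \<subseteq> carrier_mat ?m ?m" using stratum_SL SL_mat by blast
  fix p q assume pq: "regular ?m p" "regular ?m q" and z: "\<forall>x\<in>stratum n b. p x * q x = 0"
  \<comment> \<open>The largest right \<open>B\<close>-stable part of the zero set of
    \<open>f\<close> in the stratum.\<close>
  define C where "C f = {x \<in> stratum n b. \<forall>\<beta>\<in>borel n. f (x * \<beta>) = 0}" for f :: "complex mat \<Rightarrow> complex"
  have C: "C f \<subseteq> stratum n b" "\<And>x \<beta>. x \<in> C f \<Longrightarrow> \<beta> \<in> borel n \<Longrightarrow> x * \<beta> \<in> C f" for f
  proof -
    show "C f \<subseteq> stratum n b" by (auto simp: C_def)
    fix x \<beta> assume x: "x \<in> C f" and B: "\<beta> \<in> borel n"
    have "f (x * \<beta> * \<gamma>) = 0" if "\<gamma> \<in> borel n" for \<gamma>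
    proof -
      have "x \<in> GG ?m" using x stratum_SL[of x n b] by (simp add: C_def)
      from SL_assoc[OF this borel_SL[OF B] borel_SL[OF that]] have "x * \<beta> * \<gamma> = x * (\<beta> * \<gamma>)" .
      then show ?thesis using x B that borel_mult by (simp add: C_def)
    qed
    then show "x * \<beta> \<in> C f" using x B by (simp add: C_def)
  qed
  have cl: "zc ?m (C f) \<inter> stratum n b \<subseteq> C f" if f: "regular ?m f" for f
  proof
    fix x assume x: "x \<in> zc ?m (C f) \<inter> stratum n b"
    have "f (x * \<beta>) = 0" if B: "\<beta> \<in> borel n" for \<beta>
      by (rule zc_D[of x ?m "C f" "\<lambda>y. f (y * \<beta>)"]) (use x regular_right[OF f borel_SL[OF B]] B in \<open>auto simp: C_def\<close>)
    then show "x \<in> C f" using x by (simp add: C_def)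
  qed
  have cover: "stratum n b \<subseteq> C p \<union> C q"
  proof
    fix x assume x: "x \<in> stratum n b"
    have rx: "rmap ?m (\<lambda>y. x * y)" using SL_mat[OF stratum_SL[OF x]] by (intro rmap_mult rmap_id rmap_const)
    have "p (x * \<beta>) = 0 \<or> q (x * \<beta>) = 0" if "\<beta> \<in> borel n" for \<beta>
      using z stratum_borel[OF x that] by auto
    from irr_D[OF irr_borel[OF n] regular_comp[OF pq(1) rx] regular_comp[OF pq(2) rx] this]
    show "x \<in> C p \<union> C q" using x by (auto simp: C_def)
  qed
  have "stratum n (conj_refl i b) \<subseteq> (\<Union>f\<in>{p, q}. smat_prod n i (C f))"
  proof
    fix y assume "y \<in> stratum n (conj_refl i b)"
    then have "y \<in> smat_prod n i (stratum n b)" using smat_prod_whole[OF b i lt] by simp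
    then obtain x \<beta> where e: "y = x * smat ?m i * \<beta>" "x \<in> stratum n b" "\<beta> \<in> borel n"
      unfolding smat_prod_def by blast
    from cover e(2) have "x \<in> C p \<or> x \<in> C q" by blast
    then have "y \<in> smat_prod n i (C p) \<or> y \<in> smat_prod n i (C q)"
      using e(1,3) unfolding smat_prod_def by blast
    then show "y \<in> (\<Union>f\<in>{p, q}. smat_prod n i (C f))" by simp
  qed
  from irr_finite_cover[OF irr _ this] obtain f where f: "f = p \<or> f = q" "stratum n (conj_refl i b) \<subseteq> zc ?m (smat_prod n i (C f))" by auto
  have fr: "regular ?m f" using f pq by auto
  have "x \<in> C f" if x: "x \<in> stratum n b" for x
  proof -
    have xs: "x * smat ?m i \<in> stratum n (conj_refl i b)" using stratum_smat[OF b i lt x] .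
    have "x * smat ?m i \<in> smat_prod n i (C f)"
      by (rule smat_prod_closed[OF b d C(1) C(2) cl[OF fr] xs]) (use f(2) xs in auto)
    then show ?thesis using smat_prod_inj[OF b d C(1) C(2) x] by blast
  qed
  then have "\<forall>x\<in>stratum n b. f x = 0" using borel_one[of n] stratum_SL by (force simp: C_def)
  then show "(\<forall>x\<in>stratum n b. p x = 0) \<or> (\<forall>x\<in>stratum n b. q x = 0)" using f by blast
qed

lemma no_cdesc_unique:
  assumes b: "b \<in> fpf_involutions n" "\<And>i. \<not> cdesc n i b" and c: "c \<in> fpf_involutions n" "\<And>i. \<not> cdesc n i c"
  shows "b = c"
proof
  fix j
  show "b j = c j"
  proof (cases "j < 2 * n")
    case True
    obtain k where "j = 2 * k \<or> j = Suc (2 * k)" by (metis evenE oddE Suc_eq_plus1)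
    then have k: "k < n" "j = 2 * k \<or> j = Suc (2 * k)" using True by auto
    have "b (2 * k) = Suc (2 * k)" "c (2 * k) = Suc (2 * k)" using no_cdesc_top[OF b k(1)] no_cdesc_top[OF c k(1)] .
    then show ?thesis using k(2) fpfD(2)[OF b(1), of "2 * k"] fpfD(2)[OF c(1), of "2 * k"] by auto
  next
    case False
    then show ?thesis using fpfD(1)[OF b(1)] fpfD(1)[OF c(1)] unfolding permutes_def by simp
  qed
qed

text \<open>\<open>SL\<close> is irreducible and covered by finitely many strata, so one of them is
  dense. A dense stratum has no outgoing edge, and only one involution has this property.\<close>

lemma irr_stratum_top:
  assumes n: "n > 0" and b: "b \<in> fpf_involutions n" "\<And>i. \<not> cdesc n i b"
  shows "irr (2 * n) (stratum n b)"
proof -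
  let ?m = "2 * n"
  have G: "irr ?m (GG ?m)" using irr_SL n by simp
  have "GG ?m \<subseteq> (\<Union>c\<in>fpf_involutions n. stratum n c)" using stratum_cover by blast
  from irr_finite_cover[OF G finite_fpf this] obtain c where c: "c \<in> fpf_involutions n" "GG ?m \<subseteq> zc ?m (stratum n c)" by blast
  have "\<not> cdesc n i c" for i
  proof
    assume d: "cdesc n i c"
    obtain y where y: "y \<in> stratum n (conj_refl i c)" using stratum_nonempty[OF conj_refl_fpf[OF c(1)]] d by blast
    have "y \<notin> zc ?m (stratum n c)" by (rule stratum_conj_notin_closure[OF c(1) d y])
    then show False using c(2) stratum_SL[OF y] by blast
  qed
  then have "b = c" using no_cdesc_unique[OF b c(1)] by blast
  then show ?thesis using c(2) stratum_SL by (intro irr_dense'[OF G]) auto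
qed

lemma irr_stratum:
  assumes n: "n > 0" and "b \<in> fpf_involutions n"
  shows "irr (2 * n) (stratum n b)"
  using assms(2)
proof (induction "card (inversions (2 * n) b)" arbitrary: b rule: less_induct)
  case less
  show ?case
  proof (cases "\<exists>i. cdesc n i b")
    case True
    then obtain i where d: "cdesc n i b" by blast
    have "irr (2 * n) (stratum n (conj_refl i b))"
      by (rule less.hyps) (use card_inversions_conj[OF less.prems d] conj_refl_fpf[OF less.prems] d in auto)
    then show ?thesis by (rule irr_stratum_step[OF n less.prems d])
  qed (use irr_stratum_top[OF n less.prems] in blast)
qed

subsection \<open>Dimensions of the strata\<close>

lemma irr_smat_prod:
  assumes n: "n > 0" and i: "Suc i < 2 * n" and S: "irr (2 * n) S"
  shows "irr (2 * n) (smat_prod n i S)"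
proof -
  have "smat_prod n i S = mprod ((\<lambda>z. z * smat (2 * n) i) ` S) (borel n)"
    unfolding smat_prod_def mprod_def by blast
  moreover have "rmap (2 * n) (\<lambda>z. z * smat (2 * n) i)" by (intro rmap_mult rmap_id rmap_const smat_carrier)
  ultimately show ?thesis using irr_mprod[OF irr_image[OF S] irr_borel[OF n]] by simp
qed

text \<open>The additional step is gained at the bottom: the coset \<open>z s B\<close> is not dense
  in \<open>S s B\<close>, as \<open>z * ?l * ?s\<close> lies over the same point of
  \<open>G/P_i\<close> but in another coset. Higher steps stay strict because relatively closed sets
  have relatively closed transports.\<close>

lemma zchain_smat_prod:
  assumes n: "n > 0" and b: "b \<in> fpf_involutions n" and d: "cdesc n i b"
    and ch: "zchain (2 * n) (adm n (stratum n b)) S k"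
  shows "zchain (2 * n) (adm n (stratum n (conj_refl i b))) (smat_prod n i S) (Suc k)"
  using ch
proof induction
  let ?m = "2 * n" let ?s = "smat ?m i"
  have i: "Suc i < ?m" and lt: "b (Suc i) < b i" using d by auto
  have sG: "?s \<in> GG ?m" using i by auto
  have im: "i < ?m" using i by simp
  have admS: "adm n (stratum n (conj_refl i b)) (smat_prod n i S)" if "adm n (stratum n b) S" for S
  proof -
    have S: "S \<subseteq> stratum n b" using that by (simp add: adm_def)
    then have "S \<subseteq> GG ?m" using stratum_SL by blast
    from smat_prod_stratum[OF b i lt S] smat_prod_stable[OF i this] show ?thesis by (simp add: adm_def)
  qed
  {
    case (base S)
    obtain z where z: "z \<in> S" using base by (auto simp: irr_def)
    have SS: "S \<subseteq> stratum n b" and stab: "\<And>x \<beta>. x \<in> S \<Longrightarrow> \<beta> \<in> borel n \<Longrightarrow> x * \<beta> \<in> S" using base by (auto simp: adm_def)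
    have zG: "z \<in> GG ?m" using z SS stratum_SL by blast
    let ?T = "(\<lambda>\<beta>. z * ?s * \<beta>) ` borel n"
    have zs: "z * ?s \<in> GG ?m" using zG sG by simp
    have TS: "?T \<subseteq> smat_prod n i S" using z unfolding smat_prod_def by blast
    have rz: "rmap ?m (\<lambda>\<beta>. g * \<beta>)" if "g \<in> GG ?m" for g using SL_mat[OF that] by (intro rmap_mult rmap_id rmap_const)
    have Tirr: "irr ?m ?T" by (rule irr_image[OF irr_borel[OF n] rz[OF zs]])
    have Tadm: "adm n (stratum n (conj_refl i b)) ?T"
    proof -
      have "x * \<beta> \<in> ?T" if x: "x \<in> ?T" and B: "\<beta> \<in> borel n" for x \<beta>
      proof -
        obtain \<gamma> where g: "\<gamma> \<in> borel n" "x = z * ?s * \<gamma>" using x by blast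
        have "x * \<beta> = z * ?s * (\<gamma> * \<beta>)" using zs g B borel_SL by (simp add: SL_assoc[of "z * ?s" ?m])
        then show ?thesis using g B borel_mult by blast
      qed
      then show ?thesis using TS admS[OF base(2)] unfolding adm_def by blast
    qed
    let ?l = "addrow_mat ?m 1 (Suc i) i"
    have lB: "?l \<in> borel n" using i by (simp add: addrow_mat_borel)
    have lG: "?l \<in> GG ?m" using borel_SL[OF lB] .
    let ?f = "\<lambda>x. (minv ?m (z * ?s) * x) $$ (i, Suc i)"
    have T0: "zchain ?m (adm n (stratum n (conj_refl i b))) ?T 0"
      by (rule zchain.base) (rule Tirr, rule Tadm)
    show ?case
    proof (rule zchain.step[OF T0 irr_smat_prod[OF n i base(1)] admS[OF base(2)] TS, where f = ?f and y = "z * ?l * ?s"])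
      show "regular ?m ?f" using rz[OF SL_inv[OF zs]] im i by (simp add: rmap_def)
      have "z * ?l * ?s = z * ?l * ?s * 1\<^sub>m ?m" using zG sG lG by simp
      then show "z * ?l * ?s \<in> smat_prod n i S" using stab[OF z lB] borel_one[of n] unfolding smat_prod_def by blast
      have "minv ?m (z * ?s) * (z * ?l * ?s) = minv ?m ?s * (?l * ?s)"
        using zG sG lG by (simp add: SL_inv_mult SL_assoc[of _ ?m])
      moreover have "(minv ?m ?s * (?l * ?s)) $$ (i, Suc i) = - 1"
        using minv_smat_mult_index[OF SL_mat[OF SL_closed[OF lG sG]] im i i] mult_smat_index[OF SL_mat[OF lG] i i i] im i by simp
      ultimately show "?f (z * ?l * ?s) \<noteq> 0" by simp
      fix x assume "x \<in> ?T"
      then obtain \<gamma> where g: "\<gamma> \<in> borel n" "x = z * ?s * \<gamma>" by blast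
      then have "minv ?m (z * ?s) * x = \<gamma>" using zs borel_SL by simp
      then show "?f x = 0" using borel_zero[OF g(1), of i "Suc i"] i by simp
    qed
  next
    case (step S k S' f y)
    have admS0: "adm n (stratum n b) S" using zchain_adm[OF step(1)] .
    have SS: "S \<subseteq> stratum n b" and stab: "\<And>x \<beta>. x \<in> S \<Longrightarrow> \<beta> \<in> borel n \<Longrightarrow> x * \<beta> \<in> S" using admS0 by (auto simp: adm_def)
    have S'S: "S' \<subseteq> stratum n b" using step(3) by (auto simp: adm_def)
    \<comment> \<open>The member \<open>S\<close> is not closed; its closure within the stratum is,
      and \<open>y\<close> remains outside it.\<close>
    define Z where "Z = zc ?m S \<inter> stratum n b"
    have Zstab: "z * \<beta> \<in> Z" if z: "z \<in> Z" and B: "\<beta> \<in> borel n" for z \<beta>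
    proof -
      have "z * \<beta> \<in> zc ?m S" by (rule zc_right[of z ?m S]) (use z B borel_SL stab in \<open>auto simp: Z_def\<close>)
      then show ?thesis using z B by (simp add: Z_def)
    qed
    have "S \<subseteq> carrier_mat ?m ?m" using zchain_irr[OF step(1)] by (simp add: irr_def)
    from zc_superset[OF this] have SZ: "S \<subseteq> Z" using SS unfolding Z_def by blast
    have Zcl: "zc ?m Z \<inter> stratum n b \<subseteq> Z" using zc_closed[of Z ?m S] by (auto simp: Z_def)
    have yb: "y \<in> stratum n b" using step(7) S'S by blast
    have "y \<notin> Z" using zc_D[OF _ step(5,6)] step(8) by (auto simp: Z_def)
    then have "y * ?s \<notin> smat_prod n i Z" using smat_prod_inj[OF b d _ Zstab yb] by (auto simp: Z_def)
    then have "y * ?s \<notin> zc ?m (smat_prod n i Z)"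
      using smat_prod_closed[OF b d _ Zstab Zcl stratum_smat[OF b i lt yb]] by (auto simp: Z_def)
    then have "y * ?s \<notin> zc ?m (smat_prod n i S)" using zc_mono[OF smat_prod_mono[OF SZ]] by blast
    moreover have ys: "y * ?s \<in> GG ?m" using stratum_SL[OF yb] sG by simp
    ultimately obtain p where p: "regular ?m p" "\<And>x. x \<in> smat_prod n i S \<Longrightarrow> p x = 0" "p (y * ?s) \<noteq> 0"
      using SL_mat[OF ys] unfolding zc_def by blast
    have "y * ?s = y * ?s * 1\<^sub>m ?m" using ys by simp
    then have "y * ?s \<in> smat_prod n i S'" using step(7) borel_one[of n] unfolding smat_prod_def by blast
    from zchain.step[OF step.IH irr_smat_prod[OF n i step(2)] admS[OF step(3)] smat_prod_mono[OF step(4)] p(1) p(2) this p(3)]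
    show ?case .
  }
qed

lemma zc_stratum_stable: "x \<in> zc (2 * n) (stratum n b) \<Longrightarrow> \<beta> \<in> borel n \<Longrightarrow> x * \<beta> \<in> zc (2 * n) (stratum n b)"
  by (rule zc_right[of x "2 * n" "stratum n b"]) (auto dest: borel_SL)

lemma zc_stratum_adm: "adm n (zc (2 * n) (stratum n b)) (zc (2 * n) (stratum n b))"
  by (simp add: adm_def zc_stratum_stable)

text \<open>The smaller stratum lies not in the larger one but in its closure. Chains in closures
  can therefore be prolonged by adding the closure of the larger stratum, which is
  irreducible.\<close>

lemma zchain_closure_step:
  assumes n: "n > 0" and b: "b \<in> fpf_involutions n" and d: "cdesc n i b"
    and ch: "zchain (2 * n) (adm n (zc (2 * n) (stratum n b))) S k"
  shows "zchain (2 * n) (adm n (zc (2 * n) (stratum n (conj_refl i b)))) (zc (2 * n) (stratum n (conj_refl i b))) (Suc k)"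
proof -
  let ?m = "2 * n" let ?T = "zc ?m (stratum n b)" let ?T' = "zc ?m (stratum n (conj_refl i b))"
  have i: "Suc i < ?m" and lt: "b (Suc i) < b i" using d by auto
  have bf: "conj_refl i b \<in> fpf_involutions n" using conj_refl_fpf[OF b i] .
  have TT: "?T \<subseteq> ?T'" by (rule zc_closed[OF stratum_subset_closure[OF b i lt]])
  obtain y where y: "y \<in> stratum n (conj_refl i b)" using stratum_nonempty[OF bf] by blast
  have "y \<notin> ?T" by (rule stratum_conj_notin_closure[OF b d y])
  then obtain p where p: "regular ?m p" "\<And>x. x \<in> stratum n b \<Longrightarrow> p x = 0" "p y \<noteq> 0"
    using SL_mat[OF stratum_SL[OF y]] unfolding zc_def by blast
  have ST: "S \<subseteq> ?T" using zchain_adm[OF ch] by (simp add: adm_def)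
  have pS: "p x = 0" if "x \<in> S" for x using zc_D[OF subsetD[OF ST that] p(1)] p(2) by blast
  have ch': "zchain ?m (adm n ?T') S k"
    by (rule zchain_mono[OF ch]) (use TT in \<open>auto simp: adm_def\<close>)
  have irr: "irr ?m ?T'" using irr_dense[OF irr_stratum[OF n bf] stratum_zc order_refl] .
  have "y \<in> ?T'" using y stratum_zc by blast
  from zchain.step[OF ch' irr zc_stratum_adm subset_trans[OF ST TT] p(1) pS this p(3)] show ?thesis .
qed

text \<open>Along an edge \<open>k\<close> rises by one and the number of inversions falls by two,
  so the left side is constant. At the top there are at most \<open>n\<close> inversions, and the
  bound for the flag variety applies.\<close>

lemma stratum_dim_upper:
  assumes n: "n > 0" and "b \<in> fpf_involutions n" and "zchain (2 * n) (adm n (zc (2 * n) (stratum n b))) S k"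
  shows "2 * k + card (inversions (2 * n) b) + n \<le> 4 * n * n"
  using assms(2,3)
proof (induction "card (inversions (2 * n) b)" arbitrary: b S k rule: less_induct)
  case less
  show ?case
  proof (cases "\<exists>i. cdesc n i b")
    case True
    then obtain i where d: "cdesc n i b" by blast
    note c = card_inversions_conj[OF less.prems(1) d]
    have "2 * Suc k + card (inversions (2 * n) (conj_refl i b)) + n \<le> 4 * n * n"
    proof (rule less.hyps)
      show "card (inversions (2 * n) (conj_refl i b)) < card (inversions (2 * n) b)" using c by simp
      show "conj_refl i b \<in> fpf_involutions n" using conj_refl_fpf[OF less.prems(1)] d by blast
    qed (rule zchain_closure_step[OF n less.prems(1) d less.prems(2)])
    then show ?thesis using c by simp
  next
    case False
    then have "card (inversions (2 * n) b) \<le> n" using card_inversions_top[OF less.prems(1)] by blast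
    moreover have "k \<le> n * (2 * n - 1)"
    proof (rule flag_chain_bound[OF n zchain_mono[OF less.prems(2)]])
      fix S assume "adm n (zc (2 * n) (stratum n b)) S"
      then show "adm n (GG (2 * n)) S" using zc_stratum_SL by (auto simp: adm_def)
    qed
    moreover have "n * (2 * n - 1) + n = 2 * n * n" by (cases n) (simp_all add: algebra_simps)
    ultimately show ?thesis by simp
  qed
qed

lemma stratum_dim_lower:
  assumes n: "n > 0" and "b \<in> fpf_involutions n"
  shows "\<exists>S k. zchain (2 * n) (adm n (stratum n b)) S k \<and> 2 * k + card (inversions (2 * n) b) + n = 4 * n * n"
  using assms(2)
proof (induction rule: fpf_induct)
  case w0
  obtain S where "zchain (2 * n) (adm n (stratum n (w0 n))) S (n * n)" using closed_orbit_chain[OF n] by blast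
  moreover have "2 * (n * n) + card (inversions (2 * n) (w0 n)) + n = 4 * n * n"
    unfolding card_inversions_w0 by (cases n) (simp_all add: algebra_simps)
  ultimately show ?case by blast
next
  case (step b i)
  then obtain S k where k: "zchain (2 * n) (adm n (stratum n b)) S k" "2 * k + card (inversions (2 * n) b) + n = 4 * n * n" by blast
  have "2 * Suc k + card (inversions (2 * n) (conj_refl i b)) + n = 4 * n * n"
    using k(2) card_inversions_conj[OF step(1,2)] by simp
  then show ?case using zchain_smat_prod[OF n step(1,2) k(1)] by blast
qed

text \<open>For a fixed point-free involution this is \<open>n * (2 * n - 1)\<close>, the dimension
  of the flag variety, minus half the excess of the number of inversions over \<open>n\<close>, its
  value at the top.\<close>

definition stratum_dim :: "nat \<Rightarrow> (nat \<Rightarrow> nat) \<Rightarrow> nat" where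
  "stratum_dim n b = (4 * n * n - n - card (inversions (2 * n) b)) div 2"

lemma stratum_dim:
  assumes n: "n > 0" and b: "b \<in> fpf_involutions n"
  shows "\<exists>S. zchain (2 * n) (adm n (stratum n b)) S (stratum_dim n b)"
    and "zchain (2 * n) (adm n (stratum n b)) S k \<Longrightarrow> k \<le> stratum_dim n b"
    and "cdesc n i b \<Longrightarrow> stratum_dim n (conj_refl i b) = Suc (stratum_dim n b)"
proof -
  obtain T l where l: "zchain (2 * n) (adm n (stratum n b)) T l" "2 * l + card (inversions (2 * n) b) + n = 4 * n * n"
    using stratum_dim_lower[OF n b] by blast
  have sd: "stratum_dim n b = l" unfolding stratum_dim_def using l(2) by linarith
  then show "\<exists>S. zchain (2 * n) (adm n (stratum n b)) S (stratum_dim n b)" using l by blast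
  show "k \<le> stratum_dim n b" if ch: "zchain (2 * n) (adm n (stratum n b)) S k"
  proof -
    have "zchain (2 * n) (adm n (zc (2 * n) (stratum n b))) S k"
      by (rule zchain_mono[OF ch]) (use stratum_zc in \<open>auto simp: adm_def\<close>)
    from stratum_dim_upper[OF n b this] show ?thesis unfolding sd using l(2) by linarith
  qed
  show "stratum_dim n (conj_refl i b) = Suc (stratum_dim n b)" if d: "cdesc n i b"
    unfolding sd unfolding stratum_dim_def using card_inversions_conj[OF b d] l(2) by linarith
qed

section \<open>The Zariski topology on homogeneous spaces\<close>

text \<open>Products of functions give intersections of principal open sets, so these form a base
  and not only a subbase.\<close>

lemma openin_zariski_iff:
  "openin (zariski m) U \<longleftrightarrow> U \<subseteq> GG m \<and>
     (\<forall>x\<in>U. \<exists>p. regular m p \<and> p x \<noteq> 0 \<and> (\<forall>y\<in>GG m. p y \<noteq> 0 \<longrightarrow> y \<in> U))" (is "?L \<longleftrightarrow> ?R")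
proof
  assume ?L
  then have "generate_topology_on {{A \<in> GG m. p A \<noteq> 0} | p. p \<in> poly_funs m} U"
    by (simp add: zariski_def openin_topology_generated_by_iff)
  then show ?R
  proof induction
    case (Int U V)
    have "\<exists>p. regular m p \<and> p x \<noteq> 0 \<and> (\<forall>y\<in>GG m. p y \<noteq> 0 \<longrightarrow> y \<in> U \<inter> V)" if x: "x \<in> U \<inter> V" for x
    proof -
      obtain p q where "regular m p" "p x \<noteq> 0" "\<forall>y\<in>GG m. p y \<noteq> 0 \<longrightarrow> y \<in> U"
        "regular m q" "q x \<noteq> 0" "\<forall>y\<in>GG m. q y \<noteq> 0 \<longrightarrow> y \<in> V" using Int.IH x by blast
      then show ?thesis by (intro exI[of _ "\<lambda>y. p y * q y"]) (auto intro: regular_mult)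
    qed
    then show ?case using Int.IH by blast
  next
    case (UN K)
    have "\<exists>p. regular m p \<and> p x \<noteq> 0 \<and> (\<forall>y\<in>GG m. p y \<noteq> 0 \<longrightarrow> y \<in> \<Union>K)" if x: "x \<in> \<Union>K" for x
    proof -
      obtain k where k: "k \<in> K" "x \<in> k" using x by blast
      then obtain p where "regular m p" "p x \<noteq> 0" "\<forall>y\<in>GG m. p y \<noteq> 0 \<longrightarrow> y \<in> k" using UN.IH by blast
      then show ?thesis using k by blast
    qed
    then show ?case using UN.IH by blast
  next
    case (Basis s)
    then obtain p where "p \<in> poly_funs m" "s = {A \<in> GG m. p A \<noteq> 0}" by blast
    then show ?case by (auto intro: poly_funs_regular)
  qed simp
next
  assume R: ?R
  show ?L
  proof (subst openin_subopen, intro ballI)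
    fix x assume x: "x \<in> U"
    then obtain p where p: "regular m p" "p x \<noteq> 0" "\<forall>y\<in>GG m. p y \<noteq> 0 \<longrightarrow> y \<in> U" using R by blast
    obtain q where q: "q \<in> poly_funs m" "\<forall>x\<in>carrier_mat m m. p x = q x" using p(1) unfolding regular_def by blast
    let ?T = "{A \<in> GG m. q A \<noteq> 0}"
    have "openin (zariski m) ?T" unfolding zariski_def by (rule topology_generated_by_Basis) (use q(1) in blast)
    moreover have "x \<in> ?T" "?T \<subseteq> U" using p q R x SL_mat by auto
    ultimately show "\<exists>T. openin (zariski m) T \<and> x \<in> T \<and> T \<subseteq> U" by blast
  qed
qed

section \<open>Cosets and right stable sets\<close>

definition subgrp :: "nat \<Rightarrow> complex mat set \<Rightarrow> bool" where
  "subgrp n H \<longleftrightarrow> H \<subseteq> GG (2 * n) \<and> 1\<^sub>m (2 * n) \<in> H \<and> (\<forall>x\<in>H. \<forall>y\<in>H. x * y \<in> H) \<and> (\<forall>x\<in>H. minv (2 * n) x \<in> H)"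

lemma subgrp_borel: "subgrp n (borel n)"
  using borel_SL by (auto simp: subgrp_def)

lemma subgrp_parabolic: "Suc i < 2 * n \<Longrightarrow> subgrp n (parabolic n i)"
  using parabolic_SL parabolic_mult parabolic_inv borel_one[of n] borel_subset_parabolic[of n i] unfolding subgrp_def by blast

abbreviation lcoset :: "nat \<Rightarrow> complex mat set \<Rightarrow> complex mat \<Rightarrow> complex mat set" where
  "lcoset n H g \<equiv> g <#\<^bsub>grp n\<^esub> H"

lemma lcoset_iff: "x \<in> lcoset n H g \<longleftrightarrow> (\<exists>h\<in>H. x = g * h)"
  unfolding coset_mem by blast

lemma lcoset_self: "subgrp n H \<Longrightarrow> g \<in> GG (2 * n) \<Longrightarrow> g \<in> lcoset n H g"
  unfolding lcoset_iff subgrp_def by (metis SL_unit(2))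

lemma lcoset_mult:
  assumes H: "subgrp n H" and g: "g \<in> GG (2 * n)" and h: "h \<in> H"
  shows "lcoset n H (g * h) = lcoset n H g"
proof -
  have hG: "h \<in> GG (2 * n)" and sub: "H \<subseteq> GG (2 * n)" using H h unfolding subgrp_def by blast+
  have "g * h * k \<in> lcoset n H g" if "k \<in> H" for k
    using that h H SL_assoc[OF g hG, of k] sub unfolding lcoset_iff subgrp_def by blast
  moreover have "g * k \<in> lcoset n H (g * h)" if k: "k \<in> H" for k
  proof -
    have kG: "k \<in> GG (2 * n)" using k sub by blast
    have "g * k = g * h * (minv (2 * n) h * k)" using g hG kG by (simp add: SL_assoc[of _ "2 * n"])
    moreover have "minv (2 * n) h * k \<in> H" using H h k unfolding subgrp_def by blast
    ultimately show ?thesis unfolding lcoset_iff by blast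
  qed
  ultimately show ?thesis unfolding coset_mem by blast
qed

lemma lcoset_eqD:
  assumes H: "subgrp n H" and g: "g \<in> GG (2 * n)" "g' \<in> GG (2 * n)" and e: "lcoset n H g = lcoset n H g'"
  obtains h where "h \<in> H" "g' = g * h"
proof -
  have "g' \<in> lcoset n H g" using lcoset_self[OF H g(2)] e by simp
  then show ?thesis using that unfolding lcoset_iff by blast
qed

definition rstable :: "nat \<Rightarrow> complex mat set \<Rightarrow> complex mat set \<Rightarrow> bool" where
  "rstable n H W \<longleftrightarrow> W \<subseteq> GG (2 * n) \<and> (\<forall>w\<in>W. \<forall>h\<in>H. w * h \<in> W)"

lemma lcoset_in_image:
  assumes "subgrp n H" "rstable n H W" "g \<in> GG (2 * n)"
  shows "lcoset n H g \<in> lcoset n H ` W \<longleftrightarrow> g \<in> W"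
proof
  assume "lcoset n H g \<in> lcoset n H ` W"
  then obtain w where w: "w \<in> W" "lcoset n H w = lcoset n H g" by auto
  have "w \<in> GG (2 * n)" using w assms(2) by (auto simp: rstable_def)
  from lcoset_eqD[OF assms(1) this assms(3) w(2)] obtain h where h: "h \<in> H" "g = w * h" .
  then show "g \<in> W" using assms(2) w(1) unfolding rstable_def by simp
qed (rule imageI)

lemma Union_lcoset_image:
  assumes "subgrp n H" "rstable n H W"
  shows "\<Union>(lcoset n H ` W) = W"
proof
  show "\<Union>(lcoset n H ` W) \<subseteq> W" using assms(2) unfolding rstable_def coset_mem by auto
  show "W \<subseteq> \<Union>(lcoset n H ` W)"
  proof
    fix x assume x: "x \<in> W"
    then have "x \<in> GG (2 * n)" using assms(2) unfolding rstable_def by (meson subsetD)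
    from lcoset_self[OF assms(1) this] x show "x \<in> \<Union>(lcoset n H ` W)" by (intro UN_I)
  qed
qed

lemma quotient_space_image: "quotient_space n H = lcoset n H ` GG (2 * n)"
  unfolding quotient_space_def by (rule Setcompr_eq_image)

lemma quotient_subsetE:
  assumes "A \<subseteq> quotient_space n H" "C \<in> A"
  obtains g where "g \<in> GG (2 * n)" "C = lcoset n H g"
  using subsetD[OF assms] unfolding quotient_space_image by (elim imageE) (rule that)

lemma lcosetE:
  assumes "x \<in> lcoset n H g"
  obtains h where "h \<in> H" "x = g * h"
  using assms unfolding lcoset_iff by (elim bexE) (rule that)

lemma lcosetI: "h \<in> H \<Longrightarrow> g * h \<in> lcoset n H g"
  unfolding coset_mem by (rule imageI)

text \<open>Subsets of \<open>G/H\<close> correspond to right \<open>H\<close>-stable subsets of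
  \<open>G\<close>. From here on topological questions about the quotient are settled in the
  group.\<close>

lemma Union_quotient_subset:
  assumes H: "subgrp n H" and A: "A \<subseteq> quotient_space n H"
  shows "rstable n H (\<Union>A)" "lcoset n H ` \<Union>A = A" "g \<in> GG (2 * n) \<Longrightarrow> lcoset n H g \<in> A \<longleftrightarrow> g \<in> \<Union>A"
proof -
  have sub: "H \<subseteq> GG (2 * n)" using H unfolding subgrp_def by blast
  have w: "w \<in> GG (2 * n) \<and> lcoset n H w = C" if C: "C \<in> A" and wC: "w \<in> C" for w C
  proof -
    obtain g where g: "g \<in> GG (2 * n)" "C = lcoset n H g" by (rule quotient_subsetE[OF A C])
    obtain h where h: "h \<in> H" "w = g * h" by (rule lcosetE[OF wC[unfolded g(2)]])
    then show ?thesis using g lcoset_mult[OF H g(1) h(1)] sub by auto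
  qed
  show 1: "rstable n H (\<Union>A)"
    unfolding rstable_def
  proof (intro conjI subsetI ballI)
    fix x assume "x \<in> \<Union>A"
    then show "x \<in> GG (2 * n)" by (elim UnionE) (simp add: w)
  next
    fix x h assume "x \<in> \<Union>A" and h: "h \<in> H"
    then obtain C where C: "C \<in> A" "x \<in> C" by (elim UnionE)
    have "x * h \<in> lcoset n H x" by (rule lcosetI[OF h])
    then have "x * h \<in> C" using w[OF C] by simp
    then show "x * h \<in> \<Union>A" using C(1) by (intro UnionI)
  qed
  have "C \<in> lcoset n H ` \<Union>A" if C: "C \<in> A" for C
  proof -
    obtain g where g: "g \<in> GG (2 * n)" "C = lcoset n H g" by (rule quotient_subsetE[OF A C])
    have "g \<in> \<Union>A" using lcoset_self[OF H g(1)] C g(2) by (intro UnionI[of C]) simp_all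
    then show ?thesis unfolding g(2) by (rule imageI)
  qed
  moreover have "lcoset n H x \<in> A" if "x \<in> \<Union>A" for x
    using that by (elim UnionE) (simp add: w)
  ultimately show 2: "lcoset n H ` \<Union>A = A" by blast
  show "lcoset n H g \<in> A \<longleftrightarrow> g \<in> \<Union>A" if "g \<in> GG (2 * n)" using lcoset_in_image[OF H 1 that] unfolding 2 .
qed

section \<open>Open sets and closures in the quotient\<close>

lemma quot_openI:
  assumes "U \<subseteq> quotient_space n H"
    and "\<And>g. g \<in> GG (2 * n) \<Longrightarrow> lcoset n H g \<in> U \<Longrightarrow>
      \<exists>p. regular (2 * n) p \<and> p g \<noteq> 0 \<and> (\<forall>y\<in>GG (2 * n). p y \<noteq> 0 \<longrightarrow> lcoset n H y \<in> U)"
  shows "openin (quotient_zariski n H) U"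
  unfolding openin_quotient_zariski openin_zariski_iff using assms by fastforce

lemma quot_openD:
  assumes "openin (quotient_zariski n H) U" "g \<in> GG (2 * n)" "lcoset n H g \<in> U"
  shows "\<exists>p. regular (2 * n) p \<and> p g \<noteq> 0 \<and> (\<forall>y\<in>GG (2 * n). p y \<noteq> 0 \<longrightarrow> lcoset n H y \<in> U)"
proof -
  have "g \<in> {g \<in> GG (2 * n). lcoset n H g \<in> U}" using assms by simp
  from assms(1)[unfolded openin_quotient_zariski openin_zariski_iff, THEN conjunct2, THEN conjunct2, rule_format, OF this]
  show ?thesis by blast
qed

lemma topspace_quotient [simp]: "topspace (quotient_zariski n H) = quotient_space n H"
proof -
  have "openin (quotient_zariski n H) (quotient_space n H)"
    by (rule quot_openI[OF order_refl]) (auto simp: quotient_space_image intro!: exI[of _ "\<lambda>_. 1"] regular_const)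
  then have "quotient_space n H \<subseteq> topspace (quotient_zariski n H)" by (rule openin_subset)
  moreover have "topspace (quotient_zariski n H) \<subseteq> quotient_space n H"
    using openin_topspace[of "quotient_zariski n H"] unfolding openin_quotient_zariski by blast
  ultimately show ?thesis by blast
qed

text \<open>The image in \<open>G/H\<close> of the principal open set of \<open>p\<close>. Right
  translates of a regular function are regular, so this image is open.\<close>

definition quot_nonvanishing :: "nat \<Rightarrow> complex mat set \<Rightarrow> (complex mat \<Rightarrow> complex) \<Rightarrow> complex mat set set" where
  "quot_nonvanishing n H p = lcoset n H ` {g \<in> GG (2 * n). \<exists>h\<in>H. p (g * h) \<noteq> 0}"

lemma quot_open_nonvanishing:
  assumes H: "subgrp n H" and p: "regular (2 * n) p"
  shows "openin (quotient_zariski n H) (quot_nonvanishing n H p)"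
    "\<And>g. g \<in> GG (2 * n) \<Longrightarrow> lcoset n H g \<in> quot_nonvanishing n H p \<longleftrightarrow> (\<exists>h\<in>H. p (g * h) \<noteq> 0)"
proof -
  let ?m = "2 * n" let ?U = "quot_nonvanishing n H p"
  have sub: "H \<subseteq> GG ?m" using H unfolding subgrp_def by blast
  show iff: "lcoset n H g \<in> ?U \<longleftrightarrow> (\<exists>h\<in>H. p (g * h) \<noteq> 0)" if g: "g \<in> GG ?m" for g
  proof
    assume "lcoset n H g \<in> ?U"
    then obtain g' h where g': "g' \<in> GG ?m" "h \<in> H" "p (g' * h) \<noteq> 0" "lcoset n H g = lcoset n H g'"
      unfolding quot_nonvanishing_def by auto
    from lcoset_eqD[OF H g g'(1) g'(4)] obtain k where k: "k \<in> H" "g' = g * k" .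
    have "g' * h = g * (k * h)" using g k g' sub by (simp add: SL_assoc[of _ ?m] subset_iff)
    moreover have "k * h \<in> H" using H k g' unfolding subgrp_def by blast
    ultimately show "\<exists>h\<in>H. p (g * h) \<noteq> 0" using g'(3) by metis
  qed (use g in \<open>auto simp: quot_nonvanishing_def\<close>)
  show "openin (quotient_zariski n H) ?U"
  proof (rule quot_openI)
    show "?U \<subseteq> quotient_space n H" unfolding quotient_space_image quot_nonvanishing_def by auto
    fix g assume g: "g \<in> GG ?m" "lcoset n H g \<in> ?U"
    then obtain h where h: "h \<in> H" "p (g * h) \<noteq> 0" using iff by blast
    have "regular ?m (\<lambda>y. p (y * h))" using regular_right[OF p] h sub by blast
    then show "\<exists>p. regular ?m p \<and> p g \<noteq> 0 \<and> (\<forall>y\<in>GG ?m. p y \<noteq> 0 \<longrightarrow> lcoset n H y \<in> ?U)"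
      using h by (intro exI[of _ "\<lambda>y. p (y * h)"]) (auto simp: iff)
  qed
qed

text \<open>Closures can be computed in the group because the projection to the quotient is open as
  well as continuous.\<close>

lemma quot_closure_iff:
  assumes H: "subgrp n H" and A: "A \<subseteq> quotient_space n H" and g: "g \<in> GG (2 * n)"
  shows "lcoset n H g \<in> quotient_zariski n H closure_of A \<longleftrightarrow> g \<in> zc (2 * n) (\<Union>A)"
proof
  let ?m = "2 * n"
  note U = Union_quotient_subset[OF H A]
  have AG: "y \<in> GG ?m" if "y \<in> \<Union>A" for y using U(1) that unfolding rstable_def by blast
  {
    assume c: "lcoset n H g \<in> quotient_zariski n H closure_of A"
    show "g \<in> zc ?m (\<Union>A)"
      unfolding zc_def
    proof (intro CollectI conjI allI impI)
      show "g \<in> carrier_mat ?m ?m" using g SL_mat by blast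
      fix p assume p: "regular ?m p" "\<forall>y\<in>\<Union>A. p y = 0"
      show "p g = 0"
      proof (rule ccontr)
        assume pg: "p g \<noteq> 0"
        let ?U = "quot_nonvanishing n H p"
        note o = quot_open_nonvanishing[OF H p(1)]
        have "1\<^sub>m ?m \<in> H" using H unfolding subgrp_def by blast
        moreover have "p (g * 1\<^sub>m ?m) \<noteq> 0" using pg g by simp
        ultimately have "lcoset n H g \<in> ?U" using o(2)[OF g] by blast
        then obtain C where C: "C \<in> A" "C \<in> ?U" using c o(1) unfolding in_closure_of by blast
        obtain y where y: "y \<in> GG ?m" "C = lcoset n H y" by (rule quotient_subsetE[OF A C(1)])
        then obtain h where h: "h \<in> H" "p (y * h) \<noteq> 0" using o(2)[OF y(1)] C(2) by blast
        have "y * h \<in> C" unfolding y(2) by (rule lcosetI[OF h(1)])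
        then have "y * h \<in> \<Union>A" by (rule UnionI[OF C(1)])
        then show False using p(2) h(2) by blast
      qed
    qed
  }
  {
    assume z: "g \<in> zc ?m (\<Union>A)"
    show "lcoset n H g \<in> quotient_zariski n H closure_of A"
      unfolding in_closure_of
    proof (intro conjI allI impI)
      show "lcoset n H g \<in> topspace (quotient_zariski n H)" using g by (simp add: quotient_space_image)
      fix T assume T: "lcoset n H g \<in> T \<and> openin (quotient_zariski n H) T"
      then obtain p where p: "regular ?m p" "p g \<noteq> 0" "\<forall>y\<in>GG ?m. p y \<noteq> 0 \<longrightarrow> lcoset n H y \<in> T"
        using quot_openD[OF _ g] by blast
      obtain y where y: "y \<in> \<Union>A" "p y \<noteq> 0" using zc_D[OF z p(1)] p(2) by blast
      then have "lcoset n H y \<in> T" using p(3) AG by blast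
      moreover have "lcoset n H y \<in> A" using U(3)[OF AG[OF y(1)]] y(1) by blast
      ultimately show "\<exists>y. y \<in> A \<and> y \<in> T" by blast
    qed
  }
qed

section \<open>Orbits on the flag variety\<close>

definition orb :: "nat \<Rightarrow> (nat \<Rightarrow> nat) \<Rightarrow> complex mat set set" where
  "orb n b = lcoset n (borel n) ` stratum n b"

lemma rstable_stratum: "rstable n (borel n) (stratum n b)"
  using stratum_SL by (auto simp: rstable_def)

lemma Union_orb: "\<Union>(orb n b) = stratum n b"
  unfolding orb_def by (rule Union_lcoset_image[OF subgrp_borel rstable_stratum])

lemma lcoset_in_orb: "g \<in> GG (2 * n) \<Longrightarrow> lcoset n (borel n) g \<in> orb n b \<longleftrightarrow> g \<in> stratum n b"
  unfolding orb_def by (rule lcoset_in_image[OF subgrp_borel rstable_stratum])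

lemma orb_subset: "orb n b \<subseteq> flag_variety n"
  unfolding orb_def quotient_space_image using stratum_SL by blast

lemma left_lcoset: "k \<in> GG (2 * n) \<Longrightarrow> g \<in> GG (2 * n) \<Longrightarrow> H \<subseteq> GG (2 * n) \<Longrightarrow> k <#\<^bsub>grp n\<^esub> (lcoset n H g) = lcoset n H (k * g)"
  unfolding coset_mem image_image by (intro image_cong refl) (simp add: SL_assoc[of _ "2 * n"] subset_iff)

lemma K_orbit_eq:
  assumes b: "b \<in> fpf_involutions n" and x: "x \<in> stratum n b"
  shows "K_orbit n x = orb n b"
proof -
  have BG: "borel n \<subseteq> GG (2 * n)" using borel_SL by blast
  have xG: "x \<in> GG (2 * n)" using stratum_SL[OF x] .
  have e: "K_orbit n x = {lcoset n (borel n) (k * x) | k. k \<in> Sp n}"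
    unfolding K_orbit_def using left_lcoset[OF Sp_SL xG BG] by blast
  show ?thesis
  proof
    show "K_orbit n x \<subseteq> orb n b" unfolding e orb_def using x by blast
    show "orb n b \<subseteq> K_orbit n x"
    proof
      fix C assume "C \<in> orb n b"
      then obtain y where y: "y \<in> stratum n b" "C = lcoset n (borel n) y" unfolding orb_def by blast
      obtain k \<beta> where k: "k \<in> Sp n" "\<beta> \<in> borel n" "y = k * x * \<beta>" using stratum_transitive[OF x y(1) b] .
      have "C = lcoset n (borel n) (k * x)" unfolding y(2) k(3) using lcoset_mult[OF subgrp_borel _ k(2)] xG Sp_SL[OF k(1)] by simp
      then show "C \<in> K_orbit n x" unfolding e using k(1) by blast
    qed
  qed
qed

lemma K_orbits_eq: "K_orbits n = orb n ` fpf_involutions n"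
proof
  show "K_orbits n \<subseteq> orb n ` fpf_involutions n"
    unfolding K_orbits_def using stratum_cover K_orbit_eq by fastforce
  show "orb n ` fpf_involutions n \<subseteq> K_orbits n"
  proof
    fix Q assume "Q \<in> orb n ` fpf_involutions n"
    then obtain b where b: "b \<in> fpf_involutions n" "Q = orb n b" by blast
    obtain x where x: "x \<in> stratum n b" using stratum_nonempty[OF b(1)] by blast
    show "Q \<in> K_orbits n" unfolding K_orbits_def b(2) using K_orbit_eq[OF b(1) x] stratum_SL[OF x] by blast
  qed
qed

lemma orb_inj:
  assumes "b \<in> fpf_involutions n" "c \<in> fpf_involutions n" "orb n b = orb n c"
  shows "b = c"
proof -
  obtain x where x: "x \<in> stratum n b" using stratum_nonempty[OF assms(1)] by blast
  then have "x \<in> stratum n c" using arg_cong[OF assms(3), of Union] unfolding Union_orb by simp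
  then show ?thesis using stratum_disjoint x assms by blast
qed

lemma orb_closure_iff:
  "g \<in> GG (2 * n) \<Longrightarrow> lcoset n (borel n) g \<in> flag_zariski n closure_of orb n b \<longleftrightarrow> g \<in> zc (2 * n) (stratum n b)"
  using quot_closure_iff[OF subgrp_borel orb_subset] unfolding Union_orb .

subsection \<open>The Krull dimension of an orbit\<close>

lemma closedin_orb_iff:
  assumes Z: "Z \<subseteq> orb n b"
  shows "closedin (subtopology (flag_zariski n) (orb n b)) Z \<longleftrightarrow> zc (2 * n) (\<Union>Z) \<inter> stratum n b \<subseteq> \<Union>Z"
proof -
  have ZF: "Z \<subseteq> flag_variety n" using Z orb_subset by blast
  note U = Union_quotient_subset[OF subgrp_borel ZF]
  note cl = quot_closure_iff[OF subgrp_borel ZF]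
  show ?thesis
  proof
    assume "closedin (subtopology (flag_zariski n) (orb n b)) Z"
    then obtain T where T: "closedin (flag_zariski n) T" "Z = T \<inter> orb n b" unfolding closedin_subtopology by blast
    have cT: "flag_zariski n closure_of Z \<subseteq> T" using T by (simp add: closure_of_minimal)
    show "zc (2 * n) (\<Union>Z) \<inter> stratum n b \<subseteq> \<Union>Z"
    proof
      fix g assume g: "g \<in> zc (2 * n) (\<Union>Z) \<inter> stratum n b"
      then have gG: "g \<in> GG (2 * n)" using stratum_SL by blast
      have "lcoset n (borel n) g \<in> T" using cl[OF gG] g cT by blast
      moreover have "lcoset n (borel n) g \<in> orb n b" using lcoset_in_orb[OF gG] g by blast
      ultimately show "g \<in> \<Union>Z" using U(3)[OF gG] T(2) by blast
    qed
  next
    assume s: "zc (2 * n) (\<Union>Z) \<inter> stratum n b \<subseteq> \<Union>Z"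
    have "Z = (flag_zariski n closure_of Z) \<inter> orb n b"
    proof
      show "Z \<subseteq> (flag_zariski n closure_of Z) \<inter> orb n b" using Z ZF closure_of_subset[of Z "flag_zariski n"] by simp
      show "(flag_zariski n closure_of Z) \<inter> orb n b \<subseteq> Z"
      proof
        fix C assume C: "C \<in> (flag_zariski n closure_of Z) \<inter> orb n b"
        then obtain g where g: "g \<in> stratum n b" "C = lcoset n (borel n) g" unfolding orb_def by (auto elim: imageE)
        have gG: "g \<in> GG (2 * n)" using stratum_SL[OF g(1)] .
        have "g \<in> zc (2 * n) (\<Union>Z)" using cl[OF gG] C g(2) by blast
        then show "C \<in> Z" using U(3)[OF gG] g s by blast
      qed
    qed
    then show "closedin (subtopology (flag_zariski n) (orb n b)) Z"
      unfolding closedin_subtopology using closedin_closure_of by blast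
  qed
qed

text \<open>From the orbit to its preimage, irreducibility of \<open>B\<close> enters: if
  \<open>p * q\<close> vanishes on the preimage, then on each coset one factor vanishes identically.
  The cosets of either kind form two closed sets that cover \<open>Z\<close>.\<close>

lemma irreducible_orb_iff:
  assumes n: "n > 0" and Z: "Z \<subseteq> orb n b"
  shows "irreducible_in (subtopology (flag_zariski n) (orb n b)) Z \<longleftrightarrow> irr (2 * n) (\<Union>Z)"
proof -
  let ?m = "2 * n" let ?B = "borel n" let ?X = "flag_zariski n"
  have ZF: "Z \<subseteq> flag_variety n" using Z orb_subset by blast
  note U = Union_quotient_subset[OF subgrp_borel ZF]
  have WG: "g \<in> GG ?m" if "g \<in> \<Union>Z" for g using U(1) that unfolding rstable_def by blast
  have top: "topspace (subtopology ?X (orb n b)) = orb n b" using orb_subset[of n b] by (auto simp: topspace_subtopology)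
  have one: "1\<^sub>m ?m \<in> ?B" by simp
  show ?thesis
  proof
    assume I: "irreducible_in (subtopology ?X (orb n b)) Z"
    have ne: "Z \<noteq> {}" and I': "\<And>C D. closedin (subtopology ?X (orb n b)) C \<Longrightarrow> closedin (subtopology ?X (orb n b)) D \<Longrightarrow> Z \<subseteq> C \<union> D \<Longrightarrow> Z \<subseteq> C \<or> Z \<subseteq> D"
      using I unfolding irreducible_in_def by blast+
    show "irr ?m (\<Union>Z)"
      unfolding irr_def
    proof (intro conjI allI impI)
      show "\<Union>Z \<subseteq> carrier_mat ?m ?m" using WG SL_mat by blast
      show "\<Union>Z \<noteq> {}" using ne U(2) by blast
      fix p q assume p: "regular ?m p" and q: "regular ?m q" and z: "\<forall>x\<in>\<Union>Z. p x * q x = 0"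
      let ?D = "quot_nonvanishing n ?B"
      let ?C = "\<lambda>p. (flag_variety n - ?D p) \<inter> orb n b"
      have cl: "closedin (subtopology ?X (orb n b)) (?C p)" if "regular ?m p" for p
      proof -
        have "closedin ?X (topspace ?X - ?D p)" by (rule closedin_diff[OF closedin_topspace quot_open_nonvanishing(1)[OF subgrp_borel that]])
        then show ?thesis unfolding closedin_subtopology topspace_quotient by blast
      qed
      have mem: "lcoset n ?B g \<in> ?C p \<longleftrightarrow> (\<forall>h\<in>?B. p (g * h) = 0)" if "regular ?m p" "g \<in> \<Union>Z" for p g
        using quot_open_nonvanishing(2)[OF subgrp_borel that(1) WG[OF that(2)]] U(3)[OF WG[OF that(2)]] that(2) Z ZF by blast
      have "Z \<subseteq> ?C p \<union> ?C q"
      proof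
        fix C assume C: "C \<in> Z"
        then have "C \<in> lcoset n ?B ` \<Union>Z" unfolding U(2) .
        then obtain g where g: "g \<in> \<Union>Z" "C = lcoset n ?B g" by (rule imageE)
        have rx: "rmap ?m (\<lambda>y. g * y)" using SL_mat[OF WG[OF g(1)]] by (intro rmap_mult rmap_id rmap_const)
        have "p (g * \<beta>) = 0 \<or> q (g * \<beta>) = 0" if "\<beta> \<in> ?B" for \<beta>
        proof -
          have "g * \<beta> \<in> \<Union>Z" using U(1) g(1) that unfolding rstable_def by blast
          then show ?thesis using z by auto
        qed
        from irr_D[OF irr_borel[OF n] regular_comp[OF p rx] regular_comp[OF q rx] this]
        show "C \<in> ?C p \<union> ?C q" unfolding g(2) using mem[OF p g(1)] mem[OF q g(1)] by blast
      qed
      from I'[OF cl[OF p] cl[OF q] this]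
      have "(\<forall>g\<in>\<Union>Z. \<forall>h\<in>?B. p (g * h) = 0) \<or> (\<forall>g\<in>\<Union>Z. \<forall>h\<in>?B. q (g * h) = 0)"
        using mem[OF p] mem[OF q] U(3)[OF WG] by blast
      then have "(\<forall>g\<in>\<Union>Z. p (g * 1\<^sub>m ?m) = 0) \<or> (\<forall>g\<in>\<Union>Z. q (g * 1\<^sub>m ?m) = 0)" using one by blast
      then show "(\<forall>x\<in>\<Union>Z. p x = 0) \<or> (\<forall>x\<in>\<Union>Z. q x = 0)" using WG by simp
    qed
  next
    assume I: "irr ?m (\<Union>Z)"
    show "irreducible_in (subtopology ?X (orb n b)) Z"
      unfolding irreducible_in_def top
    proof (intro conjI allI impI Z)
      show "Z \<noteq> {}" using I by (auto simp: irr_def)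
      fix C D assume cC: "closedin (subtopology ?X (orb n b)) C" and cD: "closedin (subtopology ?X (orb n b)) D" and cov: "Z \<subseteq> C \<union> D"
      from cC obtain C' where C: "closedin ?X C'" "C = C' \<inter> orb n b" unfolding closedin_subtopology by (elim exE conjE) (rule that)
      from cD obtain D' where D: "closedin ?X D'" "D = D' \<inter> orb n b" unfolding closedin_subtopology by (elim exE conjE) (rule that)
      have sep: "\<exists>p g. regular ?m p \<and> g \<in> \<Union>Z \<and> p g \<noteq> 0 \<and> (\<forall>y\<in>GG ?m. p y \<noteq> 0 \<longrightarrow> lcoset n ?B y \<notin> E')"
        if E: "closedin ?X E'" "E = E' \<inter> orb n b" "\<not> Z \<subseteq> E" for E E'
      proof -
        from E(3) obtain Q where Q: "Q \<in> Z" "Q \<notin> E" by (auto simp: subset_iff)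
        then have "Q \<in> lcoset n ?B ` \<Union>Z" unfolding U(2) by simp
        then obtain g where g: "g \<in> \<Union>Z" "lcoset n ?B g \<notin> E" using Q(2) by (elim imageE) simp
        have gz: "lcoset n ?B g \<in> Z" using U(3)[OF WG[OF g(1)]] g(1) by blast
        then have "lcoset n ?B g \<in> topspace ?X - E'" using g(2) E(2) Z ZF by auto
        from quot_openD[OF openin_diff[OF openin_topspace E(1)] WG[OF g(1)] this]
        obtain p where "regular ?m p" "p g \<noteq> 0" "\<forall>y\<in>GG ?m. p y \<noteq> 0 \<longrightarrow> lcoset n ?B y \<in> topspace ?X - E'"
          by (elim exE conjE) (rule that)
        then show ?thesis using g(1) by (intro exI[of _ p] exI[of _ g]) simp
      qed
      show "Z \<subseteq> C \<or> Z \<subseteq> D"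
      proof (rule ccontr)
        assume "\<not> ?thesis"
        then have nC: "\<not> Z \<subseteq> C" and nD: "\<not> Z \<subseteq> D" by simp_all
        from sep[OF C nC] sep[OF D nD] obtain p g q h where p: "regular ?m p" "g \<in> \<Union>Z" "p g \<noteq> 0" "\<forall>y\<in>GG ?m. p y \<noteq> 0 \<longrightarrow> lcoset n ?B y \<notin> C'"
          and q: "regular ?m q" "h \<in> \<Union>Z" "q h \<noteq> 0" "\<forall>y\<in>GG ?m. q y \<noteq> 0 \<longrightarrow> lcoset n ?B y \<notin> D'"
          by (elim exE conjE) (rule that)
        obtain y where y: "y \<in> \<Union>Z" "p y \<noteq> 0" "q y \<noteq> 0" using irr_two_points[OF I p(1) q(1) p(2,3) q(2,3)] by blast
        have "lcoset n ?B y \<in> Z" using U(3)[OF WG[OF y(1)]] y(1) by blast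
        then have "lcoset n ?B y \<in> C' \<or> lcoset n ?B y \<in> D'" using cov unfolding C(2) D(2) by (auto simp: subset_iff)
        moreover have "lcoset n ?B y \<notin> C'" "lcoset n ?B y \<notin> D'" using p(4) q(4) y(2,3) WG[OF y(1)] by simp_all
        ultimately show False by simp
      qed
    qed
  qed
qed

text \<open>Preimages turn a chain of irreducible closed subsets of the orbit into a
  \<open>zchain\<close>. Conversely each member of a \<open>zchain\<close> is replaced by the image
  of its closure within the stratum, and the separating functions keep the inclusions
  strict.\<close>

lemma orbit_dim_orb:
  assumes n: "n > 0" and b: "b \<in> fpf_involutions n"
  shows "orbit_dim n (orb n b) = enat (stratum_dim n b)"
proof -
  let ?m = "2 * n" let ?B = "borel n" let ?X = "subtopology (flag_zariski n) (orb n b)" let ?S = "stratum n b"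
  let ?P = "\<lambda>Z d. (\<forall>k\<le>d. closedin ?X (Z k) \<and> irreducible_in ?X (Z k)) \<and> (\<forall>k<d. Z k \<subset> Z (Suc k))"
  have top: "topspace ?X = orb n b" using orb_subset[of n b] by (auto simp: topspace_subtopology)
  have le: "d \<le> stratum_dim n b" if P: "?P Z d" for Z :: "nat \<Rightarrow> complex mat set set" and d
  proof -
    have Zs: "Z k \<subseteq> orb n b" if "k \<le> d" for k using P that closedin_subset[of ?X "Z k"] top by blast
    have ZF: "Z k \<subseteq> flag_variety n" if "k \<le> d" for k using Zs[OF that] orb_subset by blast
    have irr: "irr ?m (\<Union>(Z k))" if "k \<le> d" for k using irreducible_orb_iff[OF n Zs[OF that]] P that by blast
    have adm: "adm n ?S (\<Union>(Z k))" if "k \<le> d" for k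
      using Union_quotient_subset(1)[OF subgrp_borel ZF[OF that]] Union_mono[OF Zs[OF that]] unfolding Union_orb adm_def rstable_def by blast
    have "zchain ?m (adm n ?S) (\<Union>(Z k)) k" if "k \<le> d" for k
      using that
    proof (induction k)
      case 0
      show ?case by (rule zchain.base) (rule irr[OF 0], rule adm[OF 0])
    next
      case (Suc k)
      then have k: "k \<le> d" "k < d" by auto
      have sub: "Z k \<subset> Z (Suc k)" using P k by blast
      then obtain C where C: "C \<in> Z (Suc k)" "C \<notin> Z k" by blast
      have "C \<in> lcoset n ?B ` \<Union>(Z (Suc k))" using C(1) Union_quotient_subset(2)[OF subgrp_borel ZF[OF Suc.prems]] by simp
      then obtain g where g: "g \<in> \<Union>(Z (Suc k))" "C = lcoset n ?B g" by (elim imageE)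
      have gS: "g \<in> ?S" using g(1) adm[OF Suc.prems] unfolding adm_def by blast
      have gG: "g \<in> GG ?m" using stratum_SL[OF gS] .
      have "g \<notin> \<Union>(Z k)" using Union_quotient_subset(3)[OF subgrp_borel ZF[OF k(1)] gG] C(2) g(2) by blast
      moreover have "zc ?m (\<Union>(Z k)) \<inter> ?S \<subseteq> \<Union>(Z k)" using closedin_orb_iff[OF Zs[OF k(1)]] P k by blast
      ultimately have "g \<notin> zc ?m (\<Union>(Z k))" using gS by blast
      then obtain p where p: "regular ?m p" "\<And>x. x \<in> \<Union>(Z k) \<Longrightarrow> p x = 0" "p g \<noteq> 0"
        using SL_mat[OF gG] unfolding zc_def by blast
      have "\<Union>(Z k) \<subseteq> \<Union>(Z (Suc k))" using sub by blast
      from zchain.step[OF Suc.IH[OF k(1)] irr[OF Suc.prems] adm[OF Suc.prems] this p(1) p(2) g(1) p(3)] show ?case .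
    qed
    from stratum_dim(2)[OF n b this[OF order_refl]] show ?thesis .
  qed
  have ex: "\<exists>Z. ?P Z k \<and> Z k = lcoset n ?B ` (zc ?m S \<inter> ?S)" if "zchain ?m (adm n ?S) S k" for S k
    using that
  proof induction
    let ?Z = "\<lambda>S. lcoset n ?B ` (zc ?m S \<inter> ?S)"
    have Z: "?Z S \<subseteq> orb n b" "\<Union>(?Z S) = zc ?m S \<inter> ?S" "closedin ?X (?Z S)" "irreducible_in ?X (?Z S)" "rstable n ?B (zc ?m S \<inter> ?S)"
      if S: "irr ?m S" "adm n ?S S" for S
    proof -
      have "x * \<beta> \<in> zc ?m S" if "x \<in> zc ?m S" "\<beta> \<in> ?B" for x \<beta>
        by (rule zc_right[of x ?m S]) (use that S(2) borel_SL in \<open>auto simp: adm_def\<close>)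
      then show r: "rstable n ?B (zc ?m S \<inter> ?S)" using stratum_SL by (auto simp: rstable_def)
      show 1: "?Z S \<subseteq> orb n b" unfolding orb_def by blast
      show 2: "\<Union>(?Z S) = zc ?m S \<inter> ?S" by (rule Union_lcoset_image[OF subgrp_borel r])
      have "zc ?m (zc ?m S \<inter> ?S) \<subseteq> zc ?m S" by (rule zc_closed) blast
      then show "closedin ?X (?Z S)" unfolding closedin_orb_iff[OF 1] 2 by blast
      have "S \<subseteq> zc ?m S \<inter> ?S" using S zc_superset[of S ?m] by (auto simp: irr_def adm_def)
      then have "irr ?m (zc ?m S \<inter> ?S)" by (rule irr_dense[OF S(1)]) blast
      then show "irreducible_in ?X (?Z S)" unfolding irreducible_orb_iff[OF n 1] 2 .
    qed
    {
      case (base S)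
      show ?case by (rule exI[of _ "\<lambda>_. ?Z S"]) (use Z[OF base] in auto)
    next
      case (step S k S' f y)
      then obtain Y where Y: "?P Y k" "Y k = ?Z S" by blast
      have S: "irr ?m S" "adm n ?S S" using zchain_irr[OF step(1)] zchain_adm[OF step(1)] .
      have SZ: "?Z S \<subseteq> ?Z S'" using zc_mono[OF step(4), of ?m] by blast
      have yS: "y \<in> ?S" "y \<in> zc ?m S'"
        using step(2,3,7) zc_superset[of S' ?m] by (auto simp: irr_def adm_def)
      have yG: "y \<in> GG ?m" using stratum_SL[OF yS(1)] .
      have "y \<notin> zc ?m S" using zc_D[OF _ step(5,6)] step(8) by blast
      then have "lcoset n ?B y \<notin> ?Z S" using lcoset_in_image[OF subgrp_borel Z(5)[OF S] yG] by blast
      then have lt: "?Z S \<subset> ?Z S'" using SZ yS by blast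
      let ?Y = "Y(Suc k := ?Z S')"
      have "?P ?Y (Suc k)"
      proof (intro conjI allI impI)
        fix j assume "j \<le> Suc k"
        then show "closedin ?X (?Y j)" "irreducible_in ?X (?Y j)" using Y(1) Z(3,4)[OF step(2,3)] by (cases "j = Suc k"; simp)+
      next
        fix j assume "j < Suc k"
        then show "?Y j \<subset> ?Y (Suc j)" using Y lt by (cases "j = k") auto
      qed
      then show ?case by (intro exI[of _ ?Y]) simp
    }
  qed
  obtain S where "zchain ?m (adm n ?S) S (stratum_dim n b)" using stratum_dim(1)[OF n b] by blast
  from ex[OF this] have E: "\<exists>Z. ?P Z (stratum_dim n b)" by blast
  show ?thesis
    unfolding orbit_dim_def krull_dim_def
  proof (rule antisym)
    show "Sup {enat d | d. \<exists>Z. ?P Z d} \<le> enat (stratum_dim n b)" by (rule Sup_least) (use le in auto)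
    show "enat (stratum_dim n b) \<le> Sup {enat d | d. \<exists>Z. ?P Z d}" by (rule Sup_upper) (use E in blast)
  qed
qed

section \<open>The involution and the Richardson--Springer map\<close>

lemma Jnn_Jnn: "Jnn n * Jnn n = (- 1) \<cdot>\<^sub>m 1\<^sub>m (2 * n)"
proof (rule square_eqI[of _ "2 * n"])
  fix r s assume r: "r < 2 * n" and s: "s < 2 * n"
  have "(Jnn n * Jnn n) $$ (r, s) = (\<Sum>k<2 * n. if k = w0 n r then jsgn n r * Jnn n $$ (w0 n r, s) else 0)"
    unfolding mult_index[OF Jnn_carrier Jnn_carrier r s] using r s by (intro sum.cong) (auto simp: Jnn_index)
  also have "\<dots> = jsgn n r * Jnn n $$ (w0 n r, s)" using r by simp
  also have "\<dots> = (if r = s then jsgn n r * jsgn n (w0 n r) else 0)"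
    using r s by (auto simp: Jnn_index w0_simps)
  also have "\<dots> = (if r = s then - 1 else 0)" using r by (simp add: jsgn_w0) (simp add: jsgn_def)
  finally show "(Jnn n * Jnn n) $$ (r, s) = ((- 1) \<cdot>\<^sub>m 1\<^sub>m (2 * n)) $$ (r, s)" using r s by simp
qed (simp_all add: mult_carrier_mat[OF Jnn_carrier Jnn_carrier])

lemma Jnn_Jnn_central:
  assumes "x \<in> GG (2 * n)"
  shows "Jnn n * (Jnn n * x) = x * (Jnn n * Jnn n)"
proof -
  note x = SL_mat[OF assms]
  have "Jnn n * (Jnn n * x) = Jnn n * Jnn n * x" by (rule mat_assoc[OF Jnn_carrier Jnn_carrier x, symmetric])
  then show ?thesis
    unfolding Jnn_Jnn using mult_smult_assoc_mat[OF one_carrier_mat x, of "- 1"] mult_smult_distrib[OF x one_carrier_mat, of "- 1"] x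
    by simp
qed

lemma transpose_mult_SL: "x \<in> GG m \<Longrightarrow> y \<in> GG m \<Longrightarrow> transpose_mat (x * y) = transpose_mat y * transpose_mat x"
  by (rule transpose_mult[OF SL_mat SL_mat])

lemma SL_inv_transpose:
  assumes x: "x \<in> GG m"
  shows "minv m (transpose_mat x) = transpose_mat (minv m x)"
proof (rule SL_inv_eq)
  have "transpose_mat (minv m x) * transpose_mat x = transpose_mat (x * minv m x)"
    using x by (simp only: transpose_mult_SL SL_inv)
  then show "transpose_mat (minv m x) * transpose_mat x = 1\<^sub>m m" using x by simp
qed (use x in auto)

lemma theta_SL [simp, intro]: "s \<in> GG (2 * n) \<Longrightarrow> theta n s \<in> GG (2 * n)"
  unfolding theta_def using Jnn_in_SL[of n] by auto

text \<open>Rests on \<open>Jnn n\<close> having a scalar square. Together with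
  \<open>theta_eqI\<close> it describes \<open>theta n s\<close> as the only solution of an equation
  without inverses.\<close>

lemma theta_form:
  assumes s: "s \<in> GG (2 * n)"
  shows "transpose_mat s * Jnn n * theta n s = Jnn n"
proof -
  let ?X = "transpose_mat s" and ?J = "Jnn n" and ?m = "2 * n"
  have X: "?X \<in> GG ?m" and J: "?J \<in> GG ?m" using s Jnn_in_SL by auto
  have "?X * ?J * theta n s = ?X * (?J * (?J * (minv ?m ?X * minv ?m ?J)))"
    unfolding theta_def SL_inv_transpose[OF s, symmetric] using X J by (simp add: SL_assoc[of _ ?m])
  also have "\<dots> = ?X * (minv ?m ?X * minv ?m ?J * (?J * ?J))"
    using X J by (simp add: Jnn_Jnn_central)
  also have "\<dots> = ?J" using X J by (simp add: SL_assoc[of _ ?m])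
  finally show ?thesis .
qed

lemma theta_eqI:
  assumes s: "s \<in> GG (2 * n)" and h: "h \<in> GG (2 * n)" and e: "transpose_mat s * Jnn n * h = Jnn n"
  shows "theta n s = h"
proof -
  let ?Y = "transpose_mat s * Jnn n"
  have Y: "?Y \<in> GG (2 * n)" using s Jnn_in_SL by auto
  have "theta n s = minv (2 * n) ?Y * (?Y * theta n s)" by (rule SL_cancel(1)[OF Y theta_SL[OF s], symmetric])
  also have "\<dots> = minv (2 * n) ?Y * (?Y * h)" unfolding theta_form[OF s] e ..
  also have "\<dots> = h" by (rule SL_cancel(1)[OF Y h])
  finally show ?thesis .
qed

lemma gram_theta:
  assumes g: "g \<in> GG (2 * n)"
  shows "gram n (minv (2 * n) g) * (g * minv (2 * n) (theta n g)) = Jnn n"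
proof -
  let ?m = "2 * n" and ?X = "transpose_mat (minv (2 * n) g)" and ?J = "Jnn n"
  have X: "?X \<in> GG ?m" and J: "?J \<in> GG ?m" and T: "theta n g \<in> GG ?m" using g Jnn_in_SL by auto
  have XX: "?X = minv ?m (transpose_mat g)" using SL_inv_transpose[OF g] by simp
  have "?X * ?J = ?J * theta n g"
  proof -
    have "?X * ?J = ?X * (transpose_mat g * ?J * theta n g)" unfolding theta_form[OF g] ..
    also have "\<dots> = ?J * theta n g" unfolding XX using g J T by (simp add: SL_assoc[of _ ?m])
    finally show ?thesis .
  qed
  then have "?X * ?J * minv ?m (theta n g) = ?J" using J T by simp
  moreover have "gram n (minv ?m g) * (g * minv ?m (theta n g)) = ?X * ?J * minv ?m (theta n g)"
    unfolding gram_def using g X J T by (simp add: SL_assoc[of _ ?m])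
  ultimately show ?thesis by simp
qed

lemma monomial_type_zero: "monomial_type n b Y \<Longrightarrow> r < 2 * n \<Longrightarrow> c < 2 * n \<Longrightarrow> r \<noteq> b c \<Longrightarrow> Y $$ (r, c) = 0"
  unfolding monomial_type_def by blast

lemma monomial_mult_index:
  assumes Y: "Y \<in> carrier_mat (2 * n) (2 * n)" and z: "z \<in> carrier_mat (2 * n) (2 * n)" and b: "b \<in> fpf_involutions n"
    and t: "monomial_type n b Y" and r: "r < 2 * n" and j: "j < 2 * n"
  shows "(Y * z) $$ (r, j) = Y $$ (r, b r) * z $$ (b r, j)"
proof -
  have "Y $$ (r, k) = 0" if "k < 2 * n" "k \<noteq> b r" for k
  proof -
    have "r \<noteq> b k" using that(2) fpfD(2)[OF b, of k] by auto
    then show ?thesis by (rule monomial_type_zero[OF t r that(1)])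
  qed
  then have "(Y * z) $$ (r, j) = (\<Sum>k<2 * n. if k = b r then Y $$ (r, b r) * z $$ (b r, j) else 0)"
    unfolding mult_index[OF Y z r j] by (intro sum.cong) auto
  then show ?thesis using fpfD(4)[OF b] r by simp
qed

lemma mult_eq_Jnn_pattern:
  assumes Y: "Y \<in> carrier_mat (2 * n) (2 * n)" and z: "z \<in> carrier_mat (2 * n) (2 * n)" and b: "b \<in> fpf_involutions n"
    and t: "monomial_type n b Y" and e: "Y * z = Jnn n" and i: "i < 2 * n" and j: "j < 2 * n"
  shows "z $$ (i, j) \<noteq> 0 \<longleftrightarrow> i = (b \<circ> w0 n) j"
proof -
  have bi: "b i < 2 * n" "b (b i) = i" using fpfD(2,4)[OF b] i by auto
  have ne: "Y $$ (b i, i) \<noteq> 0" using t bi i unfolding monomial_type_def by blast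
  have "Y $$ (b i, i) * z $$ (i, j) = Jnn n $$ (b i, j)"
    using monomial_mult_index[OF Y z b t bi(1) j] unfolding e bi(2) by simp
  then have "z $$ (i, j) \<noteq> 0 \<longleftrightarrow> Jnn n $$ (b i, j) \<noteq> 0" using ne by auto
  also have "\<dots> \<longleftrightarrow> j = w0 n (b i)" using bi j by (simp add: Jnn_index jsgn_def)
  also have "\<dots> \<longleftrightarrow> i = b (w0 n j)" using bi(2) fpfD(2)[OF b, of "w0 n j"] w0_simps(2)[of n j] w0_simps(2)[of n "b i"] by auto
  finally show ?thesis by simp
qed

text \<open>The converse of \<open>mult_eq_Jnn_pattern\<close>, which makes the value of the
  Richardson-Springer map unique. The permutation of the Gram matrix is an involution because that
  matrix is skew, and has no fixed point because its diagonal is zero.\<close>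

lemma pattern_monomial_type:
  assumes x: "x \<in> GG (2 * n)" and z: "z \<in> carrier_mat (2 * n) (2 * n)" and w: "w permutes {..<2 * n}"
    and e: "gram n x * z = Jnn n" and p: "\<forall>i<2 * n. \<forall>j<2 * n. z $$ (i, j) \<noteq> 0 \<longleftrightarrow> i = w j"
  obtains u where "u \<in> fpf_involutions n" "monomial_type n u (gram n x)" "w = u \<circ> w0 n"
proof -
  let ?m = "2 * n" let ?Y = "gram n x" let ?u = "w0 n \<circ> inv_into UNIV w"
  have Yc: "?Y \<in> carrier_mat ?m ?m" using SL_mat[OF x] by simp
  have wl: "w j < ?m" if "j < ?m" for j using permutes_in_image[OF w, of j] that by simp
  have iwl: "inv_into UNIV w j < ?m" if "j < ?m" for j using permutes_in_image[OF permutes_inv[OF w], of j] that by simp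
  have wi: "w (inv_into UNIV w j) = j" "inv_into UNIV w (w j) = j" for j using permutes_inverses[OF w] by auto
  have ul: "?u j < ?m" if "j < ?m" for j using iwl[OF that] by simp
  have Y0: "?Y $$ (r, c) \<noteq> 0 \<longleftrightarrow> r = ?u c" if r: "r < ?m" and c: "c < ?m" for r c
  proof -
    let ?j = "inv_into UNIV w c"
    have j: "?j < ?m" by (rule iwl[OF c])
    have "Jnn n $$ (r, ?j) = (\<Sum>k<?m. if k = c then ?Y $$ (r, c) * z $$ (c, ?j) else 0)"
      unfolding e[symmetric] mult_index[OF Yc z r j] using p j wi(1) by (intro sum.cong) auto
    then have "Jnn n $$ (r, ?j) = ?Y $$ (r, c) * z $$ (c, ?j)" using c by simp
    moreover have "z $$ (c, ?j) \<noteq> 0" using p c j wi(1)[of c] by simp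
    ultimately have "?Y $$ (r, c) \<noteq> 0 \<longleftrightarrow> Jnn n $$ (r, ?j) \<noteq> 0" by auto
    also have "\<dots> \<longleftrightarrow> ?j = w0 n r" using r j by (simp add: Jnn_index jsgn_def)
    also have "\<dots> \<longleftrightarrow> r = ?u c" using w0_simps(2)[of n r] w0_simps(2)[of n ?j] by auto
    finally show ?thesis .
  qed
  have t: "monomial_type n ?u ?Y" unfolding monomial_type_def using Y0 by blast
  have p: "?u permutes {..<?m}" by (rule permutes_compose[OF permutes_inv[OF w] w0_permutes])
  have uu: "?u (?u c) = c" for c
  proof (cases "c < ?m")
    case True
    have "?Y $$ (?u c, c) \<noteq> 0" using Y0[OF ul[OF True] True] by simp
    then have "?Y $$ (c, ?u c) \<noteq> 0" using gram_skew[OF SL_mat[OF x] True ul[OF True]] by simp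
    then show ?thesis using Y0[OF True ul[OF True]] by simp
  next
    case False
    then show ?thesis using permutes_not_in[OF p, of c] by simp
  qed
  have "?u c \<noteq> c" if c: "c < ?m" for c
    using Y0[OF c c] gram_diag[OF SL_mat[OF x] c] by auto
  then have "?u \<in> fpf_involutions n" unfolding fpf_involutions_def using p uu by (auto simp: fun_eq_iff)
  moreover have "w = ?u \<circ> w0 n"
  proof
    fix j
    have "?u (w j) = w0 n j" using wi(2)[of j] by simp
    then show "w j = (?u \<circ> w0 n) j" using uu[of "w j"] by simp
  qed
  ultimately show ?thesis using t that by blast
qed

section \<open>Monomial matrices normalise the torus\<close>

lemma diagonal_conj:
  assumes z: "z \<in> GG m" and d: "\<And>i j. i < m \<Longrightarrow> j < m \<Longrightarrow> z $$ (i, j) \<noteq> 0 \<Longrightarrow> d i = d' j"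
  shows "mat_diag m d * z = z * mat_diag m d'"
  unfolding mat_diag_mult_left[OF SL_mat[OF z]] mat_diag_mult_right[OF SL_mat[OF z]]
  using d by (intro eq_matI) (auto simp: mult.commute)

lemma torus_iff: "t \<in> torus n \<longleftrightarrow> (\<exists>d. t = mat_diag (2 * n) d \<and> (\<Prod>i<2 * n. d i) = 1)"
proof
  assume "t \<in> torus n"
  then have t: "t \<in> GG (2 * n)" and o: "diagonal_mat t" by (auto simp: torus_def)
  then have "t \<in> borel n" using SL_dim[OF t] by (auto simp: borel_def diagonal_mat_def)
  note p = borel_diag_prod[OF this]
  have "t = mat_diag (2 * n) (\<lambda>i. t $$ (i, i))"
    using o SL_dim[OF t] by (intro eq_matI) (auto simp: mat_diag_def diagonal_mat_def)
  with p show "\<exists>d. t = mat_diag (2 * n) d \<and> (\<Prod>i<2 * n. d i) = 1" by blast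
next
  assume "\<exists>d. t = mat_diag (2 * n) d \<and> (\<Prod>i<2 * n. d i) = 1"
  then obtain d where t: "t = mat_diag (2 * n) d" and d: "(\<Prod>i<2 * n. d i) = 1" by blast
  have "det t = prod_list (diag_mat t)"
    by (rule det_lower_triangular[of "2 * n"]) (auto simp: t mat_diag_def)
  also have "\<dots> = (\<Prod>i<2 * n. t $$ (i, i))"
    by (simp add: prod_list_diag_prod atLeast0LessThan t mat_diag_def)
  also have "\<dots> = 1" unfolding d[symmetric] by (intro prod.cong) (auto simp: t mat_diag_def)
  finally have "t \<in> GG (2 * n)" by (intro SL_I) (simp_all add: t)
  then show "t \<in> torus n" by (auto simp: torus_def t mat_diag_def diagonal_mat_def)
qed

lemma torus_SL: "t \<in> torus n \<Longrightarrow> t \<in> GG (2 * n)" by (simp add: torus_def)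

lemma torus_conj:
  assumes z: "z \<in> GG (2 * n)" and w: "w permutes {..<2 * n}" and t: "t \<in> torus n"
    and p: "\<forall>i<2 * n. \<forall>j<2 * n. z $$ (i, j) \<noteq> 0 \<longleftrightarrow> i = w j"
  shows "z * t * minv (2 * n) z \<in> torus n" "minv (2 * n) z * t * z \<in> torus n"
proof -
  let ?m = "2 * n"
  obtain d where d: "t = mat_diag ?m d" "(\<Prod>i<?m. d i) = 1" using t unfolding torus_iff by blast
  have wi: "w (inv_into UNIV w j) = j" "inv_into UNIV w (w j) = j" for j using permutes_inverses[OF w] by auto
  have "mat_diag ?m (d \<circ> inv_into UNIV w) * z = z * t" unfolding d(1) by (rule diagonal_conj[OF z]) (use p wi in auto)
  moreover have "mat_diag ?m (d \<circ> inv_into UNIV w) \<in> torus n"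
    unfolding torus_iff using d(2) prod.permute[OF permutes_inv[OF w], of d] by (intro exI[of _ "d \<circ> inv_into UNIV w"]) simp
  ultimately show "z * t * minv ?m z \<in> torus n" using SL_cancel(3)[OF z torus_SL] by metis
  have "t * z = z * mat_diag ?m (d \<circ> w)" unfolding d(1) by (rule diagonal_conj[OF z]) (use p in auto)
  moreover have *: "mat_diag ?m (d \<circ> w) \<in> torus n"
    unfolding torus_iff using d(2) prod.permute[OF w, of d] by (intro exI[of _ "d \<circ> w"]) simp
  ultimately have "minv ?m z * t * z = mat_diag ?m (d \<circ> w)"
    using z torus_SL[OF t] SL_cancel(1)[OF z torus_SL[OF *]] by (simp add: SL_assoc[of _ ?m])
  with * show "minv ?m z * t * z \<in> torus n" by simp
qed

lemma pattern_normalizer: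
  assumes z: "z \<in> GG (2 * n)" and w: "w permutes {..<2 * n}"
    and p: "\<forall>i<2 * n. \<forall>j<2 * n. z $$ (i, j) \<noteq> 0 \<longleftrightarrow> i = w j"
  shows "z \<in> normalizer (grp n) (torus n)"
proof -
  let ?m = "2 * n"
  have e: "z <#\<^bsub>grp n\<^esub> torus n #>\<^bsub>grp n\<^esub> minv ?m z = (\<lambda>t. z * t * minv ?m z) ` torus n"
    unfolding coset_mem r_coset_def mult_SL by auto
  have "t \<in> (\<lambda>t. z * t * minv ?m z) ` torus n" if t: "t \<in> torus n" for t
  proof (rule image_eqI)
    show "minv ?m z * t * z \<in> torus n" by (rule torus_conj(2)[OF z w t p])
    show "t = z * (minv ?m z * t * z) * minv ?m z" using z torus_SL[OF t] by (simp add: SL_assoc[of _ ?m])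
  qed
  then have "(\<lambda>t. z * t * minv ?m z) ` torus n = torus n" using torus_conj(1)[OF z w _ p] by auto
  then show ?thesis
    unfolding normalizer_def stabilizer_def using z e torus_SL by auto
qed

lemma RS_map_orb:
  assumes b: "b \<in> fpf_involutions n"
  shows "RS_map n (orb n b) = b \<circ> w0 n"
  unfolding RS_map_def
proof (rule the_equality)
  let ?m = "2 * n"
  obtain x where x: "x \<in> stratum n b" "monomial_type n b (gram n x)" using stratum_nonempty[OF b] by blast
  have xG: "x \<in> GG ?m" by (rule stratum_SL[OF x(1)])
  let ?g = "minv ?m x"
  have g: "?g \<in> GG ?m" "minv ?m ?g = x" using xG by auto
  let ?z = "?g * minv ?m (theta n ?g)"
  have z: "?z \<in> GG ?m" using g by auto
  have e: "gram n x * ?z = Jnn n" using gram_theta[OF g(1)] g(2) by simp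
  have p: "\<forall>i<?m. \<forall>j<?m. ?z $$ (i, j) \<noteq> 0 \<longleftrightarrow> i = (b \<circ> w0 n) j"
    using mult_eq_Jnn_pattern[OF SL_mat[OF gram_SL[OF xG]] SL_mat[OF z] b x(2) e] by blast
  have w: "(b \<circ> w0 n) permutes {..<?m}" by (rule permutes_compose[OF w0_permutes fpfD(1)[OF b]])
  have "represents n ?z (b \<circ> w0 n)" unfolding represents_def using pattern_normalizer[OF z w p] w p by blast
  moreover have "orb n b = K_orbit n (minv ?m ?g)" unfolding g(2) using K_orbit_eq[OF b x(1)] by simp
  ultimately show "\<exists>g\<in>GG ?m. orb n b = K_orbit n (minv ?m g) \<and> represents n (g \<otimes>\<^bsub>grp n\<^esub> minv ?m (theta n g)) (b \<circ> w0 n)"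
    unfolding mult_SL using g(1) by blast
next
  let ?m = "2 * n"
  fix w assume "\<exists>g\<in>GG ?m. orb n b = K_orbit n (minv ?m g) \<and> represents n (g \<otimes>\<^bsub>grp n\<^esub> minv ?m (theta n g)) w"
  then obtain g where g: "g \<in> GG ?m" and K: "orb n b = K_orbit n (minv ?m g)" and R: "represents n (g * minv ?m (theta n g)) w"
    unfolding mult_SL by blast
  let ?x = "minv ?m g" let ?z = "g * minv ?m (theta n g)"
  have x: "?x \<in> GG ?m" and z: "?z \<in> GG ?m" using g by auto
  obtain u where u: "u \<in> fpf_involutions n" "monomial_type n u (gram n ?x)" "w = u \<circ> w0 n"
    by (rule pattern_monomial_type[OF x SL_mat[OF z] _ gram_theta[OF g]]) (use R in \<open>auto simp: represents_def\<close>)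
  have "?x \<in> stratum n u"
    unfolding stratum_def using x u(2) by (auto intro!: bexI[of _ "1\<^sub>m ?m"])
  from K_orbit_eq[OF u(1) this] K have "orb n b = orb n u" by simp
  then have "b = u" by (rule orb_inj[OF b u(1)])
  then show "w = b \<circ> w0 n" using u(3) by simp
qed

lemma inv_param_orb: "b \<in> fpf_involutions n \<Longrightarrow> inv_param n (orb n b) = b"
  unfolding inv_param_def by (simp add: RS_map_orb comp_assoc w0_simps)

lemma bij_inv_param: "bij_betw (inv_param n) (K_orbits n) (fpf_involutions n)"
  by (rule bij_betw_byWitness[of _ "orb n"]) (auto simp: K_orbits_eq inv_param_orb)

section \<open>Roots\<close>

text \<open>On the torus attached to a monomial representative the involution acts through
  \<open>b\<close>, by \<open>d j\<close> to \<open>1 / d (b j)\<close>. By \<open>theta_eqI\<close>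
  this amounts to \<open>?D * ?Y * ?E = ?Y\<close>, where only the positions \<open>(b s, s)\<close>
  matter.\<close>

lemma theta_conj_torus:
  assumes b: "b \<in> fpf_involutions n" and x: "x \<in> GG (2 * n)" and t: "monomial_type n b (gram n x)"
    and d: "(\<Prod>i<2 * n. d i) = 1"
  shows "theta n (x * mat_diag (2 * n) d * minv (2 * n) x) = x * mat_diag (2 * n) (\<lambda>j. 1 / d (b j)) * minv (2 * n) x"
    and "(\<Prod>i<2 * n. 1 / d (b i)) = 1"
proof -
  let ?m = "2 * n" let ?D = "mat_diag ?m d" and ?E = "mat_diag ?m (\<lambda>j. 1 / d (b j))" let ?Y = "gram n x"
  have "(\<Prod>i<?m. d (b i)) = 1" using prod.permute[OF fpfD(1)[OF b], of d] d by simp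
  then show E1: "(\<Prod>i<?m. 1 / d (b i)) = 1" by (simp add: prod_dividef)
  have DE: "?D \<in> GG ?m" "?E \<in> GG ?m" using d E1 torus_SL torus_iff by blast+
  have d0: "d j \<noteq> 0" if "j < ?m" for j using d that prod_zero_iff[of "{..<?m}" d] by auto
  have Y: "?Y \<in> GG ?m" and J: "Jnn n \<in> GG ?m" using x Jnn_in_SL by auto
  have "?D * ?Y * ?E = ?Y"
  proof (rule square_eqI)
    fix r s assume r: "r < ?m" and s: "s < ?m"
    have "(?D * ?Y * ?E) $$ (r, s) = d r * ?Y $$ (r, s) / d (b s)"
      using r s SL_dim[OF Y] unfolding mat_diag_mult_left[OF SL_mat[OF Y]] by (subst mat_diag_mult_right[of _ ?m]) auto
    also have "\<dots> = ?Y $$ (r, s)"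
    proof (cases "r = b s")
      case False
      then have "?Y $$ (r, s) = 0" by (rule monomial_type_zero[OF t r s])
      then show ?thesis by simp
    qed (use d0[OF r] in simp)
    finally show "(?D * ?Y * ?E) $$ (r, s) = ?Y $$ (r, s)" .
  qed (use DE Y SL_mat in auto)
  have sym: "transpose_mat ?D = ?D" by (rule eq_matI) (auto simp: mat_diag_def)
  let ?X = "transpose_mat x"
  have X: "?X \<in> GG ?m" using x by simp
  show "theta n (x * ?D * minv ?m x) = x * ?E * minv ?m x"
  proof (rule theta_eqI)
    have "transpose_mat (x * ?D * minv ?m x) = minv ?m ?X * (?D * ?X)"
      unfolding transpose_mult_SL[OF SL_closed[OF x DE(1)] SL_inv[OF x]] transpose_mult_SL[OF x DE(1)] sym SL_inv_transpose[OF x] ..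
    then have "transpose_mat (x * ?D * minv ?m x) * Jnn n * (x * ?E * minv ?m x) = minv ?m ?X * (?D * ?Y * ?E) * minv ?m x"
      unfolding gram_def using x X J DE by (simp add: SL_assoc[of _ ?m])
    also have "\<dots> = Jnn n" unfolding \<open>?D * ?Y * ?E = ?Y\<close> unfolding gram_def using x X J by (simp add: SL_assoc[of _ ?m])
    finally show "transpose_mat (x * ?D * minv ?m x) * Jnn n * (x * ?E * minv ?m x) = Jnn n" .
  qed (use x DE in auto)
qed

lemma complex_root_orb:
  assumes b: "b \<in> fpf_involutions n" and i: "Suc i < 2 * n" and ne: "b i \<noteq> Suc i"
  shows "complex_root n i (orb n b)"
proof -
  let ?m = "2 * n"
  obtain x where x: "x \<in> stratum n b" "monomial_type n b (gram n x)" using stratum_nonempty[OF b] by blast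
  have xG: "x \<in> GG ?m" by (rule stratum_SL[OF x(1)])
  note th = theta_conj_torus[OF b xG x(2)]
  have CT: "conj_torus n x = {x * mat_diag ?m d * minv ?m x | d. (\<Prod>i<?m. d i) = 1}"
    unfolding conj_torus_def mult_SL torus_iff by blast
  have stable: "theta n ` conj_torus n x = conj_torus n x"
  proof
    show "theta n ` conj_torus n x \<subseteq> conj_torus n x" unfolding CT using th by blast
    show "conj_torus n x \<subseteq> theta n ` conj_torus n x"
    proof
      fix s assume "s \<in> conj_torus n x"
      then obtain d where d: "s = x * mat_diag ?m d * minv ?m x" "(\<Prod>i<?m. d i) = 1" unfolding CT by blast
      from th(1)[OF th(2)[OF d(2)]] have "theta n (x * mat_diag ?m (\<lambda>j. 1 / d (b j)) * minv ?m x) = s"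
        by (simp add: d(1) fpfD(2)[OF b])
      then show "s \<in> theta n ` conj_torus n x" unfolding CT using th(2)[OF d(2)] by blast
    qed
  qed
  have root: "conj_root n i x (x * mat_diag ?m d * minv ?m x) = d i / d (Suc i)" if "(\<Prod>i<?m. d i) = 1" for d
  proof -
    have "mat_diag ?m d \<in> GG ?m" using that torus_SL torus_iff by blast
    then have "minv ?m x * (x * mat_diag ?m d * minv ?m x) * x = mat_diag ?m d"
      using xG by (simp add: SL_assoc[of _ ?m])
    then show ?thesis using i by (simp add: conj_root_def simple_root_def mult_SL mat_diag_def)
  qed
  \<comment> \<open>A test element on which the root has value 4. As \<open>b i\<close> and
    \<open>b (Suc i)\<close> avoid \<open>i\<close> and \<open>Suc i\<close>, the image under the
    involution gives 1, which is neither 4 nor 1/4.\<close>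
  define d :: "nat \<Rightarrow> complex" where "d j = (if j = i then 2 else if j = Suc i then 1 / 2 else 1)" for j
  have "(\<Prod>j<?m. d j) = (\<Prod>j\<in>{i, Suc i}. d j)"
    by (rule prod.mono_neutral_right) (use i in \<open>auto simp: d_def\<close>)
  then have d1: "(\<Prod>j<?m. d j) = 1" by (simp add: d_def)
  let ?s = "x * mat_diag ?m d * minv ?m x"
  have s: "?s \<in> conj_torus n x" unfolding CT using d1 by blast
  have r1: "conj_root n i x ?s = 4" unfolding root[OF d1] by (simp add: d_def)
  have "d (b i) = 1" "d (b (Suc i)) = 1" using fpf_refl_nbrs[OF b i ne] ne by (simp_all add: d_def)
  then have r2: "conj_root n i x (theta n ?s) = 1" unfolding th(1)[OF d1] root[OF th(2)[OF d1]] by simp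
  have "\<not> (\<forall>s\<in>conj_torus n x. conj_root n i x (theta n s) = conj_root n i x s)"
    "\<not> (\<forall>s\<in>conj_torus n x. conj_root n i x (theta n s) = inverse (conj_root n i x s))"
    using s r1 r2 by (auto intro!: bexI[OF _ s])
  then show ?thesis
    unfolding complex_root_def using xG stable lcoset_in_orb[OF xG, of b] x(1) by blast
qed

section \<open>The action of simple reflections on orbits\<close>

lemma proj_lcoset:
  assumes i: "Suc i < 2 * n" and g: "g \<in> GG (2 * n)"
  shows "proj n i (lcoset n (borel n) g) = lcoset n (parabolic n i) g"
proof -
  note H = subgrp_parabolic[OF i]
  have e: "proj n i (lcoset n (borel n) g) = (\<Union>\<beta>\<in>borel n. lcoset n (parabolic n i) (g * \<beta>))"
    unfolding proj_def set_mult_def coset_mem mult_SL by auto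
  have "lcoset n (parabolic n i) (g * \<beta>) = lcoset n (parabolic n i) g" if "\<beta> \<in> borel n" for \<beta>
    by (rule lcoset_mult[OF H g subsetD[OF borel_subset_parabolic that]])
  then show ?thesis unfolding e using borel_one[of n] by auto
qed

definition psat :: "nat \<Rightarrow> nat \<Rightarrow> complex mat set \<Rightarrow> complex mat set" where
  "psat n i S = {x * \<kappa> | x \<kappa>. x \<in> S \<and> \<kappa> \<in> parabolic n i}"

lemma psatI: "x \<in> S \<Longrightarrow> \<kappa> \<in> parabolic n i \<Longrightarrow> x * \<kappa> \<in> psat n i S"
  unfolding psat_def by blast

lemma psatE:
  assumes "y \<in> psat n i S"
  obtains x \<kappa> where "x \<in> S" "\<kappa> \<in> parabolic n i" "y = x * \<kappa>"
  using assms unfolding psat_def by blast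

lemma psat_superset: "S \<subseteq> GG (2 * n) \<Longrightarrow> S \<subseteq> psat n i S"
  using borel_subset_parabolic[of n i] borel_one[of n] psatI[of _ S "1\<^sub>m (2 * n)" n i] by fastforce

lemma psat_mult:
  assumes i: "Suc i < 2 * n" and S: "S \<subseteq> GG (2 * n)" and y: "y \<in> psat n i S" and k: "\<kappa> \<in> parabolic n i"
  shows "y * \<kappa> \<in> psat n i S"
proof -
  obtain x \<mu> where x: "x \<in> S" "\<mu> \<in> parabolic n i" "y = x * \<mu>" by (rule psatE[OF y])
  have "y * \<kappa> = x * (\<mu> * \<kappa>)" unfolding x(3) using x S k parabolic_SL by (intro SL_assoc[of _ "2 * n"]) auto
  then show ?thesis using psatI[OF x(1) parabolic_mult[OF i x(2) k]] by simp
qed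

lemma saturation_orb:
  assumes i: "Suc i < 2 * n"
  shows "saturation n i (orb n b) = lcoset n (borel n) ` psat n i (stratum n b)"
proof -
  let ?m = "2 * n" let ?B = "borel n" let ?P = "parabolic n i"
  note HP = subgrp_parabolic[OF i]
  have "proj n i ` orb n b = lcoset n ?P ` stratum n b"
    unfolding orb_def image_image by (intro image_cong refl) (simp add: proj_lcoset[OF i] stratum_SL)
  moreover have mem: "lcoset n ?P g \<in> lcoset n ?P ` stratum n b \<longleftrightarrow> g \<in> psat n i (stratum n b)" if g: "g \<in> GG ?m" for g
  proof
    assume "lcoset n ?P g \<in> lcoset n ?P ` stratum n b"
    then obtain x where x: "x \<in> stratum n b" "lcoset n ?P x = lcoset n ?P g" by auto
    from lcoset_eqD[OF HP stratum_SL[OF x(1)] g x(2)] obtain h where "h \<in> ?P" "g = x * h" .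
    then show "g \<in> psat n i (stratum n b)" using psatI[OF x(1)] by simp
  next
    assume "g \<in> psat n i (stratum n b)"
    then obtain x \<kappa> where x: "x \<in> stratum n b" "\<kappa> \<in> ?P" "g = x * \<kappa>" by (rule psatE)
    then have "lcoset n ?P g = lcoset n ?P x" using lcoset_mult[OF HP stratum_SL[OF x(1)] x(2)] by simp
    then show "lcoset n ?P g \<in> lcoset n ?P ` stratum n b" using x(1) by simp
  qed
  ultimately have iff: "proj n i (lcoset n ?B g) \<in> proj n i ` orb n b \<longleftrightarrow> g \<in> psat n i (stratum n b)" if "g \<in> GG ?m" for g
    using that proj_lcoset[OF i that] by simp
  have PG: "psat n i (stratum n b) \<subseteq> GG ?m"
    unfolding psat_def using stratum_SL parabolic_SL SL_closed by blast
  show ?thesis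
  proof
    show "saturation n i (orb n b) \<subseteq> lcoset n ?B ` psat n i (stratum n b)"
    proof
      fix C assume C: "C \<in> saturation n i (orb n b)"
      then have "C \<in> lcoset n ?B ` GG ?m" unfolding saturation_def quotient_space_image by simp
      then obtain g where g: "g \<in> GG ?m" "C = lcoset n ?B g" by (elim imageE)
      then have "g \<in> psat n i (stratum n b)" using C iff[OF g(1)] unfolding saturation_def by simp
      then show "C \<in> lcoset n ?B ` psat n i (stratum n b)" unfolding g(2) by (rule imageI)
    qed
    show "lcoset n ?B ` psat n i (stratum n b) \<subseteq> saturation n i (orb n b)"
      unfolding saturation_def quotient_space_image using PG iff by auto
  qed
qed

lemma psat_stratum:
  assumes b: "b \<in> fpf_involutions n" and i: "Suc i < 2 * n" and lt: "b (Suc i) < b i"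
  shows "psat n i (stratum n b) = stratum n b \<union> stratum n (conj_refl i b)"
    and "psat n i (stratum n (conj_refl i b)) = stratum n b \<union> stratum n (conj_refl i b)"
proof -
  let ?m = "2 * n" let ?S = "stratum n b" let ?S' = "stratum n (conj_refl i b)" let ?P = "parabolic n i"
  have SG: "?S \<subseteq> GG ?m" "?S' \<subseteq> GG ?m" using stratum_SL by auto
  note s = smat_parabolic[OF i]
  have sG: "smat ?m i \<in> GG ?m" using i by simp
  have ex: "\<exists>x\<in>?S. \<exists>\<kappa>\<in>?P. y = x * \<kappa>" if y: "y \<in> ?S'" for y
  proof -
    obtain c where c: "y * addrow_mat ?m c (Suc i) i * smat ?m i \<in> ?S" using stratum_smat_back[OF b i lt y] by blast
    let ?a = "addrow_mat ?m c (Suc i) i"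
    have a: "?a \<in> ?P" using addrow_mat_borel[of i "Suc i" n c] borel_subset_parabolic i by blast
    have k: "?a * smat ?m i \<in> ?P" by (rule parabolic_mult[OF i a s(1)])
    note kG = parabolic_SL[OF k] and yG = stratum_SL[OF y]
    have "y * ?a * smat ?m i = y * (?a * smat ?m i)" by (rule SL_assoc[OF yG parabolic_SL[OF a] sG])
    then have "y = y * ?a * smat ?m i * minv ?m (?a * smat ?m i)" using SL_cancel(3)[OF kG yG] by simp
    then show ?thesis using c parabolic_inv[OF k i] by blast
  qed
  show 1: "psat n i ?S = ?S \<union> ?S'"
  proof
    show "psat n i ?S \<subseteq> ?S \<union> ?S'" unfolding psat_def using stratum_parabolic[OF b i lt] by blast
    show "?S \<union> ?S' \<subseteq> psat n i ?S" using psat_superset[OF SG(1)] ex psatI by blast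
  qed
  show "psat n i ?S' = ?S \<union> ?S'"
  proof
    have "?S' \<subseteq> psat n i ?S" unfolding 1 by blast
    then have "psat n i ?S' \<subseteq> psat n i ?S" using psat_mult[OF i SG(1)] unfolding psat_def[of n i ?S'] by blast
    then show "psat n i ?S' \<subseteq> ?S \<union> ?S'" unfolding 1 .
    have "x \<in> psat n i ?S'" if x: "x \<in> ?S" for x
      using psatI[OF stratum_smat[OF b i lt x] s(2)] SL_cancel(3)[OF sG stratum_SL[OF x]] by simp
    then show "?S \<union> ?S' \<subseteq> psat n i ?S'" using psat_superset[OF SG(2)] by blast
  qed
qed

text \<open>The larger stratum is dense in the saturation, and the saturation is stable under
  \<open>P_i\<close>; so the closure of the larger stratum is stable under \<open>P_i\<close>
  too.\<close>

lemma psat_closure: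
  assumes b: "b \<in> fpf_involutions n" and i: "Suc i < 2 * n" and lt: "b (Suc i) < b i"
  shows "stratum n b \<union> stratum n (conj_refl i b) \<subseteq> zc (2 * n) (stratum n (conj_refl i b))"
    and "x \<in> zc (2 * n) (stratum n (conj_refl i b)) \<Longrightarrow> \<kappa> \<in> parabolic n i \<Longrightarrow>
      x * \<kappa> \<in> zc (2 * n) (stratum n (conj_refl i b))"
proof -
  let ?m = "2 * n" let ?S' = "stratum n (conj_refl i b)"
  show 1: "stratum n b \<union> ?S' \<subseteq> zc ?m ?S'" using stratum_subset_closure[OF b i lt] stratum_zc by simp
  assume x: "x \<in> zc ?m ?S'" and k: "\<kappa> \<in> parabolic n i"
  have "x * \<kappa> \<in> zc ?m (zc ?m ?S')"
    by (rule zc_right[OF x parabolic_SL[OF k]])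
      (use 1 psatI[OF _ k, of _ ?S'] in \<open>auto simp: psat_stratum(2)[OF b i lt]\<close>)
  then show "x * \<kappa> \<in> zc ?m ?S'" using zc_closed[OF order_refl] by blast
qed

lemma s_act_orb:
  assumes b: "b \<in> fpf_involutions n" and i: "Suc i < 2 * n" and lt: "b (Suc i) < b i"
  shows "s_act n i (orb n b) = orb n (conj_refl i b)" and "s_act n i (orb n (conj_refl i b)) = orb n (conj_refl i b)"
proof -
  let ?m = "2 * n" let ?W = "stratum n b \<union> stratum n (conj_refl i b)" let ?sat = "lcoset n (borel n) ` ?W" let ?b' = "conj_refl i b"
  have b': "?b' \<in> fpf_involutions n" by (rule conj_refl_fpf[OF b i])
  have WG: "w \<in> GG ?m" if "w \<in> ?W" for w using that stratum_SL by blast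
  have sat_cl: "?sat \<subseteq> flag_zariski n closure_of orb n d \<longleftrightarrow> ?W \<subseteq> zc ?m (stratum n d)" for d
    using orb_closure_iff WG by (auto simp: image_subset_iff subset_iff)
  have sub: "orb n d \<subseteq> ?sat \<longleftrightarrow> stratum n d \<subseteq> ?W" for d
  proof -
    have r: "rstable n (borel n) ?W" using stratum_SL by (auto simp: rstable_def)
    have "lcoset n (borel n) x \<in> ?sat \<longleftrightarrow> x \<in> ?W" if "x \<in> stratum n d" for x
      by (rule lcoset_in_image[OF subgrp_borel r stratum_SL[OF that]])
    then show ?thesis unfolding orb_def image_subset_iff subset_iff[of "stratum n d"] by blast
  qed
  have "(THE R. R \<in> K_orbits n \<and> R \<subseteq> ?sat \<and> ?sat \<subseteq> flag_zariski n closure_of R) = orb n ?b'"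
  proof (rule the_equality)
    show "orb n ?b' \<in> K_orbits n \<and> orb n ?b' \<subseteq> ?sat \<and> ?sat \<subseteq> flag_zariski n closure_of orb n ?b'"
      unfolding sub sat_cl K_orbits_eq using b' psat_closure(1)[OF b i lt] by blast
  next
    fix R assume R: "R \<in> K_orbits n \<and> R \<subseteq> ?sat \<and> ?sat \<subseteq> flag_zariski n closure_of R"
    then obtain d where d: "d \<in> fpf_involutions n" "R = orb n d" unfolding K_orbits_eq by blast
    have s: "stratum n d \<subseteq> ?W" "?W \<subseteq> zc ?m (stratum n d)" using R unfolding d(2) sub sat_cl by blast+
    obtain x where x: "x \<in> stratum n d" using stratum_nonempty[OF d(1)] by blast
    obtain y where y: "y \<in> stratum n ?b'" using stratum_nonempty[OF b'] by blast
    \<comment> \<open>Two strata that are both dense in the saturation lie in the closures of each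
      other.\<close>
    have "?b' = d"
      by (rule stratum_T0[OF b' d(1) x _ y]) (use s psat_closure(1)[OF b i lt] x y in blast)+
    then show "R = orb n ?b'" using d(2) by simp
  qed
  note the = this
  show "s_act n i (orb n b) = orb n ?b'" unfolding s_act_def saturation_orb[OF i] psat_stratum(1)[OF b i lt] by (rule the)
  show "s_act n i (orb n ?b') = orb n ?b'" unfolding s_act_def saturation_orb[OF i] psat_stratum(2)[OF b i lt] by (rule the)
qed

lemma orbit_edge_iff:
  assumes n: "n > 0"
  shows "orbit_edge n i Q Q' \<longleftrightarrow> (\<exists>b\<in>fpf_involutions n. Q = orb n b \<and> cdesc n i b \<and> Q' = orb n (conj_refl i b))"
proof
  assume "orbit_edge n i Q Q'"
  then have i: "Suc i < 2 * n" and Q: "Q \<in> K_orbits n" and s: "Q' = s_act n i Q" and d: "orbit_dim n Q' = orbit_dim n Q + 1"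
    by (auto simp: orbit_edge_def)
  obtain b where b: "b \<in> fpf_involutions n" "Q = orb n b" using Q unfolding K_orbits_eq by blast
  have ne: "Q' \<noteq> Q" using d orbit_dim_orb[OF n b(1)] unfolding b(2) by (auto simp: one_enat_def)
  show "\<exists>b\<in>fpf_involutions n. Q = orb n b \<and> cdesc n i b \<and> Q' = orb n (conj_refl i b)"
  proof (cases "b (Suc i) < b i")
    case True
    have Q': "Q' = orb n (conj_refl i b)" using s_act_orb(1)[OF b(1) i True] s b(2) by simp
    then have "b i \<noteq> Suc i" using ne b(2) conj_refl_eq_iff[OF b(1) i] by auto
    then show ?thesis using b i True Q' by blast
  next
    \<comment> \<open>At an ascent the orbit is itself the dense one of its saturation, so
      \<open>s_act\<close> fixes it.\<close>
    case False
    have nb: "b i \<noteq> Suc i" using False fpfD(2)[OF b(1), of i] by auto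
    have "b i \<noteq> b (Suc i)" using fpfD(5)[OF b(1)] by simp
    then have "conj_refl i b (Suc i) < conj_refl i b i"
      using False conj_refl_simps(1,2)[OF b(1) i nb] by linarith
    from s_act_orb(2)[OF conj_refl_fpf[OF b(1) i] i this] have "Q' = Q" unfolding s b(2) conj_refl_idem .
    with ne show ?thesis by contradiction
  qed
next
  assume "\<exists>b\<in>fpf_involutions n. Q = orb n b \<and> cdesc n i b \<and> Q' = orb n (conj_refl i b)"
  then obtain b where b: "b \<in> fpf_involutions n" "Q = orb n b" and c: "cdesc n i b" and Q': "Q' = orb n (conj_refl i b)" by blast
  have i: "Suc i < 2 * n" using c by blast
  have b': "conj_refl i b \<in> fpf_involutions n" by (rule conj_refl_fpf[OF b(1) i])
  have "orbit_dim n Q' = orbit_dim n Q + 1"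
    unfolding b(2) Q' orbit_dim_orb[OF n b(1)] orbit_dim_orb[OF n b'] stratum_dim(3)[OF n b(1) c] by (simp add: one_enat_def)
  then show "orbit_edge n i Q Q'"
    unfolding orbit_edge_def K_orbits_eq using b b' i s_act_orb(1)[OF b(1) i] c Q' by simp
qed

lemma inv_edge_iff:
  assumes n: "n > 0"
  shows "inv_edge n i b b' \<longleftrightarrow> inv_step n i b b'"
proof
  assume "inv_edge n i b b'"
  then obtain Q Q' where p: "inv_param n Q = b" "inv_param n Q' = b'" and e: "orbit_edge n i Q Q'" unfolding inv_edge_def by blast
  obtain c where c: "c \<in> fpf_involutions n" "Q = orb n c" "cdesc n i c" "Q' = orb n (conj_refl i c)" using e unfolding orbit_edge_iff[OF n] by blast
  have i: "Suc i < 2 * n" using c(3) by blast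
  have "b = c" "b' = conj_refl i c"
    using p inv_param_orb[OF c(1)] inv_param_orb[OF conj_refl_fpf[OF c(1) i]] unfolding c(2,4) by simp_all
  then show "inv_step n i b b'" unfolding inv_step_iff using c(1,3) by simp
next
  assume "inv_step n i b b'"
  then have b: "b \<in> fpf_involutions n" and c: "cdesc n i b" and b': "b' = conj_refl i b" unfolding inv_step_iff by blast+
  have i: "Suc i < 2 * n" using c by blast
  have bf: "b' \<in> fpf_involutions n" unfolding b' by (rule conj_refl_fpf[OF b i])
  have "orbit_edge n i (orb n b) (orb n b')" unfolding orbit_edge_iff[OF n] b' using b c by blast
  then show "inv_edge n i b b'"
    unfolding inv_edge_def using inv_param_orb[OF b] inv_param_orb[OF bf] b bf unfolding K_orbits_eq by blast
qed

lemma weak_le_orb_iff: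
  assumes n: "n > 0" and b: "b \<in> fpf_involutions n" and b': "b' \<in> fpf_involutions n"
  shows "weak_le n (orb n b) (orb n b') \<longleftrightarrow> inv_le n b b'"
proof
  assume "weak_le n (orb n b) (orb n b')"
  then have "\<exists>c\<in>fpf_involutions n. orb n b' = orb n c \<and> inv_le n b c"
    unfolding weak_le_def
  proof (induction rule: rtranclp_induct)
    case base
    show ?case using b unfolding inv_le_def by blast
  next
    case (step Q Q')
    then obtain c i where c: "c \<in> fpf_involutions n" "Q = orb n c" "inv_le n b c" and e: "orbit_edge n i Q Q'" by blast
    obtain a where a: "a \<in> fpf_involutions n" "Q = orb n a" "cdesc n i a" "Q' = orb n (conj_refl i a)" using e unfolding orbit_edge_iff[OF n] by blast
    have "a = c" by (rule orb_inj[OF a(1) c(1)]) (use a c in simp)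
    then have "inv_step n i c (conj_refl i c)" unfolding inv_step_iff using a by simp
    then have "inv_le n b (conj_refl i c)"
      unfolding inv_le_def by (intro rtranclp.rtrancl_into_rtrancl[OF c(3)[unfolded inv_le_def]] exI)
    moreover have "conj_refl i c \<in> fpf_involutions n" using conj_refl_fpf[OF c(1)] a(3) by blast
    ultimately show ?case using a(4) \<open>a = c\<close> by blast
  qed
  then obtain c where c: "c \<in> fpf_involutions n" "orb n b' = orb n c" "inv_le n b c" by blast
  then show "inv_le n b b'" using orb_inj[OF b' c(1)] by simp
next
  assume "inv_le n b b'"
  then show "weak_le n (orb n b) (orb n b')"
    unfolding inv_le_def
  proof (induction rule: rtranclp_induct)
    case base
    show ?case unfolding weak_le_def by simp
  next
    case (step c c')
    then obtain i where "inv_step n i c c'" by blast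
    then have "orbit_edge n i (orb n c) (orb n c')" unfolding orbit_edge_iff[OF n] inv_step_iff by blast
    then show ?case
      unfolding weak_le_def by (intro rtranclp.rtrancl_into_rtrancl[OF step.IH[unfolded weak_le_def]] exI)
  qed
qed

section \<open>The degree of the projection on orbit closures\<close>

lemma quot_open_compl_zc:
  assumes H: "subgrp n H" and st: "\<And>x h. x \<in> zc (2 * n) S \<Longrightarrow> h \<in> H \<Longrightarrow> x * h \<in> zc (2 * n) S"
  shows "openin (quotient_zariski n H) (lcoset n H ` (GG (2 * n) - zc (2 * n) S))"
    and "g \<in> GG (2 * n) \<Longrightarrow> lcoset n H g \<in> lcoset n H ` (GG (2 * n) - zc (2 * n) S) \<longleftrightarrow> g \<notin> zc (2 * n) S"
proof -
  let ?m = "2 * n" let ?W = "GG (2 * n) - zc (2 * n) S"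
  have HG: "h \<in> GG ?m" "minv ?m h \<in> H" if "h \<in> H" for h using H that unfolding subgrp_def by blast+
  have r: "rstable n H ?W"
    unfolding rstable_def
  proof (intro conjI ballI)
    fix w h assume w: "w \<in> ?W" and h: "h \<in> H"
    have "w * h \<notin> zc ?m S"
    proof
      assume "w * h \<in> zc ?m S"
      from st[OF this HG(2)[OF h]] show False using w SL_cancel(3)[OF HG(1)[OF h], of w] by simp
    qed
    then show "w * h \<in> ?W" using w HG(1)[OF h] by simp
  qed blast
  have mem: "lcoset n H g \<in> lcoset n H ` ?W \<longleftrightarrow> g \<notin> zc ?m S" if g: "g \<in> GG ?m" for g
    using lcoset_in_image[OF H r g] g by simp
  then show "g \<in> GG ?m \<Longrightarrow> lcoset n H g \<in> lcoset n H ` ?W \<longleftrightarrow> g \<notin> zc ?m S" .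
  show "openin (quotient_zariski n H) (lcoset n H ` ?W)"
  proof (rule quot_openI)
    show "lcoset n H ` ?W \<subseteq> quotient_space n H" unfolding quotient_space_image by (rule image_mono) blast
    fix g assume g: "g \<in> GG ?m" "lcoset n H g \<in> lcoset n H ` ?W"
    have "g \<notin> zc ?m S" using mem[OF g(1)] g(2) by simp
    then obtain p where p: "regular ?m p" "\<forall>y\<in>S. p y = 0" "p g \<noteq> 0" unfolding zc_def using SL_mat[OF g(1)] by blast
    have "lcoset n H y \<in> lcoset n H ` ?W" if "y \<in> GG ?m" "p y \<noteq> 0" for y
      using mem[OF that(1)] zc_D[OF _ p(1), of y S] p(2) that(2) by blast
    then show "\<exists>p. regular ?m p \<and> p g \<noteq> 0 \<and> (\<forall>y\<in>GG ?m. p y \<noteq> 0 \<longrightarrow> lcoset n H y \<in> lcoset n H ` ?W)"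
      using p by (intro exI[of _ p]) simp
  qed
qed

text \<open>A pairing \<open>c i = Suc i\<close> is itself a descent, so at an ascent conjugation
  really exchanges the two values. Every stratum thus belongs to a saturation named by a descent at
  \<open>i\<close>.\<close>

lemma descent_representative:
  assumes c: "c \<in> fpf_involutions n" and i: "Suc i < 2 * n"
  obtains e where "e \<in> fpf_involutions n" "e (Suc i) < e i" "c = e \<or> c = conj_refl i e"
proof (cases "c (Suc i) < c i")
  case True
  then show ?thesis using that[of c] c by blast
next
  case False
  have ne: "c i \<noteq> Suc i" using False fpfD(2)[OF c, of i] by auto
  have "c i \<noteq> c (Suc i)" using fpfD(5)[OF c] by simp
  then have "conj_refl i c (Suc i) < conj_refl i c i" using False conj_refl_simps(1,2)[OF c i ne] by linarith
  then show ?thesis using that[OF conj_refl_fpf[OF c i]] by simp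
qed

text \<open>If the closure of each of two \<open>P\<^sub>i\<close>-saturations meets the other saturation, then their dense strata
  lie in the closures of each other, hence coincide.\<close>

lemma saturation_separation:
  assumes b: "b \<in> fpf_involutions n" and i: "Suc i < 2 * n" and lt: "b (Suc i) < b i"
    and e: "e \<in> fpf_involutions n" and lte: "e (Suc i) < e i"
    and y: "y \<in> stratum n e \<union> stratum n (conj_refl i e)" "y \<in> zc (2 * n) (stratum n (conj_refl i b))"
    and x: "x \<in> stratum n b \<union> stratum n (conj_refl i b)" "x \<in> zc (2 * n) (stratum n (conj_refl i e))"
  shows "e = b"
proof -
  have key: "\<exists>z. z \<in> stratum n (conj_refl i e) \<and> z \<in> zc (2 * n) (stratum n (conj_refl i b))"
    if "b \<in> fpf_involutions n" "b (Suc i) < b i" "e \<in> fpf_involutions n" "e (Suc i) < e i"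
      "y \<in> stratum n e \<union> stratum n (conj_refl i e)" "y \<in> zc (2 * n) (stratum n (conj_refl i b))" for b e y
  proof (cases "y \<in> stratum n e")
    case True
    show ?thesis
      using stratum_smat[OF that(3) i that(4) True] psat_closure(2)[OF that(1) i that(2) that(6) smat_parabolic(1)[OF i]] by blast
  next
    case False
    then show ?thesis using that by blast
  qed
  obtain z where z: "z \<in> stratum n (conj_refl i e)" "z \<in> zc (2 * n) (stratum n (conj_refl i b))" using key[OF b lt e lte y] by blast
  obtain w where w: "w \<in> stratum n (conj_refl i b)" "w \<in> zc (2 * n) (stratum n (conj_refl i e))" using key[OF e lte b lt x] by blast
  have "conj_refl i b = conj_refl i e"
    by (rule stratum_T0[OF conj_refl_fpf[OF b i] conj_refl_fpf[OF e i] z w])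
  then have "conj_refl i (conj_refl i e) = conj_refl i (conj_refl i b)" by (simp only:)
  then show "e = b" unfolding conj_refl_idem .
qed

text \<open>\<open>bad\<close> names the other saturations met by the closure of the stratum. By
  \<open>saturation_separation\<close> their closures avoid the saturation of \<open>b\<close>.
  There are finitely many and their closures are stable under \<open>P_i\<close>, so removing the
  images of these closures from \<open>G/P_i\<close> leaves an open set.\<close>

lemma open_image_stratum:
  assumes b: "b \<in> fpf_involutions n" and i: "Suc i < 2 * n" and lt: "b (Suc i) < b i"
  obtains T where "openin (quotient_zariski n (parabolic n i)) T"
    "\<forall>g\<in>psat n i (zc (2 * n) (stratum n b)).
       lcoset n (parabolic n i) g \<in> T \<longleftrightarrow> g \<in> stratum n b \<union> stratum n (conj_refl i b)"
proof -
  let ?m = "2 * n" let ?P = "parabolic n i" let ?Y = "quotient_zariski n ?P"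
  let ?M = "psat n i (zc ?m (stratum n b))" let ?W = "\<lambda>e. stratum n e \<union> stratum n (conj_refl i e)"
  let ?T = "\<lambda>e. lcoset n ?P ` (GG ?m - zc ?m (stratum n (conj_refl i e)))"
  define bad where "bad = {e \<in> fpf_involutions n. e (Suc i) < e i \<and> e \<noteq> b \<and> ?W e \<inter> ?M \<noteq> {}}"
  note H = subgrp_parabolic[OF i]
  have M: "g \<in> GG ?m" "g \<in> zc ?m (stratum n (conj_refl i b))" if g: "g \<in> ?M" for g
  proof -
    obtain x \<kappa> where x: "x \<in> zc ?m (stratum n b)" "\<kappa> \<in> ?P" "g = x * \<kappa>" by (rule psatE[OF g])
    then show "g \<in> GG ?m" using zc_stratum_SL[OF x(1)] parabolic_SL[OF x(2)] by simp
    have "x \<in> zc ?m (stratum n (conj_refl i b))"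
      using x(1) zc_closed[of "stratum n b" ?m "stratum n (conj_refl i b)"] psat_closure(1)[OF b i lt] by blast
    then show "g \<in> zc ?m (stratum n (conj_refl i b))" unfolding x(3) by (rule psat_closure(2)[OF b i lt _ x(2)])
  qed
  have op: "openin ?Y (?T e)" and mem: "\<And>g. g \<in> GG ?m \<Longrightarrow> lcoset n ?P g \<in> ?T e \<longleftrightarrow> g \<notin> zc ?m (stratum n (conj_refl i e))"
    if e: "e \<in> bad" for e
  proof -
    have st: "x * h \<in> zc ?m (stratum n (conj_refl i e))" if "x \<in> zc ?m (stratum n (conj_refl i e))" "h \<in> ?P" for x h
      by (rule psat_closure(2)[OF _ i _ that]) (use e in \<open>auto simp: bad_def\<close>)
    show "openin ?Y (?T e)" by (rule quot_open_compl_zc(1)[OF H]) (rule st)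
    show "lcoset n ?P g \<in> ?T e \<longleftrightarrow> g \<notin> zc ?m (stratum n (conj_refl i e))" if "g \<in> GG ?m" for g
      by (rule quot_open_compl_zc(2)[OF H _ that]) (rule st)
  qed
  let ?U = "\<Inter>(insert (quotient_space n ?P) (?T ` bad))"
  have "finite bad" unfolding bad_def by (rule finite_subset[OF _ finite_fpf[of n]]) blast
  then have oU: "openin ?Y ?U"
    using op openin_topspace[of ?Y] by (intro openin_Inter) auto
  have memU: "lcoset n ?P g \<in> ?U \<longleftrightarrow> g \<in> ?W b" if g: "g \<in> ?M" for g
  proof -
    note gG = M(1)[OF g]
    have "lcoset n ?P g \<in> ?U \<longleftrightarrow> (\<forall>e\<in>bad. g \<notin> zc ?m (stratum n (conj_refl i e)))"
      using mem[OF _ gG] gG by (simp add: quotient_space_image)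
    also have "\<dots> \<longleftrightarrow> g \<in> ?W b"
    proof
      assume no: "\<forall>e\<in>bad. g \<notin> zc ?m (stratum n (conj_refl i e))"
      obtain c where c: "c \<in> fpf_involutions n" "g \<in> stratum n c" using stratum_cover[OF gG] by blast
      obtain e where e: "e \<in> fpf_involutions n" "e (Suc i) < e i" "c = e \<or> c = conj_refl i e" by (rule descent_representative[OF c(1) i])
      have ge: "g \<in> ?W e" using c(2) e(3) by blast
      then have "e \<notin> bad" using no psat_closure(1)[OF e(1) i e(2)] by blast
      then have "e = b" using e(1,2) ge g unfolding bad_def by blast
      then show "g \<in> ?W b" using ge by simp
    next
      assume gb: "g \<in> ?W b"
      show "\<forall>e\<in>bad. g \<notin> zc ?m (stratum n (conj_refl i e))"
      proof (intro ballI notI)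
        fix e assume e: "e \<in> bad" and ge: "g \<in> zc ?m (stratum n (conj_refl i e))"
        then obtain y where y: "y \<in> ?W e" "y \<in> ?M" unfolding bad_def by blast
        have "e = b" by (rule saturation_separation[OF b i lt _ _ y(1) M(2)[OF y(2)] gb ge]) (use e in \<open>auto simp: bad_def\<close>)
        then show False using e unfolding bad_def by simp
      qed
    qed
    finally show ?thesis .
  qed
  show ?thesis by (rule that[OF oU]) (intro ballI memU)
qed

text \<open>The image of the orbit itself is the open dense set over which fibres are counted. A
  point of the closure over it lies in one of the two strata of the saturation; the larger one
  misses the closure, and on the smaller one the projection is injective.\<close>

lemma black_orb:
  assumes b: "b \<in> fpf_involutions n" and d: "cdesc n i b"
  shows "black n i (orb n b)"
proof -
  let ?m = "2 * n" let ?B = "borel n" let ?P = "parabolic n i" let ?Y = "quotient_zariski n ?P"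
  let ?S = "stratum n b" let ?S' = "stratum n (conj_refl i b)" let ?Z = "zc ?m ?S"
  let ?C = "flag_zariski n closure_of orb n b"
  have i: "Suc i < 2 * n" and lt: "b (Suc i) < b i" using d by blast+
  note H = subgrp_parabolic[OF i]
  have ZG: "g \<in> GG ?m" if "g \<in> ?Z" for g using zc_stratum_SL that .
  have C: "?C = lcoset n ?B ` ?Z"
  proof
    show "lcoset n ?B ` ?Z \<subseteq> ?C" using orb_closure_iff ZG by blast
    show "?C \<subseteq> lcoset n ?B ` ?Z"
    proof
      fix A assume A: "A \<in> ?C"
      then have "A \<in> flag_variety n" using closure_of_subset_topspace[of "flag_zariski n"] by auto
      then obtain g where g: "g \<in> GG ?m" "A = lcoset n ?B g" unfolding quotient_space_image by (elim imageE)
      then show "A \<in> lcoset n ?B ` ?Z" using A orb_closure_iff[OF g(1)] by simp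
    qed
  qed
  have pC: "proj n i ` ?C = lcoset n ?P ` ?Z"
    unfolding C image_image by (intro image_cong refl proj_lcoset[OF i] ZG)
  have ZM: "?Z \<subseteq> psat n i ?Z" by (rule psat_superset) (use ZG in blast)
  obtain T where T: "openin ?Y T" "\<forall>g\<in>psat n i ?Z. lcoset n ?P g \<in> T \<longleftrightarrow> g \<in> ?S \<union> ?S'"
    by (rule open_image_stratum[OF b i lt])
  let ?U = "lcoset n ?P ` ?S"
  have notS': "g \<notin> ?S'" if "g \<in> ?Z" for g using stratum_conj_notin_closure[OF b d, of g] that by blast
  have U: "?U = T \<inter> lcoset n ?P ` ?Z"
  proof
    show "?U \<subseteq> T \<inter> lcoset n ?P ` ?Z" using T(2) ZM stratum_zc[of n b] by blast
    show "T \<inter> lcoset n ?P ` ?Z \<subseteq> ?U" using T(2) ZM notS' by blast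
  qed
  show ?thesis
    unfolding black_def has_degree_on_def
  proof (intro exI[of _ ?U] conjI ballI)
    show "openin (subtopology ?Y (proj n i ` ?C)) ?U"
      unfolding pC openin_subtopology using T(1) U by blast
    show "?U \<noteq> {}" using stratum_nonempty[OF b] by blast
    have Uq: "?U \<subseteq> quotient_space n ?P" unfolding quotient_space_image by (rule image_mono) (use stratum_SL in blast)
    have "?S \<subseteq> \<Union>?U"
    proof
      fix x assume x: "x \<in> ?S"
      from lcoset_self[OF H stratum_SL[OF x]] x show "x \<in> \<Union>?U" by (intro UN_I)
    qed
    from zc_mono[OF this, of ?m] show "proj n i ` ?C \<subseteq> ?Y closure_of ?U"
      unfolding pC using quot_closure_iff[OF H Uq ZG] by blast
  next
    fix y assume "y \<in> ?U"
    then obtain x where x: "x \<in> ?S" "y = lcoset n ?P x" by (elim imageE)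
    note xG = stratum_SL[OF x(1)]
    have "{A \<in> ?C. proj n i A = y} = {lcoset n ?B x}"
    proof
      have "x \<in> ?Z" using stratum_zc x(1) by blast
      then show "{lcoset n ?B x} \<subseteq> {A \<in> ?C. proj n i A = y}" unfolding C x(2) using proj_lcoset[OF i xG] by simp
      show "{A \<in> ?C. proj n i A = y} \<subseteq> {lcoset n ?B x}"
      proof
        fix A assume "A \<in> {A \<in> ?C. proj n i A = y}"
        then have A: "A \<in> lcoset n ?B ` ?Z" "proj n i A = y" unfolding C by simp_all
        obtain g where g: "g \<in> ?Z" "A = lcoset n ?B g" using A(1) by (elim imageE)
        have e: "lcoset n ?P x = lcoset n ?P g" using A(2) proj_lcoset[OF i ZG[OF g(1)]] x(2) g(2) by simp
        obtain \<kappa> where k: "\<kappa> \<in> ?P" "g = x * \<kappa>" by (rule lcoset_eqD[OF H xG ZG[OF g(1)] e])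
        have "x * \<kappa> \<in> ?S" using stratum_parabolic[OF b i lt x(1) k(1)] notS'[OF g(1)] k(2) by blast
        from stratum_fibre[OF b d x(1) this k(1)] have "lcoset n ?B g = lcoset n ?B x"
          unfolding k(2) by (rule lcoset_mult[OF subgrp_borel xG])
        then show "A \<in> {lcoset n ?B x}" using g(2) by simp
      qed
    qed
    then show "finite {A \<in> ?C. proj n i A = y}" "card {A \<in> ?C. proj n i A = y} = 1" by simp_all
  qed
qed

theorem proposition2p4p3:
  fixes n :: nat
  assumes "n \<ge> 1"
  shows
    "bij_betw (inv_param n) (K_orbits n) (fpf_involutions n) \<and>
     (\<forall>b\<in>fpf_involutions n. \<forall>i. Suc i < 2 * n \<longrightarrow>
        weyl_length n (simple_refl i \<circ> b) < weyl_length n b \<longrightarrow>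
        (inv_edge n i b (simple_refl i \<circ> b \<circ> simple_refl i) \<longleftrightarrow>
         simple_refl i \<circ> b \<circ> simple_refl i \<noteq> b)) \<and>
     (\<forall>i b b'. inv_edge n i b b' \<longleftrightarrow> inv_step n i b b') \<and>
     (\<forall>Q\<in>K_orbits n. \<forall>Q'\<in>K_orbits n.
        weak_le n Q Q' \<longleftrightarrow> inv_le n (inv_param n Q) (inv_param n Q')) \<and>
     w0 n \<in> fpf_involutions n \<and> (\<forall>b\<in>fpf_involutions n. inv_le n (w0 n) b) \<and>
     (\<forall>i Q Q'. orbit_edge n i Q Q' \<longrightarrow>
        complex_root n i Q \<and> complex_root n i Q' \<and> black n i Q)"
proof (intro conjI ballI allI impI)
  have n: "n > 0" using assms by simp
  show "bij_betw (inv_param n) (K_orbits n) (fpf_involutions n)" by (rule bij_inv_param)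
  show e: "inv_edge n i b b' \<longleftrightarrow> inv_step n i b b'" for i b b' by (rule inv_edge_iff[OF n])
  show "inv_edge n i b (conj_refl i b) \<longleftrightarrow> conj_refl i b \<noteq> b"
    if "b \<in> fpf_involutions n" "Suc i < 2 * n" "weyl_length n (simple_refl i \<circ> b) < weyl_length n b" for b i
    unfolding e inv_step_def using that by blast
  show "weak_le n Q Q' \<longleftrightarrow> inv_le n (inv_param n Q) (inv_param n Q')" if "Q \<in> K_orbits n" "Q' \<in> K_orbits n" for Q Q'
    using that weak_le_orb_iff[OF n] inv_param_orb unfolding K_orbits_eq by auto
  show "w0 n \<in> fpf_involutions n" by (rule w0_fpf)
  show "inv_le n (w0 n) b" if "b \<in> fpf_involutions n" for b by (rule inv_le_w0[OF that])
  fix i Q Q' assume "orbit_edge n i Q Q'"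
  then obtain b where b: "b \<in> fpf_involutions n" "Q = orb n b" "Q' = orb n (conj_refl i b)" and c: "cdesc n i b"
    unfolding orbit_edge_iff[OF n] by blast
  have i: "Suc i < 2 * n" and ne: "b i \<noteq> Suc i" using c by blast+
  show "complex_root n i Q" unfolding b(2) by (rule complex_root_orb[OF b(1) i ne])
  \<comment> \<open>At the upper end of the edge \<open>i\<close> is paired with
    \<open>b (Suc i)\<close>, again different from \<open>Suc i\<close>.\<close>
  have "conj_refl i b i \<noteq> Suc i" using conj_refl_simps(1)[OF b(1) i ne] fpf_refl_nbrs(3)[OF b(1) i ne] by simp
  then show "complex_root n i Q'" unfolding b(3) by (rule complex_root_orb[OF conj_refl_fpf[OF b(1) i] i])
  show "black n i Q" unfolding b(2) by (rule black_orb[OF b(1) c])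
qed

end
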